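(* Let $(R,\mathfrak{m})$ be a commutative Noetherian local ring and let $I$ be a (proper) FKH ideal of $R$ with finite G-dimension. If $J$ is a (proper) ideal linked to $I$, then $J$ is quasi-perfect, that is, $\operatorname{qpd}_R(R/J)=\operatorname{grade}_R J$.
   Context: Quasi-projective dimension: for a complex $X$ put $\sup X=\sup\{i: X_i\neq 0\}$, $\inf X=\inf\{i: X_i\neq0\}$, $\operatorname{hsup}X=\sup\{i: H_i(X)\neq0\}$. A quasi-projective resolution of an $R$-module $M$ is a bounded below complex $P$ of projective $R$-modules such that for all $i\ge\inf P$ there are integers $a_i\ge0$, not all zero, with $H_i(P)\cong M^{\oplus a_i}$; it is finite if $P$ is bounded. For $M\neq0$, $\operatorname{qpd}_RM=\inf\{\sup P-\operatorname{hsup}P : P \text{ a finite quasi-projective resolution of } M\}$ (which is $\infty$ if no such $P$ exists), and $\operatorname{qpd}_R0=-\infty$. A proper ideal $I$ is an FKH ideal (ideal with free Koszul homology) if the Koszul complex of $R$ on some system of generators of $I$ is a quasi-projective resolution of $R/I$, i.e. all its homologies are free $R/I$-modules. A finitely generated $R$-module $M$ is totally reflexive if, with $(-)^*=\operatorname{Hom}_R(-,R)$, the natural map $M\to M^{**}$ is an isomorphism and $\operatorname{Ext}^i_R(M,R)=0=\operatorname{Ext}^i_R(M^*,R)$ for all $i>0$. The G-dimension of $M$ is the infimum of the $n\ge0$ for which there is an exact sequence $0\to G_n\to\cdots\to G_0\to M\to0$ with each $G_i$ totally reflexive. (For an ideal $I$, $I$ has finite G-dimension if and only if $R/I$ does.)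 Two nonzero ideals $I,J$ are linked if there is a regular sequence $\boldsymbol{x}=x_1,\dots,x_n\in I\cap J$ with $((\boldsymbol{x}):_RI)=J$ and $((\boldsymbol{x}):_RJ)=I$. An ideal $I$ is quasi-perfect if $\operatorname{qpd}_R(R/I)=\operatorname{grade}_RI$. *)

theory Defs
  imports "HOL-Algebra.Algebra" "HOL-Library.Extended_Real" "HOL-Library.Infinite_Typeclass"
begin

section \<open>Rings and ideals\<close>

locale noetherian_local_ring = cring R + noetherian_ring R for R (structure) +
  fixes m :: "'a set"
  assumes maximal: "maximalideal m R"
    and unique: "\<And>n. maximalideal n R \<Longrightarrow> n = m"

definition proper_ideal :: "('a, 'r) ring_scheme \<Rightarrow> 'a set \<Rightarrow> bool"
  where "proper_ideal R I \<longleftrightarrow> ideal I R \<and> I \<noteq> carrier R"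

text \<open>The empty sequence is regular (on a nonzero ring).\<close>

definition regular_sequence :: "('a, 'r) ring_scheme \<Rightarrow> 'a list \<Rightarrow> bool"
  where "regular_sequence R xs \<longleftrightarrow>
    set xs \<subseteq> carrier R \<and>
    (\<forall>i < length xs. \<forall>a \<in> carrier R.
       xs ! i \<otimes>\<^bsub>R\<^esub> a \<in> Idl\<^bsub>R\<^esub> (set (take i xs)) \<longrightarrow> a \<in> Idl\<^bsub>R\<^esub> (set (take i xs))) \<and>
    Idl\<^bsub>R\<^esub> (set xs) \<noteq> carrier R"

definition grade :: "('a, 'r) ring_scheme \<Rightarrow> 'a set \<Rightarrow> ereal"
  where "grade R I =
    (SUP xs \<in> {xs. regular_sequence R xs \<and> set xs \<subseteq> I}. ereal (real (length xs)))"

definition colon_ideal :: "('a, 'r) ring_scheme \<Rightarrow> 'a set \<Rightarrow> 'a set \<Rightarrow> 'a set"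
  where "colon_ideal R K I = {r \<in> carrier R. \<forall>a \<in> I. r \<otimes>\<^bsub>R\<^esub> a \<in> K}"

definition linked :: "('a, 'r) ring_scheme \<Rightarrow> 'a set \<Rightarrow> 'a set \<Rightarrow> bool"
  where "linked R I J \<longleftrightarrow>
    ideal I R \<and> ideal J R \<and> I \<noteq> {\<zero>\<^bsub>R\<^esub>} \<and> J \<noteq> {\<zero>\<^bsub>R\<^esub>} \<and>
    (\<exists>xs. regular_sequence R xs \<and> set xs \<subseteq> I \<inter> J \<and>
       colon_ideal R (Idl\<^bsub>R\<^esub> (set xs)) I = J \<and>
       colon_ideal R (Idl\<^bsub>R\<^esub> (set xs)) J = I)"


section \<open>Modules\<close>

text \<open>The record of modules extends that of rings.  The locale \<^locale>\<open>module\<close> puts no condition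
  on the two multiplicative fields of a module, so they are left unspecified.\<close>

definition mk_module ::
    "'m set \<Rightarrow> 'm \<Rightarrow> ('m \<Rightarrow> 'm \<Rightarrow> 'm) \<Rightarrow> ('a \<Rightarrow> 'm \<Rightarrow> 'm) \<Rightarrow> ('a, 'm) module"
  where "mk_module C z p s =
    \<lparr>carrier = C, monoid.mult = undefined, one = undefined, ring.zero = z, ring.add = p, smult = s\<rparr>"

definition zero_module :: "('a, 'm) module \<Rightarrow> bool"
  where "zero_module M \<longleftrightarrow> carrier M = {\<zero>\<^bsub>M\<^esub>}"

definition ring_as_module :: "('a, 'r) ring_scheme \<Rightarrow> ('a, 'a) module"
  where "ring_as_module R = mk_module (carrier R) \<zero>\<^bsub>R\<^esub> (ring.add R) (monoid.mult R)"

definition sub_module :: "('a, 'm) module \<Rightarrow> 'm set \<Rightarrow> ('a, 'm) module"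
  where "sub_module M N = M\<lparr>carrier := N\<rparr>"

definition quotient_module :: "('a, 'm) module \<Rightarrow> 'm set \<Rightarrow> ('a, 'm set) module"
  where "quotient_module M N =
    mk_module (a_rcosets\<^bsub>M\<^esub> N) N (set_add M) (\<lambda>r K. \<Union>x \<in> K. N +>\<^bsub>M\<^esub> (r \<odot>\<^bsub>M\<^esub> x))"

definition power_module :: "('a, 'm) module \<Rightarrow> nat \<Rightarrow> ('a, nat \<Rightarrow> 'm) module"
  where "power_module M n =
    mk_module ({..<n} \<rightarrow>\<^sub>E carrier M) (\<lambda>i \<in> {..<n}. \<zero>\<^bsub>M\<^esub>)
      (\<lambda>f g. \<lambda>i \<in> {..<n}. f i \<oplus>\<^bsub>M\<^esub> g i) (\<lambda>r f. \<lambda>i \<in> {..<n}. r \<odot>\<^bsub>M\<^esub> f i)"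

text \<open>The free module on the basis \<open>B\<close>: functions of finite support, equal to zero outside
  \<open>B\<close>.\<close>

definition free_module :: "('a, 'r) ring_scheme \<Rightarrow> 'x set \<Rightarrow> ('a, 'x \<Rightarrow> 'a) module"
  where "free_module R B =
    mk_module {f. (\<forall>x. f x \<in> carrier R) \<and> (\<forall>x. x \<notin> B \<longrightarrow> f x = \<zero>\<^bsub>R\<^esub>) \<and> finite {x. f x \<noteq> \<zero>\<^bsub>R\<^esub>}}
      (\<lambda>x. \<zero>\<^bsub>R\<^esub>) (\<lambda>f g x. f x \<oplus>\<^bsub>R\<^esub> g x) (\<lambda>r f x. r \<otimes>\<^bsub>R\<^esub> f x)"

definition module_hom ::
    "('a, 'r) ring_scheme \<Rightarrow> ('a, 'm) module \<Rightarrow> ('a, 'n) module \<Rightarrow> ('m \<Rightarrow> 'n) set"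
  where "module_hom R M N = {f \<in> carrier M \<rightarrow> carrier N.
    (\<forall>x \<in> carrier M. \<forall>y \<in> carrier M. f (x \<oplus>\<^bsub>M\<^esub> y) = f x \<oplus>\<^bsub>N\<^esub> f y) \<and>
    (\<forall>r \<in> carrier R. \<forall>x \<in> carrier M. f (r \<odot>\<^bsub>M\<^esub> x) = r \<odot>\<^bsub>N\<^esub> f x)}"

definition module_iso ::
    "('a, 'r) ring_scheme \<Rightarrow> ('a, 'm) module \<Rightarrow> ('a, 'n) module \<Rightarrow> ('m \<Rightarrow> 'n) set"
  where "module_iso R M N = {f \<in> module_hom R M N. bij_betw f (carrier M) (carrier N)}"

definition isomorphic_modules ::
    "('a, 'r) ring_scheme \<Rightarrow> ('a, 'm) module \<Rightarrow> ('a, 'n) module \<Rightarrow> bool"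
  where "isomorphic_modules R M N \<longleftrightarrow> module_iso R M N \<noteq> {}"

definition hom_module ::
    "('a, 'r) ring_scheme \<Rightarrow> ('a, 'm) module \<Rightarrow> ('a, 'n) module \<Rightarrow> ('a, 'm \<Rightarrow> 'n) module"
  where "hom_module R M N =
    mk_module (module_hom R M N \<inter> extensional (carrier M)) (\<lambda>x \<in> carrier M. \<zero>\<^bsub>N\<^esub>)
      (\<lambda>f g. \<lambda>x \<in> carrier M. f x \<oplus>\<^bsub>N\<^esub> g x) (\<lambda>r f. \<lambda>x \<in> carrier M. r \<odot>\<^bsub>N\<^esub> f x)"

definition dual_module :: "('a, 'r) ring_scheme \<Rightarrow> ('a, 'm) module \<Rightarrow> ('a, 'm \<Rightarrow> 'a) module"
  where "dual_module R M = hom_module R M (ring_as_module R)"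

definition finitely_generated :: "('a, 'r) ring_scheme \<Rightarrow> ('a, 'm) module \<Rightarrow> bool"
  where "finitely_generated R M \<longleftrightarrow>
    (\<exists>A. finite A \<and> A \<subseteq> carrier M \<and>
       (\<forall>x \<in> carrier M. \<exists>c \<in> A \<rightarrow> carrier R. x = (\<Oplus>\<^bsub>M\<^esub>a \<in> A. c a \<odot>\<^bsub>M\<^esub> a)))"

text \<open>Projective modules are the direct summands (retracts) of free modules.  Bases of free modules
  may be taken in the type of elements of \<open>P\<close>: a projective module is a retract of the free
  module on its own carrier.\<close>

definition projective_module :: "('a, 'r) ring_scheme \<Rightarrow> ('a, 'm) module \<Rightarrow> bool"
  where "projective_module R P \<longleftrightarrow> module R P \<and>
    (\<exists>(B :: 'm set) s p. s \<in> module_hom R P (free_module R B) \<and>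
       p \<in> module_hom R (free_module R B) P \<and> (\<forall>x \<in> carrier P. p (s x) = x))"


section \<open>Complexes\<close>

text \<open>Homological grading: \<open>cdiff C i\<close> goes from degree \<open>i\<close> to degree \<open>i - 1\<close>.  All modules of
  a complex have their carriers in one type \<open>'m\<close>.\<close>

record ('a, 'm) module_complex =
  cobj :: "int \<Rightarrow> ('a, 'm) module"
  cdiff :: "int \<Rightarrow> 'm \<Rightarrow> 'm"

definition is_complex :: "('a, 'r) ring_scheme \<Rightarrow> ('a, 'm) module_complex \<Rightarrow> bool"
  where "is_complex R C \<longleftrightarrow>
    (\<forall>i. module R (cobj C i)) \<and>
    (\<forall>i. cdiff C i \<in> module_hom R (cobj C i) (cobj C (i - 1))) \<and>
    (\<forall>i. \<forall>x \<in> carrier (cobj C i). cdiff C (i - 1) (cdiff C i x) = \<zero>\<^bsub>cobj C (i - 1 - 1)\<^esub>)"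

definition cycles :: "('a, 'm) module_complex \<Rightarrow> int \<Rightarrow> 'm set"
  where "cycles C i = {x \<in> carrier (cobj C i). cdiff C i x = \<zero>\<^bsub>cobj C (i - 1)\<^esub>}"

definition boundaries :: "('a, 'm) module_complex \<Rightarrow> int \<Rightarrow> 'm set"
  where "boundaries C i = cdiff C (i + 1) ` carrier (cobj C (i + 1))"

definition homology :: "('a, 'm) module_complex \<Rightarrow> int \<Rightarrow> ('a, 'm set) module"
  where "homology C i = quotient_module (sub_module (cobj C i) (cycles C i)) (boundaries C i)"

definition complex_sup :: "('a, 'm) module_complex \<Rightarrow> ereal"
  where "complex_sup C = (SUP i \<in> {i. \<not> zero_module (cobj C i)}. ereal (real_of_int i))"

definition complex_inf :: "('a, 'm) module_complex \<Rightarrow> ereal"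
  where "complex_inf C = (INF i \<in> {i. \<not> zero_module (cobj C i)}. ereal (real_of_int i))"

definition complex_hsup :: "('a, 'm) module_complex \<Rightarrow> ereal"
  where "complex_hsup C = (SUP i \<in> {i. \<not> zero_module (homology C i)}. ereal (real_of_int i))"

definition bounded_below :: "('a, 'm) module_complex \<Rightarrow> bool"
  where "bounded_below C \<longleftrightarrow> (\<exists>n. \<forall>i < n. zero_module (cobj C i))"

definition bounded_above :: "('a, 'm) module_complex \<Rightarrow> bool"
  where "bounded_above C \<longleftrightarrow> (\<exists>n. \<forall>i > n. zero_module (cobj C i))"


section \<open>Quasi-projective dimension\<close>

definition quasi_projective_resolution ::
    "('a, 'r) ring_scheme \<Rightarrow> ('a, 'm) module \<Rightarrow> ('a, 'p) module_complex \<Rightarrow> bool"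
  where "quasi_projective_resolution R M P \<longleftrightarrow>
    is_complex R P \<and> (\<forall>i. projective_module R (cobj P i)) \<and> bounded_below P \<and>
    (\<exists>a :: int \<Rightarrow> nat.
       (\<exists>i. complex_inf P \<le> ereal (real_of_int i) \<and> a i \<noteq> 0) \<and>
       (\<forall>i. complex_inf P \<le> ereal (real_of_int i) \<longrightarrow>
          isomorphic_modules R (homology P i) (power_module M (a i))))"

definition finite_quasi_projective_resolution ::
    "('a, 'r) ring_scheme \<Rightarrow> ('a, 'm) module \<Rightarrow> ('a, 'p) module_complex \<Rightarrow> bool"
  where "finite_quasi_projective_resolution R M P \<longleftrightarrow>
    quasi_projective_resolution R M P \<and> bounded_above P"

text \<open>The infimum ranges over complexes whose modules have carriers in \<open>'x \<Rightarrow> 'a\<close>, where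
  \<open>'a\<close> is the type of elements of \<open>R\<close>.  The type \<open>'x\<close> plays the role of a universe: since
  a free module on \<open>B :: 'x set\<close> has its carrier in \<open>'x \<Rightarrow> 'a\<close>, every projective module with
  a generating set that injects into \<open>'x\<close> has an isomorphic copy there.  For infinite \<open>'x\<close>
  this includes all countably generated ones, and by varying \<open>'x\<close> every bounded complex of
  projective modules is covered.\<close>

definition qpd :: "'x itself \<Rightarrow> ('a, 'r) ring_scheme \<Rightarrow> ('a, 'm) module \<Rightarrow> ereal"
  where "qpd _ R M =
    (if zero_module M then -\<infinity>
     else (INF P \<in> {P :: ('a, 'x \<Rightarrow> 'a) module_complex. finite_quasi_projective_resolution R M P}.
             complex_sup P - complex_hsup P))"

definition quasi_perfect :: "'x itself \<Rightarrow> ('a, 'r) ring_scheme \<Rightarrow> 'a set \<Rightarrow> bool"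
  where "quasi_perfect U R I \<longleftrightarrow>
    qpd U R (quotient_module (ring_as_module R) I) = grade R I"


section \<open>Ideals with free Koszul homology\<close>

text \<open>The Koszul complex of \<open>x\<^sub>0, \<dots>, x\<^bsub>n-1\<^esub>\<close> in terms of coordinates.  In degree \<open>i\<close> it is
  free on the basis elements \<open>e S\<close>, for \<open>S\<close> a subset of \<open>{..<n}\<close> with \<open>i\<close> elements
  (\<open>e S\<close> is the exterior product of the \<open>e s\<close>, \<open>s \<in> S\<close>, in increasing order), and
  \<open>d (e S) = (\<Sum>s \<in> S. (-1) ^ card {t \<in> S. t < s} * x s * e (S - {s}))\<close>.  So the coefficient
  of \<open>d f\<close> at \<open>T\<close> collects the contributions of the sets \<open>insert s T\<close> with \<open>s \<notin> T\<close>.\<close>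

definition koszul_complex ::
    "('a, 'r) ring_scheme \<Rightarrow> 'a list \<Rightarrow> ('a, nat set \<Rightarrow> 'a) module_complex"
  where "koszul_complex R xs =
    \<lparr>cobj = (\<lambda>i. free_module R {S. S \<subseteq> {..<length xs} \<and> int (card S) = i}),
     cdiff = (\<lambda>i f T.
       if T \<subseteq> {..<length xs} \<and> int (card T) = i - 1
       then \<Oplus>\<^bsub>R\<^esub>s \<in> {..<length xs} - T.
              (\<ominus>\<^bsub>R\<^esub> \<one>\<^bsub>R\<^esub>) [^]\<^bsub>R\<^esub> card {t \<in> T. t < s} \<otimes>\<^bsub>R\<^esub> xs ! s \<otimes>\<^bsub>R\<^esub> f (insert s T)
       else \<zero>\<^bsub>R\<^esub>)\<rparr>"

definition FKH_ideal :: "('a, 'r) ring_scheme \<Rightarrow> 'a set \<Rightarrow> bool"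
  where "FKH_ideal R I \<longleftrightarrow> proper_ideal R I \<and>
    (\<exists>xs. set xs \<subseteq> carrier R \<and> Idl\<^bsub>R\<^esub> (set xs) = I \<and>
       quasi_projective_resolution R (quotient_module (ring_as_module R) I) (koszul_complex R xs))"


section \<open>Ext and G-dimension\<close>

text \<open>\<open>\<dots> \<rightarrow> G 1 \<rightarrow> G 0 \<rightarrow> M \<rightarrow> 0\<close> is exact, with some augmentation \<open>G 0 \<rightarrow> M\<close>.\<close>

definition left_resolution ::
    "('a, 'r) ring_scheme \<Rightarrow> ('a, 'm) module \<Rightarrow> ('a, 'g) module_complex \<Rightarrow> bool"
  where "left_resolution R M G \<longleftrightarrow>
    is_complex R G \<and> (\<forall>i < 0. zero_module (cobj G i)) \<and>
    (\<forall>i > 0. cycles G i = boundaries G i) \<and>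
    (\<exists>e \<in> module_hom R (cobj G 0) M. e ` carrier (cobj G 0) = carrier M \<and>
       {x \<in> carrier (cobj G 0). e x = \<zero>\<^bsub>M\<^esub>} = boundaries G 0)"

definition projective_resolution ::
    "('a, 'r) ring_scheme \<Rightarrow> ('a, 'm) module \<Rightarrow> ('a, 'p) module_complex \<Rightarrow> bool"
  where "projective_resolution R M F \<longleftrightarrow>
    left_resolution R M F \<and> (\<forall>i. projective_module R (cobj F i))"

text \<open>In cohomological degree \<open>n\<close>, that is, homological degree \<open>- n\<close>, this complex is
  \<open>Hom (F n, N)\<close>.\<close>

definition hom_complex ::
    "('a, 'r) ring_scheme \<Rightarrow> ('a, 'p) module_complex \<Rightarrow> ('a, 'n) module \<Rightarrow>
     ('a, 'p \<Rightarrow> 'n) module_complex"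
  where "hom_complex R F N =
    \<lparr>cobj = (\<lambda>i. hom_module R (cobj F (- i)) N),
     cdiff = (\<lambda>i \<phi>. compose (carrier (cobj F (1 - i))) \<phi> (cdiff F (1 - i)))\<rparr>"

text \<open>A finitely generated module over a Noetherian ring has a projective resolution by modules
  \<open>R ^ n\<close>, whose carriers lie in \<open>nat \<Rightarrow> 'a\<close>; below, \<open>Ext\<close> is applied to such modules only.
  Up to isomorphism the choice of the resolution is irrelevant.\<close>

definition Ext ::
    "('a, 'r) ring_scheme \<Rightarrow> nat \<Rightarrow> ('a, 'm) module \<Rightarrow> ('a, 'n) module \<Rightarrow>
     ('a, ((nat \<Rightarrow> 'a) \<Rightarrow> 'n) set) module"
  where "Ext R i M N =
    homology
      (hom_complex R (SOME F :: ('a, nat \<Rightarrow> 'a) module_complex. projective_resolution R M F) N)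
      (- int i)"

definition biduality_map ::
    "('a, 'r) ring_scheme \<Rightarrow> ('a, 'm) module \<Rightarrow> 'm \<Rightarrow> ('m \<Rightarrow> 'a) \<Rightarrow> 'a"
  where "biduality_map R M x = (\<lambda>\<phi> \<in> carrier (dual_module R M). \<phi> x)"

definition totally_reflexive :: "('a, 'r) ring_scheme \<Rightarrow> ('a, 'm) module \<Rightarrow> bool"
  where "totally_reflexive R M \<longleftrightarrow>
    module R M \<and> finitely_generated R M \<and>
    biduality_map R M \<in> module_iso R M (dual_module R (dual_module R M)) \<and>
    (\<forall>i > 0. zero_module (Ext R i M (ring_as_module R))) \<and>
    (\<forall>i > 0. zero_module (Ext R i (dual_module R M) (ring_as_module R)))"

text \<open>Totally reflexive modules are finitely generated, hence isomorphic to modules with carrier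
  in \<open>nat \<Rightarrow> 'a\<close>.\<close>

definition G_dimension :: "('a, 'r) ring_scheme \<Rightarrow> ('a, 'm) module \<Rightarrow> enat"
  where "G_dimension R M =
    (INF n \<in> {n. \<exists>G :: ('a, nat \<Rightarrow> 'a) module_complex. left_resolution R M G \<and>
               (\<forall>i. 0 \<le> i \<and> i \<le> int n \<longrightarrow> totally_reflexive R (cobj G i)) \<and>
               (\<forall>i > int n. zero_module (cobj G i))}. enat n)"

end

theory Submission
  imports Defs "HOL-Library.Function_Algebras" "HOL-Library.Nat_Bijection"
begin

text \<open>Let \<open>\<aa>\<close> be generated by the linking regular sequence \<open>x\<close> of length \<open>n\<close>.  Elements of \<open>I\<close> act on the
  Koszul complex as maps homotopic to zero, so over \<open>R/\<aa>\<close> its homology is again free over \<open>R/I\<close>, and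
  the top homology is \<open>0 :\<^bsub>R/\<aa>\<^esub> I = J/\<aa>\<close>.  Finite G-dimension gives \<open>Ext\<^sup>i(R/I, R/\<aa>) = 0\<close> over \<open>R/\<aa>\<close> for
  large \<open>i\<close>, and dimension shifting along the complex lowers the bound to \<open>i > 0\<close>.  Hence functionals on the
  cycles extend to the complex, and \<open>J/\<aa>\<close>, a free \<open>R/I\<close>-module, has rank one.  Let \<open>y\<close> be a generator; the
  cone of a map of complexes inducing \<open>y : R/I \<rightarrow> R/\<aa>\<close> on homology has homology free over \<open>R/J\<close>.
  Lifting this complex along \<open>R \<rightarrow> R/\<aa>\<close>, one regular element at a time, shows
  \<open>qpd (R/J) \<le> n \<le> grade J\<close>.  Conversely a regular sequence in \<open>J\<close> can be chased up from the highest
  homology of any finite quasi-projective resolution, so the complex is at least that much longer.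

  Modules over \<open>R\<close> are handled as subquotients of \<open>nat \<Rightarrow> 's\<close> for a ring \<open>'s\<close> mapping onto \<open>R\<close>: a pair
  \<open>U, W\<close> of submodules stands for \<open>U/(U \<inter> W)\<close>, and maps are linear maps of the ambient modules.\<close>

section \<open>Vectors over a commutative ring\<close>

text \<open>The Ext conditions concern the varying quotients of R by parts of the regular sequence.
  These rings are never formed: everything is a congruence over one ring, and Ext vanishing is a
  coinductive predicate, so that long exact sequences become coinductions along syzygies. By Rees's
  change of rings each regular element shifts Ext by one degree, so finiteness of the bound survives
  the passage to the quotient by the sequence. The bound then descends to 0 because cycles always
  satisfy a bound one smaller than the homology, while in the top degree the cycles are the
  homology, a nonzero sum of copies of R/I. Rank one is forced by the top term being a single copy
  of the ring: a functional with value y at one generator and 0 at another would be multiplication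
  by some r in I with r y = y, and I annihilates y. The cone works because y embeds R/I with
  cokernel R/J. A separate obstacle is that Ext is defined by an arbitrary chosen projective
  resolution, whereas the argument needs finite free covers; the two have to be compared.\<close>

definition sc :: "'s::comm_ring_1 \<Rightarrow> ('i \<Rightarrow> 's) \<Rightarrow> 'i \<Rightarrow> 's" (infixr "*s" 75)
  where "r *s v = (\<lambda>i. r * v i)"

lemma sc_apply [simp]: "(r *s v) i = r * v i"
  by (simp add: sc_def)

lemma sc_simps [simp]:
  "0 *s v = 0" "1 *s v = v" "r *s 0 = 0" "r *s t *s v = (r * t) *s v"
  by (simp_all add: fun_eq_iff mult.assoc)

lemma sc_distrib:
  "r *s (u + v) = r *s u + r *s v" "r *s (u - v) = r *s u - r *s v"
  "(r + t) *s v = r *s v + t *s v" "(r - t) *s v = r *s v - t *s v"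
  "r *s (- v) = - (r *s v)" "(- r) *s v = - (r *s v)"
  by (simp_all add: fun_eq_iff algebra_simps)

lemma sum_fun_apply: "(\<Sum>x\<in>A. f x) i = (\<Sum>x\<in>A. f x i)"
  by (induction A rule: infinite_finite_induct) auto

text \<open>Total linear maps of the ambient function spaces. As a rule only the values on some
  \<open>Fr B\<close> with \<open>B\<close> finite matter, and there they are determined by the unit
  vectors.\<close>

definition lin :: "(('i \<Rightarrow> 's::comm_ring_1) \<Rightarrow> 'j \<Rightarrow> 's) \<Rightarrow> bool"
  where "lin f \<longleftrightarrow> (\<forall>u v. f (u + v) = f u + f v) \<and> (\<forall>r v. f (r *s v) = r *s f v)"

definition lin1 :: "(('i \<Rightarrow> 's::comm_ring_1) \<Rightarrow> 's) \<Rightarrow> bool"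
  where "lin1 f \<longleftrightarrow> (\<forall>u v. f (u + v) = f u + f v) \<and> (\<forall>r v. f (r *s v) = r * f v)"

lemma lin_add: "lin f \<Longrightarrow> f (u + v) = f u + f v"
  and lin_sc: "lin f \<Longrightarrow> f (r *s v) = r *s f v"
  by (simp_all add: lin_def)

lemma lin_zero: assumes "lin f" shows "f 0 = 0"
  using lin_sc[OF assms, of 0 0] by simp

lemma lin_minus: assumes "lin f" shows "f (- v) = - f v"
  using lin_sc[OF assms, of "-1" v] by (simp add: sc_distrib)

lemma lin_diff: assumes "lin f" shows "f (u - v) = f u - f v"
  using lin_add[OF assms, of u "- v"] lin_minus[OF assms] by simp

lemma lin_sum: assumes "lin f" shows "f (\<Sum>x\<in>A. g x) = (\<Sum>x\<in>A. f (g x))"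
proof (induction A rule: infinite_finite_induct)
  case (insert x A)
  then show ?case by (simp only: sum.insert not_False_eq_True lin_add[OF assms])
qed (simp_all only: sum.infinite sum.empty not_False_eq_True lin_zero[OF assms])

lemmas lin_simps = lin_add lin_sc lin_zero lin_minus lin_diff

lemma lin1_simps:
  assumes "lin1 f"
  shows "f (u + v) = f u + f v" "f (r *s v) = r * f v" "f 0 = 0" "f (- v) = - f v"
    "f (u - v) = f u - f v"
proof -
  show a: "f (u + v) = f u + f v" for u v using assms by (simp add: lin1_def)
  show m: "f (r *s v) = r * f v" for r v using assms by (simp add: lin1_def)
  show "f 0 = 0" using m[of 0 0] by simp
  show n: "f (- v) = - f v" for v using m[of "-1" v] by (simp add: sc_distrib)
  show "f (u - v) = f u - f v" using a[of u "- v"] n by simp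
qed

lemma lin_intros:
  "lin (\<lambda>v. v)" "lin (\<lambda>v. 0)"
  "lin f \<Longrightarrow> lin g \<Longrightarrow> lin (\<lambda>v. f v + g v)"
  "lin f \<Longrightarrow> lin g \<Longrightarrow> lin (\<lambda>v. f v - g v)"
  "lin f \<Longrightarrow> lin (\<lambda>v. - f v)"
  "lin f \<Longrightarrow> lin (\<lambda>v. r *s f v)"
  by (auto simp: lin_def sc_distrib algebra_simps)

lemma lin_comp: "lin f \<Longrightarrow> lin g \<Longrightarrow> lin (\<lambda>v. f (g v))"
  by (auto simp: lin_def)

lemma lin_coord: "(\<And>i. lin1 (\<lambda>v. f v i)) \<Longrightarrow> lin f"
  by (auto simp: lin_def lin1_def fun_eq_iff)

section \<open>Submodules, ideals and free modules in coordinates\<close>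

definition sub :: "('i \<Rightarrow> 's::comm_ring_1) set \<Rightarrow> bool"
  where "sub A \<longleftrightarrow> 0 \<in> A \<and> (\<forall>u\<in>A. \<forall>v\<in>A. u + v \<in> A) \<and> (\<forall>r. \<forall>v\<in>A. r *s v \<in> A)"

lemma sub_zero: "sub A \<Longrightarrow> 0 \<in> A"
  and sub_add: "sub A \<Longrightarrow> u \<in> A \<Longrightarrow> v \<in> A \<Longrightarrow> u + v \<in> A"
  and sub_sc: "sub A \<Longrightarrow> v \<in> A \<Longrightarrow> r *s v \<in> A"
  by (simp_all add: sub_def)

lemma sub_minus: assumes "sub A" "v \<in> A" shows "- v \<in> A"
  using sub_sc[OF assms, of "-1"] by (simp add: sc_distrib)

lemma sub_diff: assumes "sub A" "u \<in> A" "v \<in> A" shows "u - v \<in> A"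
  using sub_add[OF assms(1,2) sub_minus[OF assms(1,3)]] by simp

lemma sub_sum: "sub A \<Longrightarrow> (\<And>x. x \<in> D \<Longrightarrow> f x \<in> A) \<Longrightarrow> (\<Sum>x\<in>D. f x) \<in> A"
  by (induction D rule: infinite_finite_induct) (auto intro: sub_zero sub_add)

lemmas sub_closed = sub_zero sub_add sub_sc sub_minus sub_diff

lemma sub_diff_trans: assumes "sub W" "a - b \<in> W" "b - c \<in> W" shows "a - c \<in> W"
  using sub_add[OF assms] by simp

lemma sub_diff_sym: assumes "sub W" "a - b \<in> W" shows "b - a \<in> W"
  using sub_minus[OF assms] by simp

lemma sub_diff_iff: assumes "sub W" "a - b \<in> W" shows "a \<in> W \<longleftrightarrow> b \<in> W"
  using sub_add[OF assms(1), of "a - b" b] sub_diff[OF assms(1), of a "a - b"] assms(2) by auto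

lemma sub_preimage:
  assumes "sub U" "sub W" "lin f"
  shows "sub {v \<in> U. f v \<in> W}"
  using assms(1,2) unfolding sub_def by (simp only: mem_Collect_eq lin_simps[OF assms(3)]) blast

definition idl :: "'s::comm_ring_1 set \<Rightarrow> bool"
  where "idl I \<longleftrightarrow> 0 \<in> I \<and> (\<forall>a\<in>I. \<forall>b\<in>I. a + b \<in> I) \<and> (\<forall>r. \<forall>a\<in>I. r * a \<in> I)"

lemma idl_zero: "idl A \<Longrightarrow> 0 \<in> A"
  and idl_add: "idl A \<Longrightarrow> u \<in> A \<Longrightarrow> v \<in> A \<Longrightarrow> u + v \<in> A"
  and idl_mult: "idl A \<Longrightarrow> v \<in> A \<Longrightarrow> r * v \<in> A"
  by (simp_all add: idl_def)

lemma idl_minus: assumes "idl A" "v \<in> A" shows "- v \<in> A"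
  using idl_mult[OF assms, of "-1"] by simp

lemma idl_diff: assumes "idl A" "u \<in> A" "v \<in> A" shows "u - v \<in> A"
  using idl_add[OF assms(1,2) idl_minus[OF assms(1,3)]] by simp

lemma idl_mult2: assumes "idl A" "v \<in> A" shows "v * r \<in> A"
  using idl_mult[OF assms, of r] by (simp add: mult.commute)

lemmas idl_closed = idl_zero idl_add idl_mult idl_mult2 idl_minus idl_diff

lemma idl_diff_trans: assumes "idl A" "a - b \<in> A" "b - c \<in> A" shows "a - c \<in> A"
  using idl_add[OF assms] by simp

lemma idl_diff_iff: assumes "idl A" "a - b \<in> A" shows "a \<in> A \<longleftrightarrow> b \<in> A"
  using idl_add[OF assms(1), of "a - b" b] idl_diff[OF assms(1), of a "a - b"] assms(2) by auto

text \<open>For finite \<open>B\<close> the vectors of \<open>Fr B\<close> in \<open>hat I\<close>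
  form \<open>I\<close> times the free module. Thus \<open>hat \<aa>\<close> is the relation module
  that turns \<open>Fr B\<close> into a free module over the quotient by
  \<open>\<aa>\<close>.\<close>

definition hat :: "'s::comm_ring_1 set \<Rightarrow> ('i \<Rightarrow> 's) set"
  where "hat I = {v. \<forall>i. v i \<in> I}"

definition Fr :: "'i set \<Rightarrow> ('i \<Rightarrow> 's::comm_ring_1) set"
  where "Fr B = {v. \<forall>i. i \<notin> B \<longrightarrow> v i = 0}"

lemma sub_hat: "idl I \<Longrightarrow> sub (hat I)"
  by (auto simp: sub_def hat_def idl_closed)

lemma sub_Fr: "sub (Fr B)"
  by (auto simp: sub_def Fr_def)

lemma hat_sc: "idl I \<Longrightarrow> r \<in> I \<Longrightarrow> r *s v \<in> hat I"
  by (auto simp: hat_def idl_closed)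

lemma Fr_empty [simp]: "Fr {} = {0}"
  by (auto simp: Fr_def fun_eq_iff)

definition un :: "'i \<Rightarrow> 'i \<Rightarrow> 's::comm_ring_1"
  where "un i = (\<lambda>j. if j = i then 1 else 0)"

lemma un_Fr [simp]: "i \<in> B \<Longrightarrow> un i \<in> Fr B"
  by (auto simp: Fr_def un_def)

lemma Fr_expand: assumes "finite B" "v \<in> Fr B" shows "v = (\<Sum>i\<in>B. v i *s un i)"
proof
  fix j
  have "(\<Sum>i\<in>B. v i *s un i) j = (\<Sum>i\<in>B. if i = j then v i else 0)"
    by (auto simp: sum_fun_apply un_def intro!: sum.cong)
  also have "\<dots> = v j" using assms by (auto simp: Fr_def)
  finally show "v j = (\<Sum>i\<in>B. v i *s un i) j" by simp
qed

definition linB :: "'i set \<Rightarrow> ('i \<Rightarrow> 'j \<Rightarrow> 's::comm_ring_1) \<Rightarrow> ('i \<Rightarrow> 's) \<Rightarrow> 'j \<Rightarrow> 's"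
  where "linB B w v = (\<Sum>i\<in>B. v i *s w i)"

lemma lin_linB: "lin (linB B w)"
  unfolding lin_def linB_def
  by (auto simp: sc_distrib sum.distrib fun_eq_iff sum_fun_apply sum_distrib_left algebra_simps)

lemma linB_un: "finite B \<Longrightarrow> i \<in> B \<Longrightarrow> linB B w (un i) = w i"
proof -
  assume "finite B" "i \<in> B"
  have "linB B w (un i) = (\<Sum>j\<in>B. if j = i then w j else 0)"
    unfolding linB_def by (rule sum.cong) (auto simp: un_def)
  then show ?thesis using \<open>finite B\<close> \<open>i \<in> B\<close> by simp
qed

lemma lin_expand: assumes "finite B" "v \<in> Fr B" "lin f" shows "f v = linB B (\<lambda>i. f (un i)) v"
  by (subst Fr_expand[OF assms(1,2)])
     (simp only: linB_def lin_sum[OF assms(3)] lin_sc[OF assms(3)])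

lemma lin_into:
  assumes "finite B" "lin f" "sub T" "\<And>i. i \<in> B \<Longrightarrow> f (un i) \<in> T" "v \<in> Fr B"
  shows "f v \<in> T"
  using assms by (subst lin_expand[OF assms(1,5,2)]) (auto simp: linB_def intro!: sub_sum sub_sc)

text \<open>Such a \<open>v\<close> is a finite combination of unit vectors with coefficients in
  \<open>I\<close>. This is how a map out of a free module is seen to descend to the quotient by an
  ideal.\<close>

lemma lin_hat_into:
  assumes "finite B" "lin f" "sub T" "\<And>r i. r \<in> I \<Longrightarrow> i \<in> B \<Longrightarrow> r *s f (un i) \<in> T"
    "v \<in> Fr B" "v \<in> hat I"
  shows "f v \<in> T"
  using assms by (subst lin_expand[OF assms(1,5,2)]) (auto simp: linB_def hat_def intro!: sub_sum)

lemma lin_hat: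
  assumes "idl I" "finite B" "lin f" "v \<in> Fr B" "v \<in> hat I"
  shows "f v \<in> hat I"
  by (rule lin_hat_into[OF assms(2,3) sub_hat _ assms(4,5)]) (auto simp: assms(1) intro: hat_sc)

lemma lin1_hat:
  assumes "idl I" "finite B" "lin1 f" "v \<in> Fr B" "v \<in> hat I"
  shows "f v \<in> I"
proof -
  have "lin (\<lambda>v (_::unit). f v)" using assms(3) by (intro lin_coord) simp
  from lin_hat[OF assms(1,2) this assms(4,5)] show ?thesis by (simp add: hat_def)
qed

lemma basis_choice:
  assumes "finite B" "\<And>i. i \<in> B \<Longrightarrow> \<exists>w. P i w"
  shows "\<exists>f. lin f \<and> (\<forall>i\<in>B. P i (f (un i)))"
proof -
  from assms(2) obtain w where "\<And>i. i \<in> B \<Longrightarrow> P i (w i)" by metis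
  then show ?thesis using lin_linB[of B w] linB_un[OF assms(1), of _ w] by metis
qed

text \<open>Projectivity of \<open>Fr B\<close>: choose on unit vectors and extend linearly. Only
  pointwise solvability modulo \<open>W\<close> is asked of \<open>q\<close>, so the lemma serves
  for covers, for exact sequences and for division by a ring element alike.\<close>

lemma free_lift:
  assumes "finite B" "lin e" "lin q" "sub U" "sub W"
    and "\<And>v. v \<in> Fr B \<Longrightarrow> \<exists>u\<in>U. q u - e v \<in> W"
  shows "\<exists>s. lin s \<and> (\<forall>v\<in>Fr B. s v \<in> U \<and> q (s v) - e v \<in> W)"
proof -
  have "\<exists>w. w \<in> U \<and> q w - e (un i) \<in> W" if "i \<in> B" for i
    using assms(6)[OF un_Fr[OF that]] by (simp only: Bex_def)
  from basis_choice[OF assms(1), of "\<lambda>i w. w \<in> U \<and> q w - e (un i) \<in> W", OF this]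
  obtain s where s: "lin s" "\<And>i. i \<in> B \<Longrightarrow> s (un i) \<in> U"
    "\<And>i. i \<in> B \<Longrightarrow> q (s (un i)) - e (un i) \<in> W" by metis
  have "lin (\<lambda>v. q (s v) - e v)"
    by (rule lin_intros(4)[OF lin_comp[OF assms(3) s(1)] assms(2)])
  then have "q (s v) - e v \<in> W" if "v \<in> Fr B" for v
    using lin_into[of B "\<lambda>v. q (s v) - e v" W v] assms(1,5) s(3) that by blast
  moreover have "s v \<in> U" if "v \<in> Fr B" for v
    by (rule lin_into[OF assms(1) s(1) assms(4) s(2) that])
  ultimately show ?thesis using s(1) by blast
qed

section \<open>Direct sums by interleaving coordinates\<close>

definition ev :: "(nat \<Rightarrow> 's) \<Rightarrow> nat \<Rightarrow> 's" where "ev v = (\<lambda>i. v (2 * i))"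
definition od :: "(nat \<Rightarrow> 's) \<Rightarrow> nat \<Rightarrow> 's" where "od v = (\<lambda>i. v (2 * i + 1))"
text \<open>Pairs are stored at even and odd positions so that direct sums stay in the type
  \<open>nat => 's\<close>, to which the coinductive predicate \<open>good\<close> is
  confined.\<close>

definition jn :: "(nat \<Rightarrow> 's) \<Rightarrow> (nat \<Rightarrow> 's) \<Rightarrow> nat \<Rightarrow> 's"
  where "jn u w = (\<lambda>i. if even i then u (i div 2) else w (i div 2))"
definition jnB :: "nat set \<Rightarrow> nat set \<Rightarrow> nat set"
  where "jnB B C = {i. if even i then i div 2 \<in> B else i div 2 \<in> C}"

lemma ev_jn [simp]: "ev (jn u w) = u" and od_jn [simp]: "od (jn u w) = w"
  by (simp_all add: ev_def od_def jn_def)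

lemma jn_ev_od [simp]: "jn (ev v) (od v) = v"
  by (auto simp: ev_def od_def jn_def fun_eq_iff elim!: oddE)

lemma lin_ev: "lin ev" and lin_od: "lin od"
  by (simp_all add: lin_def ev_def od_def fun_eq_iff)

lemma lin_jn: "lin f \<Longrightarrow> lin g \<Longrightarrow> lin (\<lambda>v. jn (f v) (g v))"
  by (auto simp: lin_def jn_def fun_eq_iff)

lemma jn_simps:
  "jn u w + jn u' w' = jn (u + u') (w + w')" "jn u w - jn u' w' = jn (u - u') (w - w')"
  "r *s jn u w = jn (r *s u) (r *s w)" "jn 0 0 = 0"
  by (auto simp: jn_def fun_eq_iff)

lemma evod_simps [simp]:
  "ev (u + v) = ev u + ev v" "ev (u - v) = ev u - ev v" "ev (r *s v) = r *s ev v" "ev 0 = 0"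
  "od (u + v) = od u + od v" "od (u - v) = od u - od v" "od (r *s v) = r *s od v" "od 0 = 0"
  by (simp_all add: ev_def od_def fun_eq_iff)

lemma evod_all: "(\<forall>i. P i) \<longleftrightarrow> (\<forall>i::nat. P (2 * i)) \<and> (\<forall>i. P (2 * i + 1))"
  by (metis evenE oddE)

lemma Fr_jnB: "v \<in> Fr (jnB B C) \<longleftrightarrow> ev v \<in> Fr B \<and> od v \<in> Fr C"
  unfolding Fr_def jnB_def mem_Collect_eq by (subst evod_all) (simp add: ev_def od_def)

lemma hat_evod: "v \<in> hat I \<longleftrightarrow> ev v \<in> hat I \<and> od v \<in> hat I"
  unfolding hat_def mem_Collect_eq by (subst evod_all) (simp add: ev_def od_def)

lemma hat_jn [simp]: "jn u w \<in> hat I \<longleftrightarrow> u \<in> hat I \<and> w \<in> hat I"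
  using hat_evod[of "jn u w" I] by simp

lemma hat_ev: "v \<in> hat I \<Longrightarrow> ev v \<in> hat I" and hat_od: "v \<in> hat I \<Longrightarrow> od v \<in> hat I"
  using hat_evod by blast+

lemma finite_jnB: assumes "finite B" "finite C" shows "finite (jnB B C)"
proof (rule finite_subset)
  show "jnB B C \<subseteq> (\<lambda>i. 2 * i) ` B \<union> (\<lambda>i. 2 * i + 1) ` C"
  proof
    fix i assume "i \<in> jnB B C"
    then have "even i \<and> i div 2 \<in> B \<or> odd i \<and> i div 2 \<in> C"
      by (auto simp: jnB_def split: if_splits)
    moreover have "i = 2 * (i div 2)" if "even i" using that by simp
    moreover have "i = 2 * (i div 2) + 1" if "odd i" using that by simp
    ultimately show "i \<in> (\<lambda>i. 2 * i) ` B \<union> (\<lambda>i. 2 * i + 1) ` C" by blast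
  qed
qed (use assms in simp)

lemma jnB_empty [simp]: "jnB {} {} = {}"
  by (auto simp: jnB_def)

section \<open>Vanishing of Ext for presented modules\<close>

text \<open>The subquotient \<open>U/(U \<inter> W)\<close> is a module over the quotient by
  \<open>\<aa>\<close>; \<open>W\<close> need not be contained in \<open>U\<close>.\<close>

definition md :: "'s::comm_ring_1 set \<Rightarrow> ('i \<Rightarrow> 's) set \<Rightarrow> ('i \<Rightarrow> 's) set \<Rightarrow> bool"
  where "md \<aa> U W \<longleftrightarrow> sub U \<and> sub W \<and> (\<forall>r\<in>\<aa>. \<forall>u\<in>U. r *s u \<in> W)"

text \<open>A functional from \<open>L\<close> modulo \<open>hat \<aa>\<close> to the quotient ring
  by \<open>\<aa>\<close>, given by representatives of its values. Representatives come from
  choices, so they are linear only up to \<open>\<aa>\<close>.\<close>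

definition mlf :: "'s::comm_ring_1 set \<Rightarrow> ('i \<Rightarrow> 's) set \<Rightarrow> (('i \<Rightarrow> 's) \<Rightarrow> 's) \<Rightarrow> bool"
  where "mlf \<aa> L \<phi> \<longleftrightarrow> (\<forall>u\<in>L. \<forall>v\<in>L. \<phi> (u + v) - (\<phi> u + \<phi> v) \<in> \<aa>) \<and>
    (\<forall>r. \<forall>u\<in>L. \<phi> (r *s u) - r * \<phi> u \<in> \<aa>) \<and> (\<forall>u\<in>L. u \<in> hat \<aa> \<longrightarrow> \<phi> u \<in> \<aa>)"

text \<open>For the syzygy \<open>L\<close> of a cover by a free module this is vanishing of the
  first Ext into the quotient ring, because that Ext is the cokernel of restricting functionals from
  the cover to \<open>L\<close>.\<close>

definition ext :: "'s::comm_ring_1 set \<Rightarrow> ('i \<Rightarrow> 's) set \<Rightarrow> bool"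
  where "ext \<aa> L \<longleftrightarrow> (\<forall>\<phi>. mlf \<aa> L \<phi> \<longrightarrow> (\<exists>\<psi>. lin1 \<psi> \<and> (\<forall>v\<in>L. \<phi> v - \<psi> v \<in> \<aa>)))"

definition cov :: "(('i \<Rightarrow> 's::comm_ring_1) \<Rightarrow> 'j \<Rightarrow> 's) \<Rightarrow> 'i set \<Rightarrow> ('j \<Rightarrow> 's) set \<Rightarrow> ('j \<Rightarrow> 's) set \<Rightarrow> bool"
  where "cov e B U W \<longleftrightarrow> finite B \<and> lin e \<and> (\<forall>v\<in>Fr B. e v \<in> U) \<and> (\<forall>u\<in>U. \<exists>v\<in>Fr B. u - e v \<in> W)"

definition kr :: "(('i \<Rightarrow> 's::comm_ring_1) \<Rightarrow> 'j \<Rightarrow> 's) \<Rightarrow> 'i set \<Rightarrow> ('j \<Rightarrow> 's) set \<Rightarrow> ('i \<Rightarrow> 's) set"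
  where "kr e B W = {v \<in> Fr B. e v \<in> W}"

lemma mdD: "md \<aa> U W \<Longrightarrow> sub U" "md \<aa> U W \<Longrightarrow> sub W"
  "md \<aa> U W \<Longrightarrow> r \<in> \<aa> \<Longrightarrow> u \<in> U \<Longrightarrow> r *s u \<in> W"
  by (auto simp: md_def)

lemma md_hat: "idl \<aa> \<Longrightarrow> sub U \<Longrightarrow> md \<aa> U (hat \<aa>)"
  by (auto simp: md_def sub_hat hat_sc)

lemma covD: assumes "cov e B U W"
  shows "finite B" "lin e" "\<And>v. v \<in> Fr B \<Longrightarrow> e v \<in> U"
    "\<And>u. u \<in> U \<Longrightarrow> \<exists>v\<in>Fr B. u - e v \<in> W"
  using assms by (auto simp: cov_def)

lemma sub_kr: "lin e \<Longrightarrow> sub W \<Longrightarrow> sub (kr e B W)"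
  unfolding kr_def by (rule sub_preimage[OF sub_Fr])

lemma cov_hat:
  assumes "cov e B U W" "md \<aa> U W" "v \<in> Fr B" "v \<in> hat \<aa>"
  shows "e v \<in> W"
proof (rule lin_hat_into[of B e W \<aa> v])
  show "r *s e (un i) \<in> W" if "r \<in> \<aa>" "i \<in> B" for r i
    by (rule mdD(3)[OF assms(2) that(1) covD(3)[OF assms(1) un_Fr[OF that(2)]]])
qed (fact covD(1,2)[OF assms(1)] mdD(2)[OF assms(2)] assms(3,4))+

lemma mlfD:
  assumes "mlf \<aa> L \<phi>"
  shows "\<And>u v. u \<in> L \<Longrightarrow> v \<in> L \<Longrightarrow> \<phi> (u + v) - (\<phi> u + \<phi> v) \<in> \<aa>"
    "\<And>r u. u \<in> L \<Longrightarrow> \<phi> (r *s u) - r * \<phi> u \<in> \<aa>"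
    "\<And>u. u \<in> L \<Longrightarrow> u \<in> hat \<aa> \<Longrightarrow> \<phi> u \<in> \<aa>"
  using assms by (auto simp: mlf_def)

lemma mlf_minus:
  assumes "mlf \<aa> L \<phi>" "idl \<aa>" "sub L" "u \<in> L" "v \<in> L"
  shows "\<phi> (u - v) - (\<phi> u - \<phi> v) \<in> \<aa>"
proof -
  have "\<phi> ((u - v) + v) - (\<phi> (u - v) + \<phi> v) \<in> \<aa>"
    using mlfD(1)[OF assms(1)] sub_diff[OF assms(3,4,5)] assms(5) by blast
  from idl_minus[OF assms(2) this] show ?thesis by (simp add: algebra_simps)
qed

lemma mlf_cong:
  assumes "mlf \<aa> L \<phi>" "idl \<aa>" "sub L" "u \<in> L" "v \<in> L" "u - v \<in> hat \<aa>"
  shows "\<phi> u - \<phi> v \<in> \<aa>"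
  using idl_diff_iff[OF assms(2) mlf_minus[OF assms(1-5)]]
    mlfD(3)[OF assms(1) sub_diff[OF assms(3-5)] assms(6)] by blast

lemma mlf_lin1:
  assumes "idl \<aa>" "finite B" "L \<subseteq> Fr B" "lin1 \<psi>"
  shows "mlf \<aa> L \<psi>"
  using lin1_hat[OF assms(1,2,4)] assms(3) by (auto simp: mlf_def lin1_simps[OF assms(4)] idl_zero[OF assms(1)])

lemma mlf_sub:
  assumes "mlf \<aa> L \<phi>" "mlf \<aa> L \<psi>" "idl \<aa>"
  shows "mlf \<aa> L (\<lambda>v. \<phi> v - \<psi> v)"
  unfolding mlf_def
proof (intro conjI ballI allI impI)
  fix u v assume "u \<in> L" "v \<in> L"
  then show "\<phi> (u + v) - \<psi> (u + v) - (\<phi> u - \<psi> u + (\<phi> v - \<psi> v)) \<in> \<aa>"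
    using idl_diff[OF assms(3) mlfD(1)[OF assms(1)] mlfD(1)[OF assms(2)]] by (simp add: algebra_simps)
next
  fix r u assume "u \<in> L"
  then show "\<phi> (r *s u) - \<psi> (r *s u) - r * (\<phi> u - \<psi> u) \<in> \<aa>"
    using idl_diff[OF assms(3) mlfD(2)[OF assms(1)] mlfD(2)[OF assms(2)], of u u r r]
    by (simp add: algebra_simps)
next
  fix u assume "u \<in> L" "u \<in> hat \<aa>"
  then show "\<phi> u - \<psi> u \<in> \<aa>"
    using idl_diff[OF assms(3)] mlfD(3)[OF assms(1)] mlfD(3)[OF assms(2)] by blast
qed

lemma mlf_comp:
  assumes "mlf \<aa> L \<phi>" "lin f" "\<And>v. v \<in> L' \<Longrightarrow> f v \<in> L"
    "\<And>v. v \<in> L' \<Longrightarrow> v \<in> hat \<aa> \<Longrightarrow> f v \<in> hat \<aa>"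
  shows "mlf \<aa> L' (\<lambda>v. \<phi> (f v))"
  unfolding mlf_def using mlfD[OF assms(1)] assms(3,4) by (simp add: lin_simps[OF assms(2)])

text \<open>On a finite free module the values at the unit vectors determine a functional modulo
  \<open>\<aa>\<close>, so representatives can be replaced by a genuinely linear map.\<close>

lemma mlf_linear:
  assumes "mlf \<aa> (Fr B) \<phi>" "idl \<aa>" "finite B"
  shows "\<exists>\<psi>. lin1 \<psi> \<and> (\<forall>v\<in>Fr B. \<phi> v - \<psi> v \<in> \<aa>)"
proof -
  let ?\<psi> = "\<lambda>v. \<Sum>i\<in>B. v i * \<phi> (un i)"
  have "lin1 ?\<psi>"
    by (auto simp: lin1_def sum.distrib sum_distrib_left algebra_simps)
  moreover have "\<phi> (\<Sum>i\<in>C. v i *s un i) - (\<Sum>i\<in>C. v i * \<phi> (un i)) \<in> \<aa>" if "C \<subseteq> B" for C v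
    using finite_subset[OF that assms(3)] that
  proof (induction C)
    case empty
    have "\<phi> 0 \<in> \<aa>" using mlfD(3)[OF assms(1) sub_zero[OF sub_Fr] sub_zero[OF sub_hat[OF assms(2)]]] .
    then show ?case by (simp only: sum.empty diff_zero)
  next
    case (insert x C)
    have 1: "un x \<in> Fr B" "(\<Sum>i\<in>C. v i *s un i) \<in> Fr B"
      using insert.prems by (auto intro!: sub_sum sub_sc sub_Fr)
    let ?s = "\<Sum>i\<in>C. v i *s un i"
    have 2: "\<phi> (v x *s un x + ?s) - (\<phi> (v x *s un x) + \<phi> ?s) \<in> \<aa>"
      by (rule mlfD(1)[OF assms(1) sub_sc[OF sub_Fr 1(1)] 1(2)])
    have 3: "\<phi> (v x *s un x) - v x * \<phi> (un x) \<in> \<aa>" by (rule mlfD(2)[OF assms(1) 1(1)])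
    have 4: "\<phi> ?s - (\<Sum>i\<in>C. v i * \<phi> (un i)) \<in> \<aa>" using insert by blast
    have "\<phi> (v x *s un x + ?s) - (v x * \<phi> (un x) + (\<Sum>i\<in>C. v i * \<phi> (un i))) \<in> \<aa>"
      using idl_add[OF assms(2) idl_add[OF assms(2) 2 3] 4] by (simp add: algebra_simps)
    then show ?case using insert.hyps by (simp only: sum.insert not_False_eq_True)
  qed
  then have "\<phi> v - ?\<psi> v \<in> \<aa>" if "v \<in> Fr B" for v
    using Fr_expand[OF assms(3) that] by (metis order_refl)
  ultimately show ?thesis by blast
qed

lemma ext_Fr: "idl \<aa> \<Longrightarrow> finite B \<Longrightarrow> ext \<aa> (Fr B)"
  unfolding ext_def using mlf_linear by blast

text \<open>\<open>L\<close> is an extension of \<open>L2\<close>, its odd parts, by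
  \<open>L1\<close>, the vectors with odd part zero. Subtract an extension of the restriction to
  \<open>L1\<close>; what is left factors through \<open>L2\<close>. This is the Ext part of the
  horseshoe step below.\<close>

lemma ext_jn:
  assumes a: "idl \<aa>" and L: "sub L" "finite B" "L \<subseteq> Fr B" "sub L1" "ext \<aa> L1" "ext \<aa> L2"
    and i: "\<And>c. jn c 0 \<in> L \<longleftrightarrow> c \<in> L1"
    and o: "\<And>v. v \<in> L \<Longrightarrow> od v \<in> L2" "\<And>l. l \<in> L2 \<Longrightarrow> \<exists>v\<in>L. od v = l"
    and h: "\<And>l. l \<in> L2 \<Longrightarrow> l \<in> hat \<aa> \<Longrightarrow> jn 0 l \<in> L"
  shows "ext \<aa> L"
  unfolding ext_def
proof (intro allI impI)
  fix \<phi> assume \<phi>: "mlf \<aa> L \<phi>"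
  have z: "(0 :: nat \<Rightarrow> 'a) \<in> hat \<aa>" by (rule sub_zero[OF sub_hat[OF a]])
  have "mlf \<aa> L1 (\<lambda>c. \<phi> (jn c 0))"
  proof (rule mlf_comp[OF \<phi>, of "\<lambda>c. jn c 0" L1])
    show "lin (\<lambda>c. jn c 0 :: nat \<Rightarrow> 'a)" by (rule lin_jn[OF lin_intros(1,2)])
  qed (simp_all add: i z)
  then obtain \<psi>1 where \<psi>1: "lin1 \<psi>1" "\<And>v. v \<in> L1 \<Longrightarrow> \<phi> (jn v 0) - \<psi>1 v \<in> \<aa>"
    using L(5) unfolding ext_def by blast
  have l: "lin1 (\<lambda>v. \<psi>1 (ev v))" using \<psi>1(1) by (simp add: lin1_def)
  \<comment> \<open>The corrected functional vanishes on the copy of \<open>L1\<close>, hence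
    depends modulo \<open>\<aa>\<close> only on the odd part of its argument.\<close>
  define \<phi>' where "\<phi>' = (\<lambda>v. \<phi> v - \<psi>1 (ev v))"
  have \<phi>': "mlf \<aa> L \<phi>'"
    unfolding \<phi>'_def by (rule mlf_sub[OF \<phi> mlf_lin1[OF a L(2,3) l] a])
  have eq: "\<phi>' v - \<phi>' w \<in> \<aa>" if "v \<in> L" "w \<in> L" "od v = od w" for v w
  proof -
    have "v - w = jn (ev v - ev w) 0" using that(3)
      by (metis evod_simps(2,6) jn_ev_od right_minus_eq)
    moreover have "v - w \<in> L" using sub_diff[OF L(1) that(1,2)] .
    ultimately have "\<phi>' (v - w) \<in> \<aa>" using \<psi>1(2)[of "ev v - ev w"] i by (simp add: \<phi>'_def)
    then show ?thesis using idl_diff_iff[OF a mlf_minus[OF \<phi>' a L(1) that(1,2)]] by blast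
  qed
  \<comment> \<open>An arbitrary section of \<open>od\<close>, not assumed additive: by
    \<open>eq\<close> its defects are invisible modulo \<open>\<aa>\<close>.\<close>
  obtain \<sigma> where \<sigma>: "\<And>l. l \<in> L2 \<Longrightarrow> \<sigma> l \<in> L" "\<And>l. l \<in> L2 \<Longrightarrow> od (\<sigma> l) = l"
    using o(2) by metis
  have "mlf \<aa> L2 (\<lambda>l. \<phi>' (\<sigma> l))"
    unfolding mlf_def
  proof (intro conjI ballI allI impI)
    fix u v assume uv: "u \<in> L2" "v \<in> L2"
    have s: "\<sigma> u + \<sigma> v \<in> L" by (rule sub_add[OF L(1) \<sigma>(1)[OF uv(1)] \<sigma>(1)[OF uv(2)]])
    have o': "od (\<sigma> u + \<sigma> v) = u + v" by (simp add: \<sigma> uv)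
    then have l': "u + v \<in> L2" using o(1)[OF s] by simp
    have "\<phi>' (\<sigma> (u + v)) - \<phi>' (\<sigma> u + \<sigma> v) \<in> \<aa>"
      by (rule eq[OF \<sigma>(1)[OF l'] s]) (simp only: \<sigma>(2)[OF l'] o')
    then show "\<phi>' (\<sigma> (u + v)) - (\<phi>' (\<sigma> u) + \<phi>' (\<sigma> v)) \<in> \<aa>"
      by (rule idl_diff_trans[OF a _ mlfD(1)[OF \<phi>' \<sigma>(1)[OF uv(1)] \<sigma>(1)[OF uv(2)]]])
  next
    fix r u assume u: "u \<in> L2"
    have s: "r *s \<sigma> u \<in> L" by (rule sub_sc[OF L(1) \<sigma>(1)[OF u]])
    have o': "od (r *s \<sigma> u) = r *s u" by (simp add: \<sigma> u)
    then have l': "r *s u \<in> L2" using o(1)[OF s] by simp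
    have "\<phi>' (\<sigma> (r *s u)) - \<phi>' (r *s \<sigma> u) \<in> \<aa>"
      by (rule eq[OF \<sigma>(1)[OF l'] s]) (simp only: \<sigma>(2)[OF l'] o')
    then show "\<phi>' (\<sigma> (r *s u)) - r * \<phi>' (\<sigma> u) \<in> \<aa>"
      by (rule idl_diff_trans[OF a _ mlfD(2)[OF \<phi>' \<sigma>(1)[OF u]]])
  next
    fix u :: "nat \<Rightarrow> 'a" assume u: "u \<in> L2" "u \<in> hat \<aa>"
    have "\<phi>' (\<sigma> u) - \<phi>' (jn 0 u) \<in> \<aa>" using eq[OF \<sigma>(1) h] u \<sigma>(2) by simp
    moreover have "\<phi>' (jn 0 u) \<in> \<aa>" by (rule mlfD(3)[OF \<phi>' h]) (use u z in simp_all)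
    ultimately show "\<phi>' (\<sigma> u) \<in> \<aa>" using idl_diff_iff[OF a] by blast
  qed
  then obtain \<psi>2 where \<psi>2: "lin1 \<psi>2" "\<And>v. v \<in> L2 \<Longrightarrow> \<phi>' (\<sigma> v) - \<psi>2 v \<in> \<aa>"
    using L(6) unfolding ext_def by blast
  let ?\<psi> = "\<lambda>v. \<psi>1 (ev v) + \<psi>2 (od v)"
  have "lin1 ?\<psi>" using \<psi>1(1) \<psi>2(1) by (simp add: lin1_def algebra_simps)
  moreover have "\<phi> v - ?\<psi> v \<in> \<aa>" if v: "v \<in> L" for v
  proof -
    have "\<phi>' v - \<phi>' (\<sigma> (od v)) \<in> \<aa>" using eq[OF v \<sigma>(1)] \<sigma>(2) o(1)[OF v] by simp
    from idl_add[OF a this \<psi>2(2)[OF o(1)[OF v]]] show ?thesis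
      by (simp add: \<phi>'_def algebra_simps)
  qed
  ultimately show "\<exists>\<psi>. lin1 \<psi> \<and> (\<forall>v\<in>L. \<phi> v - \<psi> v \<in> \<aa>)" by blast
qed

text \<open>\<open>good \<aa> h U W\<close> says that \<open>Ext\<^sup>i(U/(U \<inter> W), S/\<aa>) = 0\<close> over \<open>S/\<aa>\<close> for all \<open>i > h\<close>,
  and that the module has a resolution by finitely generated free modules: the syzygy of the cover
  \<open>e\<close> is the submodule \<open>kr e B W\<close> of \<open>Fr B\<close> modulo \<open>\<aa>\<close>, and \<open>Ext\<^sup>1\<close> is tested by extending
  functionals from the syzygy to the cover.\<close>

coinductive good :: "'s::comm_ring_1 set \<Rightarrow> nat \<Rightarrow> (nat \<Rightarrow> 's) set \<Rightarrow> (nat \<Rightarrow> 's) set \<Rightarrow> bool"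
  for \<aa> where
  goodI: "md \<aa> U W \<Longrightarrow> cov e B U W \<Longrightarrow> (h = 0 \<Longrightarrow> ext \<aa> (kr e B W)) \<Longrightarrow>
    good \<aa> (h - 1) (kr e B W) (hat \<aa>) \<Longrightarrow> good \<aa> h U W"

lemma goodE:
  assumes "good \<aa> h U W"
  obtains e B where "md \<aa> U W" "cov e B U W" "h = 0 \<longrightarrow> ext \<aa> (kr e B W)"
    "good \<aa> (h - 1) (kr e B W) (hat \<aa>)"
  using assms by (cases rule: good.cases) (use that in blast)

lemma good_md: "good \<aa> h U W \<Longrightarrow> md \<aa> U W"
  by (erule goodE)

section \<open>Closure properties of the Ext condition\<close>

lemma good_coind:
  assumes P: "P h U W"
    and step: "\<And>h U W. P h U W \<Longrightarrow> md \<aa> U W \<and> (\<exists>e B. cov e B U W \<and> (h = 0 \<longrightarrow> ext \<aa> (kr e B W)) \<and>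
      (P (h - 1) (kr e B W) (hat \<aa>) \<or> good \<aa> (h - 1) (kr e B W) (hat \<aa>)))"
  shows "good \<aa> h U W"
  using P
proof (rule good.coinduct[of P])
  fix h U W assume "P h U W"
  from step[OF this] show "\<exists>U' W' e B h'. h = h' \<and> U = U' \<and> W = W' \<and> md \<aa> U' W' \<and> cov e B U' W' \<and>
    (h' = 0 \<longrightarrow> ext \<aa> (kr e B W')) \<and> (P (h' - 1) (kr e B W') (hat \<aa>) \<or> good \<aa> (h' - 1) (kr e B W') (hat \<aa>))"
    by metis
qed

lemma good_Suc: assumes "good \<aa> h U W" shows "good \<aa> (Suc h) U W"
\<comment> \<open>The invariant admits both \<open>h'\<close> and \<open>Suc h'\<close> because
  \<open>0 - 1 = 0\<close>: once the smaller bound has reached 0 it stays there and the larger one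
  catches up.\<close>
proof (rule good_coind[of "\<lambda>h U W. \<exists>h'. h \<in> {h', Suc h'} \<and> good \<aa> h' U W"])
  show "\<exists>h'. Suc h \<in> {h', Suc h'} \<and> good \<aa> h' U W" using assms by blast
  fix h U W assume "\<exists>h'. h \<in> {h', Suc h'} \<and> good \<aa> h' U W"
  then obtain h' where h': "h \<in> {h', Suc h'}" and g: "good \<aa> h' U W" by blast
  from g obtain e B where e: "md \<aa> U W" "cov e B U W" "h' = 0 \<longrightarrow> ext \<aa> (kr e B W)"
    "good \<aa> (h' - 1) (kr e B W) (hat \<aa>)" by (rule goodE)
  have "h - 1 \<in> {h' - 1, Suc (h' - 1)}" using h' by auto
  moreover have "h = 0 \<longrightarrow> ext \<aa> (kr e B W)" using e(3) h' by auto
  ultimately show "md \<aa> U W \<and> (\<exists>e B. cov e B U W \<and> (h = 0 \<longrightarrow> ext \<aa> (kr e B W)) \<and>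
      ((\<exists>h'. h - 1 \<in> {h', Suc h'} \<and> good \<aa> h' (kr e B W) (hat \<aa>)) \<or> good \<aa> (h - 1) (kr e B W) (hat \<aa>)))"
    using e(1,2,4) by blast
qed

lemma good_mono: assumes "good \<aa> h U W" "h \<le> k" shows "good \<aa> k U W"
  using assms(2,1) by (induction k rule: dec_induct) (auto intro: good_Suc)

lemma good_zero:
  assumes a: "idl \<aa>" and UW: "sub U" "sub W" "U \<subseteq> W"
  shows "good \<aa> h U W"
proof (rule good_coind[of "\<lambda>h U W. sub U \<and> sub W \<and> U \<subseteq> W"])
  show "sub U \<and> sub W \<and> U \<subseteq> W" using UW by simp
  fix h :: nat and U W :: "(nat \<Rightarrow> 'a) set" assume UW: "sub U \<and> sub W \<and> U \<subseteq> W"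
  have z: "0 \<in> W" "0 \<in> U" using UW sub_zero by blast+
  have k: "kr (\<lambda>v. v) {} W = {0 :: nat \<Rightarrow> 'a}" using z by (simp only: kr_def Fr_empty) blast
  have m: "md \<aa> U W" using UW sub_sc by (auto simp: md_def)
  have c: "cov (\<lambda>v. v) {} U W" using UW z by (auto simp: cov_def lin_intros)
  have e: "ext \<aa> {0 :: nat \<Rightarrow> 'a}" using ext_Fr[OF a, of "{} :: nat set"] by simp
  have s: "sub ({0} :: (nat \<Rightarrow> 'a) set)" using sub_Fr[of "{} :: nat set"] by simp
  have h: "sub (hat \<aa> :: (nat \<Rightarrow> 'a) set)" by (rule sub_hat[OF a])
  show "md \<aa> U W \<and> (\<exists>e B. cov e B U W \<and> (h = 0 \<longrightarrow> ext \<aa> (kr e B W)) \<and>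
    (sub (kr e B W) \<and> sub (hat \<aa> :: (nat \<Rightarrow> 'a) set) \<and> kr e B W \<subseteq> hat \<aa> \<or> good \<aa> (h - 1) (kr e B W) (hat \<aa>)))"
    by (intro conjI exI[of _ "\<lambda>v. v"] exI[of _ "{}"]) (simp_all add: m c k e s h sub_zero[OF h])
qed

text \<open>The identity cover has its syzygy inside \<open>hat \<aa>\<close>. As a module over the
  quotient that syzygy is zero, so its functionals extend by 0.\<close>

lemma good_Fr: assumes a: "idl \<aa>" and B: "finite B" shows "good \<aa> h (Fr B) (hat \<aa>)"
proof (rule goodI)
  show "md \<aa> (Fr B) (hat \<aa>)" using md_hat[OF a sub_Fr] .
  show "cov (\<lambda>v. v) B (Fr B) (hat \<aa>)" using B sub_zero[OF sub_hat[OF a]]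
    by (auto simp: cov_def lin_intros intro!: bexI)
  show "ext \<aa> (kr (\<lambda>v. v) B (hat \<aa>))"
    unfolding ext_def
  proof (intro allI impI exI[of _ "\<lambda>v. 0"] conjI ballI)
    fix \<phi> v assume "mlf \<aa> (kr (\<lambda>v. v) B (hat \<aa>)) \<phi>" "v \<in> kr (\<lambda>v. v) B (hat \<aa>)"
    from mlfD(3)[OF this] this(2) show "\<phi> v - 0 \<in> \<aa>" by (simp add: kr_def)
  qed (simp add: lin1_def)
  show "good \<aa> (h - 1) (kr (\<lambda>v. v) B (hat \<aa>)) (hat \<aa>)"
    by (rule good_zero[OF a sub_kr[OF lin_intros(1) sub_hat[OF a]] sub_hat[OF a]]) (auto simp: kr_def)
qed

subsection \<open>Short exact sequences\<close>

text \<open>Exactness of \<open>0 -> U1/W1 -> U/W -> U2/W2 -> 0\<close> for maps induced by ambient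
  linear maps. Well-definedness is contained in the equivalences: taking \<open>u1 = 0\<close> in
  the condition on \<open>q\<close> shows that elements of \<open>U\<close> in \<open>W\<close> go
  to \<open>W2\<close>.\<close>

definition ses where
  "ses p q U1 W1 U W U2 W2 \<longleftrightarrow> lin p \<and> lin q \<and> (\<forall>u\<in>U1. p u \<in> U) \<and> (\<forall>u\<in>U. q u \<in> U2) \<and>
    (\<forall>u\<in>U1. p u \<in> W \<longleftrightarrow> u \<in> W1) \<and> (\<forall>u\<in>U. q u \<in> W2 \<longleftrightarrow> (\<exists>u1\<in>U1. u - p u1 \<in> W)) \<and>
    (\<forall>u2\<in>U2. \<exists>u\<in>U. q u - u2 \<in> W2)"

lemma sesD:
  assumes "ses p q U1 W1 U W U2 W2"
  shows "lin p" "lin q" "\<And>u. u \<in> U1 \<Longrightarrow> p u \<in> U" "\<And>u. u \<in> U \<Longrightarrow> q u \<in> U2"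
    "\<And>u. u \<in> U1 \<Longrightarrow> p u \<in> W \<longleftrightarrow> u \<in> W1"
    "\<And>u. u \<in> U \<Longrightarrow> q u \<in> W2 \<Longrightarrow> \<exists>u1\<in>U1. u - p u1 \<in> W"
    "\<And>u u1. u \<in> U \<Longrightarrow> u1 \<in> U1 \<Longrightarrow> u - p u1 \<in> W \<Longrightarrow> q u \<in> W2"
    "\<And>u2. u2 \<in> U2 \<Longrightarrow> \<exists>u\<in>U. q u - u2 \<in> W2"
  using assms unfolding ses_def by blast+

text \<open>Horseshoe lemma: the sum of covers of the ends covers the middle, and the three syzygies
  again form a short exact sequence, so the step can be repeated coinductively.\<close>

lemma good_ses_step:
  assumes a: "idl \<aa>" and s: "ses p q U1 W1 U W U2 W2"
    and g1: "good \<aa> h U1 W1" and g2: "good \<aa> h U2 W2" and m: "md \<aa> U W"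
  shows "\<exists>e B L1 L2. cov e B U W \<and> (h = 0 \<longrightarrow> ext \<aa> (kr e B W)) \<and> good \<aa> (h - 1) L1 (hat \<aa>) \<and>
    good \<aa> (h - 1) L2 (hat \<aa>) \<and> ses (\<lambda>v. jn v 0) od L1 (hat \<aa>) (kr e B W) (hat \<aa>) L2 (hat \<aa>)"
proof -
  note S = sesD[OF s]
  note p = lin_simps[OF sesD(1)[OF s]] and q = lin_simps[OF sesD(2)[OF s]]
  obtain e1 B1 where 1: "cov e1 B1 U1 W1" "h = 0 \<longrightarrow> ext \<aa> (kr e1 B1 W1)"
    "good \<aa> (h - 1) (kr e1 B1 W1) (hat \<aa>)" using g1 by (rule goodE)
  obtain e2 B2 where 2: "cov e2 B2 U2 W2" "h = 0 \<longrightarrow> ext \<aa> (kr e2 B2 W2)"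
    "good \<aa> (h - 1) (kr e2 B2 W2) (hat \<aa>)" using g2 by (rule goodE)
  note C1 = covD[OF 1(1)] and C2 = covD[OF 2(1)]
  note U = mdD(1)[OF m] and W = mdD(2)[OF m] and m1 = good_md[OF g1] and m2 = good_md[OF g2]
  note W1 = mdD(2)[OF m1] and W2 = mdD(2)[OF m2]
  have "\<exists>s. lin s \<and> (\<forall>v\<in>Fr B2. s v \<in> U \<and> q (s v) - e2 v \<in> W2)"
    by (rule free_lift[OF C2(1,2) S(2) U W2]) (rule S(8)[OF C2(3)])
  then obtain t where t: "lin t" "\<And>v. v \<in> Fr B2 \<Longrightarrow> t v \<in> U" "\<And>v. v \<in> Fr B2 \<Longrightarrow> q (t v) - e2 v \<in> W2"
    by blast
  \<comment> \<open>\<open>t\<close> lifts the cover of \<open>U2\<close> through \<open>q\<close>;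
    together with the cover of \<open>U1\<close> pushed forward by \<open>p\<close> it covers the
    middle.\<close>
  define e where "e = (\<lambda>v. p (e1 (ev v)) + t (od v))"
  define B where "B = jnB B1 B2"
  let ?L = "kr e B W" and ?L1 = "kr e1 B1 W1" and ?L2 = "kr e2 B2 W2"
  have le: "lin e" using S(1) C1(2) t(1)
    by (simp add: e_def lin_def sc_distrib add_ac)
  have e_jn: "e (jn x y) = p (e1 x) + t y" for x y by (simp add: e_def)
  have B_jn: "jn x y \<in> Fr B \<longleftrightarrow> x \<in> Fr B1 \<and> y \<in> Fr B2" for x y by (simp add: B_def Fr_jnB)
  have z: "0 \<in> Fr B1" "0 \<in> Fr B2" by (rule sub_zero[OF sub_Fr])+
  have e10: "e1 0 = 0" and t0: "t 0 = 0" by (rule lin_zero[OF C1(2)], rule lin_zero[OF t(1)])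
  have eU: "e v \<in> U" if "v \<in> Fr B" for v
    unfolding e_def using that sub_add[OF U S(3)[OF C1(3)] t(2)]
    by (simp add: B_def Fr_jnB)
  \<comment> \<open>Used twice: for arbitrary \<open>u\<close> it gives surjectivity of
    \<open>e\<close>, and for \<open>u = 0\<close> it lifts an element of the syzygy of
    \<open>U2\<close> to the syzygy of the middle.\<close>
  have onto: "\<exists>x\<in>Fr B1. u - (p (e1 x) + t b) \<in> W" if u: "u \<in> U" and b: "b \<in> Fr B2" and ub: "q u - e2 b \<in> W2" for u b
  proof -
    have "q (u - t b) \<in> W2" using sub_diff_trans[OF W2 ub sub_diff_sym[OF W2 t(3)[OF b]]] by (simp only: q)
    from S(6)[OF sub_diff[OF U u t(2)[OF b]] this] obtain u1 where
      u1: "u1 \<in> U1" "u - t b - p u1 \<in> W" by blast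
    from C1(4)[OF u1(1)] obtain x where x: "x \<in> Fr B1" "u1 - e1 x \<in> W1" by blast
    have "p (u1 - e1 x) \<in> W"
      using S(5)[OF sub_diff[OF mdD(1)[OF m1] u1(1) C1(3)[OF x(1)]]] x(2) by blast
    from sub_add[OF W u1(2) this] have "u - (p (e1 x) + t b) \<in> W" by (simp add: p algebra_simps)
    then show ?thesis using x(1) by blast
  qed
  have ce: "cov e B U W"
    unfolding cov_def
  proof (intro conjI ballI)
    show "finite B" unfolding B_def by (rule finite_jnB[OF C1(1) C2(1)])
    fix u assume u: "u \<in> U"
    from C2(4)[OF S(4)[OF u]] obtain b where b: "b \<in> Fr B2" "q u - e2 b \<in> W2" by blast
    from onto[OF u b] obtain x where "x \<in> Fr B1" "u - (p (e1 x) + t b) \<in> W" by blast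
    then show "\<exists>v\<in>Fr B. u - e v \<in> W" using b(1) by (intro bexI[of _ "jn x b"]) (simp_all add: e_jn B_jn)
  qed (use le eU in auto)
  have L: "sub ?L" by (rule sub_kr[OF le W])
  have L1: "sub ?L1" by (rule sub_kr[OF C1(2) W1])
  have i: "jn c 0 \<in> ?L \<longleftrightarrow> c \<in> ?L1" for c
    using S(5)[OF C1(3)] z(2) by (auto simp: kr_def e_jn B_jn t0)
  have o: "od v \<in> ?L2" if v: "v \<in> ?L" for v
  proof -
    have v': "ev v \<in> Fr B1" "od v \<in> Fr B2" "p (e1 (ev v)) + t (od v) \<in> W"
      using v by (auto simp: kr_def B_def Fr_jnB e_def)
    have "t (od v) - p (- e1 (ev v)) \<in> W" using v'(3) by (simp add: p add.commute)
    then have "q (t (od v)) \<in> W2"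
      by (rule S(7)[OF t(2)[OF v'(2)] sub_minus[OF mdD(1)[OF m1] C1(3)[OF v'(1)]]])
    then have "e2 (od v) \<in> W2" using sub_diff_iff[OF W2 t(3)[OF v'(2)]] by blast
    then show ?thesis using v'(2) by (simp add: kr_def)
  qed
  have o': "\<exists>v\<in>?L. od v = l" if l: "l \<in> ?L2" for l
  proof -
    have l': "l \<in> Fr B2" "e2 l \<in> W2" using l by (auto simp: kr_def)
    have "q 0 - e2 l \<in> W2" using sub_minus[OF W2 l'(2)] by (simp add: q)
    from onto[OF sub_zero[OF U] l'(1) this] obtain x where x: "x \<in> Fr B1" "0 - (p (e1 x) + t l) \<in> W" by blast
    have "p (e1 x) + t l \<in> W" using sub_minus[OF W x(2)] by (simp add: add.commute)
    then show ?thesis using x(1) l'(1) by (intro bexI[of _ "jn x l"]) (simp_all add: kr_def e_jn B_jn)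
  qed
  have tW: "t l \<in> W" if "l \<in> Fr B2" "l \<in> hat \<aa>" for l
  proof (rule lin_hat_into[of B2 t W \<aa>])
    show "r *s t (un i) \<in> W" if "r \<in> \<aa>" "i \<in> B2" for r i
      by (rule mdD(3)[OF m that(1) t(2)[OF un_Fr[OF that(2)]]])
  qed (fact C2(1) t(1) W that)+
  have h: "jn 0 l \<in> ?L" if "l \<in> ?L2" "l \<in> hat \<aa>" for l
    using that tW z(1) by (simp add: kr_def e_jn B_jn e10 p)
  have "ext \<aa> ?L" if "h = 0"
    by (rule ext_jn[OF a L covD(1)[OF ce] _ L1 _ _ i o o' h])
       (use that 1(2) 2(2) in \<open>auto simp: kr_def\<close>)
  moreover have "ses (\<lambda>v. jn v 0) od ?L1 (hat \<aa>) ?L (hat \<aa>) ?L2 (hat \<aa>)"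
    unfolding ses_def
  proof (intro conjI ballI)
    show "lin (\<lambda>v. jn v 0 :: nat \<Rightarrow> 'a)" by (rule lin_jn[OF lin_intros(1,2)])
    show "lin (od :: (nat \<Rightarrow> 'a) \<Rightarrow> _)" by (rule lin_od)
    have zh: "(0 :: nat \<Rightarrow> 'a) \<in> hat \<aa>" by (rule sub_zero[OF sub_hat[OF a]])
    show "jn u 0 \<in> hat \<aa> \<longleftrightarrow> u \<in> hat \<aa>" for u :: "nat \<Rightarrow> 'a" using zh by simp
    show "\<exists>u\<in>?L. od u - u2 \<in> hat \<aa>" if "u2 \<in> ?L2" for u2
      using o'[OF that] zh by (metis diff_self)
    fix u assume u: "u \<in> ?L"
    show "od u \<in> hat \<aa> \<longleftrightarrow> (\<exists>u1\<in>?L1. u - jn u1 0 \<in> hat \<aa>)"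
    proof
      assume h: "od u \<in> hat \<aa>"
      have u': "ev u \<in> Fr B1" "od u \<in> Fr B2" "p (e1 (ev u)) + t (od u) \<in> W"
        using u by (auto simp: kr_def B_def Fr_jnB e_def)
      have "p (e1 (ev u)) \<in> W" using sub_diff[OF W u'(3) tW[OF u'(2) h]] by simp
      then have "ev u \<in> ?L1" using S(5)[OF C1(3)[OF u'(1)]] u'(1) by (simp add: kr_def)
      moreover have "u - jn (ev u) 0 = jn 0 (od u)" by (metis cancel_comm_monoid_add_class.diff_cancel diff_zero jn_ev_od jn_simps(2))
      then have "u - jn (ev u) 0 \<in> hat \<aa>" using h zh by simp
      ultimately show "\<exists>u1\<in>?L1. u - jn u1 0 \<in> hat \<aa>" by blast
    next
      assume "\<exists>u1\<in>?L1. u - jn u1 0 \<in> hat \<aa>"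
      then obtain u1 where "u - jn u1 0 \<in> hat \<aa>" by blast
      from hat_od[OF this] show "od u \<in> hat \<aa>" by simp
    qed
  qed (use i o in auto)
  ultimately show ?thesis using ce 1(3) 2(3) by blast
qed

lemma good_ses:
  assumes a: "idl \<aa>" and "ses p q U1 W1 U W U2 W2" "good \<aa> h U1 W1" "good \<aa> h U2 W2" "md \<aa> U W"
  shows "good \<aa> h U W"
proof (rule good_coind[of "\<lambda>h U W. \<exists>p q U1 W1 U2 W2. ses p q U1 W1 U W U2 W2 \<and> good \<aa> h U1 W1 \<and>
    good \<aa> h U2 W2 \<and> md \<aa> U (W :: (nat \<Rightarrow> 'a) set)"])
  show "\<exists>p q U1 W1 U2 W2. ses p q U1 W1 U W U2 W2 \<and> good \<aa> h U1 W1 \<and> good \<aa> h U2 W2 \<and> md \<aa> U W"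
    using assms by blast
  fix h U W
  assume "\<exists>p q U1 W1 U2 W2. ses p q U1 W1 U W U2 W2 \<and> good \<aa> h U1 W1 \<and> good \<aa> h U2 W2 \<and>
    md \<aa> U (W :: (nat \<Rightarrow> 'a) set)"
  then obtain p q U1 W1 U2 W2 where s: "ses p q U1 W1 U W U2 W2" and g: "good \<aa> h U1 W1" "good \<aa> h U2 W2"
    and m: "md \<aa> U W" by blast
  from good_ses_step[OF a s g m] obtain e B L1 L2 where e: "cov e B U W" "h = 0 \<longrightarrow> ext \<aa> (kr e B W)"
    "good \<aa> (h - 1) L1 (hat \<aa>)" "good \<aa> (h - 1) L2 (hat \<aa>)"
    "ses (\<lambda>v. jn v 0) od L1 (hat \<aa>) (kr e B W) (hat \<aa>) L2 (hat \<aa>)" by blast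
  have "md \<aa> (kr e B W) (hat \<aa>)"
    by (rule md_hat[OF a sub_kr[OF covD(2)[OF e(1)] mdD(2)[OF m]]])
  then show "md \<aa> U W \<and> (\<exists>e B. cov e B U W \<and> (h = 0 \<longrightarrow> ext \<aa> (kr e B W)) \<and>
    ((\<exists>p q U1 W1 U2 W2. ses p q U1 W1 (kr e B W) (hat \<aa>) U2 W2 \<and> good \<aa> (h - 1) U1 W1 \<and>
      good \<aa> (h - 1) U2 W2 \<and> md \<aa> (kr e B W) (hat \<aa>)) \<or> good \<aa> (h - 1) (kr e B W) (hat \<aa>)))"
    using m e by metis
qed

definition miso where
  "miso f U W U' W' \<longleftrightarrow> lin f \<and> (\<forall>u\<in>U. f u \<in> U') \<and> (\<forall>u\<in>U. f u \<in> W' \<longleftrightarrow> u \<in> W) \<and>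
    (\<forall>u'\<in>U'. \<exists>u\<in>U. u' - f u \<in> W')"

lemma misoD:
  assumes "miso f U W U' W'"
  shows "lin f" "\<And>u. u \<in> U \<Longrightarrow> f u \<in> U'" "\<And>u. u \<in> U \<Longrightarrow> f u \<in> W' \<longleftrightarrow> u \<in> W"
    "\<And>u'. u' \<in> U' \<Longrightarrow> \<exists>u\<in>U. u' - f u \<in> W'"
  using assms unfolding miso_def by blast+

lemma good_miso:
  assumes a: "idl \<aa>" and f: "miso f U W U' W'" and g: "good \<aa> h U W" and m: "md \<aa> U' W'"
  shows "good \<aa> h U' W'"
proof (rule good_ses[OF a _ g _ m])
  note F = misoD[OF f]
  show "good \<aa> h {0} {0}" using good_zero[OF a sub_Fr sub_Fr, of "{}" "{}"] by simp
  show "ses f (\<lambda>v. 0) U W U' W' {0} {0}"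
    unfolding ses_def using F sub_zero[OF mdD(1)[OF m]] by (auto simp: lin_intros)
qed

text \<open>Here \<open>f\<close> is read as an exact sequence with zero kernel, whereas
  \<open>good_miso\<close> reads it as one with zero cokernel. Goodness thus moves in both
  directions without an inverse linear map.\<close>

lemma good_miso_rev:
  assumes a: "idl \<aa>" and f: "miso f U W U' W'" and g: "good \<aa> h U' W'" and m: "md \<aa> U W"
  shows "good \<aa> h U W"
proof (rule good_ses[OF a _ _ g m])
  note F = misoD[OF f]
  have z: "0 \<in> W'" by (rule sub_zero[OF mdD(2)[OF good_md[OF g]]])
  have s: "\<exists>u\<in>U. f u - u' \<in> W'" if "u' \<in> U'" for u'
    using F(4)[OF that] sub_diff_sym[OF mdD(2)[OF good_md[OF g]]] by blast
  show "good \<aa> h {0} {0}" using good_zero[OF a sub_Fr sub_Fr, of "{}" "{}"] by simp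
  show "ses (\<lambda>v. 0) f {0} {0} U W U' W'"
    unfolding ses_def using F(1,2,3) s z sub_zero[OF mdD(1)[OF m]] sub_zero[OF mdD(2)[OF m]]
    by (auto simp: lin_intros)
qed

lemma md_subset: "md \<aa> U W \<Longrightarrow> sub N \<Longrightarrow> N \<subseteq> U \<Longrightarrow> md \<aa> N W"
  by (auto simp: md_def)

lemma ses_kernel:
  assumes s: "ses p q U1 W1 U W U2 W2" and W: "sub W"
  shows "miso p U1 W1 {u \<in> U. q u \<in> W2} W"
proof -
  note S = sesD[OF s]
  have "q (p u) \<in> W2" if "u \<in> U1" for u
    using S(7)[OF S(3)[OF that] that] sub_zero[OF W] by simp
  then show ?thesis unfolding miso_def using S(1,3,5,6) by blast
qed

lemma ses_null:
  assumes s: "ses p q U1 W1 U W U2 W2" and "sub U1" "u \<in> U" "u \<in> W"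
  shows "q u \<in> W2"
proof -
  note S = sesD[OF s]
  show ?thesis using S(7)[OF assms(3) sub_zero[OF assms(2)]] assms(4) lin_zero[OF S(1)] by simp
qed

text \<open>In the long exact sequence Ext of \<open>U2\<close> lies between Ext of
  \<open>U1\<close> one degree lower and Ext of \<open>U\<close>. The cover of \<open>U\<close> also
  covers \<open>U2\<close>, and the new syzygy is an extension of \<open>U1\<close> by the syzygy of
  \<open>U\<close>. The bound \<open>Suc h\<close> makes the first Ext condition void, so only that
  syzygy counts.\<close>

lemma good_coker:
  assumes a: "idl \<aa>" and s: "ses p q U1 W1 U W U2 W2"
    and g1: "good \<aa> h U1 W1" and g: "good \<aa> (Suc h) U W" and m: "md \<aa> U2 W2"
  shows "good \<aa> (Suc h) U2 W2"
proof -
  note S = sesD[OF s]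
  obtain e B where e: "md \<aa> U W" "cov e B U W" "good \<aa> h (kr e B W) (hat \<aa>)"
    using g by (rule goodE) simp
  note E = covD[OF e(2)] and U = mdD(1)[OF e(1)] and W = mdD(2)[OF e(1)] and W2 = mdD(2)[OF m]
  note q = lin_simps[OF S(2)] and U1 = mdD(1)[OF good_md[OF g1]]
  let ?N = "{u \<in> U. q u \<in> W2}"
  have N: "sub ?N" by (rule sub_preimage[OF U W2 S(2)])
  have gN: "good \<aa> h ?N W"
    by (rule good_miso[OF a ses_kernel[OF s W] g1 md_subset[OF e(1) N]]) blast
  have lq: "lin (\<lambda>v. q (e v))" by (rule lin_comp[OF S(2) E(2)])
  have c: "cov (\<lambda>v. q (e v)) B U2 W2"
    unfolding cov_def
  proof (intro conjI ballI)
    fix u2 assume "u2 \<in> U2"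
    from S(8)[OF this] obtain u where u: "u \<in> U" "q u - u2 \<in> W2" by blast
    from E(4)[OF u(1)] obtain v where v: "v \<in> Fr B" "u - e v \<in> W" by blast
    have "q (u - e v) \<in> W2"
      by (rule ses_null[OF s U1 sub_diff[OF U u(1) E(3)[OF v(1)]] v(2)])
    then have "q u - q (e v) \<in> W2" by (simp only: q)
    from sub_diff_trans[OF W2 sub_diff_sym[OF W2 u(2)] this] v(1)
    show "\<exists>v\<in>Fr B. u2 - q (e v) \<in> W2" by blast
  qed (use E S(4) lq in auto)
  let ?L = "kr (\<lambda>v. q (e v)) B W2"
  have L: "sub ?L" by (rule sub_kr[OF lq W2])
  have zh: "0 \<in> hat \<aa>" by (rule sub_zero[OF sub_hat[OF a]])
  have "ses (\<lambda>v. v) e (kr e B W) (hat \<aa>) ?L (hat \<aa>) ?N W"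
    unfolding ses_def
  proof (intro conjI ballI)
    show "lin (\<lambda>v. v :: nat \<Rightarrow> 'a)" by (rule lin_intros)
    show "lin e" by (rule E(2))
    show "u \<in> ?L" if "u \<in> kr e B W" for u
      using that ses_null[OF s U1 E(3)] by (simp add: kr_def)
    show "e u \<in> ?N" if "u \<in> ?L" for u using that E(3) by (simp add: kr_def)
    show "e u \<in> W \<longleftrightarrow> (\<exists>u1\<in>kr e B W. u - u1 \<in> hat \<aa>)" if u: "u \<in> ?L" for u
    proof
      assume "e u \<in> W"
      then show "\<exists>u1\<in>kr e B W. u - u1 \<in> hat \<aa>" using u zh by (intro bexI[of _ u]) (simp_all add: kr_def)
    next
      assume "\<exists>u1\<in>kr e B W. u - u1 \<in> hat \<aa>"
      then obtain u1 where u1: "u1 \<in> Fr B" "e u1 \<in> W" "u - u1 \<in> hat \<aa>" by (auto simp: kr_def)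
      have uF: "u \<in> Fr B" using u by (simp add: kr_def)
      have "e (u - u1) \<in> W" by (rule cov_hat[OF e(2,1) sub_diff[OF sub_Fr uF u1(1)] u1(3)])
      then have "e u - e u1 \<in> W" by (simp only: lin_diff[OF E(2)])
      then show "e u \<in> W" using sub_diff_iff[OF W] u1(2) by blast
    qed
    show "\<exists>u\<in>?L. e u - u2 \<in> W" if u2: "u2 \<in> ?N" for u2
    proof -
      from u2 E(4) obtain v where v: "v \<in> Fr B" "u2 - e v \<in> W" by blast
      have "q (u2 - e v) \<in> W2"
        by (rule ses_null[OF s U1 sub_diff[OF U _ E(3)[OF v(1)]] v(2)]) (use u2 in simp)
      then have "q u2 - q (e v) \<in> W2" by (simp only: q)
      then have "q (e v) \<in> W2" using sub_diff_iff[OF W2] u2 by blast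
      then show ?thesis using v sub_diff_sym[OF W v(2)] by (intro bexI[of _ v]) (simp_all add: kr_def)
    qed
  qed auto
  from good_ses[OF a this e(3) gN md_hat[OF a L]] have gL: "good \<aa> h ?L (hat \<aa>)" .
  show ?thesis by (rule goodI[OF m c]) (simp_all add: gL)
qed

text \<open>Ext of \<open>U1\<close> lies between Ext of \<open>U\<close> and Ext of
  \<open>U2\<close> one degree higher. The proof uses the pullback \<open>T\<close> of
  \<open>q\<close> and the cover of \<open>U2\<close>. It is an extension of \<open>U\<close> by a
  syzygy of \<open>U2\<close>, hence good, and it is also the sum of \<open>U1\<close> and the free
  module \<open>Fr B2\<close>, from which \<open>U1\<close> inherits a cover.\<close>

lemma good_ker:
  assumes a: "idl \<aa>" and s: "ses p q U1 W1 U W U2 W2"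
    and g: "good \<aa> h U W" and g2: "good \<aa> (Suc h) U2 W2" and m: "md \<aa> U1 W1"
  shows "good \<aa> h U1 W1"
proof -
  note S = sesD[OF s]
  note p = lin_simps[OF S(1)] and q = lin_simps[OF S(2)]
  obtain e2 B2 where 2: "md \<aa> U2 W2" "cov e2 B2 U2 W2" "good \<aa> h (kr e2 B2 W2) (hat \<aa>)"
    using g2 by (rule goodE) simp
  note E2 = covD[OF 2(2)] and mU = good_md[OF g]
  note U = mdD(1)[OF mU] and W = mdD(2)[OF mU] and W2 = mdD(2)[OF 2(1)] and U1 = mdD(1)[OF m]
  note e2 = lin_simps[OF E2(2)]
  have zh: "(0 :: nat \<Rightarrow> 'a) \<in> hat \<aa>" and sh: "sub (hat \<aa> :: (nat \<Rightarrow> 'a) set)"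
    using sub_zero[OF sub_hat[OF a]] sub_hat[OF a] by blast+
  define T where "T = {t. ev t \<in> U \<and> od t \<in> Fr B2 \<and> q (ev t) - e2 (od t) \<in> W2}"
  define T0 where "T0 = {t. ev t \<in> W \<and> od t \<in> hat \<aa>}"
  have sT0: "sub T0"
    unfolding T0_def sub_def using sub_closed[OF W] sub_closed[OF sh] by auto
  have sT: "sub T"
    unfolding sub_def
  proof (intro conjI ballI allI)
    show "0 \<in> T" using sub_zero[OF U] sub_zero[OF sub_Fr] sub_zero[OF W2] by (simp add: T_def q e2)
    fix u assume u: "u \<in> T"
    show "r *s u \<in> T" for r
    proof -
      have "r *s (q (ev u) - e2 (od u)) \<in> W2" using u by (intro sub_sc[OF W2]) (simp add: T_def)
      then show ?thesis using u by (simp add: T_def q e2 sc_distrib sub_sc[OF U] sub_sc[OF sub_Fr])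
    qed
    fix v assume v: "v \<in> T"
    have "(q (ev u) - e2 (od u)) + (q (ev v) - e2 (od v)) \<in> W2"
      using u v by (intro sub_add[OF W2]) (simp_all add: T_def)
    then show "u + v \<in> T"
      using u v by (simp add: T_def q e2 sub_add[OF U] sub_add[OF sub_Fr] algebra_simps)
  qed
  have mT: "md \<aa> T T0"
    unfolding md_def using sT sT0 by (auto simp: T_def T0_def mdD(3)[OF mU] hat_sc[OF a])
  have "ses (\<lambda>b. jn 0 b) ev (kr e2 B2 W2) (hat \<aa>) T T0 U W"
    unfolding ses_def
  proof (intro conjI ballI)
    show "lin (\<lambda>b. jn 0 b :: nat \<Rightarrow> 'a)" by (rule lin_jn[OF lin_intros(2,1)])
    show "lin (ev :: (nat \<Rightarrow> 'a) \<Rightarrow> _)" by (rule lin_ev)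
    show "jn 0 u \<in> T" if "u \<in> kr e2 B2 W2" for u
      using that sub_zero[OF U] sub_minus[OF W2] by (simp add: T_def kr_def q)
    show "ev u \<in> U" if "u \<in> T" for u using that by (simp add: T_def)
    show "jn 0 u \<in> T0 \<longleftrightarrow> u \<in> hat \<aa>" for u :: "nat \<Rightarrow> 'a" by (simp add: T0_def sub_zero[OF W])
    show "\<exists>u\<in>T. ev u - u2 \<in> W" if u2: "u2 \<in> U" for u2
    proof -
      from E2(4)[OF S(4)[OF u2]] obtain b where b: "b \<in> Fr B2" "q u2 - e2 b \<in> W2" by blast
      then show ?thesis using u2 by (intro bexI[of _ "jn u2 b"]) (simp_all add: T_def sub_zero[OF W])
    qed
    fix t assume t: "t \<in> T"
    then have t': "ev t \<in> U" "od t \<in> Fr B2" "q (ev t) - e2 (od t) \<in> W2" by (auto simp: T_def)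
    show "ev t \<in> W \<longleftrightarrow> (\<exists>u1\<in>kr e2 B2 W2. t - jn 0 u1 \<in> T0)"
    proof
      assume w: "ev t \<in> W"
      have "q (ev t) \<in> W2" by (rule ses_null[OF s U1 t'(1) w])
      then have "e2 (od t) \<in> W2" using sub_diff_iff[OF W2 t'(3)] by blast
      then show "\<exists>u1\<in>kr e2 B2 W2. t - jn 0 u1 \<in> T0"
        using t' w zh by (intro bexI[of _ "od t"]) (simp_all add: kr_def T0_def)
    next
      assume "\<exists>u1\<in>kr e2 B2 W2. t - jn 0 u1 \<in> T0"
      then show "ev t \<in> W" by (auto simp: T0_def)
    qed
  qed
  from good_ses[OF a this 2(3) g mT] have gT: "good \<aa> h T T0" .
  then obtain e B where e: "cov e B T T0" "h = 0 \<longrightarrow> ext \<aa> (kr e B T0)"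
    "good \<aa> (h - 1) (kr e B T0) (hat \<aa>)" by (rule goodE)
  note E = covD[OF e(1)]
  note el = lin_simps[OF E(2)]
  have "\<exists>r. lin r \<and> (\<forall>v\<in>Fr B2. r v \<in> U \<and> q (r v) - e2 v \<in> W2)"
    by (rule free_lift[OF E2(1,2) S(2) U W2]) (rule S(8)[OF E2(3)])
  then obtain r where r: "lin r" "\<And>v. v \<in> Fr B2 \<Longrightarrow> r v \<in> U"
    "\<And>v. v \<in> Fr B2 \<Longrightarrow> q (r v) - e2 v \<in> W2" by blast
  note rl = lin_simps[OF r(1)]
  have rW: "r l \<in> W" if "l \<in> Fr B2" "l \<in> hat \<aa>" for l
  proof (rule lin_hat_into[of B2 r W \<aa>])
    show "c *s r (un i) \<in> W" if "c \<in> \<aa>" "i \<in> B2" for c i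
      by (rule mdD(3)[OF mU that(1) r(2)[OF un_Fr[OF that(2)]]])
  qed (fact E2(1) r(1) W that)+
  \<comment> \<open>\<open>r\<close> splits the projection of \<open>T\<close> onto
    \<open>Fr B2\<close>. Subtracting it leaves the component in the kernel of \<open>q\<close>,
    which is \<open>U1\<close>; lifting \<open>k\<close> through \<open>p\<close> gives the cover of
    \<open>U1\<close>.\<close>
  define k where "k = (\<lambda>v. ev (e v) - r (od (e v)))"
  have lk: "lin k" using E(2) r(1) by (simp add: k_def lin_def sc_distrib algebra_simps)
  have kv: "\<exists>u1\<in>U1. p u1 - k v \<in> W" if v: "v \<in> Fr B" for v
  proof -
    have t: "ev (e v) \<in> U" "od (e v) \<in> Fr B2" "q (ev (e v)) - e2 (od (e v)) \<in> W2"
      using E(3)[OF v] by (auto simp: T_def)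
    have "q (k v) \<in> W2"
      using sub_diff_trans[OF W2 t(3) sub_diff_sym[OF W2 r(3)[OF t(2)]]] by (simp add: k_def q)
    moreover have "k v \<in> U" unfolding k_def by (rule sub_diff[OF U t(1) r(2)[OF t(2)]])
    ultimately obtain u1 where "u1 \<in> U1" "k v - p u1 \<in> W" using S(6) by blast
    then show ?thesis using sub_diff_sym[OF W] by blast
  qed
  have "\<exists>f. lin f \<and> (\<forall>v\<in>Fr B. f v \<in> U1 \<and> p (f v) - k v \<in> W)"
    by (rule free_lift[OF E(1) lk S(1) U1 W kv])
  then obtain f where f: "lin f" "\<And>v. v \<in> Fr B \<Longrightarrow> f v \<in> U1" "\<And>v. v \<in> Fr B \<Longrightarrow> p (f v) - k v \<in> W"
    by blast
  have fk: "f v \<in> W1 \<longleftrightarrow> k v \<in> W" if "v \<in> Fr B" for v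
    using S(5)[OF f(2)[OF that]] sub_diff_iff[OF W f(3)[OF that]] by blast
  have T_onto: "\<exists>v\<in>Fr B. ev t - ev (e v) \<in> W \<and> od t - od (e v) \<in> hat \<aa>" if "t \<in> T" for t
    using E(4)[OF that] by (simp add: T0_def)
  have cf: "cov f B U1 W1"
    unfolding cov_def
  proof (intro conjI ballI)
    fix u1 assume u1: "u1 \<in> U1"
    have "q (p u1) \<in> W2" using S(7)[OF S(3)[OF u1] u1] sub_zero[OF W] by simp
    then have "jn (p u1) 0 \<in> T" using S(3)[OF u1] sub_zero[OF sub_Fr] by (simp add: T_def e2)
    from T_onto[OF this] obtain v where v: "v \<in> Fr B" "p u1 - ev (e v) \<in> W" "- od (e v) \<in> hat \<aa>" by auto
    have o: "od (e v) \<in> Fr B2" using E(3)[OF v(1)] by (simp add: T_def)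
    have "od (e v) \<in> hat \<aa>" using sub_minus[OF sh v(3)] by simp
    from sub_add[OF W v(2) rW[OF o this]] have "p u1 - k v \<in> W" by (simp add: k_def algebra_simps)
    from sub_diff_trans[OF W this sub_diff_sym[OF W f(3)[OF v(1)]]] have "p (u1 - f v) \<in> W" by (simp only: p)
    then have "u1 - f v \<in> W1" using S(5)[OF sub_diff[OF U1 u1 f(2)[OF v(1)]]] by blast
    then show "\<exists>v\<in>Fr B. u1 - f v \<in> W1" using v(1) by blast
  qed (use E f in auto)
  note W1 = mdD(2)[OF m]
  let ?L = "kr e B T0" and ?L' = "kr f B W1"
  have L': "sub ?L'" by (rule sub_kr[OF f(1) W1])
  have LL': "?L \<subseteq> ?L'"
  proof
    fix v assume "v \<in> ?L"
    then have v: "v \<in> Fr B" "ev (e v) \<in> W" "od (e v) \<in> hat \<aa>" by (auto simp: kr_def T0_def)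
    have "od (e v) \<in> Fr B2" using E(3)[OF v(1)] by (simp add: T_def)
    from sub_diff[OF W v(2) rW[OF this v(3)]] show "v \<in> ?L'" using v(1) fk by (simp add: kr_def k_def)
  qed
  have L_iff: "v \<in> ?L" if "v \<in> ?L'" "od (e v) \<in> hat \<aa>" for v
  proof -
    have v: "v \<in> Fr B" "k v \<in> W" using that(1) fk by (auto simp: kr_def)
    have "od (e v) \<in> Fr B2" using E(3)[OF v(1)] by (simp add: T_def)
    from sub_add[OF W v(2) rW[OF this that(2)]] have "ev (e v) \<in> W" by (simp add: k_def)
    then show ?thesis using v(1) that(2) by (simp add: kr_def T0_def)
  qed
  have L'_onto: "\<exists>v\<in>?L'. od (e v) - b \<in> hat \<aa>" if b: "b \<in> Fr B2" for b
  proof -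
    have "jn (r b) b \<in> T" using r(2,3)[OF b] b by (simp add: T_def)
    from T_onto[OF this] obtain v where v: "v \<in> Fr B" "r b - ev (e v) \<in> W" "b - od (e v) \<in> hat \<aa>" by auto
    have o: "od (e v) \<in> Fr B2" using E(3)[OF v(1)] by (simp add: T_def)
    have "r (b - od (e v)) \<in> W" by (rule rW[OF sub_diff[OF sub_Fr b o] v(3)])
    then have "r b - r (od (e v)) \<in> W" by (simp only: rl)
    from sub_diff_trans[OF W sub_diff_sym[OF W v(2)] this] have "k v \<in> W" by (simp add: k_def)
    then show ?thesis using v(1) fk[OF v(1)] sub_diff_sym[OF sh v(3)] by (intro bexI[of _ v]) (simp_all add: kr_def)
  qed
  have lo: "lin (\<lambda>v. od (e v))" by (rule lin_comp[OF lin_od E(2)])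
  \<comment> \<open>The syzygy of \<open>U1\<close> exceeds that of \<open>T\<close> by the free
    module \<open>Fr B2\<close>, so goodness carries over.\<close>
  have "ses (\<lambda>v. v) (\<lambda>v. od (e v)) ?L (hat \<aa>) ?L' (hat \<aa>) (Fr B2) (hat \<aa>)"
    unfolding ses_def
  proof (intro conjI ballI)
    show "lin (\<lambda>v. v :: nat \<Rightarrow> 'a)" by (rule lin_intros)
    show "u \<in> ?L'" if "u \<in> ?L" for u using that LL' by blast
    show "od (e u) \<in> Fr B2" if "u \<in> ?L'" for u using that E(3) by (simp add: kr_def T_def)
    show "\<exists>u\<in>?L'. od (e u) - b \<in> hat \<aa>" if "b \<in> Fr B2" for b using L'_onto[OF that] .
    show "od (e u) \<in> hat \<aa> \<longleftrightarrow> (\<exists>u1\<in>?L. u - u1 \<in> hat \<aa>)" if u: "u \<in> ?L'" for u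
    proof
      assume "od (e u) \<in> hat \<aa>"
      from L_iff[OF u this] show "\<exists>u1\<in>?L. u - u1 \<in> hat \<aa>" using zh by (intro bexI[of _ u]) simp_all
    next
      assume "\<exists>u1\<in>?L. u - u1 \<in> hat \<aa>"
      then obtain u1 where u1: "u1 \<in> Fr B" "od (e u1) \<in> hat \<aa>" "u - u1 \<in> hat \<aa>" by (auto simp: kr_def T0_def)
      have "u \<in> Fr B" using u by (simp add: kr_def)
      from sub_diff[OF sub_Fr this u1(1)] have "u - u1 \<in> Fr B" .
      from lin_hat[OF a E(1) lo this u1(3)] have "od (e u) - od (e u1) \<in> hat \<aa>" by (simp add: el)
      then show "od (e u) \<in> hat \<aa>" using sub_diff_iff[OF sh] u1(2) by blast
    qed
  qed (use lo in auto)
  from good_ses[OF a this e(3) good_Fr[OF a E2(1)] md_hat[OF a L']]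
  have gL': "good \<aa> (h - 1) ?L' (hat \<aa>)" .
  have "ext \<aa> ?L'" if h0: "h = 0"
    unfolding ext_def
  proof (intro allI impI)
    fix \<phi> assume \<phi>: "mlf \<aa> ?L' \<phi>"
    have "mlf \<aa> ?L \<phi>" using \<phi> LL' unfolding mlf_def by blast
    then obtain \<psi> where \<psi>: "lin1 \<psi>" "\<And>v. v \<in> ?L \<Longrightarrow> \<phi> v - \<psi> v \<in> \<aa>"
      using e(2) h0 unfolding ext_def by blast
    define \<phi>' where "\<phi>' = (\<lambda>v. \<phi> v - \<psi> v)"
    have \<phi>': "mlf \<aa> ?L' \<phi>'"
      unfolding \<phi>'_def by (rule mlf_sub[OF \<phi> mlf_lin1[OF a E(1) _ \<psi>(1)] a]) (auto simp: kr_def)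
    have eq: "\<phi>' v - \<phi>' w \<in> \<aa>" if "v \<in> ?L'" "w \<in> ?L'" "od (e v) - od (e w) \<in> hat \<aa>" for v w
    proof -
      have "v - w \<in> ?L" by (rule L_iff[OF sub_diff[OF L' that(1,2)]]) (use that(3) in \<open>simp add: el\<close>)
      then have "\<phi>' (v - w) \<in> \<aa>" using \<psi>(2) by (simp add: \<phi>'_def)
      then show ?thesis using idl_diff_iff[OF a mlf_minus[OF \<phi>' a L' that(1,2)]] by blast
    qed
    \<comment> \<open>The difference \<open>\<phi>'\<close> vanishes on \<open>?L\<close> and
      therefore lives on the free quotient \<open>Fr B2\<close>; along a linear section
      \<open>g\<close> it becomes a functional on a free module.\<close>
    have "\<exists>g. lin g \<and> (\<forall>b\<in>Fr B2. g b \<in> ?L' \<and> od (e (g b)) - b \<in> hat \<aa>)"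
      by (rule free_lift[OF E2(1) lin_intros(1) lo L' sh L'_onto])
    then obtain g where g: "lin g" "\<And>b. b \<in> Fr B2 \<Longrightarrow> g b \<in> ?L'" "\<And>b. b \<in> Fr B2 \<Longrightarrow> od (e (g b)) - b \<in> hat \<aa>"
      by blast
    have "mlf \<aa> (Fr B2) (\<lambda>b. \<phi>' (g b))"
      by (rule mlf_comp[OF \<phi>' g(1)]) (use g(2) lin_hat[OF a E2(1) g(1)] in blast)+
    from mlf_linear[OF this a E2(1)] obtain \<theta> where \<theta>: "lin1 \<theta>" "\<And>b. b \<in> Fr B2 \<Longrightarrow> \<phi>' (g b) - \<theta> b \<in> \<aa>"
      by blast
    let ?\<psi> = "\<lambda>v. \<psi> v + \<theta> (od (e v))"
    have "lin1 ?\<psi>" using \<psi>(1) \<theta>(1) E(2) by (simp add: lin1_def lin_def algebra_simps)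
    moreover have "\<phi> v - ?\<psi> v \<in> \<aa>" if v: "v \<in> ?L'" for v
    proof -
      have b: "od (e v) \<in> Fr B2" using v E(3) by (simp add: kr_def T_def)
      have "\<phi>' v - \<phi>' (g (od (e v))) \<in> \<aa>"
        by (rule eq[OF v g(2)[OF b] sub_diff_sym[OF sh g(3)[OF b]]])
      from idl_diff_trans[OF a this \<theta>(2)[OF b]] show ?thesis by (simp add: \<phi>'_def algebra_simps)
    qed
    ultimately show "\<exists>\<psi>. lin1 \<psi> \<and> (\<forall>v\<in>?L'. \<phi> v - \<psi> v \<in> \<aa>)" by blast
  qed
  then show ?thesis by (rule goodI[OF m cf _ gL'])
qed

text \<open>Independence of the cover, as in Schanuel's lemma. With comparison maps \<open>s\<close>
  and \<open>s'\<close>, the vector \<open>v - s (s' v)\<close> always lies in the syzygy, so the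
  functional composed with it is defined on the whole free module. The remainder passes through the
  cover that comes with \<open>good\<close>.\<close>

lemma good_ext:
  assumes a: "idl \<aa>" and g: "good \<aa> 0 U W" and c: "cov e' B' U W"
  shows "ext \<aa> (kr e' B' W)"
  unfolding ext_def
proof (intro allI impI)
  fix \<phi> assume \<phi>: "mlf \<aa> (kr e' B' W) \<phi>"
  obtain e and B :: "nat set" where e: "cov e B U W" "ext \<aa> (kr e B W)" using g by (rule goodE) blast
  note E = covD[OF e(1)] and E' = covD[OF c] and m = good_md[OF g]
  note U = mdD(1)[OF m] and W = mdD(2)[OF m]
  have "\<exists>s. lin s \<and> (\<forall>v\<in>Fr B. s v \<in> Fr B' \<and> e' (s v) - e v \<in> W)"
    by (rule free_lift[OF E(1,2) E'(2) sub_Fr W]) (use E'(4)[OF E(3)] sub_diff_sym[OF W] in blast)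
  then obtain s where s: "lin s" "\<And>v. v \<in> Fr B \<Longrightarrow> s v \<in> Fr B'" "\<And>v. v \<in> Fr B \<Longrightarrow> e' (s v) - e v \<in> W" by blast
  have "\<exists>s. lin s \<and> (\<forall>v\<in>Fr B'. s v \<in> Fr B \<and> e (s v) - e' v \<in> W)"
    by (rule free_lift[OF E'(1,2) E(2) sub_Fr W]) (use E(4)[OF E'(3)] sub_diff_sym[OF W] in blast)
  then obtain s' where s': "lin s'" "\<And>v. v \<in> Fr B' \<Longrightarrow> s' v \<in> Fr B" "\<And>v. v \<in> Fr B' \<Longrightarrow> e (s' v) - e' v \<in> W" by blast
  have L': "sub (kr e' B' W)" by (rule sub_kr[OF E'(2) W])
  have "mlf \<aa> (kr e B W) (\<lambda>v. \<phi> (s v))"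
  proof (rule mlf_comp[OF \<phi> s(1)])
    show "s v \<in> kr e' B' W" if "v \<in> kr e B W" for v
      using that s(2,3) sub_diff_iff[OF W] by (auto simp: kr_def)
    show "s v \<in> hat \<aa>" if "v \<in> kr e B W" "v \<in> hat \<aa>" for v
      by (rule lin_hat[OF a E(1) s(1) _ that(2)]) (use that in \<open>simp add: kr_def\<close>)
  qed
  then obtain \<psi> where \<psi>: "lin1 \<psi>" "\<And>v. v \<in> kr e B W \<Longrightarrow> \<phi> (s v) - \<psi> v \<in> \<aa>"
    using e(2) unfolding ext_def by blast
  let ?d = "\<lambda>v. v - s (s' v)"
  have ld: "lin ?d" using s(1) s'(1) by (simp add: lin_def sc_distrib algebra_simps)
  have "mlf \<aa> (Fr B') (\<lambda>v. \<phi> (?d v))"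
  proof (rule mlf_comp[OF \<phi> ld])
    show "?d v \<in> kr e' B' W" if v: "v \<in> Fr B'" for v
    proof -
      have "e' (?d v) \<in> W" using sub_diff_trans[OF W sub_diff_sym[OF W s'(3)[OF v]] sub_diff_sym[OF W s(3)[OF s'(2)[OF v]]]]
        by (simp only: lin_diff[OF E'(2)])
      then show ?thesis using sub_diff[OF sub_Fr v s(2)[OF s'(2)[OF v]]] by (simp add: kr_def)
    qed
    show "?d v \<in> hat \<aa>" if "v \<in> Fr B'" "v \<in> hat \<aa>" for v
      by (rule lin_hat[OF a E'(1) ld that])
  qed
  from mlf_linear[OF this a E'(1)] obtain \<theta> where \<theta>: "lin1 \<theta>" "\<And>v. v \<in> Fr B' \<Longrightarrow> \<phi> (?d v) - \<theta> v \<in> \<aa>"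
    by blast
  have "lin1 (\<lambda>v. \<theta> v + \<psi> (s' v))" using \<theta>(1) \<psi>(1) s'(1) by (simp add: lin1_def lin_def algebra_simps)
  moreover have "\<phi> v - (\<theta> v + \<psi> (s' v)) \<in> \<aa>" if v: "v \<in> kr e' B' W" for v
  proof -
    have v': "v \<in> Fr B'" "e' v \<in> W" using v by (auto simp: kr_def)
    have k: "s' v \<in> kr e B W" using s'(2,3)[OF v'(1)] sub_diff_iff[OF W] v'(2) by (simp add: kr_def)
    have k': "s (s' v) \<in> kr e' B' W"
      using k s(2,3) sub_diff_iff[OF W] by (auto simp: kr_def)
    have 1: "\<phi> (?d v) - (\<phi> v - \<phi> (s (s' v))) \<in> \<aa>" by (rule mlf_minus[OF \<phi> a L' v k'])
    have 2: "(\<phi> (?d v) - \<theta> v) + (\<phi> (s (s' v)) - \<psi> (s' v)) - (\<phi> (?d v) - (\<phi> v - \<phi> (s (s' v)))) \<in> \<aa>"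
      by (rule idl_diff[OF a idl_add[OF a \<theta>(2)[OF v'(1)] \<psi>(2)[OF k]] 1])
    then show ?thesis by (simp add: algebra_simps)
  qed
  ultimately show "\<exists>\<psi>. lin1 \<psi> \<and> (\<forall>v\<in>kr e' B' W. \<phi> v - \<psi> v \<in> \<aa>)" by blast
qed

subsection \<open>Killing a regular element\<close>

definition adj :: "'s::comm_ring_1 set \<Rightarrow> 's \<Rightarrow> 's set"
  where "adj \<aa> x = {r. \<exists>t. r - x * t \<in> \<aa>}"

definition reg :: "'s::comm_ring_1 set \<Rightarrow> 's \<Rightarrow> bool"
  where "reg \<aa> x \<longleftrightarrow> (\<forall>r. x * r \<in> \<aa> \<longrightarrow> r \<in> \<aa>)"

lemma regD: "reg \<aa> x \<Longrightarrow> x * r \<in> \<aa> \<Longrightarrow> r \<in> \<aa>"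
  by (simp add: reg_def)

lemma reg_hat: "reg \<aa> x \<Longrightarrow> x *s v \<in> hat \<aa> \<Longrightarrow> v \<in> hat \<aa>"
  by (auto simp: reg_def hat_def)

lemma idl_adj: assumes "idl \<aa>" shows "idl (adj \<aa> x)"
  unfolding idl_def adj_def
proof (intro conjI ballI allI CollectI)
  show "\<exists>t. 0 - x * t \<in> \<aa>" by (rule exI[of _ 0]) (simp add: idl_zero[OF assms])
  fix a assume a: "a \<in> {r. \<exists>t. r - x * t \<in> \<aa>}"
  then obtain t where t: "a - x * t \<in> \<aa>" by blast
  show "\<exists>t. r * a - x * t \<in> \<aa>" for r
    by (rule exI[of _ "r * t"]) (use idl_mult[OF assms t, of r] in \<open>simp add: algebra_simps\<close>)
  fix b assume "b \<in> {r. \<exists>t. r - x * t \<in> \<aa>}"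
  then obtain t' where t': "b - x * t' \<in> \<aa>" by blast
  show "\<exists>t. a + b - x * t \<in> \<aa>"
    by (rule exI[of _ "t + t'"]) (use idl_add[OF assms t t'] in \<open>simp add: algebra_simps\<close>)
qed

lemma adj_incl: "a \<in> \<aa> \<Longrightarrow> a \<in> adj \<aa> x"
  unfolding adj_def by (auto intro: exI[of _ 0])

lemma adj_x: "idl \<aa> \<Longrightarrow> x * t \<in> adj \<aa> x"
  unfolding adj_def by (auto simp: idl_zero intro!: exI[of _ t])

lemma hat_adj_incl: "v \<in> hat \<aa> \<Longrightarrow> v \<in> hat (adj \<aa> x)"
  by (auto simp: hat_def adj_incl)

lemma hat_adj_x: "idl \<aa> \<Longrightarrow> x *s v \<in> hat (adj \<aa> x)"
  by (auto simp: hat_def adj_x)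

lemma hat_adjE:
  assumes a: "idl \<aa>" and v: "v \<in> Fr B" "v \<in> hat (adj \<aa> x)"
  obtains b where "b \<in> Fr B" "v - x *s b \<in> hat \<aa>"
proof -
  from v(2) have "\<forall>i. \<exists>t. v i - x * t \<in> \<aa>" by (simp add: hat_def adj_def)
  then obtain t where t: "\<And>i. v i - x * t i \<in> \<aa>" by metis
  show ?thesis
    by (rule that[of "\<lambda>i. if i \<in> B then t i else 0"])
       (use v(1) t idl_zero[OF a] in \<open>auto simp: Fr_def hat_def\<close>)
qed

text \<open>Rees's change of rings in degree one. The obstruction to lifting a functional on
  \<open>L\<close> with values modulo \<open>\<aa> + xS\<close> to one with values modulo
  \<open>\<aa>\<close> lies in an Ext of \<open>L\<close> that vanishes. The lift satisfies
  \<open>\<rho> (x v) = x \<alpha> v\<close> with a functional \<open>\<alpha>\<close> on the cover,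
  and regularity of \<open>x\<close> shows that \<open>\<alpha>\<close> extends it.\<close>

lemma ext_adj:
  assumes a: "idl \<aa>" and x: "reg \<aa> x" and B: "finite B" and L: "sub L" "L \<subseteq> Fr B"
    and xL: "\<And>v. v \<in> Fr B \<Longrightarrow> x *s v \<in> L" and g: "good \<aa> 0 L (hat \<aa>)"
  shows "ext (adj \<aa> x) L"
  unfolding ext_def
proof (intro allI impI)
  let ?b = "adj \<aa> x"
  note b = idl_adj[OF a, of x]
  have sh: "sub (hat \<aa> :: (nat \<Rightarrow> 'a) set)" by (rule sub_hat[OF a])
  fix \<phi> assume \<phi>: "mlf ?b L \<phi>"
  obtain f and C :: "nat set" where c: "cov f C L (hat \<aa>)" "ext \<aa> (kr f C (hat \<aa>))" using g by (rule goodE) blast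
  note C = covD[OF c(1)]
  note f = lin_simps[OF C(2)]
  let ?K = "kr f C (hat \<aa>)"
  have "mlf ?b (Fr C) (\<lambda>v. \<phi> (f v))"
    by (rule mlf_comp[OF \<phi> C(2,3)]) (use lin_hat[OF b C(1,2)] in blast)+
  from mlf_linear[OF this b C(1)] obtain \<theta> where \<theta>: "lin1 \<theta>" "\<And>v. v \<in> Fr C \<Longrightarrow> \<phi> (f v) - \<theta> v \<in> ?b" by blast
  note \<theta>l = lin1_simps[OF \<theta>(1)]
  have "\<theta> v \<in> ?b" if "v \<in> ?K" for v
    using that mlfD(3)[OF \<phi> C(3) hat_adj_incl] \<theta>(2) idl_diff_iff[OF b] by (auto simp: kr_def)
  then have "\<forall>v. \<exists>t. v \<in> ?K \<longrightarrow> \<theta> v - x * t \<in> \<aa>" unfolding adj_def by blast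
  \<comment> \<open>On the syzygy of \<open>f\<close> the functional dies modulo \<open>?b\<close>,
    so its linear representative \<open>\<theta>\<close> is divisible by \<open>x\<close> modulo
    \<open>\<aa>\<close>. The quotient \<open>\<chi>\<close> is a functional because
    \<open>x\<close> is regular, and it extends because \<open>L\<close> is good.\<close>
  then obtain \<chi> where \<chi>: "\<And>v. v \<in> ?K \<Longrightarrow> \<theta> v - x * \<chi> v \<in> \<aa>" by metis
  have K: "sub ?K" by (rule sub_kr[OF C(2) sh])
  have "mlf \<aa> ?K \<chi>"
    unfolding mlf_def
  proof (intro conjI ballI allI impI)
    fix u v assume uv: "u \<in> ?K" "v \<in> ?K"
    have "x * (\<chi> (u + v) - (\<chi> u + \<chi> v)) =
      (\<theta> u - x * \<chi> u) + (\<theta> v - x * \<chi> v) - (\<theta> (u + v) - x * \<chi> (u + v))"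
      by (simp add: \<theta>l algebra_simps)
    also have "\<dots> \<in> \<aa>" by (intro idl_diff idl_add a \<chi> uv sub_add[OF K])
    finally show "\<chi> (u + v) - (\<chi> u + \<chi> v) \<in> \<aa>" by (rule regD[OF x])
  next
    fix r u assume u: "u \<in> ?K"
    have "x * (\<chi> (r *s u) - r * \<chi> u) = r * (\<theta> u - x * \<chi> u) - (\<theta> (r *s u) - x * \<chi> (r *s u))"
      by (simp add: \<theta>l algebra_simps)
    also have "\<dots> \<in> \<aa>" by (intro idl_diff idl_mult a \<chi> u sub_sc[OF K])
    finally show "\<chi> (r *s u) - r * \<chi> u \<in> \<aa>" by (rule regD[OF x])
  next
    fix u assume u: "u \<in> ?K" "u \<in> hat \<aa>"
    have "\<theta> u \<in> \<aa>" by (rule lin1_hat[OF a C(1) \<theta>(1) _ u(2)]) (use u in \<open>simp add: kr_def\<close>)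
    then have "x * \<chi> u \<in> \<aa>" using idl_diff_iff[OF a \<chi>[OF u(1)]] by blast
    then show "\<chi> u \<in> \<aa>" by (rule regD[OF x])
  qed
  then obtain \<chi>' where \<chi>': "lin1 \<chi>'" "\<And>v. v \<in> ?K \<Longrightarrow> \<chi> v - \<chi>' v \<in> \<aa>" using c(2) unfolding ext_def by blast
  \<comment> \<open>The correction does not change \<open>\<theta>\<close> modulo \<open>?b\<close>,
    but makes it vanish on the syzygy modulo \<open>\<aa>\<close>. So \<open>\<rho>\<close> descends
    to \<open>L\<close> and is the lift of the functional.\<close>
  define \<rho> where "\<rho> = (\<lambda>v. \<theta> v - x * \<chi>' v)"
  have l\<rho>: "lin1 \<rho>" using \<theta>(1) \<chi>'(1) by (simp add: \<rho>_def lin1_def algebra_simps)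
  note \<rho>l = lin1_simps[OF l\<rho>]
  have \<rho>K: "\<rho> v \<in> \<aa>" if "v \<in> ?K" for v
    using idl_add[OF a \<chi>[OF that] idl_mult[OF a \<chi>'(2)[OF that], of x]] by (simp add: \<rho>_def algebra_simps)
  have \<rho>\<phi>: "\<phi> (f v) - \<rho> v \<in> ?b" if "v \<in> Fr C" for v
    using idl_add[OF b \<theta>(2)[OF that] adj_x[OF a, of x "\<chi>' v"]] by (simp add: \<rho>_def algebra_simps)
  have \<rho>eq: "\<rho> u - \<rho> v \<in> \<aa>" if "u \<in> Fr C" "v \<in> Fr C" "f u - f v \<in> hat \<aa>" for u v
  proof -
    have "u - v \<in> ?K" using sub_diff[OF sub_Fr that(1,2)] that(3) by (simp add: kr_def f)
    from \<rho>K[OF this] show ?thesis by (simp add: \<rho>l)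
  qed
  from C(4) obtain c where c: "\<And>l. l \<in> L \<Longrightarrow> c l \<in> Fr C" "\<And>l. l \<in> L \<Longrightarrow> l - f (c l) \<in> hat \<aa>" by metis
  have c': "f (c l) - l \<in> hat \<aa>" if "l \<in> L" for l by (rule sub_diff_sym[OF sh c(2)[OF that]])
  have \<phi>c: "\<phi> l - \<rho> (c l) \<in> ?b" if l: "l \<in> L" for l
    by (rule idl_diff_trans[OF b mlf_cong[OF \<phi> b L(1) l C(3)[OF c(1)[OF l]] hat_adj_incl[OF c(2)[OF l]]] \<rho>\<phi>[OF c(1)[OF l]]])
  have "\<exists>t. \<rho> (c (x *s v)) - x * t \<in> \<aa>" if v: "v \<in> Fr B" for v
  proof -
    have "\<phi> (x *s v) \<in> ?b" by (rule mlfD(3)[OF \<phi> xL[OF v] hat_adj_x[OF a]])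
    then have "\<rho> (c (x *s v)) \<in> ?b" using idl_diff_iff[OF b \<phi>c[OF xL[OF v]]] by blast
    then show ?thesis by (simp add: adj_def)
  qed
  then obtain \<alpha> where \<alpha>: "\<And>v. v \<in> Fr B \<Longrightarrow> \<rho> (c (x *s v)) - x * \<alpha> v \<in> \<aa>" by metis
  have "mlf \<aa> (Fr B) \<alpha>"
    unfolding mlf_def
  proof (intro conjI ballI allI impI)
    fix u v :: "nat \<Rightarrow> 'a" assume uv: "u \<in> Fr B" "v \<in> Fr B"
    have s: "u + v \<in> Fr B" by (rule sub_add[OF sub_Fr uv])
    let ?g = "\<lambda>v. c (x *s v)"
    have "f (?g (u + v)) - f (?g u + ?g v) =
      (f (?g (u + v)) - x *s (u + v)) - (f (?g u) - x *s u) - (f (?g v) - x *s v)"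
      by (simp add: f sc_distrib algebra_simps)
    also have "\<dots> \<in> hat \<aa>" by (intro sub_diff[OF sh] c' xL s uv)
    finally have r: "\<rho> (?g (u + v)) - \<rho> (?g u + ?g v) \<in> \<aa>"
      by (intro \<rho>eq c(1) sub_add[OF sub_Fr] xL s uv)
    have "x * (\<alpha> (u + v) - (\<alpha> u + \<alpha> v)) = (\<rho> (?g (u + v)) - \<rho> (?g u + ?g v)) +
      (\<rho> (?g u) - x * \<alpha> u) + (\<rho> (?g v) - x * \<alpha> v) - (\<rho> (?g (u + v)) - x * \<alpha> (u + v))"
      by (simp add: \<rho>l algebra_simps)
    also have "\<dots> \<in> \<aa>" by (intro idl_diff[OF a] idl_add[OF a] r \<alpha> s uv)
    finally show "\<alpha> (u + v) - (\<alpha> u + \<alpha> v) \<in> \<aa>" by (rule regD[OF x])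
  next
    fix r and u :: "nat \<Rightarrow> 'a" assume u: "u \<in> Fr B"
    have s: "r *s u \<in> Fr B" by (rule sub_sc[OF sub_Fr u])
    let ?g = "\<lambda>v. c (x *s v)"
    have "f (?g (r *s u)) - f (r *s ?g u) = (f (?g (r *s u)) - x *s (r *s u)) - r *s (f (?g u) - x *s u)"
      by (simp add: f sc_distrib algebra_simps)
    also have "\<dots> \<in> hat \<aa>" by (intro sub_diff[OF sh] sub_sc[OF sh] c' xL s u)
    finally have r: "\<rho> (?g (r *s u)) - \<rho> (r *s ?g u) \<in> \<aa>"
      by (intro \<rho>eq c(1) sub_sc[OF sub_Fr] xL s u)
    have "x * (\<alpha> (r *s u) - r * \<alpha> u) = (\<rho> (?g (r *s u)) - \<rho> (r *s ?g u)) +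
      r * (\<rho> (?g u) - x * \<alpha> u) - (\<rho> (?g (r *s u)) - x * \<alpha> (r *s u))"
      by (simp add: \<rho>l algebra_simps)
    also have "\<dots> \<in> \<aa>" by (intro idl_diff[OF a] idl_add[OF a] idl_mult[OF a] r \<alpha> s u)
    finally show "\<alpha> (r *s u) - r * \<alpha> u \<in> \<aa>" by (rule regD[OF x])
  next
    fix u :: "nat \<Rightarrow> 'a" assume u: "u \<in> Fr B" "u \<in> hat \<aa>"
    have "x *s u \<in> hat \<aa>" by (rule sub_sc[OF sh u(2)])
    then have "f (c (x *s u)) \<in> hat \<aa>" using sub_diff_iff[OF sh c'[OF xL[OF u(1)]]] by blast
    then have "c (x *s u) \<in> ?K" using c(1)[OF xL[OF u(1)]] by (simp add: kr_def)
    from \<rho>K[OF this] have "x * \<alpha> u \<in> \<aa>" using idl_diff_iff[OF a \<alpha>[OF u(1)]] by blast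
    then show "\<alpha> u \<in> \<aa>" by (rule regD[OF x])
  qed
  from mlf_linear[OF this a B] obtain \<beta> where \<beta>: "lin1 \<beta>" "\<And>v. v \<in> Fr B \<Longrightarrow> \<alpha> v - \<beta> v \<in> \<aa>" by blast
  have "\<phi> l - \<beta> l \<in> ?b" if l: "l \<in> L" for l
  proof -
    have lB: "l \<in> Fr B" using l L(2) by blast
    \<comment> \<open>Both arguments represent \<open>x *s l\<close>, so
      \<open>x * \<rho> (c l)\<close> agrees with \<open>x * \<alpha> l\<close>, and
      \<open>x\<close> cancels.\<close>
    have "f (x *s c l) - f (c (x *s l)) = x *s (f (c l) - l) - (f (c (x *s l)) - x *s l)"
      by (simp add: f sc_distrib)
    also have "\<dots> \<in> hat \<aa>" by (intro sub_diff[OF sh] sub_sc[OF sh] c' xL l lB)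
    finally have r: "\<rho> (x *s c l) - \<rho> (c (x *s l)) \<in> \<aa>"
      by (intro \<rho>eq c(1) sub_sc[OF sub_Fr] xL l lB)
    from idl_diff_trans[OF a this \<alpha>[OF lB]] have "x * (\<rho> (c l) - \<alpha> l) \<in> \<aa>" by (simp add: \<rho>l algebra_simps)
    from idl_diff_trans[OF a regD[OF x this] \<beta>(2)[OF lB]] have "\<rho> (c l) - \<beta> l \<in> ?b" by (rule adj_incl)
    from idl_diff_trans[OF b \<phi>c[OF l] this] show ?thesis .
  qed
  then show "\<exists>\<psi>. lin1 \<psi> \<and> (\<forall>v\<in>L. \<phi> v - \<psi> v \<in> ?b)" using \<beta>(1) by blast
qed

text \<open>Rees's theorem: Ext over the quotient by \<open>\<aa> + xS\<close> in degree
  \<open>i\<close> is Ext over the quotient by \<open>\<aa>\<close> in degree \<open>i + 1\<close>.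
  One cover serves over both rings. The new syzygy is the old one modulo \<open>x\<close> times the
  cover, and \<open>good_coker\<close> for multiplication by \<open>x\<close> keeps the invariant
  \<open>good \<aa> (Suc h)\<close> along all syzygies.\<close>

lemma good_adj:
  assumes a: "idl \<aa>" and x: "reg \<aa> x" and m: "md (adj \<aa> x) U W" and g: "good \<aa> (Suc h) U W"
  shows "good (adj \<aa> x) h U W"
proof (rule good_coind[of "\<lambda>h U W. md (adj \<aa> x) U W \<and> good \<aa> (Suc h) U W"])
  show "md (adj \<aa> x) U W \<and> good \<aa> (Suc h) U W" using m g by blast
  fix h U W assume P: "md (adj \<aa> x) U W \<and> good \<aa> (Suc h) (U :: (nat \<Rightarrow> 'a) set) W"
  then have m: "md (adj \<aa> x) U W" and g: "good \<aa> (Suc h) U W" by blast+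
  obtain e B where e: "cov e B U W" "good \<aa> h (kr e B W) (hat \<aa>)"
    using g by (rule goodE) simp
  note E = covD[OF e(1)]
  note b = idl_adj[OF a, of x] and W = mdD(2)[OF m]
  let ?L = "kr e B W"
  have L: "sub ?L" by (rule sub_kr[OF E(2) W])
  have xL: "x *s v \<in> ?L" if v: "v \<in> Fr B" for v
    using mdD(3)[OF m adj_x[OF a, of x 1] E(3)[OF v]] sub_sc[OF sub_Fr v] by (simp add: kr_def lin_sc[OF E(2)])
  have sh: "sub (hat \<aa> :: (nat \<Rightarrow> 'a) set)" by (rule sub_hat[OF a])
  have zh: "(0 :: nat \<Rightarrow> 'a) \<in> hat (adj \<aa> x)" by (rule sub_zero[OF sub_hat[OF b]])
  have s: "ses (\<lambda>v. x *s v) (\<lambda>v. v) (Fr B) (hat \<aa>) ?L (hat \<aa>) ?L (hat (adj \<aa> x))"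
    unfolding ses_def
  proof (intro conjI ballI)
    show "lin (\<lambda>v. x *s v :: nat \<Rightarrow> 'a)" "lin (\<lambda>v. v :: nat \<Rightarrow> 'a)" by (intro lin_intros)+
    show "x *s u \<in> hat \<aa> \<longleftrightarrow> u \<in> hat \<aa>" for u :: "nat \<Rightarrow> 'a"
      using reg_hat[OF x] sub_sc[OF sh] by blast
    show "\<exists>u\<in>?L. u - u2 \<in> hat (adj \<aa> x)" if "u2 \<in> ?L" for u2 using that zh by (intro bexI[of _ u2]) simp_all
    show "u \<in> hat (adj \<aa> x) \<longleftrightarrow> (\<exists>u1\<in>Fr B. u - x *s u1 \<in> hat \<aa>)" if u: "u \<in> ?L" for u
    proof
      assume "u \<in> hat (adj \<aa> x)"
      then show "\<exists>u1\<in>Fr B. u - x *s u1 \<in> hat \<aa>" using u hat_adjE[OF a, of u B x] by (auto simp: kr_def)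
    next
      assume "\<exists>u1\<in>Fr B. u - x *s u1 \<in> hat \<aa>"
      then obtain u1 where "u - x *s u1 \<in> hat \<aa>" by blast
      from sub_add[OF sub_hat[OF b] hat_adj_incl[OF this] hat_adj_x[OF a, of x u1]] show "u \<in> hat (adj \<aa> x)" by simp
    qed
  qed (use xL in auto)
  have mL: "md (adj \<aa> x) ?L (hat (adj \<aa> x))" by (rule md_hat[OF b L])
  have mL': "md \<aa> ?L (hat (adj \<aa> x))" using mdD[OF mL] adj_incl[of _ \<aa> x] unfolding md_def by blast
  \<comment> \<open>For \<open>h = 0\<close> the bound is raised to 1, as \<open>good_coker\<close>
    needs a positive one; the condition in degree one is supplied by \<open>ext_adj\<close>
    instead.\<close>
  have "good \<aa> (Suc (h - 1)) ?L (hat \<aa>)" by (rule good_mono[OF e(2)]) simp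
  from good_coker[OF a s good_Fr[OF a E(1)] this mL'] have "good \<aa> (Suc (h - 1)) ?L (hat (adj \<aa> x))" .
  moreover have "ext (adj \<aa> x) ?L" if "h = 0"
    by (rule ext_adj[OF a x E(1) L _ xL]) (use e(2) that in \<open>auto simp: kr_def\<close>)
  ultimately show "md (adj \<aa> x) U W \<and> (\<exists>e B. cov e B U W \<and> (h = 0 \<longrightarrow> ext (adj \<aa> x) (kr e B W)) \<and>
    (md (adj \<aa> x) (kr e B W) (hat (adj \<aa> x)) \<and> good \<aa> (Suc (h - 1)) (kr e B W) (hat (adj \<aa> x)) \<or>
      good (adj \<aa> x) (h - 1) (kr e B W) (hat (adj \<aa> x))))"
    using m mL e(1) by blast
qed

section \<open>Complexes modulo an ideal\<close>

text \<open>A complex of finite free modules over the quotient by \<open>\<aa>\<close>, given by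
  lifted differentials, whose square is zero only modulo \<open>\<aa>\<close>.\<close>

definition cpx :: "'s::comm_ring_1 set \<Rightarrow> (int \<Rightarrow> nat set) \<Rightarrow> (int \<Rightarrow> (nat \<Rightarrow> 's) \<Rightarrow> nat \<Rightarrow> 's) \<Rightarrow> bool"
  where "cpx \<aa> B d \<longleftrightarrow> (\<forall>i. finite (B i)) \<and> (\<forall>i. lin (d i)) \<and> (\<forall>i. \<forall>v\<in>Fr (B i). d i v \<in> Fr (B (i - 1))) \<and>
    (\<forall>i. \<forall>v\<in>Fr (B i). d (i - 1) (d i v) \<in> hat \<aa>)"

definition Zc :: "'s::comm_ring_1 set \<Rightarrow> (int \<Rightarrow> nat set) \<Rightarrow> (int \<Rightarrow> (nat \<Rightarrow> 's) \<Rightarrow> nat \<Rightarrow> 's) \<Rightarrow> int \<Rightarrow> (nat \<Rightarrow> 's) set"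
  where "Zc \<aa> B d i = {v \<in> Fr (B i). d i v \<in> hat \<aa>}"

definition Bc :: "'s::comm_ring_1 set \<Rightarrow> (int \<Rightarrow> nat set) \<Rightarrow> (int \<Rightarrow> (nat \<Rightarrow> 's) \<Rightarrow> nat \<Rightarrow> 's) \<Rightarrow> int \<Rightarrow> (nat \<Rightarrow> 's) set"
  where "Bc \<aa> B d i = {v \<in> Fr (B i). \<exists>w\<in>Fr (B (i + 1)). v - d (i + 1) w \<in> hat \<aa>}"

text \<open>The homology in degree \<open>i\<close> is free over \<open>S/I\<close> on the classes of the \<open>\<zeta> (un c)\<close>, \<open>c \<in> C\<close>.\<close>

definition hb where
  "hb \<aa> I B d C \<zeta> i \<longleftrightarrow> finite C \<and> miso \<zeta> (Fr C) (hat I) (Zc \<aa> B d i) (Bc \<aa> B d i)"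

lemma cpxD:
  assumes "cpx \<aa> B d"
  shows "\<And>i. finite (B i)" "\<And>i. lin (d i)" "\<And>i v. v \<in> Fr (B i) \<Longrightarrow> d i v \<in> Fr (B (i - 1))"
    "\<And>i v. v \<in> Fr (B i) \<Longrightarrow> d (i - 1) (d i v) \<in> hat \<aa>"
    "\<And>i v. v \<in> Fr (B (i + 1)) \<Longrightarrow> d (i + 1) v \<in> Fr (B i)"
    "\<And>i v. v \<in> Fr (B (i + 1)) \<Longrightarrow> d i (d (i + 1) v) \<in> hat \<aa>"
proof -
  show 1: "\<And>i. finite (B i)" "\<And>i. lin (d i)" and 2: "\<And>i v. v \<in> Fr (B i) \<Longrightarrow> d i v \<in> Fr (B (i - 1))"
    and 3: "\<And>i v. v \<in> Fr (B i) \<Longrightarrow> d (i - 1) (d i v) \<in> hat \<aa>"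
    using assms by (auto simp: cpx_def)
  show "\<And>i v. v \<in> Fr (B (i + 1)) \<Longrightarrow> d (i + 1) v \<in> Fr (B i)" using 2[of _ "_ + 1"] by fastforce
  show "\<And>i v. v \<in> Fr (B (i + 1)) \<Longrightarrow> d i (d (i + 1) v) \<in> hat \<aa>" using 3[of _ "_ + 1"] by fastforce
qed

lemma hbD:
  assumes "hb \<aa> I B d C \<zeta> i"
  shows "finite C" "miso \<zeta> (Fr C) (hat I) (Zc \<aa> B d i) (Bc \<aa> B d i)" "lin \<zeta>"
    "\<And>c. c \<in> Fr C \<Longrightarrow> \<zeta> c \<in> Zc \<aa> B d i" "\<And>c. c \<in> Fr C \<Longrightarrow> \<zeta> c \<in> Bc \<aa> B d i \<longleftrightarrow> c \<in> hat I"
    "\<And>v. v \<in> Zc \<aa> B d i \<Longrightarrow> \<exists>c\<in>Fr C. v - \<zeta> c \<in> Bc \<aa> B d i"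
  using assms misoD[of \<zeta> "Fr C" "hat I" "Zc \<aa> B d i" "Bc \<aa> B d i"] unfolding hb_def by blast+

lemma hbI:
  assumes "finite C" "lin \<zeta>"
    and "\<And>c. c \<in> Fr C \<Longrightarrow> \<zeta> c \<in> Fr (B i) \<and> d i (\<zeta> c) \<in> hat \<aa>"
    and "\<And>c. c \<in> Fr C \<Longrightarrow> \<zeta> c \<in> Fr (B i) \<Longrightarrow> \<zeta> c \<in> Bc \<aa> B d i \<longleftrightarrow> c \<in> hat I"
    and "\<And>v. v \<in> Fr (B i) \<Longrightarrow> d i v \<in> hat \<aa> \<Longrightarrow> \<exists>c\<in>Fr C. v - \<zeta> c \<in> Bc \<aa> B d i"
  shows "hb \<aa> I B d C \<zeta> i"
  using assms unfolding hb_def miso_def Zc_def by blast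

lemma ZcD: "v \<in> Zc \<aa> B d i \<Longrightarrow> v \<in> Fr (B i)" "v \<in> Zc \<aa> B d i \<Longrightarrow> d i v \<in> hat \<aa>"
  by (simp_all add: Zc_def)

lemma BcE:
  assumes "v \<in> Bc \<aa> B d i"
  obtains w where "v \<in> Fr (B i)" "w \<in> Fr (B (i + 1))" "v - d (i + 1) w \<in> hat \<aa>"
  using assms by (auto simp: Bc_def)

lemma BcI: "v \<in> Fr (B i) \<Longrightarrow> w \<in> Fr (B (i + 1)) \<Longrightarrow> v - d (i + 1) w \<in> hat \<aa> \<Longrightarrow> v \<in> Bc \<aa> B d i"
  by (auto simp: Bc_def)

lemma sub_Zc: "idl \<aa> \<Longrightarrow> cpx \<aa> B d \<Longrightarrow> sub (Zc \<aa> B d i)"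
  unfolding Zc_def by (rule sub_preimage[OF sub_Fr sub_hat cpxD(2)])

lemma sub_Bc:
  assumes a: "idl \<aa>" and c: "cpx \<aa> B d" shows "sub (Bc \<aa> B d i)"
proof -
  note C = cpxD[OF c]
  note d = lin_simps[OF C(2)] and h = sub_hat[OF a]
  show ?thesis
    unfolding sub_def
  proof (intro conjI ballI allI)
    show "0 \<in> Bc \<aa> B d i"
      by (rule BcI[of _ _ _ 0]) (simp_all add: sub_zero[OF sub_Fr] d sub_zero[OF h])
    fix u assume "u \<in> Bc \<aa> B d i"
    then obtain w where w: "u \<in> Fr (B i)" "w \<in> Fr (B (i + 1))" "u - d (i + 1) w \<in> hat \<aa>" by (rule BcE)
    show "r *s u \<in> Bc \<aa> B d i" for r
      by (rule BcI[of _ _ _ "r *s w"])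
         (use w sub_sc[OF sub_Fr] sub_sc[OF h w(3), of r] in \<open>simp_all add: d sc_distrib\<close>)
    fix v assume "v \<in> Bc \<aa> B d i"
    then obtain w' where w': "v \<in> Fr (B i)" "w' \<in> Fr (B (i + 1))" "v - d (i + 1) w' \<in> hat \<aa>" by (rule BcE)
    show "u + v \<in> Bc \<aa> B d i"
      by (rule BcI[of _ _ _ "w + w'"])
         (use w w' sub_add[OF sub_Fr] sub_add[OF h w(3) w'(3)] in \<open>simp_all add: d algebra_simps\<close>)
  qed
qed

lemma Bc_Zc: assumes a: "idl \<aa>" and c: "cpx \<aa> B d" shows "Bc \<aa> B d i \<subseteq> Zc \<aa> B d i"
proof
  note C = cpxD[OF c]
  fix v assume "v \<in> Bc \<aa> B d i"
  then obtain w where w: "v \<in> Fr (B i)" "w \<in> Fr (B (i + 1))" "v - d (i + 1) w \<in> hat \<aa>" by (rule BcE)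
  have "d i (v - d (i + 1) w) \<in> hat \<aa>"
    by (rule lin_hat[OF a C(1,2) sub_diff[OF sub_Fr w(1) C(5)[OF w(2)]] w(3)])
  then have "d i v - d i (d (i + 1) w) \<in> hat \<aa>" by (simp only: lin_diff[OF C(2)])
  then have "d i v \<in> hat \<aa>" using sub_diff_iff[OF sub_hat[OF a]] C(6)[OF w(2)] by blast
  then show "v \<in> Zc \<aa> B d i" using w(1) by (simp add: Zc_def)
qed

lemma hat_Bc: assumes "idl \<aa>" "cpx \<aa> B d" "v \<in> Fr (B i)" "v \<in> hat \<aa>" shows "v \<in> Bc \<aa> B d i"
proof -
  note C = cpxD[OF assms(2)]
  show ?thesis
    by (rule BcI[of _ _ _ 0]) (use assms sub_zero[OF sub_Fr] in \<open>simp_all add: lin_zero[OF C(2)]\<close>)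
qed

lemma Bc_d: assumes "idl \<aa>" "cpx \<aa> B d" "w \<in> Fr (B (i + 1))" shows "d (i + 1) w \<in> Bc \<aa> B d i"
proof -
  note C = cpxD[OF assms(2)]
  show ?thesis
    by (rule BcI[OF C(5)[OF assms(3)] assms(3)]) (simp add: sub_zero[OF sub_hat[OF assms(1)]])
qed

lemma cpx_adj: assumes "cpx \<aa> B d" shows "cpx (adj \<aa> x) B d"
  using assms hat_adj_incl unfolding cpx_def by blast

text \<open>Multiplication by \<open>x\<close> is homotopic to zero, hence zero on homology, and the
  long exact sequence of \<open>0 -> B -> B -> B/xB -> 0\<close> breaks into sequences
  \<open>0 -> H_i -> H_i(B/xB) -> H_{i-1} -> 0\<close>. The homotopy also splits them: a cycle
  \<open>z\<close> in degree \<open>i - 1\<close> goes to \<open>h z\<close>, which is a cycle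
  modulo \<open>x\<close> because \<open>d (h z) = x z\<close> modulo \<open>\<aa>\<close>.\<close>

lemma hb_adj:
  assumes a: "idl \<aa>" and c: "cpx \<aa> B d" and x: "reg \<aa> x"
    and h: "\<And>i. lin (h i)" "\<And>i v. v \<in> Fr (B i) \<Longrightarrow> h i v \<in> Fr (B (i + 1))"
      "\<And>i v. v \<in> Fr (B i) \<Longrightarrow> d (i + 1) (h i v) + h (i - 1) (d i v) - x *s v \<in> hat \<aa>"
    and 1: "hb \<aa> I B d C \<zeta> i" and 2: "hb \<aa> I B d C' \<zeta>' (i - 1)"
  shows "hb (adj \<aa> x) I B d (jnB C C') (\<lambda>c. \<zeta> (ev c) + h (i - 1) (\<zeta>' (od c))) i"
proof -
  note C = cpxD[OF c] and H1 = hbD[OF 1] and H2 = hbD[OF 2]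
  note b = idl_adj[OF a, of x]
  note sh = sub_hat[OF a] and sb = sub_hat[OF b]
  have dl: "\<And>i u v. d i (u + v) = d i u + d i v" "\<And>i u v. d i (u - v) = d i u - d i v"
    "\<And>i u r. d i (r *s u) = r *s d i u" using C(2) lin_add lin_diff lin_sc by blast+
  have hl: "\<And>i u v. h i (u + v) = h i u + h i v" "\<And>i u v. h i (u - v) = h i u - h i v"
    "\<And>i u r. h i (r *s u) = r *s h i u" using h(1) lin_add lin_diff lin_sc by blast+
  have hi: "h (i - 1) v \<in> Fr (B i)" if "v \<in> Fr (B (i - 1))" for v using h(2)[OF that] by simp
  have hd: "d i (h (i - 1) v) + h (i - 2) (d (i - 1) v) - x *s v \<in> hat \<aa>" if "v \<in> Fr (B (i - 1))" for v
    using h(3)[OF that] by (simp add: diff_diff_eq)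
  have hz: "d i (h (i - 1) v) - x *s v \<in> hat \<aa>" if v: "v \<in> Fr (B (i - 1))" "d (i - 1) v \<in> hat \<aa>" for v
  proof -
    have "h (i - 2) (d (i - 1) v) \<in> hat \<aa>"
      by (rule lin_hat[OF a C(1) h(1) C(3)[OF v(1), simplified] v(2), of "i - 2"]) 
    from sub_diff[OF sh hd[OF v(1)] this] show ?thesis by (simp add: algebra_simps)
  qed
  have ab: "\<And>v. v \<in> hat \<aa> \<Longrightarrow> v \<in> hat (adj \<aa> x)" by (rule hat_adj_incl)
  note hx = hat_adj_x[OF a, of x]
  have Z1: "\<zeta> (ev c) \<in> Fr (B i)" "d i (\<zeta> (ev c)) \<in> hat \<aa>"
    and Z2: "\<zeta>' (od c) \<in> Fr (B (i - 1))" "d (i - 1) (\<zeta>' (od c)) \<in> hat \<aa>"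
    if "c \<in> Fr (jnB C C')" for c
    using H1(4)[of "ev c"] H2(4)[of "od c"] that by (simp_all add: Fr_jnB Zc_def)
  show ?thesis
  proof (rule hbI)
    show "finite (jnB C C')" by (rule finite_jnB[OF H1(1) H2(1)])
    show "lin (\<lambda>c. \<zeta> (ev c) + h (i - 1) (\<zeta>' (od c)))"
      using H1(3) H2(3) h(1) by (simp add: lin_def sc_distrib algebra_simps)
  next
    fix c :: "nat \<Rightarrow> 'a" assume c: "c \<in> Fr (jnB C C')"
    note z1 = Z1[OF c] and z2 = Z2[OF c]
    have "d i (\<zeta> (ev c) + h (i - 1) (\<zeta>' (od c))) =
      (d i (\<zeta> (ev c)) + (d i (h (i - 1) (\<zeta>' (od c))) - x *s \<zeta>' (od c))) + x *s \<zeta>' (od c)" by (simp add: dl)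
    also have "\<dots> \<in> hat (adj \<aa> x)"
      by (intro sub_add[OF sb] hx ab sub_add[OF sh] z1 hz[OF z2])
    finally show "\<zeta> (ev c) + h (i - 1) (\<zeta>' (od c)) \<in> Fr (B i) \<and>
      d i (\<zeta> (ev c) + h (i - 1) (\<zeta>' (od c))) \<in> hat (adj \<aa> x)"
      using sub_add[OF sub_Fr z1(1) hi[OF z2(1)]] by blast
  next
    fix c :: "nat \<Rightarrow> 'a" assume c: "c \<in> Fr (jnB C C')"
    note z1 = Z1[OF c] and z2 = Z2[OF c]
    let ?u = "\<zeta> (ev c)" and ?z = "\<zeta>' (od c)"
    let ?v = "?u + h (i - 1) ?z"
    have vF: "?v \<in> Fr (B i)" by (rule sub_add[OF sub_Fr z1(1) hi[OF z2(1)]])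
    have cc: "ev c \<in> Fr C" "od c \<in> Fr C'" using c by (simp_all add: Fr_jnB)
    show "?v \<in> Bc (adj \<aa> x) B d i \<longleftrightarrow> c \<in> hat I"
    proof
      assume "?v \<in> Bc (adj \<aa> x) B d i"
      then obtain \<delta> where \<delta>: "\<delta> \<in> Fr (B (i + 1))" "?v - d (i + 1) \<delta> \<in> hat (adj \<aa> x)" by (rule BcE)
      have F: "?v - d (i + 1) \<delta> \<in> Fr (B i)" by (rule sub_diff[OF sub_Fr vF C(5)[OF \<delta>(1)]])
      from hat_adjE[OF a F \<delta>(2)] obtain \<gamma> where
        \<gamma>: "\<gamma> \<in> Fr (B i)" "?v - d (i + 1) \<delta> - x *s \<gamma> \<in> hat \<aa>" .
      have F2: "?v - d (i + 1) \<delta> - x *s \<gamma> \<in> Fr (B i)" by (rule sub_diff[OF sub_Fr F sub_sc[OF sub_Fr \<gamma>(1)]])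
      \<comment> \<open>Apply the differential to the relation for \<open>?v\<close> and cancel
        \<open>x\<close>: the component in degree \<open>i - 1\<close> is a boundary.\<close>
      have "x *s (?z - d i \<gamma>) = d i (?v - d (i + 1) \<delta> - x *s \<gamma>) - d i ?u
        - (d i (h (i - 1) ?z) - x *s ?z) + d i (d (i + 1) \<delta>)"
        by (simp add: dl sc_distrib algebra_simps)
      also have "\<dots> \<in> hat \<aa>"
        by (intro sub_add[OF sh] sub_diff[OF sh] lin_hat[OF a C(1,2) F2 \<gamma>(2)] z1 hz[OF z2] C(6)[OF \<delta>(1)])
      finally have zg: "?z - d i \<gamma> \<in> hat \<aa>" by (rule reg_hat[OF x])
      then have "?z \<in> Bc \<aa> B d (i - 1)" using \<gamma>(1) z2(1) by (auto simp: Bc_def)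
      then have o: "od c \<in> hat I" using H2(5)[OF cc(2)] by blast
      have zF: "?z - d i \<gamma> \<in> Fr (B (i - 1))" by (rule sub_diff[OF sub_Fr z2(1) C(3)[OF \<gamma>(1)]])
      have "?u - d (i + 1) (\<delta> + h i \<gamma>) = (?v - d (i + 1) \<delta> - x *s \<gamma>) - h (i - 1) (?z - d i \<gamma>)
        - (d (i + 1) (h i \<gamma>) + h (i - 1) (d i \<gamma>) - x *s \<gamma>)"
        by (simp add: dl hl algebra_simps)
      also have "\<dots> \<in> hat \<aa>"
        by (intro sub_diff[OF sh] \<gamma>(2) lin_hat[OF a C(1) h(1) zF zg] h(3)[OF \<gamma>(1)])
      finally have "?u \<in> Bc \<aa> B d i"
        by (rule BcI[where w = "\<delta> + h i \<gamma>", OF z1(1) sub_add[OF sub_Fr \<delta>(1) h(2)[OF \<gamma>(1)]]])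
      then have "ev c \<in> hat I" using H1(5)[OF cc(1)] by blast
      then show "c \<in> hat I" using o hat_evod by blast
    next
      assume cI: "c \<in> hat I"
      have "?u \<in> Bc \<aa> B d i" using H1(5)[OF cc(1)] hat_ev[OF cI] by blast
      then obtain \<delta> where \<delta>: "\<delta> \<in> Fr (B (i + 1))" "?u - d (i + 1) \<delta> \<in> hat \<aa>" by (rule BcE)
      have "?z \<in> Bc \<aa> B d (i - 1)" using H2(5)[OF cc(2)] hat_od[OF cI] by blast
      then obtain \<gamma> where \<gamma>: "\<gamma> \<in> Fr (B i)" "?z - d i \<gamma> \<in> hat \<aa>" by (auto simp: Bc_def)
      have zF: "?z - d i \<gamma> \<in> Fr (B (i - 1))" by (rule sub_diff[OF sub_Fr z2(1) C(3)[OF \<gamma>(1)]])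
      have "?v - d (i + 1) (\<delta> - h i \<gamma>) = ((?u - d (i + 1) \<delta>) + h (i - 1) (?z - d i \<gamma>)
        + (d (i + 1) (h i \<gamma>) + h (i - 1) (d i \<gamma>) - x *s \<gamma>)) + x *s \<gamma>"
        by (simp add: dl hl algebra_simps)
      also have "\<dots> \<in> hat (adj \<aa> x)"
        by (intro sub_add[OF sb] hx ab sub_add[OF sh] \<delta>(2) lin_hat[OF a C(1) h(1) zF \<gamma>(2)] h(3)[OF \<gamma>(1)])
      finally show "?v \<in> Bc (adj \<aa> x) B d i"
        by (rule BcI[where w = "\<delta> - h i \<gamma>", OF vF sub_diff[OF sub_Fr \<delta>(1) h(2)[OF \<gamma>(1)]]])
    qed
  next
    fix v assume v: "v \<in> Fr (B i)" "d i v \<in> hat (adj \<aa> x)"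
    \<comment> \<open>\<open>\<beta>\<close>, the quotient of \<open>d i v\<close> by
      \<open>x\<close>, is the image of the class of \<open>v\<close> under the connecting
      homomorphism.\<close>
    from hat_adjE[OF a C(3)[OF v(1)] v(2)] obtain \<beta> where
      \<beta>: "\<beta> \<in> Fr (B (i - 1))" "d i v - x *s \<beta> \<in> hat \<aa>" .
    have "x *s d (i - 1) \<beta> = d (i - 1) (d i v) - d (i - 1) (d i v - x *s \<beta>)" by (simp add: dl)
    also have "\<dots> \<in> hat \<aa>"
      by (intro sub_diff[OF sh] C(4)[OF v(1)] lin_hat[OF a C(1,2) sub_diff[OF sub_Fr C(3)[OF v(1)] sub_sc[OF sub_Fr \<beta>(1)]] \<beta>(2)])
    finally have "d (i - 1) \<beta> \<in> hat \<aa>" by (rule reg_hat[OF x])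
    then have "\<beta> \<in> Zc \<aa> B d (i - 1)" using \<beta>(1) by (simp add: Zc_def)
    from H2(6)[OF this] obtain c' where c': "c' \<in> Fr C'" "\<beta> - \<zeta>' c' \<in> Bc \<aa> B d (i - 1)" by blast
    then obtain \<gamma> where \<gamma>: "\<gamma> \<in> Fr (B i)" "\<beta> - \<zeta>' c' - d i \<gamma> \<in> hat \<aa>" by (auto simp: Bc_def)
    have z: "\<zeta>' c' \<in> Fr (B (i - 1))" "d (i - 1) (\<zeta>' c') \<in> hat \<aa>" using H2(4)[OF c'(1)] by (simp_all add: Zc_def)
    let ?v = "v - h (i - 1) (\<zeta>' c') - x *s \<gamma>"
    have vF: "?v \<in> Fr (B i)" by (intro sub_diff[OF sub_Fr] sub_sc[OF sub_Fr] v(1) hi[OF z(1)] \<gamma>(1))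
    have "d i ?v = (d i v - x *s \<beta>) + x *s (\<beta> - \<zeta>' c' - d i \<gamma>) - (d i (h (i - 1) (\<zeta>' c')) - x *s \<zeta>' c')"
      by (simp add: dl sc_distrib algebra_simps)
    also have "\<dots> \<in> hat \<aa>"
      by (intro sub_diff[OF sh] sub_add[OF sh] sub_sc[OF sh] \<beta>(2) \<gamma>(2) hz[OF z])
    finally have "?v \<in> Zc \<aa> B d i" using vF by (simp add: Zc_def)
    from H1(6)[OF this] obtain c1 where c1: "c1 \<in> Fr C" "?v - \<zeta> c1 \<in> Bc \<aa> B d i" by blast
    from c1(2) obtain \<delta> where \<delta>: "\<delta> \<in> Fr (B (i + 1))" "?v - \<zeta> c1 - d (i + 1) \<delta> \<in> hat \<aa>" by (rule BcE)
    let ?c = "jn c1 c'"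
    have cF: "?c \<in> Fr (jnB C C')" using c1(1) c'(1) by (simp add: Fr_jnB)
    have zc: "\<zeta> c1 \<in> Fr (B i)" using H1(4)[OF c1(1)] by (simp add: Zc_def)
    have F: "v - (\<zeta> (ev ?c) + h (i - 1) (\<zeta>' (od ?c))) \<in> Fr (B i)"
      by (intro sub_diff[OF sub_Fr] sub_add[OF sub_Fr] v(1)) (simp_all add: zc hi[OF z(1)])
    have "v - (\<zeta> (ev ?c) + h (i - 1) (\<zeta>' (od ?c))) - d (i + 1) \<delta> = (?v - \<zeta> c1 - d (i + 1) \<delta>) + x *s \<gamma>"
      by (simp add: algebra_simps)
    also have "\<dots> \<in> hat (adj \<aa> x)" by (intro sub_add[OF sb] hx ab \<delta>(2))
    finally have "v - (\<zeta> (ev ?c) + h (i - 1) (\<zeta>' (od ?c))) \<in> Bc (adj \<aa> x) B d i"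
      by (rule BcI[OF F \<delta>(1)])
    then show "\<exists>c\<in>Fr (jnB C C'). v - (\<zeta> (ev c) + h (i - 1) (\<zeta>' (od c))) \<in> Bc (adj \<aa> x) B d i"
      using cF by blast
  qed
qed

text \<open>A complex modulo \<open>\<aa> + xS\<close> lifts to one modulo \<open>\<aa>\<close> with the same homology: if \<open>d\<close> denotes
  arbitrary lifts of the differentials, then \<open>d d = - x h\<close> modulo \<open>\<aa>\<close> for some \<open>h\<close>, and \<open>d h = h d\<close>
  because \<open>x\<close> is regular.\<close>

lemma cpx_lift:
  assumes a: "idl \<aa>" and c: "cpx (adj \<aa> x) B d" and x: "reg \<aa> x"
  obtains h where "\<And>i. lin (h i)" "\<And>i v. v \<in> Fr (B i) \<Longrightarrow> h i v \<in> Fr (B (i - 2))"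
    "\<And>i v. v \<in> Fr (B i) \<Longrightarrow> d (i - 1) (d i v) + x *s h i v \<in> hat \<aa>"
proof -
  note C = cpxD[OF c]
  have "\<exists>s. lin s \<and> (\<forall>v\<in>Fr (B i). s v \<in> Fr (B (i - 2)) \<and> x *s s v - (- d (i - 1) (d i v)) \<in> hat \<aa>)" for i
  proof (rule free_lift[OF C(1) _ _ sub_Fr sub_hat[OF a]])
    show "lin (\<lambda>v. - d (i - 1) (d i v))" using C(2) by (simp add: lin_def sc_distrib)
    show "lin (\<lambda>v. x *s v :: nat \<Rightarrow> 'a)" by (intro lin_intros)
    fix v :: "nat \<Rightarrow> 'a" assume v: "v \<in> Fr (B i)"
    have F: "d (i - 1) (d i v) \<in> Fr (B (i - 2))" using C(3)[OF C(3)[OF v]] by (simp add: diff_diff_eq)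
    from hat_adjE[OF a F C(4)[OF v]] obtain b where b: "b \<in> Fr (B (i - 2))" "d (i - 1) (d i v) - x *s b \<in> hat \<aa>" .
    show "\<exists>u\<in>Fr (B (i - 2)). x *s u - - d (i - 1) (d i v) \<in> hat \<aa>"
      by (rule bexI[of _ "- b"]) (use b sub_minus[OF sub_Fr b(1)] in \<open>simp_all add: sc_distrib\<close>)
  qed
  then obtain h where h: "\<And>i. lin (h i)" "\<And>i v. v \<in> Fr (B i) \<Longrightarrow> h i v \<in> Fr (B (i - 2))"
    "\<And>i v. v \<in> Fr (B i) \<Longrightarrow> x *s h i v - (- d (i - 1) (d i v)) \<in> hat \<aa>" by metis
  show ?thesis by (rule that[OF h(1,2)]) (use h(3) in \<open>simp_all add: add.commute\<close>)
qed

text \<open>The lift is a twisted cone of multiplication by \<open>x\<close>, with differential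
  \<open>(u, w) -> (d u + x w, h u - d w)\<close>. Since \<open>x\<close> is regular, the first
  component of a cycle determines the second modulo \<open>\<aa>\<close>, so projection to
  \<open>u\<close> identifies the homology with that of the original complex.\<close>

lemma hb_lift:
  fixes C :: "int \<Rightarrow> nat set"
  assumes a: "idl \<aa>" and c: "cpx (adj \<aa> x) B d" and x: "reg \<aa> x"
    and hb: "\<And>i. hb (adj \<aa> x) J B d (C i) (\<zeta> i) i"
  shows "\<exists>d' \<zeta>'. cpx \<aa> (\<lambda>i. jnB (B i) (B (i - 1))) d' \<and>
    (\<forall>i. hb \<aa> J (\<lambda>i. jnB (B i) (B (i - 1))) d' (C i) (\<zeta>' i) i)"
proof -
  obtain h where h: "\<And>i. lin (h i)" "\<And>i v. v \<in> Fr (B i) \<Longrightarrow> h i v \<in> Fr (B (i - 2))"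
    "\<And>i v. v \<in> Fr (B i) \<Longrightarrow> d (i - 1) (d i v) + x *s h i v \<in> hat \<aa>" by (rule cpx_lift[OF a c x]) blast
  note C = cpxD[OF c]
  note b = idl_adj[OF a, of x]
  note sh = sub_hat[OF a] and sb = sub_hat[OF b]
  have dl: "\<And>i u v. d i (u + v) = d i u + d i v" "\<And>i u v. d i (u - v) = d i u - d i v"
    "\<And>i u r. d i (r *s u) = r *s d i u" "\<And>i u. d i (- u) = - d i u"
    using C(2) lin_add lin_diff lin_sc lin_minus by blast+
  have hl: "\<And>i u v. h i (u + v) = h i u + h i v" "\<And>i u v. h i (u - v) = h i u - h i v"
    "\<And>i u r. h i (r *s u) = r *s h i u" using h(1) lin_add lin_diff lin_sc by blast+
  define B' where "B' = (\<lambda>i. jnB (B i) (B (i - 1)))"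
  define d' where "d' = (\<lambda>i v. jn (d i (ev v) + x *s od v) (h i (ev v) - d (i - 1) (od v)))"
  have FB: "v \<in> Fr (B' i) \<longleftrightarrow> ev v \<in> Fr (B i) \<and> od v \<in> Fr (B (i - 1))" for v i by (simp add: B'_def Fr_jnB)
  have dh: "d (i - 2) (h i v) - h (i - 1) (d i v) \<in> hat \<aa>" if v: "v \<in> Fr (B i)" for i v
  proof -
    have F: "d (i - 1) (d i v) + x *s h i v \<in> Fr (B (i - 2))"
      using sub_add[OF sub_Fr _ sub_sc[OF sub_Fr h(2)[OF v]]] C(3)[OF C(3)[OF v]] by (simp add: diff_diff_eq)
    have e: "d (i - 2) (d (i - 1) (d i v)) + x *s h (i - 1) (d i v) \<in> hat \<aa>"
      using h(3)[OF C(3)[OF v]] by (simp add: diff_diff_eq)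
    have "x *s (d (i - 2) (h i v) - h (i - 1) (d i v)) =
      d (i - 2) (d (i - 1) (d i v) + x *s h i v) - (d (i - 2) (d (i - 1) (d i v)) + x *s h (i - 1) (d i v))"
      by (simp add: dl sc_distrib)
    also have "\<dots> \<in> hat \<aa>" by (intro sub_diff[OF sh] e lin_hat[OF a C(1,2) F h(3)[OF v]])
    finally show ?thesis by (rule reg_hat[OF x])
  qed
  have c': "cpx \<aa> B' d'"
    unfolding cpx_def
  proof (intro conjI allI ballI)
    show "finite (B' i)" for i unfolding B'_def by (rule finite_jnB[OF C(1) C(1)])
    show "lin (d' i)" for i
      unfolding d'_def by (rule lin_jn) (use C(2) h(1) in \<open>simp_all add: lin_def sc_distrib algebra_simps\<close>)
    fix i and v :: "nat \<Rightarrow> 'a" assume "v \<in> Fr (B' i)"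
    then have v: "ev v \<in> Fr (B i)" "od v \<in> Fr (B (i - 1))" by (simp_all add: FB)
    have F: "d (i - 1) (od v) \<in> Fr (B (i - 2))" using C(3)[OF v(2)] by (simp add: diff_diff_eq)
    show "d' i v \<in> Fr (B' (i - 1))"
      using sub_add[OF sub_Fr C(3)[OF v(1)] sub_sc[OF sub_Fr v(2)]] sub_diff[OF sub_Fr h(2)[OF v(1)] F]
      by (simp add: FB d'_def diff_diff_eq)
    have 1: "d (i - 1) (d i (ev v)) + x *s h i (ev v) \<in> hat \<aa>" by (rule h(3)[OF v(1)])
    have 2: "d (i - 2) (h i (ev v)) - h (i - 1) (d i (ev v)) \<in> hat \<aa>" by (rule dh[OF v(1)])
    have 3: "d (i - 2) (d (i - 1) (od v)) + x *s h (i - 1) (od v) \<in> hat \<aa>" using h(3)[OF v(2)] by (simp add: diff_diff_eq)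
    show "d' (i - 1) (d' i v) \<in> hat \<aa>"
      using 1 sub_add[OF sh sub_minus[OF sh 2] 3]
      by (simp add: d'_def dl hl sc_distrib algebra_simps diff_diff_eq)
  qed
  \<comment> \<open>By regularity a cycle whose first component is zero modulo \<open>\<aa>\<close>
    is zero altogether.\<close>
  have key: "w \<in> hat \<aa>" if u: "u \<in> hat \<aa>" "u \<in> Fr (B i)" and w: "d i u + x *s w \<in> hat \<aa>" for i u w
  proof -
    have "x *s w = (d i u + x *s w) - d i u" by simp
    also have "\<dots> \<in> hat \<aa>" by (intro sub_diff[OF sh] w lin_hat[OF a C(1,2) u(2,1)])
    finally show ?thesis by (rule reg_hat[OF x])
  qed
  have "\<exists>\<zeta>'. hb \<aa> J B' d' (C i) \<zeta>' i" for i
  proof -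
    note H = hbD[OF hb[of i]]
    have "\<exists>s. lin s \<and> (\<forall>v\<in>Fr (C i). s v \<in> Fr (B (i - 1)) \<and> x *s s v - (- d i (\<zeta> i v)) \<in> hat \<aa>)"
    proof (rule free_lift[OF H(1) _ _ sub_Fr sub_hat[OF a]])
      show "lin (\<lambda>v. - d i (\<zeta> i v))" using C(2) H(3) by (simp add: lin_def sc_distrib)
      show "lin (\<lambda>v. x *s v :: nat \<Rightarrow> 'a)" by (intro lin_intros)
      fix v :: "nat \<Rightarrow> 'a" assume v: "v \<in> Fr (C i)"
      note z = ZcD[OF H(4)[OF v]]
      from hat_adjE[OF a C(3)[OF z(1)] z(2)] obtain b where b: "b \<in> Fr (B (i - 1))" "d i (\<zeta> i v) - x *s b \<in> hat \<aa>" .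
      show "\<exists>u\<in>Fr (B (i - 1)). x *s u - - d i (\<zeta> i v) \<in> hat \<aa>"
        by (rule bexI[of _ "- b"]) (use b sub_minus[OF sub_Fr b(1)] in \<open>simp_all add: sc_distrib\<close>)
    qed
    then obtain \<beta> where \<beta>: "lin \<beta>" "\<And>v. v \<in> Fr (C i) \<Longrightarrow> \<beta> v \<in> Fr (B (i - 1))"
      "\<And>v. v \<in> Fr (C i) \<Longrightarrow> d i (\<zeta> i v) + x *s \<beta> v \<in> hat \<aa>" by (auto simp: add.commute)
    let ?z = "\<lambda>c. jn (\<zeta> i c) (\<beta> c)"
    have cyc: "h i u - d (i - 1) w \<in> hat \<aa>" if "u \<in> Fr (B i)" "w \<in> Fr (B (i - 1))" "d i u + x *s w \<in> hat \<aa>" for u w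
    proof -
      have F: "d i u + x *s w \<in> Fr (B (i - 1))" by (rule sub_add[OF sub_Fr C(3)[OF that(1)] sub_sc[OF sub_Fr that(2)]])
      have "x *s (h i u - d (i - 1) w) = (d (i - 1) (d i u) + x *s h i u) - d (i - 1) (d i u + x *s w)"
        by (simp add: dl sc_distrib)
      also have "\<dots> \<in> hat \<aa>" by (intro sub_diff[OF sh] h(3)[OF that(1)] lin_hat[OF a C(1,2) F that(3)])
      finally show ?thesis by (rule reg_hat[OF x])
    qed
    \<comment> \<open>If the first component bounds modulo \<open>\<aa> + xS\<close>, it is
      \<open>d w + x b\<close> modulo \<open>\<aa>\<close>, and the pair of \<open>w\<close> and
      \<open>b\<close> bounds \<open>v\<close>: the first components agree by choice of
      \<open>b\<close>, the second ones by \<open>key\<close>.\<close>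
    have bdry: "v \<in> Bc \<aa> B' d' i" if v: "ev v \<in> Fr (B i)" "od v \<in> Fr (B (i - 1))" "d i (ev v) + x *s od v \<in> hat \<aa>"
      and e: "ev v \<in> Bc (adj \<aa> x) B d i" for v
    proof -
      from e obtain w where w: "w \<in> Fr (B (i + 1))" "ev v - d (i + 1) w \<in> hat (adj \<aa> x)" by (rule BcE)
      have F: "ev v - d (i + 1) w \<in> Fr (B i)" by (rule sub_diff[OF sub_Fr v(1) C(5)[OF w(1)]])
      from hat_adjE[OF a F w(2)] obtain b where b: "b \<in> Fr (B i)" "ev v - d (i + 1) w - x *s b \<in> hat \<aa>" .
      let ?w = "jn w b"
      have w': "?w \<in> Fr (B' (i + 1))" using w(1) b(1) by (simp add: FB)
      have v': "v \<in> Fr (B' i)" using v by (simp add: FB)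
      let ?r = "v - d' (i + 1) ?w"
      note C' = cpxD[OF c']
      have r: "?r \<in> Fr (B' i)" by (rule sub_diff[OF sub_Fr v' C'(5)[OF w']])
      have "d' i v \<in> hat \<aa>" using v cyc by (simp add: d'_def)
      from sub_diff[OF sh this C'(6)[OF w']] have "d' i ?r \<in> hat \<aa>" by (simp only: lin_diff[OF C'(2)])
      then have k: "d i (ev ?r) + x *s od ?r \<in> hat \<aa>" by (simp add: d'_def)
      have e: "ev ?r \<in> hat \<aa>" using b(2) by (simp add: d'_def algebra_simps)
      have "ev ?r \<in> Fr (B i)" using r FB by blast
      from key[OF e this k] have "od ?r \<in> hat \<aa>" .
      with e have "?r \<in> hat \<aa>" using hat_evod by blast
      then show ?thesis by (rule BcI[OF v' w'])
    qed
    have "hb \<aa> J B' d' (C i) ?z i"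
    proof (rule hbI)
      show "finite (C i)" by (rule H(1))
      show "lin ?z" by (rule lin_jn[OF H(3) \<beta>(1)])
    next
      fix c :: "nat \<Rightarrow> 'a" assume c: "c \<in> Fr (C i)"
      note z = ZcD[OF H(4)[OF c]]
      show "?z c \<in> Fr (B' i) \<and> d' i (?z c) \<in> hat \<aa>"
        using z \<beta>(2,3)[OF c] cyc by (simp add: FB d'_def)
      show "?z c \<in> Bc \<aa> B' d' i \<longleftrightarrow> c \<in> hat J"
      proof
        assume "?z c \<in> Bc \<aa> B' d' i"
        then obtain w where w: "w \<in> Fr (B' (i + 1))" "?z c - d' (i + 1) w \<in> hat \<aa>" by (rule BcE)
        have w': "ev w \<in> Fr (B (i + 1))" "od w \<in> Fr (B i)" using w(1) by (simp_all add: FB)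
        have "\<zeta> i c - (d (i + 1) (ev w) + x *s od w) \<in> hat \<aa>" using hat_ev[OF w(2)] by (simp add: d'_def)
        from sub_add[OF sb hat_adj_incl[OF this] hat_adj_x[OF a, of x "od w"]]
        have "\<zeta> i c - d (i + 1) (ev w) \<in> hat (adj \<aa> x)" by (simp add: algebra_simps)
        then have "\<zeta> i c \<in> Bc (adj \<aa> x) B d i" by (rule BcI[OF z(1) w'(1)])
        then show "c \<in> hat J" using H(5)[OF c] by blast
      next
        assume "c \<in> hat J"
        then have "\<zeta> i c \<in> Bc (adj \<aa> x) B d i" using H(5)[OF c] by blast
        then show "?z c \<in> Bc \<aa> B' d' i" using z \<beta>(2,3)[OF c] by (intro bdry) simp_all
      qed
    next
      fix v assume v: "v \<in> Fr (B' i)" "d' i v \<in> hat \<aa>"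
      have v': "ev v \<in> Fr (B i)" "od v \<in> Fr (B (i - 1))" using v(1) by (simp_all add: FB)
      have e: "d i (ev v) + x *s od v \<in> hat \<aa>" using hat_ev[OF v(2)] by (simp add: d'_def)
      from sub_diff[OF sb hat_adj_incl[OF this] hat_adj_x[OF a, of x "od v"]]
      have "d i (ev v) \<in> hat (adj \<aa> x)" by simp
      then have "ev v \<in> Zc (adj \<aa> x) B d i" using v'(1) by (simp add: Zc_def)
      from H(6)[OF this] obtain c where c: "c \<in> Fr (C i)" "ev v - \<zeta> i c \<in> Bc (adj \<aa> x) B d i" by blast
      note z = ZcD[OF H(4)[OF c(1)]]
      have "v - ?z c \<in> Bc \<aa> B' d' i"
      proof (rule bdry)
        show "ev (v - ?z c) \<in> Bc (adj \<aa> x) B d i" using c(2) by simp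
        show "ev (v - ?z c) \<in> Fr (B i)" using sub_diff[OF sub_Fr v'(1) z(1)] by simp
        show "od (v - ?z c) \<in> Fr (B (i - 1))" using sub_diff[OF sub_Fr v'(2) \<beta>(2)[OF c(1)]] by simp
        show "d i (ev (v - ?z c)) + x *s od (v - ?z c) \<in> hat \<aa>"
          using sub_diff[OF sh e \<beta>(3)[OF c(1)]] by (simp add: dl sc_distrib algebra_simps)
      qed
      then show "\<exists>c\<in>Fr (C i). v - ?z c \<in> Bc \<aa> B' d' i" using c(1) by blast
    qed
    then show ?thesis by blast
  qed
  then obtain \<zeta>' where "\<And>i. hb \<aa> J B' d' (C i) (\<zeta>' i) i" by metis
  then show ?thesis using c' unfolding B'_def by blast
qed

section \<open>Linkage\<close>

text \<open>\<open>Fr {0}\<close> modulo \<open>hat I\<close> is the standard copy of the cyclic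
  module with annihilator \<open>I\<close>. Splitting off one coordinate allows induction on the
  rank.\<close>

lemma ses_Fr_insert:
  fixes C :: "nat set"
  assumes I: "idl I" and c: "c \<notin> C"
  shows "ses (\<lambda>v. v 0 *s un c) (\<lambda>v i. if i = c then 0 else v i) (Fr {0::nat}) (hat I)
    (Fr (insert c C)) (hat I) (Fr C) (hat (I :: 's::comm_ring_1 set))"
  unfolding ses_def
proof (intro conjI ballI)
  show "lin (\<lambda>v. v 0 *s un c :: nat \<Rightarrow> 's)" by (simp add: lin_def sc_distrib)
  show "lin (\<lambda>(v :: nat \<Rightarrow> 's) i. if i = c then 0 else v i)" by (auto simp: lin_def fun_eq_iff)
  show "u 0 *s un c \<in> Fr (insert c C)" for u :: "nat \<Rightarrow> 's" by (intro sub_sc[OF sub_Fr] un_Fr) simp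
  show "(\<lambda>i. if i = c then 0 else u i) \<in> Fr C" if "u \<in> Fr (insert c C)" for u :: "nat \<Rightarrow> 's"
    using that by (auto simp: Fr_def)
  show "u 0 *s un c \<in> hat I \<longleftrightarrow> u \<in> hat I" if "u \<in> Fr {0}" for u :: "nat \<Rightarrow> 's"
  proof -
    have "u \<in> hat I \<longleftrightarrow> u 0 \<in> I" using that idl_zero[OF I] by (auto simp: Fr_def hat_def) (metis gr0I)
    moreover have "u 0 *s un c \<in> hat I \<longleftrightarrow> u 0 \<in> I"
      using idl_zero[OF I] by (auto simp: hat_def un_def split: if_splits)
    ultimately show ?thesis by blast
  qed
  show "\<exists>u\<in>Fr (insert c C). (\<lambda>i. if i = c then 0 else u i) - u2 \<in> hat I" if "u2 \<in> Fr C" for u2 :: "nat \<Rightarrow> 's"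
    by (rule bexI[of _ u2]) (use that c idl_zero[OF I] in \<open>auto simp: Fr_def hat_def\<close>)
  show "(\<lambda>i. if i = c then 0 else u i) \<in> hat I \<longleftrightarrow> (\<exists>u1\<in>Fr {0::nat}. u - u1 0 *s un c \<in> hat I)" for u :: "nat \<Rightarrow> 's"
  proof
    assume "(\<lambda>i. if i = c then 0 else u i) \<in> hat I"
    then show "\<exists>u1\<in>Fr {0::nat}. u - u1 0 *s un c \<in> hat I"
      by (intro bexI[of _ "u c *s un 0"]) (auto simp: hat_def un_def Fr_def idl_zero[OF I] split: if_splits)
  next
    assume "\<exists>u1\<in>Fr {0::nat}. u - u1 0 *s un c \<in> hat I"
    then obtain u1 :: "nat \<Rightarrow> 's" where u1: "u - u1 0 *s un c \<in> hat I" by blast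
    have "u i \<in> I" if "i \<noteq> c" for i
      using u1 that unfolding hat_def by (auto dest!: spec[of _ i] simp: un_def)
    then show "(\<lambda>i. if i = c then 0 else u i) \<in> hat I" by (auto simp: hat_def idl_zero[OF I])
  qed
qed

lemma md_Fr_hat: "idl I \<Longrightarrow> \<aa> \<subseteq> I \<Longrightarrow> md \<aa> (Fr C) (hat I)"
  unfolding md_def using sub_Fr sub_hat hat_sc by blast

lemma good_power:
  assumes "idl \<aa>" "idl I" "\<aa> \<subseteq> I" "finite C" "good \<aa> h (Fr {0}) (hat I)"
  shows "good \<aa> h (Fr C) (hat I)"
  using assms(4)
proof (induction C)
  case empty
  show ?case
    by (rule good_zero[OF assms(1) sub_Fr sub_hat[OF assms(2)]])
       (simp add: sub_zero[OF sub_hat[OF assms(2)]])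
next
  case (insert c C)
  show ?case
    by (rule good_ses[OF assms(1) ses_Fr_insert[OF assms(2) insert.hyps(2)] assms(5) insert.IH
          md_Fr_hat[OF assms(2,3)]])
qed

text \<open>The cyclic module is the kernel of a projection from its nonempty power to the remaining
  coordinates. As \<open>good_ker\<close> wants the quotient good one step above, the bound
  \<open>Suc h\<close> is assumed and improved to \<open>h\<close>.\<close>

lemma good_root:
  assumes "idl \<aa>" "idl I" "\<aa> \<subseteq> I" "finite C" "c \<in> C" "good \<aa> (Suc h) (Fr {0}) (hat I)"
    "good \<aa> h (Fr C) (hat I)"
  shows "good \<aa> h (Fr {0}) (hat I)"
proof -
  have C: "insert c (C - {c}) = C" using assms(5) by blast
  have s: "ses (\<lambda>v. v 0 *s un c) (\<lambda>v i. if i = c then 0 else v i) (Fr {0::nat}) (hat I)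
      (Fr C) (hat I) (Fr (C - {c})) (hat I)"
  proof -
    have "c \<notin> C - {c}" by blast
    from ses_Fr_insert[OF assms(2) this] show ?thesis by (simp only: C)
  qed
  have "good \<aa> (Suc h) (Fr (C - {c})) (hat I)"
    by (rule good_power[OF assms(1-3) _ assms(6)]) (simp add: assms(4))
  from good_ker[OF assms(1) s assms(7) this md_Fr_hat[OF assms(2,3)]] show ?thesis .
qed

locale linkage =
  fixes \<aa> I J :: "'s::comm_ring_1 set" and B :: "int \<Rightarrow> nat set"
    and d :: "int \<Rightarrow> (nat \<Rightarrow> 's) \<Rightarrow> nat \<Rightarrow> 's" and N :: int and q :: nat
    and C :: "int \<Rightarrow> nat set" and \<zeta> :: "int \<Rightarrow> (nat \<Rightarrow> 's) \<Rightarrow> nat \<Rightarrow> 's" and k :: nat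
  assumes a: "idl \<aa>" and I: "idl I" and aI: "\<aa> \<subseteq> I" and proper: "1 \<notin> I"
    and cpx: "cpx \<aa> B d" and hb: "\<And>i. hb \<aa> I B d (C i) (\<zeta> i) i"
    and range: "\<And>i. i < 0 \<or> N < i \<Longrightarrow> B i = {}" and top: "B N = {q}"
    and top_cycles: "\<And>v. v \<in> Fr {q} \<Longrightarrow> d N v \<in> hat \<aa> \<longleftrightarrow> v q \<in> J"
    and J_eq: "J = {r. \<forall>s\<in>I. r * s \<in> \<aa>}" and I_eq: "I = {r. \<forall>s\<in>J. r * s \<in> \<aa>}"
    and good: "good \<aa> k (Fr {0}) (hat I)"
begin

lemmas c = cpxD[OF cpx]
lemmas H = hbD[OF hb]
lemmas sh = sub_hat[OF a]
lemmas sZ = sub_Zc[OF a cpx]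
lemmas sB = sub_Bc[OF a cpx]
lemmas BZ = Bc_Zc[OF a cpx]

lemma zh: "(0 :: nat \<Rightarrow> 's) \<in> hat \<aa>"
  by (rule sub_zero[OF sub_hat[OF a]])

lemma md_Zc_Bc: "md \<aa> (Zc \<aa> B d i) (Bc \<aa> B d i)"
  unfolding md_def using sZ[of i] sB[of i] hat_Bc[OF a cpx] hat_sc[OF a] sub_sc[OF sub_Fr] ZcD(1) by blast

text \<open>Bounds travel up the complex through the sequence from cycles to chains to boundaries
  one degree lower, and the sequence from boundaries to cycles to homology. They start in negative
  degrees, where everything is zero. Taking the kernel of the map onto homology is what reduces
  \<open>Suc h\<close> to \<open>h\<close>.\<close>

lemma good_cycles:
  assumes "good \<aa> (Suc h) (Fr {0}) (hat I)"
  shows "good \<aa> h (Zc \<aa> B d i) (hat \<aa>) \<and> good \<aa> h (Bc \<aa> B d i) (hat \<aa>)"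
proof -
  have gH: "good \<aa> (Suc h) (Zc \<aa> B d i) (Bc \<aa> B d i)" for i
    by (rule good_miso[OF a H(2) good_power[OF a I aI H(1) assms] md_Zc_Bc])
  have step: "good \<aa> h (Zc \<aa> B d i) (hat \<aa>) \<and> good \<aa> h (Bc \<aa> B d i) (hat \<aa>)"
    if g: "good \<aa> h (Bc \<aa> B d (i - 1)) (hat \<aa>)" for i
  proof
    have "ses (\<lambda>v. v) (d i) (Zc \<aa> B d i) (hat \<aa>) (Fr (B i)) (hat \<aa>) (Bc \<aa> B d (i - 1)) (hat \<aa>)"
      unfolding ses_def
    proof (intro conjI ballI)
      show "lin (\<lambda>v. v :: nat \<Rightarrow> 's)" "lin (d i)" by (rule lin_intros, rule c)
      show "d i u \<in> Bc \<aa> B d (i - 1)" if "u \<in> Fr (B i)" for u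
        using Bc_d[OF a cpx, of u "i - 1"] that by simp
      show "d i u \<in> hat \<aa> \<longleftrightarrow> (\<exists>u1\<in>Zc \<aa> B d i. u - u1 \<in> hat \<aa>)" if u: "u \<in> Fr (B i)" for u
      proof
        assume "d i u \<in> hat \<aa>"
        then show "\<exists>u1\<in>Zc \<aa> B d i. u - u1 \<in> hat \<aa>" using u zh by (intro bexI[of _ u]) (simp_all add: Zc_def)
      next
        assume "\<exists>u1\<in>Zc \<aa> B d i. u - u1 \<in> hat \<aa>"
        then obtain u1 where u1: "u1 \<in> Fr (B i)" "d i u1 \<in> hat \<aa>" "u - u1 \<in> hat \<aa>" by (auto simp: Zc_def)
        have "d i u - d i u1 \<in> hat \<aa>"
          using lin_hat[OF a c(1,2) sub_diff[OF sub_Fr u u1(1)] u1(3), of i] by (simp only: lin_diff[OF c(2)])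
        then show "d i u \<in> hat \<aa>" using sub_diff_iff[OF sh] u1(2) by blast
      qed
      show "\<exists>u\<in>Fr (B i). d i u - u2 \<in> hat \<aa>" if "u2 \<in> Bc \<aa> B d (i - 1)" for u2
      proof -
        from that obtain w where "w \<in> Fr (B i)" "u2 - d i w \<in> hat \<aa>" by (auto simp: Bc_def)
        then show ?thesis using sub_diff_sym[OF sh] by blast
      qed
    qed (auto simp: Zc_def)
    from good_ker[OF a this good_Fr[OF a c(1)] good_Suc[OF g] md_hat[OF a sZ]]
    show gZ: "good \<aa> h (Zc \<aa> B d i) (hat \<aa>)" .
    have "ses (\<lambda>v. v) (\<lambda>v. v) (Bc \<aa> B d i) (hat \<aa>) (Zc \<aa> B d i) (hat \<aa>) (Zc \<aa> B d i) (Bc \<aa> B d i)"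
      unfolding ses_def
    proof (intro conjI ballI)
      show "u \<in> Bc \<aa> B d i \<longleftrightarrow> (\<exists>u1\<in>Bc \<aa> B d i. u - u1 \<in> hat \<aa>)" if u: "u \<in> Zc \<aa> B d i" for u
      proof
        assume "u \<in> Bc \<aa> B d i"
        then show "\<exists>u1\<in>Bc \<aa> B d i. u - u1 \<in> hat \<aa>" using zh by (intro bexI[of _ u]) simp_all
      next
        assume "\<exists>u1\<in>Bc \<aa> B d i. u - u1 \<in> hat \<aa>"
        then obtain u1 where u1: "u1 \<in> Bc \<aa> B d i" "u - u1 \<in> hat \<aa>" by blast
        have "u1 \<in> Fr (B i)" using BZ u1(1) ZcD(1) by blast
        from hat_Bc[OF a cpx sub_diff[OF sub_Fr ZcD(1)[OF u] this] u1(2)]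
        show "u \<in> Bc \<aa> B d i" using sub_diff_iff[OF sB] u1(1) by blast
      qed
      show "\<exists>u\<in>Zc \<aa> B d i. u - u2 \<in> Bc \<aa> B d i" if "u2 \<in> Zc \<aa> B d i" for u2
        using that sub_zero[OF sB] by (intro bexI[of _ u2]) simp_all
    qed (use BZ lin_intros(1) in auto)
    from good_ker[OF a this gZ gH md_hat[OF a sB]] show "good \<aa> h (Bc \<aa> B d i) (hat \<aa>)" .
  qed
  have neg: "good \<aa> h (Bc \<aa> B d (i - 1)) (hat \<aa>)" if "i \<le> 0" for i
  proof (rule good_zero[OF a sB sh])
    have "B (i - 1) = {}" using range that by simp
    then show "Bc \<aa> B d (i - 1) \<subseteq> hat \<aa>" using zh by (auto simp: Bc_def)
  qed
  have "good \<aa> h (Bc \<aa> B d (int n - 1)) (hat \<aa>)" for n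
  proof (induction n)
    case (Suc n)
    from step[OF this] show ?case by simp
  qed (simp add: neg[of 0, simplified])
  then have "good \<aa> h (Bc \<aa> B d (i - 1)) (hat \<aa>)"
    using neg[of i] by (cases "i \<le> 0") (metis nat_0_le linorder_not_le order_less_imp_le)+
  from step[OF this] show ?thesis .
qed

text \<open>A basis element in these degrees would have zero class, and that would put
  \<open>1\<close> into \<open>I\<close>.\<close>

lemma C_range: assumes "i < 0 \<or> N < i" shows "C i = {}"
proof (rule ccontr)
  assume "C i \<noteq> {}"
  then obtain j where "j \<in> C i" by blast
  then have j: "(un j :: nat \<Rightarrow> 's) \<in> Fr (C i)" by simp
  have "\<zeta> i (un j) = 0" using ZcD(1)[OF H(4)[OF j]] range[OF assms] by simp
  then have "un j \<in> hat I" using H(5)[OF j] sub_zero[OF sB] by simp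
  then have "un j j \<in> I" unfolding hat_def by blast
  then show False using proper by (simp add: un_def)
qed

lemma top_Bc: "Bc \<aa> B d N \<subseteq> hat \<aa>"
proof
  fix v assume "v \<in> Bc \<aa> B d N"
  then obtain w where w: "w \<in> Fr (B (N + 1))" "v - d (N + 1) w \<in> hat \<aa>" by (rule BcE)
  have "B (N + 1) = {}" using range by simp
  then have "w = 0" using w(1) by simp
  then show "v \<in> hat \<aa>" using w(2) by (simp add: lin_zero[OF c(2)])
qed

lemma J: "idl J" "\<aa> \<subseteq> J"
proof -
  have "u + v \<in> J" if "u \<in> J" "v \<in> J" for u v
    using that idl_add[OF a] unfolding J_eq by (simp add: distrib_right)
  moreover have "r * v \<in> J" if "v \<in> J" for r v
    using that idl_mult[OF a] unfolding J_eq by (simp add: mult.assoc)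
  ultimately show "idl J" using idl_zero[OF a] by (auto simp: idl_def J_eq)
  show "\<aa> \<subseteq> J" using idl_mult2[OF a] by (auto simp: J_eq)
qed

lemma zeta_top: "v \<in> Fr (C N) \<Longrightarrow> \<zeta> N v \<in> Fr {q} \<and> \<zeta> N v q \<in> J"
  using ZcD[OF H(4)[of v N]] top top_cycles by simp

lemma Zc_top: assumes "r \<in> J" shows "r *s un q \<in> Zc \<aa> B d N"
proof -
  have F: "r *s un q \<in> Fr {q}" by (intro sub_sc[OF sub_Fr] un_Fr) simp
  have "(r *s un q) q = r" by (simp add: un_def)
  then show ?thesis using top_cycles[OF F] F top assms by (simp add: Zc_def)
qed

text \<open>Vanishing top homology would put \<open>J\<close> into \<open>\<aa>\<close>, and then
  \<open>I\<close>, the annihilator of \<open>J\<close> modulo \<open>\<aa>\<close>, would be the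
  whole ring.\<close>

lemma C_top: "C N \<noteq> {}"
proof
  assume e: "C N = {}"
  have "r \<in> \<aa>" if "r \<in> J" for r
  proof -
    from H(6)[OF Zc_top[OF that]] have "r *s un q \<in> Bc \<aa> B d N" using e by (simp add: lin_zero[OF H(3)])
    then have "r *s un q \<in> hat \<aa>" using top_Bc by blast
    then show ?thesis by (auto simp: hat_def un_def dest: spec[of _ q])
  qed
  then have "1 \<in> I" by (subst I_eq) simp
  then show False using proper by blast
qed

text \<open>There are no boundaries in the top degree, so cycles and homology agree there. Hence
  \<open>good_cycles\<close> and \<open>good_root\<close> lower the bound by one, as often as
  necessary.\<close>

lemma good_0: "good \<aa> 0 (Fr {0}) (hat I)"
proof -
  have "good \<aa> h (Fr {0}) (hat I)" if g: "good \<aa> (Suc h) (Fr {0}) (hat I)" for h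
  proof -
    have "miso (\<lambda>v. v) (Zc \<aa> B d N) (hat \<aa>) (Zc \<aa> B d N) (Bc \<aa> B d N)"
      unfolding miso_def using top_Bc hat_Bc[OF a cpx ZcD(1)] sub_zero[OF sB]
      by (auto simp: lin_intros intro!: bexI)
    then have "good \<aa> h (Zc \<aa> B d N) (Bc \<aa> B d N)"
      using good_miso[OF a _ _ md_Zc_Bc] good_cycles[OF g] by blast
    from good_miso_rev[OF a H(2) this md_Fr_hat[OF I aI]] have "good \<aa> h (Fr (C N)) (hat I)" .
    with C_top show ?thesis using good_root[OF a I aI H(1) _ g] by blast
  qed
  then show ?thesis using good by (induction k) auto
qed

lemma ext_Zc: "ext \<aa> (Zc \<aa> B d i)"
proof -
  have "good \<aa> 0 (Bc \<aa> B d (i - 1)) (hat \<aa>)" using good_cycles[OF good_Suc[OF good_0]] by blast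
  moreover have "cov (d i) (B i) (Bc \<aa> B d (i - 1)) (hat \<aa>)"
    unfolding cov_def using c(1,2) Bc_d[OF a cpx, of _ "i - 1"] by (auto simp: Bc_def)
  ultimately have "ext \<aa> (kr (d i) (B i) (hat \<aa>))" by (rule good_ext[OF a])
  then show ?thesis by (simp add: kr_def Zc_def)
qed

text \<open>A coordinate of the homology class is defined only modulo \<open>I\<close>. Multiplied
  by an element \<open>y\<close> that kills \<open>I\<close> modulo \<open>\<aa>\<close>, it becomes
  a functional on the cycles, and \<open>ext_Zc\<close> extends it to the whole term of the
  complex.\<close>

lemma coord_functional:
  assumes y: "\<And>s. s \<in> I \<Longrightarrow> s * y \<in> \<aa>"
  shows "\<exists>\<psi>. lin1 \<psi> \<and> (\<forall>v\<in>Zc \<aa> B d i. \<forall>w\<in>Fr (C i). v - \<zeta> i w \<in> Bc \<aa> B d i \<longrightarrow> \<psi> v - w m * y \<in> \<aa>)"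
proof -
  obtain \<tau> where \<tau>: "\<And>v. v \<in> Zc \<aa> B d i \<Longrightarrow> \<tau> v \<in> Fr (C i)" "\<And>v. v \<in> Zc \<aa> B d i \<Longrightarrow> v - \<zeta> i (\<tau> v) \<in> Bc \<aa> B d i"
    using H(6)[of _ i] by metis
  note zl = lin_simps[OF H(3)[of i]]
  have uniq: "\<tau> v m * y - w m * y \<in> \<aa>" if v: "v \<in> Zc \<aa> B d i" and w: "w \<in> Fr (C i)" "v - \<zeta> i w \<in> Bc \<aa> B d i" for v w
  proof -
    have "\<zeta> i (\<tau> v - w) \<in> Bc \<aa> B d i"
      using sub_diff[OF sB w(2) \<tau>(2)[OF v]] by (simp add: zl)
    then have "\<tau> v - w \<in> hat I" using H(5)[OF sub_diff[OF sub_Fr \<tau>(1)[OF v] w(1)]] by blast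
    then have "\<tau> v m - w m \<in> I" by (simp add: hat_def)
    from y[OF this] show ?thesis by (simp add: algebra_simps)
  qed
  have "mlf \<aa> (Zc \<aa> B d i) (\<lambda>v. \<tau> v m * y)"
    unfolding mlf_def
  proof (intro conjI ballI allI impI)
    fix u v assume uv: "u \<in> Zc \<aa> B d i" "v \<in> Zc \<aa> B d i"
    have "(u + v) - \<zeta> i (\<tau> u + \<tau> v) \<in> Bc \<aa> B d i"
      using sub_add[OF sB \<tau>(2)[OF uv(1)] \<tau>(2)[OF uv(2)]] by (simp add: zl algebra_simps)
    from uniq[OF sub_add[OF sZ uv] sub_add[OF sub_Fr \<tau>(1)[OF uv(1)] \<tau>(1)[OF uv(2)]] this]
    show "\<tau> (u + v) m * y - (\<tau> u m * y + \<tau> v m * y) \<in> \<aa>" by (simp add: algebra_simps)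
  next
    fix r u assume u: "u \<in> Zc \<aa> B d i"
    have "r *s u - \<zeta> i (r *s \<tau> u) \<in> Bc \<aa> B d i"
      using sub_sc[OF sB \<tau>(2)[OF u], of r] by (simp add: zl sc_distrib)
    from uniq[OF sub_sc[OF sZ u] sub_sc[OF sub_Fr \<tau>(1)[OF u]] this]
    show "\<tau> (r *s u) m * y - r * (\<tau> u m * y) \<in> \<aa>" by (simp add: algebra_simps)
  next
    fix u assume u: "u \<in> Zc \<aa> B d i" "u \<in> hat \<aa>"
    have "u - \<zeta> i 0 \<in> Bc \<aa> B d i" using hat_Bc[OF a cpx ZcD(1)[OF u(1)] u(2)] by (simp add: zl)
    from uniq[OF u(1) sub_zero[OF sub_Fr] this] show "\<tau> u m * y \<in> \<aa>" by simp
  qed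
  then obtain \<psi> where \<psi>: "lin1 \<psi>" "\<And>v. v \<in> Zc \<aa> B d i \<Longrightarrow> \<tau> v m * y - \<psi> v \<in> \<aa>"
    using ext_Zc unfolding ext_def by blast
  have "\<psi> v - w m * y \<in> \<aa>" if "v \<in> Zc \<aa> B d i" "w \<in> Fr (C i)" "v - \<zeta> i w \<in> Bc \<aa> B d i" for v w
    using idl_diff[OF a uniq[OF that] \<psi>(2)[OF that(1)]] by simp
  then show ?thesis using \<psi>(1) by blast
qed

text \<open>\<open>J/\<aa>\<close> is the top homology, so it is free over \<open>S/I\<close>; its rank is \<open>1\<close> because functionals on it
  extend to multiplications on \<open>S/\<aa>\<close>.\<close>

lemma J_principal:
  obtains y where "y \<in> J" "\<And>r. r \<in> J \<Longrightarrow> \<exists>t. r - t * y \<in> \<aa>" "\<And>r. r * y \<in> \<aa> \<longleftrightarrow> r \<in> I"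
proof -
  obtain e where e: "e \<in> C N" using C_top by blast
  define y where "y = \<zeta> N (un e) q"
  have eF: "un e \<in> Fr (C N)" using e by simp
  have yJ: "y \<in> J" using zeta_top[OF eF] by (simp add: y_def)
  have at_q: "\<zeta> N w \<in> hat \<aa> \<longleftrightarrow> \<zeta> N w q \<in> \<aa>" if "w \<in> Fr (C N)" for w
  proof -
    have "\<zeta> N w i \<in> \<aa>" if "i \<noteq> q" for i
      using zeta_top[OF \<open>w \<in> _\<close>] that idl_zero[OF a] by (simp add: Fr_def)
    then have "\<forall>i. i \<noteq> q \<longrightarrow> \<zeta> N w i \<in> \<aa>" by blast
    then show ?thesis unfolding hat_def mem_Collect_eq by metis
  qed
  have top_hat: "\<zeta> N w q \<in> \<aa> \<longleftrightarrow> w \<in> hat I" if w: "w \<in> Fr (C N)" for w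
    using at_q[OF w] H(5)[OF w] top_Bc hat_Bc[OF a cpx ZcD(1)[OF H(4)[OF w]]] by blast
  have zq: "\<zeta> N (r *s w) q = r * \<zeta> N w q" for r w by (simp add: lin_sc[OF H(3)])
  have un_hat: "r *s un j \<in> hat I \<longleftrightarrow> r \<in> I" for r and j :: nat
    using idl_zero[OF I] by (auto simp: hat_def un_def split: if_splits)
  have y_ann: "r * y \<in> \<aa> \<longleftrightarrow> r \<in> I" for r
    using top_hat[OF sub_sc[OF sub_Fr eF], of r] un_hat by (simp add: zq y_def)
  have "C N = {e}"
  proof (rule ccontr)
    assume "C N \<noteq> {e}"
    then obtain e' where e': "e' \<in> C N" "e' \<noteq> e" using e by blast
    \<comment> \<open>A functional that is \<open>y\<close> on the generator \<open>e\<close> and 0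
      on \<open>e'\<close>. As the top term has rank one, its extension is multiplication by the
      value at \<open>un q\<close>.\<close>
    from coord_functional[of y N e] y_ann obtain \<psi> where \<psi>: "lin1 \<psi>"
      "\<And>v w. v \<in> Zc \<aa> B d N \<Longrightarrow> w \<in> Fr (C N) \<Longrightarrow> v - \<zeta> N w \<in> Bc \<aa> B d N \<Longrightarrow> \<psi> v - w e * y \<in> \<aa>"
      by blast
    have \<psi>': "\<psi> (\<zeta> N w) - w e * y \<in> \<aa>" if "w \<in> Fr (C N)" for w
      by (rule \<psi>(2)[OF H(4)[OF that] that]) (simp add: sub_zero[OF sB])
    have m: "\<psi> v = v q * \<psi> (un q)" if "v \<in> Fr {q}" for v
    proof -
      have "v = v q *s un q" using that by (auto simp: fun_eq_iff Fr_def un_def)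
      then show ?thesis using lin1_simps(2)[OF \<psi>(1)] by metis
    qed
    let ?r = "\<psi> (un q)"
    have e'F: "un e' \<in> Fr (C N)" using e' by simp
    have 1: "?r * y - y \<in> \<aa>"
      using \<psi>'[OF eF] m[of "\<zeta> N (un e)"] zeta_top[OF eF] by (simp add: un_def y_def mult.commute)
    have "?r * \<zeta> N (un e') q \<in> \<aa>"
      using \<psi>'[OF e'F] m[of "\<zeta> N (un e')"] zeta_top[OF e'F] e'(2) by (simp add: un_def mult.commute)
    \<comment> \<open>\<open>?r\<close> annihilates a free generator over the quotient by
      \<open>I\<close>, so it lies in \<open>I\<close> and kills \<open>y\<close>; but
      \<open>?r * y\<close> is also \<open>y\<close> modulo \<open>\<aa>\<close>.\<close>
    then have "?r \<in> I" using top_hat[OF sub_sc[OF sub_Fr e'F], of ?r] un_hat by (simp add: zq)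
    then have "?r * y \<in> \<aa>" using y_ann by blast
    then have "1 * y \<in> \<aa>" using idl_diff_iff[OF a 1] by simp
    then have "1 \<in> I" using y_ann[of 1] by blast
    then show False using proper by blast
  qed
  have "\<exists>t. r - t * y \<in> \<aa>" if r: "r \<in> J" for r
  proof -
    from H(6)[OF Zc_top[OF r]] obtain w where w: "w \<in> Fr (C N)" "r *s un q - \<zeta> N w \<in> Bc \<aa> B d N" by blast
    have "w = w e *s un e" using w(1) \<open>C N = {e}\<close> by (auto simp: fun_eq_iff Fr_def un_def)
    then have "\<zeta> N w q = w e * y" using zq[of "w e" "un e"] by (simp add: y_def)
    moreover have "r *s un q - \<zeta> N w \<in> hat \<aa>" using w(2) top_Bc by blast
    then have "(r *s un q - \<zeta> N w) q \<in> \<aa>" by (simp add: hat_def)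
    ultimately show ?thesis by (auto simp: un_def)
  qed
  then show ?thesis using that[OF yJ _ y_ann] by blast
qed


text \<open>The coordinate functionals assembled into one map. It is defined on the full term in
  degree \<open>i\<close>, which is what allows it to be a component of a map of complexes.\<close>

lemma omega:
  assumes y: "\<And>s. s \<in> I \<Longrightarrow> s * y \<in> \<aa>"
  obtains \<omega> where "lin \<omega>" "\<And>v. \<omega> v \<in> Fr (C i)"
    "\<And>v w. v \<in> Zc \<aa> B d i \<Longrightarrow> w \<in> Fr (C i) \<Longrightarrow> v - \<zeta> i w \<in> Bc \<aa> B d i \<Longrightarrow> \<omega> v - y *s w \<in> hat \<aa>"
proof -
  from coord_functional[OF y] obtain \<psi> where \<psi>: "\<And>m. lin1 (\<psi> m)"
    "\<And>m v w. v \<in> Zc \<aa> B d i \<Longrightarrow> w \<in> Fr (C i) \<Longrightarrow> v - \<zeta> i w \<in> Bc \<aa> B d i \<Longrightarrow> \<psi> m v - w m * y \<in> \<aa>"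
    by metis
  define \<omega> where "\<omega> = (\<lambda>v m. if m \<in> C i then \<psi> m v else 0)"
  show ?thesis
  proof (rule that[of \<omega>])
    show "lin \<omega>" unfolding \<omega>_def by (rule lin_coord) (use \<psi>(1) in \<open>auto simp: lin1_def\<close>)
    show "\<omega> v \<in> Fr (C i)" for v by (simp add: \<omega>_def Fr_def)
    show "\<omega> v - y *s w \<in> hat \<aa>" if "v \<in> Zc \<aa> B d i" "w \<in> Fr (C i)" "v - \<zeta> i w \<in> Bc \<aa> B d i" for v w
      using \<psi>(2)[OF that] that(2) idl_zero[OF a] by (auto simp: \<omega>_def hat_def Fr_def mult.commute)
  qed
qed

text \<open>The cone of a map from the truncation of \<open>B\<close> below \<open>N\<close> to the sum of the \<open>(S/\<aa>)\<^bsup>C i\<^esup>[i]\<close>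
  that induces multiplication by the generator \<open>y\<close> of \<open>J\<close> on homology; the cokernel of
  \<open>y : S/I \<rightarrow> S/\<aa>\<close> is \<open>S/J\<close>.\<close>

lemma linked_complex:
  assumes N0: "0 \<le> N"
  shows "\<exists>B' d' C' \<zeta>'. cpx \<aa> B' d' \<and> (\<forall>j. hb \<aa> J B' d' (C' j) (\<zeta>' j) j) \<and>
    (\<forall>j. j < 0 \<or> N < j \<longrightarrow> B' j = ({} :: nat set)) \<and> C' N \<noteq> ({} :: nat set) \<and> (\<forall>j. N < j \<longrightarrow> C' j = {})"
proof -
  obtain y where y: "y \<in> J" "\<And>r. r \<in> J \<Longrightarrow> \<exists>t. r - t * y \<in> \<aa>" "\<And>r. r * y \<in> \<aa> \<longleftrightarrow> r \<in> I"
    by (rule J_principal) blast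
  have "\<forall>i. \<exists>\<omega>. lin \<omega> \<and> (\<forall>v. \<omega> v \<in> Fr (C i)) \<and>
    (\<forall>v w. v \<in> Zc \<aa> B d i \<longrightarrow> w \<in> Fr (C i) \<longrightarrow> v - \<zeta> i w \<in> Bc \<aa> B d i \<longrightarrow> \<omega> v - y *s w \<in> hat \<aa>)"
  proof
    fix i
    obtain \<omega> where "lin \<omega>" "\<And>v. \<omega> v \<in> Fr (C i)"
      "\<And>v w. v \<in> Zc \<aa> B d i \<Longrightarrow> w \<in> Fr (C i) \<Longrightarrow> v - \<zeta> i w \<in> Bc \<aa> B d i \<Longrightarrow> \<omega> v - y *s w \<in> hat \<aa>"
      by (rule omega[of y i]) (use y(3) in blast)+
    then show "\<exists>\<omega>. lin \<omega> \<and> (\<forall>v. \<omega> v \<in> Fr (C i)) \<and>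
      (\<forall>v w. v \<in> Zc \<aa> B d i \<longrightarrow> w \<in> Fr (C i) \<longrightarrow> v - \<zeta> i w \<in> Bc \<aa> B d i \<longrightarrow> \<omega> v - y *s w \<in> hat \<aa>)" by blast
  qed
  then obtain \<omega> where \<omega>: "\<And>i. lin (\<omega> i)" "\<And>i v. \<omega> i v \<in> Fr (C i)"
    "\<And>i v w. v \<in> Zc \<aa> B d i \<Longrightarrow> w \<in> Fr (C i) \<Longrightarrow> v - \<zeta> i w \<in> Bc \<aa> B d i \<Longrightarrow> \<omega> i v - y *s w \<in> hat \<aa>"
    by metis
  \<comment> \<open>Degree \<open>N\<close> is dropped on both sides. There the image of the old top
    differential, isomorphic to the ring modulo \<open>J\<close>, will appear as homology.\<close>
  define B0 where "B0 i = (if i < N then B i else {})" for i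
  define C0 where "C0 i = (if i < N then C i else {})" for i
  define B' where "B' j = jnB (B0 (j - 1)) (C0 j)" for j
  define d' where "d' j v = jn (d (j - 1) (ev v)) (\<omega> (j - 1) (ev v))" for j v
  define C' where "C' j = (if j = N then {q} else C0 j)" for j
  \<comment> \<open>In degree \<open>N\<close> the cycles of the cone are the vectors
    \<open>d N v\<close> modulo \<open>\<aa>\<close>, and \<open>v\<close> is determined up to
    \<open>J\<close>. In lower degrees the homology is the cokernel of \<open>y\<close>, one copy
    for each index in \<open>C j\<close>.\<close>
  define \<zeta>' where "\<zeta>' j v = (if j = N then jn (d N v) 0 else jn 0 v)" for j v
  have FB: "v \<in> Fr (B' j) \<longleftrightarrow> ev v \<in> Fr (B0 (j - 1)) \<and> od v \<in> Fr (C0 j)" for v j by (simp add: B'_def Fr_jnB)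
  have zF: "(0 :: nat \<Rightarrow> 's) \<in> Fr D" for D by (rule sub_zero[OF sub_Fr])
  have B0: "v \<in> Fr (B0 i) \<Longrightarrow> v \<in> Fr (B i)" for i and v :: "nat \<Rightarrow> 's" using zF by (auto simp: B0_def split: if_splits)
  have dB0: "d i v \<in> Fr (B0 (i - 1))" if "v \<in> Fr (B0 i)" for i v
    using c(3)[OF B0[OF that]] that by (auto simp: B0_def lin_zero[OF c(2)] split: if_splits)
  have \<omega>0: "\<omega> i v \<in> Fr (C0 i)" if "v \<in> Fr (B0 i)" for i v
    using \<omega>(2)[of i v] that by (auto simp: B0_def C0_def lin_zero[OF \<omega>(1)] split: if_splits)
  have \<omega>B: "\<omega> i v \<in> hat \<aa>" if v: "v \<in> Bc \<aa> B d i" for i v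
  proof -
    have "v - \<zeta> i 0 \<in> Bc \<aa> B d i" using v by (simp add: lin_zero[OF H(3)])
    then show ?thesis using \<omega>(3)[of v i 0] v BZ zF by auto
  qed
  \<comment> \<open>Multiplication by \<open>y\<close> is injective on the cyclic module, because
    the annihilator of \<open>y\<close> modulo \<open>\<aa>\<close> is exactly
    \<open>I\<close>.\<close>
  have \<omega>inj: "v \<in> Bc \<aa> B d i" if v: "v \<in> Zc \<aa> B d i" "\<omega> i v \<in> hat \<aa>" for i v
  proof -
    from H(6)[OF v(1)] obtain w where w: "w \<in> Fr (C i)" "v - \<zeta> i w \<in> Bc \<aa> B d i" by blast
    have "y *s w \<in> hat \<aa>" using sub_diff_iff[OF sh \<omega>(3)[OF v(1) w]] v(2) by blast
    then have "w \<in> hat I" using y(3) by (simp add: hat_def mult.commute[of y])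
    then have "\<zeta> i w \<in> Bc \<aa> B d i" using H(5)[OF w(1)] by blast
    then show ?thesis using sub_diff_iff[OF sB w(2)] by blast
  qed
  note dl = lin_simps[OF c(2)] and \<omega>l = lin_simps[OF \<omega>(1)]
  have cpx': "cpx \<aa> B' d'"
    unfolding cpx_def
  proof (intro conjI allI ballI)
    show "finite (B' i)" for i
      unfolding B'_def B0_def C0_def using c(1) H(1) by (intro finite_jnB) simp_all
    show "lin (d' i)" for i
      unfolding d'_def by (rule lin_jn) (use c(2) \<omega>(1) in \<open>simp_all add: lin_def sc_distrib\<close>)
    fix i and v :: "nat \<Rightarrow> 's" assume "v \<in> Fr (B' i)"
    then have v: "ev v \<in> Fr (B0 (i - 1))" "ev v \<in> Fr (B (i - 1))" using B0 by (simp_all add: FB)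
    show "d' i v \<in> Fr (B' (i - 1))" using dB0[OF v(1)] \<omega>0[OF v(1)] by (simp add: FB d'_def)
    have "d (i - 1) (ev v) \<in> Bc \<aa> B d (i - 1 - 1)" using Bc_d[OF a cpx, of "ev v" "i - 1 - 1"] v(2) by simp
    from \<omega>B[OF this] c(4)[OF v(2)] show "d' (i - 1) (d' i v) \<in> hat \<aa>" by (simp add: d'_def)
  qed
  have spl: "v \<in> hat \<aa>" if "ev v \<in> hat \<aa>" "od v \<in> hat \<aa>" for v :: "nat \<Rightarrow> 's" using that hat_evod by blast
  have hb': "hb \<aa> J B' d' (C' j) (\<zeta>' j) j" for j
  proof (rule hbI)
    show "finite (C' j)" using H(1) by (simp add: C'_def C0_def)
    show "lin (\<zeta>' j)" unfolding \<zeta>'_def using lin_jn[OF c(2)[of N] lin_intros(2)] lin_jn[OF lin_intros(2,1)]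
      by (cases "j = N") simp_all
  next
    fix w :: "nat \<Rightarrow> 's" assume w: "w \<in> Fr (C' j)"
    show "\<zeta>' j w \<in> Fr (B' j) \<and> d' j (\<zeta>' j w) \<in> hat \<aa>"
    proof (cases "j = N")
      case True
      then have w': "w \<in> Fr (B N)" using w top by (simp add: C'_def)
      have "d N w \<in> Bc \<aa> B d (N - 1)" using Bc_d[OF a cpx, of w "N - 1"] w' by simp
      then show ?thesis using \<omega>B c(3,4)[OF w'] True by (simp add: \<zeta>'_def FB zF B0_def d'_def)
    next
      case False
      then show ?thesis using w by (simp add: \<zeta>'_def FB zF C'_def d'_def dl \<omega>l zh)
    qed
    show "\<zeta>' j w \<in> Bc \<aa> B' d' j \<longleftrightarrow> w \<in> hat J"
    proof (cases "j = N")
      case True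
      then have w': "w \<in> Fr {q}" using w by (simp add: C'_def)
      have "B' (N + 1) = {}" by (simp add: B'_def B0_def C0_def)
      then have "\<zeta>' N w \<in> Bc \<aa> B' d' N \<longleftrightarrow> \<zeta>' N w \<in> Fr (B' N) \<and> \<zeta>' N w \<in> hat \<aa>"
        using lin_zero[of "d' (N + 1)"] cpx' by (simp add: Bc_def cpx_def)
      moreover have "\<zeta>' N w \<in> Fr (B' N)" using c(3)[of w N] w' top by (simp add: \<zeta>'_def FB zF B0_def)
      moreover have "\<zeta>' N w \<in> hat \<aa> \<longleftrightarrow> w q \<in> J" using top_cycles[OF w'] by (simp add: \<zeta>'_def zh)
      moreover have "w q \<in> J \<longleftrightarrow> w \<in> hat J" using w' idl_zero[OF J(1)] by (auto simp: hat_def Fr_def)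
      ultimately show ?thesis using True by blast
    next
      case False
      show ?thesis
      proof
        assume "\<zeta>' j w \<in> Bc \<aa> B' d' j"
        then obtain u where u: "u \<in> Fr (B' (j + 1))" "jn 0 w - d' (j + 1) u \<in> hat \<aa>"
          using False by (auto simp: \<zeta>'_def elim: BcE)
        have uF: "ev u \<in> Fr (B j)" using u(1) B0 by (simp add: FB)
        have "- d j (ev u) \<in> hat \<aa>" using hat_ev[OF u(2)] by (simp add: d'_def)
        then have "d j (ev u) \<in> hat \<aa>" using sub_minus[OF sh] by fastforce
        then have uZ: "ev u \<in> Zc \<aa> B d j" using uF by (simp add: Zc_def)
        from H(6)[OF this] obtain t where t: "t \<in> Fr (C j)" "ev u - \<zeta> j t \<in> Bc \<aa> B d j" by blast
        have "w - \<omega> j (ev u) \<in> hat \<aa>" using hat_od[OF u(2)] by (simp add: d'_def)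
        from sub_diff_trans[OF sh this \<omega>(3)[OF uZ t]] have wt: "w - y *s t \<in> hat \<aa>" .
        have "y *s t \<in> hat J" by (rule hat_sc[OF J(1) y(1)])
        moreover have "w - y *s t \<in> hat J" using wt J(2) by (auto simp: hat_def)
        ultimately show "w \<in> hat J" using sub_diff_iff[OF sub_hat[OF J(1)]] by blast
      next
        assume wJ: "w \<in> hat J"
        have "\<forall>m. \<exists>t. w m - t * y \<in> \<aa>" using y(2) wJ by (simp add: hat_def)
        then obtain t0 where t0: "\<And>m. w m - t0 m * y \<in> \<aa>" by metis
        define t where "t = (\<lambda>m. if m \<in> C j then t0 m else 0)"
        have wC: "w \<in> Fr (C0 j)" using w False by (simp add: C'_def)
        then have wC': "w \<in> Fr (C j)" using zF by (auto simp: C0_def split: if_splits)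
        have t: "t \<in> Fr (C j)" "w - y *s t \<in> hat \<aa>"
          using t0 wC' idl_zero[OF a] by (auto simp: t_def hat_def Fr_def mult.commute)
        have z: "\<zeta> j t \<in> Zc \<aa> B d j" by (rule H(4)[OF t(1)])
        show "\<zeta>' j w \<in> Bc \<aa> B' d' j"
        proof (cases "j < N")
          case True
          have e: "\<omega> j (\<zeta> j t) - y *s t \<in> hat \<aa>" by (rule \<omega>(3)[OF z t(1)]) (simp add: sub_zero[OF sB])
          have 1: "w - \<omega> j (\<zeta> j t) \<in> hat \<aa>" by (rule sub_diff_trans[OF sh t(2) sub_diff_sym[OF sh e]])
          have 2: "- d j (\<zeta> j t) \<in> hat \<aa>" by (rule sub_minus[OF sh ZcD(2)[OF z]])
          have "jn 0 w - d' (j + 1) (jn (\<zeta> j t) 0) \<in> hat \<aa>"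
            by (rule spl) (use 1 2 in \<open>simp_all add: d'_def\<close>)
          moreover have "jn (\<zeta> j t) 0 \<in> Fr (B' (j + 1))" using ZcD(1)[OF z] True by (simp add: FB B0_def zF)
          moreover have "jn 0 w \<in> Fr (B' j)" using wC by (simp add: FB zF)
          ultimately show ?thesis using False BcI[of "jn 0 w" B' j] by (simp add: \<zeta>'_def)
        next
          case notless: False
          then have "w = 0" using wC by (simp add: C0_def)
          then have "\<zeta>' j w = 0" using False by (simp add: \<zeta>'_def jn_simps)
          then show ?thesis using sub_zero[OF sub_Bc[OF a cpx']] by simp
        qed
      qed
    qed
  next
    fix v assume v: "v \<in> Fr (B' j)" "d' j v \<in> hat \<aa>"
    have e: "ev v \<in> Fr (B0 (j - 1))" "ev v \<in> Fr (B (j - 1))" and o: "od v \<in> Fr (C0 j)" using v(1) B0 by (simp_all add: FB)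
    have "d (j - 1) (ev v) \<in> hat \<aa>" "\<omega> (j - 1) (ev v) \<in> hat \<aa>"
      using hat_ev[OF v(2)] hat_od[OF v(2)] by (simp_all add: d'_def)
    then have "ev v \<in> Bc \<aa> B d (j - 1)" using \<omega>inj e(2) by (simp add: Zc_def)
    then obtain w where w: "w \<in> Fr (B j)" "ev v - d j w \<in> hat \<aa>" by (auto simp: Bc_def)
    show "\<exists>u\<in>Fr (C' j). v - \<zeta>' j u \<in> Bc \<aa> B' d' j"
    proof (cases "j < N")
      case True
      let ?u = "od v - \<omega> j w"
      have F: "?u \<in> Fr (C j)" using o sub_diff[OF sub_Fr _ \<omega>(2)] True by (simp add: C0_def)
      have "v - jn 0 ?u - d' (j + 1) (jn w 0) \<in> hat \<aa>" by (rule spl) (use w(2) zh in \<open>simp_all add: d'_def\<close>)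
      moreover have "jn w 0 \<in> Fr (B' (j + 1))" using w(1) True by (simp add: FB B0_def zF)
      moreover have "v - jn 0 ?u \<in> Fr (B' j)" using v(1) F True by (intro sub_diff[OF sub_Fr]) (simp_all add: FB zF C0_def)
      ultimately have "v - jn 0 ?u \<in> Bc \<aa> B' d' j" using BcI[of _ B' j] by blast
      then show ?thesis using F True by (intro bexI[of _ ?u]) (simp_all add: \<zeta>'_def C'_def C0_def)
    next
      case False
      then have o0: "od v = 0" using o by (simp add: C0_def)
      show ?thesis
      proof (cases "j = N")
        case True
        have "v - jn (d N w) 0 \<in> hat \<aa>" by (rule spl) (use w(2) zh o0 True in simp_all)
        moreover have "v - jn (d N w) 0 \<in> Fr (B' j)"
          by (rule sub_diff[OF sub_Fr v(1)]) (use c(3)[OF w(1)] True in \<open>simp add: FB B0_def zF\<close>)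
        ultimately have "v - jn (d N w) 0 \<in> Bc \<aa> B' d' j" by (intro hat_Bc[OF a cpx'])
        then show ?thesis using w(1) top True by (intro bexI[of _ w]) (simp_all add: \<zeta>'_def C'_def)
      next
        case neq: False
        then have "ev v = 0" using e(1) False by (simp add: B0_def)
        then have "v = 0" using o0 by (metis jn_ev_od jn_simps(4))
        then show ?thesis using sub_zero[OF sub_Bc[OF a cpx']] zF neq
          by (intro bexI[of _ 0]) (simp_all add: \<zeta>'_def jn_simps)
      qed
    qed
  qed
  have "B' j = {}" if "j < 0 \<or> N < j" for j
    using that range[of "j - 1"] N0 C_range by (auto simp: B'_def B0_def C0_def)
  then show ?thesis using cpx' hb' by (intro exI[of _ B'] exI[of _ d'] exI[of _ C'] exI[of _ \<zeta>'] conjI)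
    (auto simp: C'_def C0_def)
qed

end

subsection \<open>Regular sequences\<close>

fun adjl :: "'s::comm_ring_1 set \<Rightarrow> 's list \<Rightarrow> 's set" where
  "adjl \<aa> [] = \<aa>"
| "adjl \<aa> (x # xs) = adjl (adj \<aa> x) xs"

fun regl :: "'s::comm_ring_1 set \<Rightarrow> 's list \<Rightarrow> bool" where
  "regl \<aa> [] = True"
| "regl \<aa> (x # xs) = (reg \<aa> x \<and> regl (adj \<aa> x) xs)"

lemma adjl_incl: "a \<in> \<aa> \<Longrightarrow> a \<in> adjl \<aa> xs"
  by (induction xs arbitrary: \<aa>) (auto intro: adj_incl)

lemma idl_adjl: "idl \<aa> \<Longrightarrow> idl (adjl \<aa> xs)"
  by (induction xs arbitrary: \<aa>) (auto intro: idl_adj)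

lemma adj_subset:
  assumes "idl I" "\<aa> \<subseteq> I" "x \<in> I" shows "adj \<aa> x \<subseteq> I"
proof
  fix r assume "r \<in> adj \<aa> x"
  then obtain t where "r - x * t \<in> I" using assms(2) unfolding adj_def by blast
  then show "r \<in> I" using idl_diff_iff[OF assms(1)] idl_mult2[OF assms(1,3)] by blast
qed

lemma adjl_subset: "idl I \<Longrightarrow> \<aa> \<subseteq> I \<Longrightarrow> set xs \<subseteq> I \<Longrightarrow> adjl \<aa> xs \<subseteq> I"
proof (induction xs arbitrary: \<aa>)
  case (Cons x xs)
  have "adj \<aa> x \<subseteq> I" by (rule adj_subset) (use Cons.prems in auto)
  then show ?case using Cons by simp
qed simp

text \<open>One change of rings per element, each lowering the bound by one.\<close>

lemma good_adjl:
  assumes "idl I" "idl \<aa>" "\<aa> \<subseteq> I" "set xs \<subseteq> I" "regl \<aa> xs" "good \<aa> (length xs + k) (Fr C) (hat I)"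
  shows "good (adjl \<aa> xs) k (Fr C) (hat I)"
  using assms(2-)
proof (induction xs arbitrary: \<aa>)
  case (Cons x xs)
  have s: "adj \<aa> x \<subseteq> I" by (rule adj_subset) (use Cons.prems assms(1) in auto)
  have "good (adj \<aa> x) (length xs + k) (Fr C) (hat I)"
    by (rule good_adj[OF Cons.prems(1) _ md_Fr_hat[OF assms(1) s]]) (use Cons.prems in auto)
  then show ?case using Cons.IH[OF idl_adj[OF Cons.prems(1)] s] Cons.prems by simp
qed simp

text \<open>Homotopies for the later elements remain homotopies modulo the larger ideals, so
  \<open>hb_adj\<close> can be iterated.\<close>

lemma hb_adjl:
  fixes C :: "int \<Rightarrow> nat set"
  assumes "idl \<aa>" "cpx \<aa> B d" "regl \<aa> xs" "\<And>i. hb \<aa> I B d (C i) (\<zeta> i) i"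
    and "\<And>x. x \<in> set xs \<Longrightarrow> \<exists>h. \<forall>i. lin (h i) \<and> (\<forall>v\<in>Fr (B i). h i v \<in> Fr (B (i + 1)) \<and>
        d (i + 1) (h i v) + h (i - 1) (d i v) - x *s v \<in> hat \<aa>)"
  shows "\<exists>(C :: int \<Rightarrow> nat set) \<zeta>. \<forall>i. hb (adjl \<aa> xs) I B d (C i) (\<zeta> i) i"
  using assms
proof (induction xs arbitrary: \<aa> C \<zeta>)
  case Nil
  then show ?case by auto
next
  case (Cons x xs)
  from Cons.prems(5)[of x] obtain h where h: "\<And>i. lin (h i)" "\<And>i v. v \<in> Fr (B i) \<Longrightarrow> h i v \<in> Fr (B (i + 1))"
      "\<And>i v. v \<in> Fr (B i) \<Longrightarrow> d (i + 1) (h i v) + h (i - 1) (d i v) - x *s v \<in> hat \<aa>"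
    using list.set_intros(1)[of x xs] by blast
  have r: "reg \<aa> x" "regl (adj \<aa> x) xs" using Cons.prems(3) by simp_all
  have hb': "hb (adj \<aa> x) I B d (jnB (C i) (C (i - 1))) (\<lambda>c. \<zeta> i (ev c) + h (i - 1) (\<zeta> (i - 1) (od c))) i" for i
    by (rule hb_adj[OF Cons.prems(1,2) r(1) h Cons.prems(4,4)])
  have "\<exists>(C :: int \<Rightarrow> nat set) \<zeta>. \<forall>i. hb (adjl (adj \<aa> x) xs) I B d (C i) (\<zeta> i) i"
  proof (rule Cons.IH[OF idl_adj[OF Cons.prems(1)] cpx_adj[OF Cons.prems(2)] r(2) hb'])
    fix x' assume "x' \<in> set xs"
    then show "\<exists>h. \<forall>i. lin (h i) \<and> (\<forall>v\<in>Fr (B i). h i v \<in> Fr (B (i + 1)) \<and>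
        d (i + 1) (h i v) + h (i - 1) (d i v) - x' *s v \<in> hat (adj \<aa> x))"
      using Cons.prems(5)[of x'] hat_adj_incl by (metis list.set_intros(2))
  qed
  then show ?case by simp
qed

text \<open>The reduction is undone one element at a time. Each lift adds one degree at the top and
  none at the bottom, while the homology keeps its ranks and degrees; this is the source of
  \<open>length xs\<close> in the final estimate.\<close>

lemma hb_liftl:
  fixes C :: "int \<Rightarrow> nat set"
  assumes "idl \<aa>" "regl \<aa> xs" "cpx (adjl \<aa> xs) B d" "\<And>i. hb (adjl \<aa> xs) J B d (C i) (\<zeta> i) i"
    and "\<And>i. i < 0 \<or> N < i \<Longrightarrow> B i = {}"
  shows "\<exists>B' d' \<zeta>'. cpx \<aa> B' d' \<and> (\<forall>i. hb \<aa> J B' d' (C i) (\<zeta>' i) i) \<and>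
    (\<forall>i. i < 0 \<or> N + int (length xs) < i \<longrightarrow> B' i = {})"
  using assms(1-4)
proof (induction xs arbitrary: \<aa>)
  case Nil
  have "cpx \<aa> B d" "\<And>i. hb \<aa> J B d (C i) (\<zeta> i) i" using Nil.prems(3,4) by simp_all
  moreover have "\<forall>i. i < 0 \<or> N + int (length []) < i \<longrightarrow> B i = {}" using assms(5) by simp
  ultimately show ?case by blast
next
  case (Cons x xs)
  have r: "reg \<aa> x" "regl (adj \<aa> x) xs" using Cons.prems(2) by simp_all
  have p: "cpx (adjl (adj \<aa> x) xs) B d" "\<And>i. hb (adjl (adj \<aa> x) xs) J B d (C i) (\<zeta> i) i"
    using Cons.prems(3,4) by simp_all
  from Cons.IH[OF idl_adj[OF Cons.prems(1)] r(2) p] obtain B' d' \<zeta>' where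
    1: "cpx (adj \<aa> x) B' d'" "\<And>i. hb (adj \<aa> x) J B' d' (C i) (\<zeta>' i) i"
      "\<And>i. i < 0 \<or> N + int (length xs) < i \<Longrightarrow> B' i = {}" by blast
  from hb_lift[OF Cons.prems(1) 1(1) r(1) 1(2)] obtain d2 \<zeta>2 where
    2: "cpx \<aa> (\<lambda>i. jnB (B' i) (B' (i - 1))) d2" "\<And>i. hb \<aa> J (\<lambda>i. jnB (B' i) (B' (i - 1))) d2 (C i) (\<zeta>2 i) i"
    by blast
  have "jnB (B' i) (B' (i - 1)) = {}" if "i < 0 \<or> N + int (length (x # xs)) < i" for i
    using 1(3)[of i] 1(3)[of "i - 1"] that by auto
  then show ?case using 2 by blast
qed

text \<open>Down to the quotient by the sequence, across by linkage, and up again. The result has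
  nonzero homology in degree \<open>N\<close> and ends at most \<open>length xs\<close> degrees
  higher, which will bound the quasi-projective dimension from above.\<close>

theorem linked_resolution:
  fixes C :: "int \<Rightarrow> nat set"
  assumes k: "idl \<kk>" and I: "idl I" "1 \<notin> I" "\<kk> \<subseteq> I" and xs: "regl \<kk> xs" "set xs \<subseteq> I"
    and J: "J = {r. \<forall>s\<in>I. r * s \<in> adjl \<kk> xs}" "I = {r. \<forall>s\<in>J. r * s \<in> adjl \<kk> xs}"
    and B: "cpx \<kk> B d" "\<And>i. hb \<kk> I B d (C i) (\<zeta> i) i" "\<And>i. i < 0 \<or> N < i \<Longrightarrow> B i = {}" "B N = {q}" "0 \<le> N"
    and h: "\<And>x. x \<in> set xs \<Longrightarrow> \<exists>h. \<forall>i. lin (h i) \<and> (\<forall>v\<in>Fr (B i). h i v \<in> Fr (B (i + 1)) \<and>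
        d (i + 1) (h i v) + h (i - 1) (d i v) - x *s v \<in> hat \<kk>)"
    and t: "\<And>v. v \<in> Fr {q} \<Longrightarrow> d N v \<in> hat (adjl \<kk> xs) \<longleftrightarrow> (\<forall>s\<in>I. v q * s \<in> adjl \<kk> xs)"
    and g: "good \<kk> k (Fr {0}) (hat I)"
  shows "\<exists>B' d' C' \<zeta>'. cpx \<kk> B' d' \<and> (\<forall>j. hb \<kk> J B' d' (C' j) (\<zeta>' j) j) \<and>
    (\<forall>j. j < 0 \<or> N + int (length xs) < j \<longrightarrow> B' j = ({} :: nat set)) \<and> C' N \<noteq> ({} :: nat set) \<and> (\<forall>j. N < j \<longrightarrow> C' j = {})"
proof -
  let ?a = "adjl \<kk> xs"
  from hb_adjl[OF k B(1) xs(1) B(2) h] obtain C1 :: "int \<Rightarrow> nat set" and \<zeta>1 where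
    1: "\<And>i. hb ?a I B d (C1 i) (\<zeta>1 i) i" by blast
  have "good \<kk> (length xs + k) (Fr {0}) (hat I)" by (rule good_mono[OF g]) simp
  then have g': "good ?a k (Fr {0}) (hat I)" by (rule good_adjl[OF I(1) k I(3) xs(2,1)])
  have c: "cpx ?a B d"
    using B(1) adjl_incl[of _ \<kk> xs] unfolding cpx_def hat_def by blast
  interpret linkage ?a I J B d N q C1 \<zeta>1 k
  proof
    show "J = {r. \<forall>s\<in>I. r * s \<in> ?a}" "I = {r. \<forall>s\<in>J. r * s \<in> ?a}" by (rule J)+
    show "d N v \<in> hat ?a \<longleftrightarrow> v q \<in> J" if "v \<in> Fr {q}" for v using t[OF that] by (subst J(1)) simp
  qed (use idl_adjl[OF k] I adjl_subset[OF I(1,3) xs(2)] c 1 B(3,4) g' in blast)+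
  from linked_complex[OF B(5)] obtain B' d' C' \<zeta>' where
    2: "cpx ?a B' d' \<and> (\<forall>j. hb ?a J B' d' (C' j) (\<zeta>' j) j) \<and>
      (\<forall>j. j < 0 \<or> N < j \<longrightarrow> B' j = ({} :: nat set)) \<and> C' N \<noteq> ({} :: nat set) \<and> (\<forall>j. N < j \<longrightarrow> C' j = {})"
    by (elim exE)
  have 3: "cpx ?a B' d'" "\<And>j. hb ?a J B' d' (C' j) (\<zeta>' j) j" "\<And>j. j < 0 \<or> N < j \<Longrightarrow> B' j = {}"
    and 4: "C' N \<noteq> {} \<and> (\<forall>j. N < j \<longrightarrow> C' j = {})" using 2 by blast+
  have "\<exists>B2 d2 \<zeta>2. cpx \<kk> B2 d2 \<and> (\<forall>i. hb \<kk> J B2 d2 (C' i) (\<zeta>2 i) i) \<and>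
      (\<forall>i. i < 0 \<or> N + int (length xs) < i \<longrightarrow> B2 i = {})"
    by (rule hb_liftl[OF k xs(1) 3(1,2)]) (rule 3(3))
  then obtain B2 d2 \<zeta>2 where
    5: "cpx \<kk> B2 d2 \<and> (\<forall>i. hb \<kk> J B2 d2 (C' i) (\<zeta>2 i) i) \<and>
      (\<forall>i. i < 0 \<or> N + int (length xs) < i \<longrightarrow> B2 i = {})" by (elim exE)
  show ?thesis
    by (intro exI[of _ B2] exI[of _ d2] exI[of _ C'] exI[of _ \<zeta>2]) (use 4 5 in blast)
qed

section \<open>A type of ring elements\<close>

text \<open>The free commutative ring on \<open>'a\<close> maps onto every commutative ring \<open>R\<close> with elements in \<open>'a\<close>.
  Thus modules over \<open>R\<close> are modules over a fixed instance of the class \<open>comm_ring_1\<close>, and \<open>R\<close> is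
  replaced by the quotient by the kernel of the evaluation.\<close>

datatype 'a tm = Var 'a | Zr | On | Ad "'a tm" "'a tm" | Ng "'a tm" | Ml "'a tm" "'a tm"

text \<open>The least congruence containing the axioms of commutative rings; the quotient is the
  polynomial ring over the integers with one variable for each element of \<open>'a\<close>.\<close>

inductive eqv :: "'a tm \<Rightarrow> 'a tm \<Rightarrow> bool" where
  refl: "eqv s s"
| sym: "eqv s t \<Longrightarrow> eqv t s"
| trans: "eqv s t \<Longrightarrow> eqv t u \<Longrightarrow> eqv s u"
| cong_Ad: "eqv s s' \<Longrightarrow> eqv t t' \<Longrightarrow> eqv (Ad s t) (Ad s' t')"
| cong_Ng: "eqv s s' \<Longrightarrow> eqv (Ng s) (Ng s')"
| cong_Ml: "eqv s s' \<Longrightarrow> eqv t t' \<Longrightarrow> eqv (Ml s t) (Ml s' t')"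
| Ad_assoc: "eqv (Ad (Ad s t) u) (Ad s (Ad t u))"
| Ad_comm: "eqv (Ad s t) (Ad t s)"
| Ad_zero: "eqv (Ad Zr s) s"
| Ad_neg: "eqv (Ad (Ng s) s) Zr"
| Ml_assoc: "eqv (Ml (Ml s t) u) (Ml s (Ml t u))"
| Ml_comm: "eqv (Ml s t) (Ml t s)"
| Ml_one: "eqv (Ml On s) s"
| Ml_distrib: "eqv (Ml (Ad s t) u) (Ad (Ml s u) (Ml t u))"

quotient_type 'a frng = "'a tm" / eqv
  by (rule equivpI) (auto intro!: reflpI sympI transpI intro: eqv.refl eqv.sym eqv.trans)

text \<open>Evaluation of all variables at 0 in the integers, an invariant of \<open>eqv\<close>
  that keeps 0 and 1 apart.\<close>

primrec int_eval :: "'a tm \<Rightarrow> int" where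
  "int_eval (Var a) = 0"
| "int_eval Zr = 0"
| "int_eval On = 1"
| "int_eval (Ad s t) = int_eval s + int_eval t"
| "int_eval (Ng s) = - int_eval s"
| "int_eval (Ml s t) = int_eval s * int_eval t"

lemma eqv_int_eval: "eqv s t \<Longrightarrow> int_eval s = int_eval t"
  by (induction rule: eqv.induct) (auto simp: algebra_simps)

instantiation frng :: (type) comm_ring_1
begin

lift_definition zero_frng :: "'a frng" is Zr .
lift_definition one_frng :: "'a frng" is On .
lift_definition plus_frng :: "'a frng \<Rightarrow> 'a frng \<Rightarrow> 'a frng" is Ad by (rule eqv.cong_Ad)
lift_definition uminus_frng :: "'a frng \<Rightarrow> 'a frng" is Ng by (rule eqv.cong_Ng)
lift_definition times_frng :: "'a frng \<Rightarrow> 'a frng \<Rightarrow> 'a frng" is Ml by (rule eqv.cong_Ml)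
definition minus_frng :: "'a frng \<Rightarrow> 'a frng \<Rightarrow> 'a frng" where "minus_frng s t = s + - t"

instance
proof
  show "(0 :: 'a frng) \<noteq> 1" by transfer (auto dest: eqv_int_eval)
qed (simp add: minus_frng_def |
    transfer, rule eqv.Ad_assoc eqv.Ad_comm eqv.Ad_zero eqv.Ad_neg eqv.Ml_assoc eqv.Ml_comm eqv.Ml_one eqv.Ml_distrib)+

end

lift_definition fvar :: "'a \<Rightarrow> 'a frng" is Var .

text \<open>Variables outside the carrier are sent to zero, so evaluation is total and always lands
  in the carrier.\<close>

primrec tm_eval :: "('a, 'r) ring_scheme \<Rightarrow> 'a tm \<Rightarrow> 'a" where
  "tm_eval R (Var a) = (if a \<in> carrier R then a else \<zero>\<^bsub>R\<^esub>)"
| "tm_eval R Zr = \<zero>\<^bsub>R\<^esub>"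
| "tm_eval R On = \<one>\<^bsub>R\<^esub>"
| "tm_eval R (Ad s t) = tm_eval R s \<oplus>\<^bsub>R\<^esub> tm_eval R t"
| "tm_eval R (Ng s) = \<ominus>\<^bsub>R\<^esub> tm_eval R s"
| "tm_eval R (Ml s t) = tm_eval R s \<otimes>\<^bsub>R\<^esub> tm_eval R t"

definition feval :: "('a, 'r) ring_scheme \<Rightarrow> 'a frng \<Rightarrow> 'a"
  where "feval R s = tm_eval R (rep_frng s)"

context cring
begin

abbreviation \<pi> where "\<pi> \<equiv> feval R"

lemma tm_eval_closed [simp]: "tm_eval R s \<in> carrier R"
  by (induction s) auto

lemma eqv_tm_eval: "eqv s t \<Longrightarrow> tm_eval R s = tm_eval R t"
  by (induction rule: eqv.induct) (auto simp: a_ac m_ac l_distr r_distr l_neg r_neg)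

lemma feval_abs: "\<pi> (abs_frng s) = tm_eval R s"
  unfolding feval_def by (rule eqv_tm_eval) (metis Quotient3_frng rep_abs_rsp_left eqv.refl eqv.sym)

lemma pi_closed [simp]: "\<pi> s \<in> carrier R"
  by (simp add: feval_def)

lemma pi_zero [simp]: "\<pi> 0 = \<zero>" and pi_one [simp]: "\<pi> 1 = \<one>"
  by (simp_all add: zero_frng_def one_frng_def feval_abs)

lemma pi_add [simp]: "\<pi> (s + t) = \<pi> s \<oplus> \<pi> t"
  by (induct s rule: frng.abs_induct, induct t rule: frng.abs_induct) (simp add: plus_frng.abs_eq feval_abs)

lemma pi_mult [simp]: "\<pi> (s * t) = \<pi> s \<otimes> \<pi> t"
  by (induct s rule: frng.abs_induct, induct t rule: frng.abs_induct) (simp add: times_frng.abs_eq feval_abs)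

lemma pi_uminus [simp]: "\<pi> (- s) = \<ominus> \<pi> s"
  by (induct s rule: frng.abs_induct) (simp add: uminus_frng.abs_eq feval_abs)

lemma pi_minus [simp]: "\<pi> (s - t) = \<pi> s \<ominus> \<pi> t"
  by (simp only: minus_frng_def pi_add pi_uminus a_minus_def)

lemma pi_var [simp]: "a \<in> carrier R \<Longrightarrow> \<pi> (fvar a) = a"
  by (simp add: fvar_def feval_abs)

lemma pi_sum: "finite A \<Longrightarrow> \<pi> (\<Sum>x\<in>A. f x) = (\<Oplus>x\<in>A. \<pi> (f x))"
  by (induction A rule: finite_induct) (auto simp: finsum_insert)

lemma pi_pow: "\<pi> (s ^ n) = \<pi> s [^] n"
  by (induction n) (auto simp: m_comm)

section \<open>Ideals of R pulled back to the free ring\<close>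

definition pre :: "'a set \<Rightarrow> 'a frng set" where "pre K = {s. \<pi> s \<in> K}"

abbreviation \<kk> where "\<kk> \<equiv> pre {\<zero>}"

lemma idl_pre: assumes "ideal K R" shows "idl (pre K)"
proof -
  interpret ideal K R by fact
  show ?thesis by (auto simp: idl_def pre_def I_l_closed)
qed

lemma idl_kk: "idl \<kk>"
  by (rule idl_pre[OF zeroideal])

lemma kk_pre: "ideal K R \<Longrightarrow> \<kk> \<subseteq> pre K"
  by (auto simp: pre_def additive_subgroup.zero_closed ideal.axioms(1))

lemma pi_diff_zero: "s - t \<in> \<kk> \<longleftrightarrow> \<pi> s = \<pi> t"
  by (simp add: pre_def)

lemma ideal_image: assumes b: "idl \<bb>" shows "ideal (\<pi> ` \<bb>) R"
proof (rule idealI)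
  show "ring R" by (rule ring_axioms)
  show "subgroup (\<pi> ` \<bb>) (add_monoid R)"
  proof (rule add.subgroupI)
    show "\<pi> ` \<bb> \<noteq> {}" using idl_zero[OF b] by blast
    show "\<ominus> a \<in> \<pi> ` \<bb>" if "a \<in> \<pi> ` \<bb>" for a
    proof -
      from that obtain s where "s \<in> \<bb>" "a = \<pi> s" by blast
      then show ?thesis using idl_minus[OF b] by (intro image_eqI[of _ _ "- s"]) simp_all
    qed
    show "a \<oplus> c \<in> \<pi> ` \<bb>" if "a \<in> \<pi> ` \<bb>" "c \<in> \<pi> ` \<bb>" for a c
    proof -
      from that obtain s t where "s \<in> \<bb>" "a = \<pi> s" "t \<in> \<bb>" "c = \<pi> t" by blast
      then show ?thesis using idl_add[OF b] by (intro image_eqI[of _ _ "s + t"]) simp_all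
    qed
  qed auto
  fix a x assume "a \<in> \<pi> ` \<bb>" and x: "x \<in> carrier R"
  then obtain s where s: "s \<in> \<bb>" "a = \<pi> s" by blast
  have "\<pi> (fvar x * s) \<in> \<pi> ` \<bb>" using idl_mult[OF b s(1)] by blast
  then show "x \<otimes> a \<in> \<pi> ` \<bb>" using x s(2) by simp
  then show "a \<otimes> x \<in> \<pi> ` \<bb>" using x s(2) by (simp add: m_comm)
qed

lemma pre_image: assumes "idl \<bb>" "\<kk> \<subseteq> \<bb>" shows "s \<in> \<bb> \<longleftrightarrow> \<pi> s \<in> \<pi> ` \<bb>"
proof
  assume "\<pi> s \<in> \<pi> ` \<bb>"
  then obtain t where t: "t \<in> \<bb>" "\<pi> s = \<pi> t" by blast
  then have "s - t \<in> \<bb>" using pi_diff_zero assms(2) by blast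
  then show "s \<in> \<bb>" using idl_diff_iff[OF assms(1)] t(1) by blast
qed simp

lemma genideal_least: "idl \<bb> \<Longrightarrow> A \<subseteq> \<pi> ` \<bb> \<Longrightarrow> Idl A \<subseteq> \<pi> ` \<bb>"
  by (rule genideal_minimal[OF ideal_image])

text \<open>For the inclusion of the generated ideal, evaluation maps the left side to an ideal
  containing all generators, and an ideal above \<open>\<kk>\<close> is recovered from its
  image.\<close>

lemma adj_pre:
  assumes A: "A \<subseteq> carrier R" and x: "x \<in> carrier R"
  shows "adj (pre (Idl A)) (fvar x) = pre (Idl (insert x A))"
proof
  have iA: "ideal (Idl A) R" by (rule genideal_ideal[OF A])
  have xA: "insert x A \<subseteq> carrier R" using A x by blast
  interpret B: ideal "Idl (insert x A)" R by (rule genideal_ideal[OF xA])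
  have sub: "Idl A \<subseteq> Idl (insert x A)"
    using genideal_minimal[OF B.ideal_axioms] genideal_self[OF xA] by blast
  have xin: "x \<in> Idl (insert x A)" using genideal_self[OF xA] by blast
  show "adj (pre (Idl A)) (fvar x) \<subseteq> pre (Idl (insert x A))"
    by (rule adj_subset[OF idl_pre[OF B.ideal_axioms]]) (use sub xin x in \<open>auto simp: pre_def\<close>)
  let ?b = "adj (pre (Idl A)) (fvar x)"
  have b: "idl ?b" by (rule idl_adj[OF idl_pre[OF iA]])
  have 1: "A \<subseteq> \<pi> ` ?b"
  proof
    fix a assume a: "a \<in> A"
    then have c: "a \<in> carrier R" "a \<in> Idl A" using A genideal_self[OF A] by blast+
    have "fvar a \<in> ?b" by (rule adj_incl) (simp add: pre_def c)
    then show "a \<in> \<pi> ` ?b" by (rule image_eqI[rotated]) (simp add: c)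
  qed
  have "fvar x \<in> ?b" using adj_x[OF idl_pre[OF iA], of "fvar x" 1] by simp
  then have "x \<in> \<pi> ` ?b" by (rule image_eqI[rotated]) (simp add: x)
  with 1 have i: "insert x A \<subseteq> \<pi> ` ?b" by simp
  have k: "\<kk> \<subseteq> ?b"
  proof
    fix s assume "s \<in> \<kk>"
    then have "s \<in> pre (Idl A)" using kk_pre[OF iA] by (rule rev_subsetD)
    then show "s \<in> ?b" by (rule adj_incl)
  qed
  show "pre (Idl (insert x A)) \<subseteq> ?b"
  proof
    fix s assume "s \<in> pre (Idl (insert x A))"
    then have "\<pi> s \<in> Idl (insert x A)" by (simp only: pre_def mem_Collect_eq)
    then have "\<pi> s \<in> \<pi> ` ?b" by (rule rev_subsetD[OF _ genideal_least[OF b i]])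
    then show "s \<in> ?b" by (simp only: pre_image[OF b k])
  qed
qed

lemma adjl_snoc: "adjl \<aa> (xs @ [x]) = adj (adjl \<aa> xs) x"
  by (induction xs arbitrary: \<aa>) auto

lemma regl_snoc: "regl \<aa> (xs @ [x]) \<longleftrightarrow> regl \<aa> xs \<and> reg (adjl \<aa> xs) x"
  by (induction xs arbitrary: \<aa>) auto

lemma Idl_empty: "Idl {} = {\<zero>}"
proof
  show "Idl {} \<subseteq> {\<zero>}" by (rule genideal_minimal[OF zeroideal]) simp
  show "{\<zero>} \<subseteq> Idl {}"
    using additive_subgroup.zero_closed[OF ideal.axioms(1)[OF genideal_ideal[of "{}"]]] by simp
qed

lemma adjl_pre: "set xs \<subseteq> carrier R \<Longrightarrow> adjl \<kk> (map fvar xs) = pre (Idl (set xs))"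
proof (induction xs rule: rev_induct)
  case Nil
  show ?case by (simp add: Idl_empty)
next
  case (snoc x xs)
  then show ?case using adj_pre[of "set xs" x] by (simp add: adjl_snoc)
qed

lemma reg_pre:
  assumes "x \<in> carrier R"
  shows "reg (pre K) (fvar x) \<longleftrightarrow> (\<forall>a\<in>carrier R. x \<otimes> a \<in> K \<longrightarrow> a \<in> K)"
  using assms unfolding reg_def pre_def by simp (metis pi_closed pi_var)

lemma regl_pre:
  assumes "set xs \<subseteq> carrier R"
  shows "regl \<kk> (map fvar xs) \<longleftrightarrow> (\<forall>i<length xs. \<forall>a\<in>carrier R.
    xs ! i \<otimes> a \<in> Idl (set (take i xs)) \<longrightarrow> a \<in> Idl (set (take i xs)))"
  using assms
proof (induction xs rule: rev_induct)
  case (snoc x xs)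
  then show ?case
    by (simp add: regl_snoc adjl_pre reg_pre All_less_Suc nth_append) auto
qed simp

text \<open>The free ring is not Noetherian when \<open>'a\<close> is infinite, so finite generation
  can be claimed only modulo \<open>\<kk>\<close>; it comes from the image in
  \<open>R\<close>.\<close>

lemma noeth:
  assumes N: "noetherian_ring R" and b: "idl \<bb>" "\<kk> \<subseteq> \<bb>"
  shows "\<exists>fs. set fs \<subseteq> \<bb> \<and> (\<forall>r\<in>\<bb>. \<exists>c. r - (\<Sum>i<length fs. c i * fs ! i) \<in> \<kk>)"
proof -
  interpret N: noetherian_ring R by (rule N)
  from N.finetely_gen[OF ideal_image[OF b(1)]] obtain A where
    A: "A \<subseteq> carrier R" "finite A" "\<pi> ` \<bb> = Idl A" by blast
  obtain as where as: "set as = A" using finite_list[OF A(2)] by blast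
  define fs where "fs = map fvar as"
  \<comment> \<open>The combinations of the lifted generators modulo \<open>\<kk>\<close> form an
    ideal above \<open>\<kk>\<close>, so they can be compared with \<open>\<bb>\<close> after
    evaluation.\<close>
  define \<cc> where "\<cc> = {r. \<exists>c. r - (\<Sum>i<length fs. c i * fs ! i) \<in> \<kk>}"
  have c: "idl \<cc>"
    unfolding idl_def
  proof (intro conjI ballI allI)
    show "0 \<in> \<cc>" unfolding \<cc>_def by (intro CollectI exI[of _ "\<lambda>_. 0"]) (simp add: idl_zero[OF idl_kk])
    fix u assume "u \<in> \<cc>"
    then obtain f where f: "u - (\<Sum>i<length fs. f i * fs ! i) \<in> \<kk>" by (auto simp: \<cc>_def)
    show "r * u \<in> \<cc>" for r
      unfolding \<cc>_def
      by (intro CollectI exI[of _ "\<lambda>i. r * f i"])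
         (use idl_mult[OF idl_kk f, of r] in \<open>simp add: sum_distrib_left algebra_simps\<close>)
    fix v assume "v \<in> \<cc>"
    then obtain g where g: "v - (\<Sum>i<length fs. g i * fs ! i) \<in> \<kk>" by (auto simp: \<cc>_def)
    show "u + v \<in> \<cc>"
      unfolding \<cc>_def
      by (intro CollectI exI[of _ "\<lambda>i. f i + g i"])
         (use idl_add[OF idl_kk f g] in \<open>simp add: sum.distrib algebra_simps\<close>)
  qed
  have kc: "\<kk> \<subseteq> \<cc>" unfolding \<cc>_def by (auto intro!: exI[of _ "\<lambda>_. 0"])
  have "fs ! j \<in> \<cc>" if "j < length fs" for j
    unfolding \<cc>_def
  proof (intro CollectI exI[of _ "\<lambda>i. if i = j then 1 else 0"])
    have "(\<Sum>i<length fs. (if i = j then 1 else 0) * fs ! i) = (\<Sum>i<length fs. if i = j then fs ! i else 0)"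
      by (rule sum.cong) auto
    then show "fs ! j - (\<Sum>i<length fs. (if i = j then 1 else 0) * fs ! i) \<in> \<kk>"
      using that idl_zero[OF idl_kk] by simp
  qed
  then have "set fs \<subseteq> \<cc>" by (auto simp: in_set_conv_nth)
  moreover have "A = \<pi> ` set fs" using A(1) as by (auto simp: fs_def image_image subset_iff intro!: rev_image_eqI)
  ultimately have "A \<subseteq> \<pi> ` \<cc>" by blast
  then have "\<pi> ` \<bb> \<subseteq> \<pi> ` \<cc>" using genideal_least[OF c] A(3) by simp
  then have "\<bb> \<subseteq> \<cc>" using pre_image[OF c kc] by blast
  moreover have "set fs \<subseteq> \<bb>"
  proof
    fix f assume f: "f \<in> set fs"
    then have "\<pi> f \<in> \<pi> ` \<bb>" using \<open>A = \<pi> ` set fs\<close> A(3) genideal_self[OF A(1)] by blast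
    then show "f \<in> \<bb>" using pre_image[OF b] by blast
  qed
  ultimately show ?thesis unfolding \<cc>_def by blast
qed

text \<open>Submodules of finite free modules are finitely generated: the entries at the coordinate
  \<open>b\<close> form a finitely generated ideal, and the elements vanishing there lie in a free
  module of smaller rank.\<close>

lemma noeth_cover:
  assumes N: "noetherian_ring R" and B: "finite B" and L: "sub L" "L \<subseteq> Fr B"
    and k: "\<And>v. v \<in> Fr B \<Longrightarrow> v \<in> hat \<kk> \<Longrightarrow> v \<in> L"
  shows "\<exists>e (C :: nat set). cov e C L (hat \<kk>)"
  using B L k
proof (induction B arbitrary: L)
  case empty
  have "L = {0}" using empty.prems(1,2) sub_zero by fastforce
  then have "cov (\<lambda>v. 0) ({} :: nat set) L (hat \<kk>)"
    using sub_zero[OF sub_hat[OF idl_kk]] by (simp add: cov_def lin_intros)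
  then show ?case by blast
next
  case (insert b B)
  note sh = sub_hat[OF idl_kk]
  define \<bb> where "\<bb> = (\<lambda>l. l b) ` L"
  have b: "idl \<bb>"
    unfolding idl_def
  proof (intro conjI ballI allI)
    show "0 \<in> \<bb>" unfolding \<bb>_def by (rule image_eqI[OF _ sub_zero[OF insert.prems(1)]]) simp
    fix u assume "u \<in> \<bb>"
    then obtain l where l: "l \<in> L" "u = l b" by (auto simp: \<bb>_def)
    show "r * u \<in> \<bb>" for r
      unfolding \<bb>_def by (rule image_eqI[OF _ sub_sc[OF insert.prems(1) l(1), of r]]) (simp add: l(2))
    fix v assume "v \<in> \<bb>"
    then obtain l' where l': "l' \<in> L" "v = l' b" by (auto simp: \<bb>_def)
    show "u + v \<in> \<bb>"
      unfolding \<bb>_def by (rule image_eqI[OF _ sub_add[OF insert.prems(1) l(1) l'(1)]]) (simp add: l(2) l'(2))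
  qed
  have un_L: "s *s un b \<in> L" if "s \<in> \<kk>" for s
    by (rule insert.prems(3)[OF sub_sc[OF sub_Fr un_Fr] hat_sc[OF idl_kk that]]) simp
  have kb: "\<kk> \<subseteq> \<bb>"
  proof
    fix s assume "s \<in> \<kk>"
    from un_L[OF this] show "s \<in> \<bb>" unfolding \<bb>_def by (rule rev_image_eqI) (simp add: un_def)
  qed
  from noeth[OF N b kb] obtain fs where
    fs: "set fs \<subseteq> \<bb> \<and> (\<forall>r\<in>\<bb>. \<exists>c. r - (\<Sum>i<length fs. c i * fs ! i) \<in> \<kk>)" by (elim exE)
  have "\<exists>l. l \<in> L \<and> l b = fs ! i" if "i < length fs" for i
  proof -
    have "fs ! i \<in> (\<lambda>l. l b) ` L"
      using subsetD[OF conjunct1[OF fs] nth_mem[OF that]] by (simp only: \<bb>_def)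
    then show ?thesis by (auto simp only: image_iff)
  qed
  then obtain l where l: "\<And>i. i < length fs \<Longrightarrow> l i \<in> L" "\<And>i. i < length fs \<Longrightarrow> l i b = fs ! i" by metis
  define L' where "L' = {v \<in> L. v b = 0}"
  have "sub L'" using insert.prems(1) unfolding L'_def sub_def by auto
  moreover have "L' \<subseteq> Fr B" using insert.prems(2) by (auto simp: L'_def Fr_def)
  moreover have "v \<in> L'" if "v \<in> Fr B" "v \<in> hat \<kk>" for v
    unfolding L'_def using insert.prems(3)[OF _ that(2)] that(1) insert.hyps(2) by (auto simp: Fr_def)
  ultimately obtain e and C :: "nat set" where e: "cov e C L' (hat \<kk>)" using insert.IH by blast
  note E = covD[OF e]
  define e' where "e' v = e (ev v) + linB {..<length fs} l (od v)" for v
  have el: "linB {..<length fs} l v \<in> L" for v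
    unfolding linB_def by (rule sub_sum[OF insert.prems(1)]) (use l(1) sub_sc[OF insert.prems(1)] in blast)
  have "cov e' (jnB C {..<length fs}) L (hat \<kk>)"
    unfolding cov_def
  proof (intro conjI ballI)
    show "finite (jnB C {..<length fs})" by (rule finite_jnB[OF E(1)]) simp
    show "lin e'" using E(2) lin_linB[of "{..<length fs}" l] by (simp add: e'_def lin_def sc_distrib algebra_simps)
    show "e' v \<in> L" if "v \<in> Fr (jnB C {..<length fs})" for v
      unfolding e'_def using that E(3)[of "ev v"] el by (intro sub_add[OF insert.prems(1)]) (auto simp: Fr_jnB L'_def)
    fix u assume u: "u \<in> L"
    then have "u b \<in> \<bb>" by (simp add: \<bb>_def)
    from bspec[OF conjunct2[OF fs] this] obtain c where
      c: "u b - (\<Sum>i<length fs. c i * fs ! i) \<in> \<kk>" by (elim exE)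
    define c' where "c' i = (if i < length fs then c i else 0)" for i
    have c'F: "c' \<in> Fr {..<length fs}" by (simp add: c'_def Fr_def)
    let ?s = "linB {..<length fs} l c'"
    \<comment> \<open>The combination matches \<open>u\<close> at \<open>b\<close> only modulo
      \<open>\<kk>\<close>. This vector removes the error, lies in \<open>L\<close> by
      \<open>un_L\<close>, and is zero modulo \<open>hat \<kk>\<close>.\<close>
    let ?r = "(u b - (\<Sum>i<length fs. c i * fs ! i)) *s un b"
    have sb: "?s b = (\<Sum>i<length fs. c i * fs ! i)"
      unfolding linB_def sum_fun_apply by (rule sum.cong) (auto simp: l(2) c'_def)
    have "u - ?s - ?r \<in> L'"
      unfolding L'_def using sub_diff[OF insert.prems(1) sub_diff[OF insert.prems(1) u el] un_L[OF c]] sb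
      by (simp add: un_def)
    from E(4)[OF this] obtain v where v: "v \<in> Fr C" "u - ?s - ?r - e v \<in> hat \<kk>" by blast
    have "u - e' (jn v c') = (u - ?s - ?r - e v) + ?r" by (simp add: e'_def algebra_simps)
    also have "\<dots> \<in> hat \<kk>" by (rule sub_add[OF sh v(2) hat_sc[OF idl_kk c]])
    finally show "\<exists>v\<in>Fr (jnB C {..<length fs}). u - e' v \<in> hat \<kk>"
      using v(1) c'F by (intro bexI[of _ "jn v c'"]) (simp_all add: Fr_jnB)
  qed
  then show ?case by blast
qed

end

section \<open>Modules and their quotients\<close>

lemma mk_module_simps [simp]:
  "carrier (mk_module C z p s) = C" "ring.zero (mk_module C z p s) = z"
  "ring.add (mk_module C z p s) = p" "smult (mk_module C z p s) = s"
  by (simp_all add: mk_module_def)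

lemma sub_module_simps [simp]:
  "carrier (sub_module M N) = N" "ring.zero (sub_module M N) = ring.zero M"
  "ring.add (sub_module M N) = ring.add M" "smult (sub_module M N) = smult M"
  by (simp_all add: sub_module_def)

context cring
begin

definition smod :: "('a, 'm) module \<Rightarrow> 'm set \<Rightarrow> bool"
  where "smod M N \<longleftrightarrow> N \<subseteq> carrier M \<and> \<zero>\<^bsub>M\<^esub> \<in> N \<and> (\<forall>x\<in>N. \<forall>y\<in>N. x \<oplus>\<^bsub>M\<^esub> y \<in> N) \<and>
    (\<forall>r\<in>carrier R. \<forall>x\<in>N. r \<odot>\<^bsub>M\<^esub> x \<in> N)"

lemma smodD:
  assumes "smod M N"
  shows "N \<subseteq> carrier M" "\<zero>\<^bsub>M\<^esub> \<in> N" "\<And>x y. x \<in> N \<Longrightarrow> y \<in> N \<Longrightarrow> x \<oplus>\<^bsub>M\<^esub> y \<in> N"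
    "\<And>r x. r \<in> carrier R \<Longrightarrow> x \<in> N \<Longrightarrow> r \<odot>\<^bsub>M\<^esub> x \<in> N"
  using assms by (auto simp: smod_def)

lemma smod_uminus:
  assumes "module R M" "smod M N" "x \<in> N" shows "\<ominus>\<^bsub>M\<^esub> x \<in> N"
proof -
  interpret M: module R M by fact
  have "(\<ominus> \<one>) \<odot>\<^bsub>M\<^esub> x \<in> N" by (rule smodD(4)[OF assms(2) _ assms(3)]) simp
  moreover have "x \<in> carrier M" using smodD(1)[OF assms(2)] assms(3) by blast
  ultimately show ?thesis by (simp add: M.smult_l_minus)
qed

lemma smod_minus:
  assumes "module R M" "smod M N" "x \<in> N" "y \<in> N" shows "x \<ominus>\<^bsub>M\<^esub> y \<in> N"
  unfolding a_minus_def by (rule smodD(3)[OF assms(2,3) smod_uminus[OF assms(1,2,4)]])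

lemma moduleI':
  assumes "\<And>x y. x \<in> carrier M \<Longrightarrow> y \<in> carrier M \<Longrightarrow> x \<oplus>\<^bsub>M\<^esub> y \<in> carrier M" "\<zero>\<^bsub>M\<^esub> \<in> carrier M"
    and "\<And>x y z. x \<in> carrier M \<Longrightarrow> y \<in> carrier M \<Longrightarrow> z \<in> carrier M \<Longrightarrow>
      x \<oplus>\<^bsub>M\<^esub> y \<oplus>\<^bsub>M\<^esub> z = x \<oplus>\<^bsub>M\<^esub> (y \<oplus>\<^bsub>M\<^esub> z)"
    and "\<And>x y. x \<in> carrier M \<Longrightarrow> y \<in> carrier M \<Longrightarrow> x \<oplus>\<^bsub>M\<^esub> y = y \<oplus>\<^bsub>M\<^esub> x"
    and "\<And>x. x \<in> carrier M \<Longrightarrow> \<zero>\<^bsub>M\<^esub> \<oplus>\<^bsub>M\<^esub> x = x"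
    and "\<And>x. x \<in> carrier M \<Longrightarrow> \<exists>y\<in>carrier M. y \<oplus>\<^bsub>M\<^esub> x = \<zero>\<^bsub>M\<^esub>"
    and "\<And>a x. a \<in> carrier R \<Longrightarrow> x \<in> carrier M \<Longrightarrow> a \<odot>\<^bsub>M\<^esub> x \<in> carrier M"
    and "\<And>a b x. a \<in> carrier R \<Longrightarrow> b \<in> carrier R \<Longrightarrow> x \<in> carrier M \<Longrightarrow>
      (a \<oplus> b) \<odot>\<^bsub>M\<^esub> x = (a \<odot>\<^bsub>M\<^esub> x) \<oplus>\<^bsub>M\<^esub> (b \<odot>\<^bsub>M\<^esub> x)"
    and "\<And>a x y. a \<in> carrier R \<Longrightarrow> x \<in> carrier M \<Longrightarrow> y \<in> carrier M \<Longrightarrow>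
      a \<odot>\<^bsub>M\<^esub> (x \<oplus>\<^bsub>M\<^esub> y) = (a \<odot>\<^bsub>M\<^esub> x) \<oplus>\<^bsub>M\<^esub> (a \<odot>\<^bsub>M\<^esub> y)"
    and "\<And>a b x. a \<in> carrier R \<Longrightarrow> b \<in> carrier R \<Longrightarrow> x \<in> carrier M \<Longrightarrow>
      (a \<otimes> b) \<odot>\<^bsub>M\<^esub> x = a \<odot>\<^bsub>M\<^esub> (b \<odot>\<^bsub>M\<^esub> x)"
    and "\<And>x. x \<in> carrier M \<Longrightarrow> \<one> \<odot>\<^bsub>M\<^esub> x = x"
  shows "module R M"
  by (rule moduleI[OF is_cring abelian_groupI]) (use assms in auto)

lemma module_ring: "module R (ring_as_module R)"
  unfolding ring_as_module_def
  by (rule moduleI') (auto simp: a_ac m_assoc l_distr r_distr intro!: bexI[of _ "\<ominus> _"] l_neg)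

lemma module_sub: assumes "module R M" "smod M N" shows "module R (sub_module M N)"
proof -
  interpret M: module R M by fact
  note S = smodD[OF assms(2)]
  have N: "x \<in> carrier M" if "x \<in> N" for x using S(1) that by blast
  show ?thesis
  proof (rule moduleI', simp_all add: S)
    show "\<exists>y\<in>N. y \<oplus>\<^bsub>M\<^esub> x = \<zero>\<^bsub>M\<^esub>" if "x \<in> N" for x
      using smod_uminus[OF assms that] N[OF that] M.l_neg by blast
  qed (auto simp: N M.a_ac M.smult_l_distr M.smult_r_distr M.smult_assoc1)
qed

lemma module_free: "module R (free_module R B)"
  unfolding free_module_def
proof (rule moduleI', simp_all)
  fix f g
  assume f: "(\<forall>x. f x \<in> carrier R) \<and> (\<forall>x. x \<notin> B \<longrightarrow> f x = \<zero>) \<and> finite {x. f x \<noteq> \<zero>}"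
    and g: "(\<forall>x. g x \<in> carrier R) \<and> (\<forall>x. x \<notin> B \<longrightarrow> g x = \<zero>) \<and> finite {x. g x \<noteq> \<zero>}"
  show "finite {x. f x \<oplus> g x \<noteq> \<zero>}"
    by (rule finite_subset[of _ "{x. f x \<noteq> \<zero>} \<union> {x. g x \<noteq> \<zero>}"]) (use f g in auto)
next
  fix f assume f: "(\<forall>x. f x \<in> carrier R) \<and> (\<forall>x. x \<notin> B \<longrightarrow> f x = \<zero>) \<and> finite {x. f x \<noteq> \<zero>}"
  have "finite {x. \<ominus> f x \<noteq> \<zero>}"
    by (rule finite_subset[of _ "{x. f x \<noteq> \<zero>}"]) (use f in auto)
  then show "\<exists>y. (\<forall>x. y x \<in> carrier R) \<and> (\<forall>x. x \<notin> B \<longrightarrow> y x = \<zero>) \<and> finite {x. y x \<noteq> \<zero>} \<and>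
      (\<lambda>x. y x \<oplus> f x) = (\<lambda>x. \<zero>)"
    using f by (intro exI[of _ "\<lambda>x. \<ominus> f x"]) (auto simp: l_neg)
next
  fix a f assume a: "a \<in> carrier R"
    and f: "(\<forall>x. f x \<in> carrier R) \<and> (\<forall>x. x \<notin> B \<longrightarrow> f x = \<zero>) \<and> finite {x. f x \<noteq> \<zero>}"
  show "finite {x. a \<otimes> f x \<noteq> \<zero>}"
    by (rule finite_subset[of _ "{x. f x \<noteq> \<zero>}"]) (use a f in auto)
qed (auto simp: a_ac m_assoc l_distr r_distr fun_eq_iff)

subsection \<open>Semilinear maps\<close>

text \<open>Maps from vectors to an \<open>R\<close>-module that are linear along
  \<open>\<pi>\<close>; with them a module over \<open>R\<close> is presented by coordinate vectors
  over the free ring.\<close>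

definition slin :: "('a, 'm) module \<Rightarrow> ((nat \<Rightarrow> 'a frng) \<Rightarrow> 'm) \<Rightarrow> bool"
  where "slin M \<phi> \<longleftrightarrow> (\<forall>v. \<phi> v \<in> carrier M) \<and> (\<forall>u v. \<phi> (u + v) = \<phi> u \<oplus>\<^bsub>M\<^esub> \<phi> v) \<and>
    (\<forall>r v. \<phi> (r *s v) = \<pi> r \<odot>\<^bsub>M\<^esub> \<phi> v)"

lemma slinD:
  assumes "slin M \<phi>"
  shows "\<And>v. \<phi> v \<in> carrier M" "\<And>u v. \<phi> (u + v) = \<phi> u \<oplus>\<^bsub>M\<^esub> \<phi> v" "\<And>r v. \<phi> (r *s v) = \<pi> r \<odot>\<^bsub>M\<^esub> \<phi> v"
  using assms by (auto simp: slin_def)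

lemma slin_zero: assumes "module R M" "slin M \<phi>" shows "\<phi> 0 = \<zero>\<^bsub>M\<^esub>"
proof -
  interpret M: module R M by fact
  show ?thesis using slinD(3)[OF assms(2), of 0 0] slinD(1)[OF assms(2)] by simp
qed

lemma slin_minus: assumes "module R M" "slin M \<phi>" shows "\<phi> (u - v) = \<phi> u \<ominus>\<^bsub>M\<^esub> \<phi> v"
proof -
  interpret M: module R M by fact
  note S = slinD[OF assms(2)]
  have "\<phi> (u - v) = \<phi> (u + (-1) *s v)" by (simp add: sc_distrib)
  also have "\<dots> = \<phi> u \<ominus>\<^bsub>M\<^esub> \<phi> v" using S(1) by (simp only: S(2,3) pi_uminus pi_one) (simp add: M.smult_l_minus M.minus_eq)
  finally show ?thesis .
qed

lemma slin_ex:
  assumes "module R M" "finite B" "\<And>i. i \<in> B \<Longrightarrow> a i \<in> carrier M"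
  shows "\<exists>\<phi>. slin M \<phi> \<and> (\<forall>i\<in>B. \<phi> (un i) = a i)"
  using assms(2,3)
proof (induction B)
  interpret M: module R M by fact
  case empty
  have "slin M (\<lambda>_. \<zero>\<^bsub>M\<^esub>)" by (simp add: slin_def)
  then show ?case by blast
next
  interpret M: module R M by fact
  case (insert b B)
  then obtain \<phi> where \<phi>: "slin M \<phi>" "\<forall>i\<in>B. \<phi> (un i) = a i" by auto
  note S = slinD[OF \<phi>(1)]
  have ab: "a b \<in> carrier M" using insert.prems by blast
  let ?\<phi> = "\<lambda>v. \<phi> (v(b := 0)) \<oplus>\<^bsub>M\<^esub> \<pi> (v b) \<odot>\<^bsub>M\<^esub> a b"
  have u1: "(u + v)(b := 0) = u(b := 0) + v(b := 0)" for u v :: "nat \<Rightarrow> 'a frng" by (auto simp: fun_eq_iff)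
  have u2: "(r *s v)(b := 0) = r *s v(b := 0)" for r and v :: "nat \<Rightarrow> 'a frng" by (auto simp: fun_eq_iff)
  have u3: "(un i)(b := 0) = (un i :: _ \<Rightarrow> 'a frng)" if "i \<noteq> b" for i using that by (auto simp: fun_eq_iff un_def)
  have u4: "(un b)(b := 0) = (0 :: _ \<Rightarrow> 'a frng)" by (auto simp: fun_eq_iff un_def)
  have "slin M ?\<phi>"
    unfolding slin_def using S(1) ab
    by (simp add: u1 u2 S(2,3) M.smult_l_distr M.smult_r_distr M.smult_assoc1 M.a_ac)
  moreover have "?\<phi> (un i) = a i" if "i \<in> insert b B" for i
  proof (cases "i = b")
    case True
    then show ?thesis using ab by (simp add: u4 slin_zero[OF assms(1) \<phi>(1)]) (simp add: un_def)
  next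
    case False
    then have "i \<in> B" "un i b = (0 :: 'a frng)" using that by (auto simp: un_def)
    then show ?thesis using \<phi>(2) False ab insert.prems by (simp add: u3)
  qed
  ultimately show ?case by blast
qed

lemma slin_sub:
  assumes "module R M" "slin M \<phi>" "smod M T" shows "sub {v. \<phi> v \<in> T}"
  using smodD[OF assms(3)] by (simp add: sub_def slinD(2,3)[OF assms(2)] slin_zero[OF assms(1,2)])

lemma smod_zero: assumes "module R M" shows "smod M {\<zero>\<^bsub>M\<^esub>}"
proof -
  interpret M: module R M by fact
  show ?thesis by (simp add: smod_def)
qed

lemma smod_carrier: assumes "module R M" shows "smod M (carrier M)"
proof -
  interpret M: module R M by fact
  show ?thesis by (simp add: smod_def)
qed

lemma slin_hat:
  assumes "module R M" "slin M \<phi>" "finite B" "v \<in> Fr B" "v \<in> hat \<kk>"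
  shows "\<phi> v = \<zero>\<^bsub>M\<^esub>"
proof -
  interpret M: module R M by fact
  have "v \<in> {v. \<phi> v \<in> {\<zero>\<^bsub>M\<^esub>}}"
    by (rule lin_hat_into[OF assms(3) lin_intros(1) slin_sub[OF assms(1,2) smod_zero[OF assms(1)]] _ assms(4,5)])
       (auto simp: slinD[OF assms(2)] pre_def)
  then show ?thesis by simp
qed

lemma slin_eqI:
  assumes "module R M" "slin M \<phi>" "slin M \<psi>" "finite B" "\<And>i. i \<in> B \<Longrightarrow> \<phi> (un i) = \<psi> (un i)" "v \<in> Fr B"
  shows "\<phi> v = \<psi> v"
proof -
  interpret M: module R M by fact
  have "sub {v. \<phi> v = \<psi> v}"
    by (simp add: sub_def slinD(2,3)[OF assms(2)] slinD(2,3)[OF assms(3)] slin_zero[OF assms(1,2)] slin_zero[OF assms(1,3)])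
  from lin_into[OF assms(4) lin_intros(1) this _ assms(6)] show ?thesis using assms(5) by simp
qed

subsection \<open>Quotients\<close>

lemma abelian_subgroup_smod:
  assumes "module R M" "smod M N" shows "abelian_subgroup N M"
proof -
  interpret M: module R M by fact
  note S = smodD[OF assms(2)]
  show ?thesis
  proof (rule abelian_subgroupI3)
    show "additive_subgroup N M"
    proof (rule additive_subgroupI, rule M.add.subgroupI)
      show "\<ominus>\<^bsub>M\<^esub> a \<in> N" if "a \<in> N" for a by (rule smod_uminus[OF assms that])
    qed (use S in auto)
  qed (rule M.abelian_group_axioms)
qed

lemma quot:
  assumes "module R M" "smod M N"
  shows "carrier (quotient_module M N) = (\<lambda>x. N +>\<^bsub>M\<^esub> x) ` carrier M"
    "\<And>x y. x \<in> carrier M \<Longrightarrow> y \<in> carrier M \<Longrightarrow>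
      (N +>\<^bsub>M\<^esub> x) \<oplus>\<^bsub>quotient_module M N\<^esub> (N +>\<^bsub>M\<^esub> y) = N +>\<^bsub>M\<^esub> (x \<oplus>\<^bsub>M\<^esub> y)"
    "\<And>r x. r \<in> carrier R \<Longrightarrow> x \<in> carrier M \<Longrightarrow>
      r \<odot>\<^bsub>quotient_module M N\<^esub> (N +>\<^bsub>M\<^esub> x) = N +>\<^bsub>M\<^esub> (r \<odot>\<^bsub>M\<^esub> x)"
    "\<zero>\<^bsub>quotient_module M N\<^esub> = N" "N +>\<^bsub>M\<^esub> \<zero>\<^bsub>M\<^esub> = N"
    "\<And>x y. x \<in> carrier M \<Longrightarrow> y \<in> carrier M \<Longrightarrow> N +>\<^bsub>M\<^esub> x = N +>\<^bsub>M\<^esub> y \<longleftrightarrow> x \<ominus>\<^bsub>M\<^esub> y \<in> N"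
proof -
  interpret M: module R M by fact
  interpret A: abelian_subgroup N M by (rule abelian_subgroup_smod[OF assms])
  note S = smodD[OF assms(2)]
  show "carrier (quotient_module M N) = (\<lambda>x. N +>\<^bsub>M\<^esub> x) ` carrier M"
    by (auto simp: quotient_module_def A_RCOSETS_def')
  show "(N +>\<^bsub>M\<^esub> x) \<oplus>\<^bsub>quotient_module M N\<^esub> (N +>\<^bsub>M\<^esub> y) = N +>\<^bsub>M\<^esub> (x \<oplus>\<^bsub>M\<^esub> y)"
    if "x \<in> carrier M" "y \<in> carrier M" for x y
    using A.a_rcos_sum[OF that] by (simp add: quotient_module_def)
  show "\<zero>\<^bsub>quotient_module M N\<^esub> = N" by (simp add: quotient_module_def)
  show "N +>\<^bsub>M\<^esub> \<zero>\<^bsub>M\<^esub> = N" using S(1) by simp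
  show eq: "N +>\<^bsub>M\<^esub> x = N +>\<^bsub>M\<^esub> y \<longleftrightarrow> x \<ominus>\<^bsub>M\<^esub> y \<in> N" if "x \<in> carrier M" "y \<in> carrier M" for x y
  proof
    assume "N +>\<^bsub>M\<^esub> x = N +>\<^bsub>M\<^esub> y"
    then have "x \<in> N +>\<^bsub>M\<^esub> y" using A.a_rcos_self[OF that(1)] by simp
    then show "x \<ominus>\<^bsub>M\<^esub> y \<in> N" using A.a_rcos_module[OF that(2,1)] by (simp add: a_minus_def)
  next
    assume "x \<ominus>\<^bsub>M\<^esub> y \<in> N"
    then have "x \<in> N +>\<^bsub>M\<^esub> y" using A.a_rcos_module[OF that(2,1)] by (simp add: a_minus_def)
    then show "N +>\<^bsub>M\<^esub> x = N +>\<^bsub>M\<^esub> y" using M.a_repr_independence[OF _ that(2) A.a_subgroup] by metis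
  qed
  show "r \<odot>\<^bsub>quotient_module M N\<^esub> (N +>\<^bsub>M\<^esub> x) = N +>\<^bsub>M\<^esub> (r \<odot>\<^bsub>M\<^esub> x)"
    if r: "r \<in> carrier R" and x: "x \<in> carrier M" for r x
  proof -
    \<comment> \<open>All cosets in the union that defines scalar multiplication coincide, so the
      union is a single coset.\<close>
    have "N +>\<^bsub>M\<^esub> (r \<odot>\<^bsub>M\<^esub> y) = N +>\<^bsub>M\<^esub> (r \<odot>\<^bsub>M\<^esub> x)" if y: "y \<in> N +>\<^bsub>M\<^esub> x" for y
    proof -
      from y obtain h where h: "h \<in> N" "y = h \<oplus>\<^bsub>M\<^esub> x" by (auto simp: a_r_coset_def')
      have hM: "h \<in> carrier M" using S(1) h(1) by blast
      have "r \<odot>\<^bsub>M\<^esub> y \<ominus>\<^bsub>M\<^esub> r \<odot>\<^bsub>M\<^esub> x = r \<odot>\<^bsub>M\<^esub> h"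
        using h hM r x by (simp add: M.smult_r_distr M.minus_eq M.a_assoc M.r_neg)
      then show ?thesis using eq h hM r x S(4)[OF r h(1)] by simp
    qed
    then have "(\<Union>y\<in>N +>\<^bsub>M\<^esub> x. N +>\<^bsub>M\<^esub> (r \<odot>\<^bsub>M\<^esub> y)) = (\<Union>y\<in>N +>\<^bsub>M\<^esub> x. N +>\<^bsub>M\<^esub> (r \<odot>\<^bsub>M\<^esub> x))"
      by (intro SUP_cong) simp_all
    also have "\<dots> = N +>\<^bsub>M\<^esub> (r \<odot>\<^bsub>M\<^esub> x)" using A.a_rcos_self[OF x] by blast
    finally show ?thesis by (simp only: quotient_module_def mk_module_simps)
  qed
qed

lemma quot_closed:
  assumes "module R M" "smod M N" "x \<in> carrier M" shows "N +>\<^bsub>M\<^esub> x \<in> carrier (quotient_module M N)"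
  using quot(1)[OF assms(1,2)] assms(3) by blast

lemma power_simps [simp]:
  "carrier (power_module M n) = {..<n} \<rightarrow>\<^sub>E carrier M"
  "\<zero>\<^bsub>power_module M n\<^esub> = (\<lambda>i\<in>{..<n}. \<zero>\<^bsub>M\<^esub>)"
  "f \<oplus>\<^bsub>power_module M n\<^esub> g = (\<lambda>i\<in>{..<n}. f i \<oplus>\<^bsub>M\<^esub> g i)"
  "r \<odot>\<^bsub>power_module M n\<^esub> f = (\<lambda>i\<in>{..<n}. r \<odot>\<^bsub>M\<^esub> f i)"
  by (simp_all add: power_module_def)

lemma ring_simps [simp]:
  "carrier (ring_as_module R) = carrier R" "\<zero>\<^bsub>ring_as_module R\<^esub> = \<zero>"
  "x \<oplus>\<^bsub>ring_as_module R\<^esub> y = x \<oplus> y" "x \<odot>\<^bsub>ring_as_module R\<^esub> y = x \<otimes> y"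
  by (simp_all add: ring_as_module_def)

lemma ring_as_module_minus:
  assumes "x \<in> carrier R" "y \<in> carrier R" shows "x \<ominus>\<^bsub>ring_as_module R\<^esub> y = x \<ominus> y"
proof -
  interpret M: module R "ring_as_module R" by (rule module_ring)
  have "\<ominus>\<^bsub>ring_as_module R\<^esub> y = \<ominus> y"
    by (rule M.minus_equality) (use assms in \<open>simp_all add: l_neg\<close>)
  then show ?thesis by (simp add: a_minus_def)
qed

lemma smod_ideal: assumes "ideal I R" shows "smod (ring_as_module R) I"
proof -
  interpret ideal I R by fact
  show ?thesis by (auto simp: smod_def I_l_closed)
qed

abbreviation cosI where "cosI I x \<equiv> I +>\<^bsub>ring_as_module R\<^esub> x"

lemma cosI_eq: "ideal I R \<Longrightarrow> cosI I (\<pi> r) = cosI I (\<pi> s) \<longleftrightarrow> r - s \<in> pre I"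
  using quot(6)[OF module_ring smod_ideal, of I "\<pi> r" "\<pi> s"] by (simp add: ring_as_module_minus pre_def)

lemma quotI_elem:
  assumes "ideal I R" "g \<in> carrier (quotient_module (ring_as_module R) I)"
  shows "\<exists>s. g = cosI I (\<pi> s)"
proof -
  from assms obtain x where "x \<in> carrier R" "g = cosI I x" using quot(1)[OF module_ring smod_ideal] by auto
  then show ?thesis by (intro exI[of _ "fvar x"]) simp
qed

lemma quotI_ops:
  assumes "ideal I R"
  shows "cosI I (\<pi> r) \<in> carrier (quotient_module (ring_as_module R) I)"
    "cosI I (\<pi> r) \<oplus>\<^bsub>quotient_module (ring_as_module R) I\<^esub> cosI I (\<pi> s) = cosI I (\<pi> (r + s))"
    "\<pi> r \<odot>\<^bsub>quotient_module (ring_as_module R) I\<^esub> cosI I (\<pi> s) = cosI I (\<pi> (r * s))"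
    "\<zero>\<^bsub>quotient_module (ring_as_module R) I\<^esub> = cosI I (\<pi> 0)"
  using quot[OF module_ring smod_ideal[OF assms]] by simp_all

definition pw :: "'a set \<Rightarrow> nat \<Rightarrow> (nat \<Rightarrow> 'a frng) \<Rightarrow> nat \<Rightarrow> 'a set"
  where "pw I n v = (\<lambda>i\<in>{..<n}. cosI I (\<pi> (v i)))"

lemma pw:
  fixes n :: nat
  assumes I: "ideal I R"
  defines "P \<equiv> power_module (quotient_module (ring_as_module R) I) n"
  shows "pw I n v \<in> carrier P" "pw I n u \<oplus>\<^bsub>P\<^esub> pw I n v = pw I n (u + v)"
    "\<pi> r \<odot>\<^bsub>P\<^esub> pw I n v = pw I n (r *s v)" "\<zero>\<^bsub>P\<^esub> = pw I n 0"
    "u \<in> Fr {..<n} \<Longrightarrow> v \<in> Fr {..<n} \<Longrightarrow> pw I n u = pw I n v \<longleftrightarrow> u - v \<in> hat (pre I)"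
    "g \<in> carrier P \<Longrightarrow> \<exists>v\<in>Fr {..<n}. g = pw I n v"
proof -
  note q = quotI_ops[OF I]
  show "pw I n v \<in> carrier P" "pw I n u \<oplus>\<^bsub>P\<^esub> pw I n v = pw I n (u + v)"
    "\<pi> r \<odot>\<^bsub>P\<^esub> pw I n v = pw I n (r *s v)" "\<zero>\<^bsub>P\<^esub> = pw I n 0"
    unfolding P_def pw_def by (auto simp: q simp del: pi_add pi_mult pi_zero intro!: restrict_ext)
  show "pw I n u = pw I n v \<longleftrightarrow> u - v \<in> hat (pre I)" if "u \<in> Fr {..<n}" "v \<in> Fr {..<n}"
  proof -
    have "pw I n u = pw I n v \<longleftrightarrow> (\<forall>i<n. cosI I (\<pi> (u i)) = cosI I (\<pi> (v i)))"
      unfolding pw_def by (auto simp: fun_eq_iff restrict_def)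
    also have "\<dots> \<longleftrightarrow> (\<forall>i<n. u i - v i \<in> pre I)" by (simp only: cosI_eq[OF I])
    also have "\<dots> \<longleftrightarrow> (\<forall>i. u i - v i \<in> pre I)"
    proof -
      have "u i - v i \<in> pre I" if "\<not> i < n" for i
      proof -
        have "u i = 0" "v i = 0" using \<open>u \<in> _\<close> \<open>v \<in> _\<close> that by (simp_all add: Fr_def)
        then show ?thesis using idl_zero[OF idl_pre[OF I]] by (simp only: diff_zero)
      qed
      then show ?thesis by blast
    qed
    finally show ?thesis by (simp only: hat_def mem_Collect_eq minus_apply)
  qed
  show "\<exists>v\<in>Fr {..<n}. g = pw I n v" if g: "g \<in> carrier P"
  proof -
    have "\<exists>s. g i = cosI I (\<pi> s)" if "i < n" for i
      by (rule quotI_elem[OF I]) (use g that in \<open>auto simp: P_def\<close>)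
    then obtain s where s: "\<And>i. i < n \<Longrightarrow> g i = cosI I (\<pi> (s i))" by metis
    define v where "v i = (if i < n then s i else 0)" for i
    have "v \<in> Fr {..<n}" by (simp add: v_def Fr_def)
    moreover have "g = pw I n v" unfolding pw_def
      by (rule extensionalityI[of _ "{..<n}"]) (use g s in \<open>auto simp: v_def P_def PiE_def\<close>)
    ultimately show ?thesis by blast
  qed
qed

text \<open>The quotient \<open>M/N\<close> is free over \<open>R/I\<close> on the classes of the \<open>\<phi> (un i)\<close>, \<open>i \<in> C\<close>.\<close>

definition fbas where
  "fbas M N I C \<phi> \<longleftrightarrow> slin M \<phi> \<and> (\<forall>v\<in>Fr C. \<phi> v \<in> N \<longleftrightarrow> v \<in> hat (pre I)) \<and> (\<forall>m\<in>carrier M. \<exists>v\<in>Fr C. m \<ominus>\<^bsub>M\<^esub> \<phi> v \<in> N)"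

text \<open>Pull the unit vectors of the power back along the isomorphism and choose representatives
  in \<open>M\<close>; agreement on unit vectors propagates by linearity.\<close>

lemma iso_fbas:
  assumes M: "module R M" and N: "smod M N" and I: "ideal I R"
    and iso: "isomorphic_modules R (quotient_module M N) (power_module (quotient_module (ring_as_module R) I) n)"
  shows "\<exists>\<phi>. fbas M N I {..<n} \<phi>"
proof -
  interpret M: module R M by fact
  note q = quot[OF M N] and p = pw[OF I, where n = n]
  let ?P = "power_module (quotient_module (ring_as_module R) I) n"
  from iso obtain f where f: "f \<in> module_hom R (quotient_module M N) ?P"
    "bij_betw f (carrier (quotient_module M N)) (carrier ?P)" by (auto simp: isomorphic_modules_def module_iso_def)
  have fa: "f (x \<oplus>\<^bsub>quotient_module M N\<^esub> y) = f x \<oplus>\<^bsub>?P\<^esub> f y"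
    if "x \<in> carrier (quotient_module M N)" "y \<in> carrier (quotient_module M N)" for x y
    using f(1) that unfolding module_hom_def by blast
  have fs: "f (r \<odot>\<^bsub>quotient_module M N\<^esub> x) = r \<odot>\<^bsub>?P\<^esub> f x"
    if "r \<in> carrier R" "x \<in> carrier (quotient_module M N)" for r x
    using f(1) that unfolding module_hom_def by blast
  have inj: "f x = f y \<longleftrightarrow> x = y" if "x \<in> carrier (quotient_module M N)" "y \<in> carrier (quotient_module M N)" for x y
    using f(2) that by (auto simp: bij_betw_def inj_on_def)
  have onto: "\<exists>m\<in>carrier M. f (N +>\<^bsub>M\<^esub> m) = g" if "g \<in> carrier ?P" for g
  proof -
    have "g \<in> f ` carrier (quotient_module M N)" using f(2) that by (simp only: bij_betw_def)
    then show ?thesis unfolding q(1) by blast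
  qed
  have "\<forall>i. \<exists>m. m \<in> carrier M \<and> f (N +>\<^bsub>M\<^esub> m) = pw I n (un i)" using onto[OF p(1)] by blast
  then obtain a where a: "\<And>i. a i \<in> carrier M" "\<And>i. f (N +>\<^bsub>M\<^esub> a i) = pw I n (un i)" by metis
  obtain \<phi> where \<phi>: "slin M \<phi>" "\<And>i. i \<in> {..<n} \<Longrightarrow> \<phi> (un i) = a i"
    using slin_ex[OF M, of "{..<n}" a] a(1) by auto
  note S = slinD[OF \<phi>(1)]
  let ?T = "{v. f (N +>\<^bsub>M\<^esub> \<phi> v) = pw I n v}"
  have qc: "N +>\<^bsub>M\<^esub> \<phi> v \<in> carrier (quotient_module M N)" for v by (rule quot_closed[OF M N S(1)])
  have T: "sub ?T"
    unfolding sub_def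
  proof (intro conjI ballI allI CollectI)
    fix u v assume "u \<in> ?T" "v \<in> ?T"
    then show "f (N +>\<^bsub>M\<^esub> \<phi> (u + v)) = pw I n (u + v)"
      using fa[OF qc qc, of u v] by (simp only: S(2) q(2)[OF S(1) S(1)] p(2) mem_Collect_eq)
  next
    have sc: "f (N +>\<^bsub>M\<^esub> \<phi> (r *s v)) = \<pi> r \<odot>\<^bsub>?P\<^esub> f (N +>\<^bsub>M\<^esub> \<phi> v)" for r v
      using fs[OF pi_closed qc, of r v] by (simp only: S(3) q(3)[OF pi_closed S(1)])
    show "f (N +>\<^bsub>M\<^esub> \<phi> (r *s v)) = pw I n (r *s v)" if "v \<in> ?T" for r v
      using that sc[of r v] by (simp only: p(3) mem_Collect_eq)
    obtain w where w: "f (N +>\<^bsub>M\<^esub> \<phi> 0) = pw I n w"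
      using f(1) qc[of 0] p(6) unfolding module_hom_def by blast
    have "\<phi> 0 = \<phi> (0 *s 0)" by simp
    then have "f (N +>\<^bsub>M\<^esub> \<phi> 0) = pw I n (0 *s w)" using sc[of 0 0] w by (simp only: p(3))
    then show "f (N +>\<^bsub>M\<^esub> \<phi> 0) = pw I n 0" by simp
  qed
  have T': "f (N +>\<^bsub>M\<^esub> \<phi> v) = pw I n v" if "v \<in> Fr {..<n}" for v
    using lin_into[OF _ lin_intros(1) T _ that] \<phi>(2) a(2) by simp
  have "fbas M N I {..<n} \<phi>"
    unfolding fbas_def
  proof (intro conjI ballI)
    fix v :: "nat \<Rightarrow> 'a frng" assume v: "v \<in> Fr {..<n}"
    have z: "0 \<in> Fr {..<n}" by (rule sub_zero[OF sub_Fr])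
    have "\<phi> v \<in> N \<longleftrightarrow> N +>\<^bsub>M\<^esub> \<phi> v = N +>\<^bsub>M\<^esub> \<phi> 0"
      using q(6)[OF S(1) S(1), of v 0] slin_minus[OF M \<phi>(1), of v 0] by simp
    also have "\<dots> \<longleftrightarrow> v \<in> hat (pre I)"
      using inj[OF qc qc, of v 0] p(5)[OF v z] by (simp add: T'[OF v] T'[OF z])
    finally show "\<phi> v \<in> N \<longleftrightarrow> v \<in> hat (pre I)" .
  next
    fix m assume m: "m \<in> carrier M"
    have "f (N +>\<^bsub>M\<^esub> m) \<in> carrier ?P" using f(1) quot_closed[OF M N m] unfolding module_hom_def by blast
    then obtain v where v: "v \<in> Fr {..<n}" "f (N +>\<^bsub>M\<^esub> m) = pw I n v" using p(6) by blast
    then have "N +>\<^bsub>M\<^esub> m = N +>\<^bsub>M\<^esub> \<phi> v" using inj[OF quot_closed[OF M N m] qc] T'[OF v(1)] by metis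
    then show "\<exists>v\<in>Fr {..<n}. m \<ominus>\<^bsub>M\<^esub> \<phi> v \<in> N" using q(6)[OF m S(1)] v(1) by blast
  qed (rule \<phi>(1))
  then show ?thesis by blast
qed

text \<open>Coordinates of a class are picked by \<open>SOME\<close>. They are determined modulo
  \<open>hat (pre I)\<close>, and \<open>pw\<close> forgets precisely that ambiguity.\<close>

lemma fbas_iso:
  assumes M: "module R M" and N: "smod M N" and I: "ideal I R" and b: "fbas M N I {..<n} \<phi>"
  shows "isomorphic_modules R (quotient_module M N) (power_module (quotient_module (ring_as_module R) I) n)"
proof -
  interpret M: module R M by fact
  note q = quot[OF M N] and p = pw[OF I, where n = n]
  have \<phi>: "slin M \<phi>" "\<And>v. v \<in> Fr {..<n} \<Longrightarrow> \<phi> v \<in> N \<longleftrightarrow> v \<in> hat (pre I)"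
    "\<And>m. m \<in> carrier M \<Longrightarrow> \<exists>v\<in>Fr {..<n}. m \<ominus>\<^bsub>M\<^esub> \<phi> v \<in> N" using b unfolding fbas_def by blast+
  note S = slinD[OF \<phi>(1)]
  let ?P = "power_module (quotient_module (ring_as_module R) I) n"
  let ?Q = "quotient_module M N"
  define f where "f c = pw I n (SOME v. v \<in> Fr {..<n} \<and> c = N +>\<^bsub>M\<^esub> \<phi> v)" for c
  have qc: "N +>\<^bsub>M\<^esub> \<phi> v \<in> carrier ?Q" for v by (rule quot_closed[OF M N S(1)])
  have eq: "N +>\<^bsub>M\<^esub> \<phi> u = N +>\<^bsub>M\<^esub> \<phi> v \<longleftrightarrow> pw I n u = pw I n v" if "u \<in> Fr {..<n}" "v \<in> Fr {..<n}" for u v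
    using q(6)[OF S(1) S(1), of u v] \<phi>(2)[OF sub_diff[OF sub_Fr that]] p(5)[OF that]
    by (simp only: slin_minus[OF M \<phi>(1)])
  have f: "f (N +>\<^bsub>M\<^esub> \<phi> v) = pw I n v" if v: "v \<in> Fr {..<n}" for v
  proof -
    let ?v = "SOME u. u \<in> Fr {..<n} \<and> N +>\<^bsub>M\<^esub> \<phi> v = N +>\<^bsub>M\<^esub> \<phi> u"
    have "?v \<in> Fr {..<n} \<and> N +>\<^bsub>M\<^esub> \<phi> v = N +>\<^bsub>M\<^esub> \<phi> ?v"
      by (rule someI[of _ v]) (use v in simp)
    then show ?thesis using eq[OF v] unfolding f_def by metis
  qed
  have el: "\<exists>v\<in>Fr {..<n}. c = N +>\<^bsub>M\<^esub> \<phi> v" if "c \<in> carrier ?Q" for c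
  proof -
    from that obtain m where m: "m \<in> carrier M" "c = N +>\<^bsub>M\<^esub> m" unfolding q(1) by blast
    from \<phi>(3)[OF m(1)] obtain v where v: "v \<in> Fr {..<n}" "m \<ominus>\<^bsub>M\<^esub> \<phi> v \<in> N" by blast
    then show ?thesis using q(6)[OF m(1) S(1)] m(2) by blast
  qed
  have "f \<in> module_hom R ?Q ?P"
    unfolding module_hom_def
  proof (intro CollectI conjI ballI)
    show "f \<in> carrier ?Q \<rightarrow> carrier ?P"
    proof
      fix c assume "c \<in> carrier ?Q"
      from el[OF this] show "f c \<in> carrier ?P" using f p(1) by metis
    qed
    fix c assume "c \<in> carrier ?Q"
    then obtain u where u: "u \<in> Fr {..<n}" "c = N +>\<^bsub>M\<^esub> \<phi> u" using el by blast
    show "f (c \<oplus>\<^bsub>?Q\<^esub> c') = f c \<oplus>\<^bsub>?P\<^esub> f c'" if "c' \<in> carrier ?Q" for c'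
    proof -
      obtain v where v: "v \<in> Fr {..<n}" "c' = N +>\<^bsub>M\<^esub> \<phi> v" using el \<open>c' \<in> _\<close> by blast
      have "c \<oplus>\<^bsub>?Q\<^esub> c' = N +>\<^bsub>M\<^esub> \<phi> (u + v)" by (simp only: u(2) v(2) q(2)[OF S(1) S(1)] S(2))
      then show ?thesis using f[OF sub_add[OF sub_Fr u(1) v(1)]] f[OF u(1)] f[OF v(1)]
        by (simp only: u(2) v(2) p(2))
    qed
    show "f (r \<odot>\<^bsub>?Q\<^esub> c) = r \<odot>\<^bsub>?P\<^esub> f c" if r: "r \<in> carrier R" for r
    proof -
      have r': "r = \<pi> (fvar r)" using r by simp
      have "r \<odot>\<^bsub>?Q\<^esub> c = N +>\<^bsub>M\<^esub> \<phi> (fvar r *s u)"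
        unfolding u(2) q(3)[OF r S(1)] S(3) r'[symmetric] ..
      then show ?thesis using f[OF sub_sc[OF sub_Fr u(1)]] f[OF u(1)] p(3)[of "fvar r" u] r' u(2) by metis
    qed
  qed
  moreover have "bij_betw f (carrier ?Q) (carrier ?P)"
    unfolding bij_betw_def
  proof
    show "inj_on f (carrier ?Q)"
      by (rule inj_onI) (metis el f eq)
    show "f ` carrier ?Q = carrier ?P"
    proof
      show "f ` carrier ?Q \<subseteq> carrier ?P" using el f p(1) by (metis image_subsetI)
      show "carrier ?P \<subseteq> f ` carrier ?Q"
      proof
        fix g assume "g \<in> carrier ?P"
        from p(6)[OF this] obtain v where "v \<in> Fr {..<n}" "g = pw I n v" by blast
        then show "g \<in> f ` carrier ?Q" using f qc by (metis image_eqI)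
      qed
    qed
  qed
  ultimately show ?thesis unfolding isomorphic_modules_def module_iso_def by blast
qed

end

section \<open>Totally reflexive modules\<close>

text \<open>The vector-valued counterpart of \<open>mlf\<close>: maps assembled from chosen
  representatives respect sums, scalars and relations only modulo \<open>W'\<close>.\<close>

definition qlin where
  "qlin U W W' f \<longleftrightarrow> (\<forall>u\<in>U. \<forall>v\<in>U. f (u + v) - (f u + f v) \<in> W') \<and> (\<forall>r. \<forall>u\<in>U. f (r *s u) - r *s f u \<in> W') \<and>
    (\<forall>u\<in>U. u \<in> W \<longrightarrow> f u \<in> W')"

lemma qlinD:
  assumes "qlin U W W' f"
  shows "\<And>u v. u \<in> U \<Longrightarrow> v \<in> U \<Longrightarrow> f (u + v) - (f u + f v) \<in> W'"
    "\<And>r u. u \<in> U \<Longrightarrow> f (r *s u) - r *s f u \<in> W'" "\<And>u. u \<in> U \<Longrightarrow> u \<in> W \<Longrightarrow> f u \<in> W'"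
  using assms by (auto simp: qlin_def)

lemma qlin_lin:
  assumes "lin f" "sub W'" "\<And>u. u \<in> U \<Longrightarrow> u \<in> W \<Longrightarrow> f u \<in> W'" shows "qlin U W W' f"
  unfolding qlin_def using assms(3) sub_zero[OF assms(2)] by (simp add: lin_simps[OF assms(1)])

lemma qlin_diff:
  assumes "qlin U W W' f" "qlin U W W' g" "sub W'" shows "qlin U W W' (\<lambda>u. f u - g u)"
proof -
  note F = qlinD[OF assms(1)] and G = qlinD[OF assms(2)]
  have "f (u + v) - g (u + v) - (f u - g u + (f v - g v)) \<in> W'" if "u \<in> U" "v \<in> U" for u v
  proof -
    have "f (u + v) - g (u + v) - (f u - g u + (f v - g v)) = (f (u + v) - (f u + f v)) - (g (u + v) - (g u + g v))"
      by (simp add: algebra_simps)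
    then show ?thesis using sub_diff[OF assms(3) F(1)[OF that] G(1)[OF that]] by (simp only:)
  qed
  moreover have "f (r *s u) - g (r *s u) - r *s (f u - g u) \<in> W'" if "u \<in> U" for r u
  proof -
    have "f (r *s u) - g (r *s u) - r *s (f u - g u) = (f (r *s u) - r *s f u) - (g (r *s u) - r *s g u)"
      by (simp add: sc_distrib algebra_simps)
    then show ?thesis using sub_diff[OF assms(3) F(2)[OF that] G(2)[OF that]] by (simp only:)
  qed
  moreover have "f u - g u \<in> W'" if "u \<in> U" "u \<in> W" for u
    by (rule sub_diff[OF assms(3) F(3)[OF that] G(3)[OF that]])
  ultimately show ?thesis unfolding qlin_def by blast
qed

lemma qlin_comp_lin:
  assumes f: "qlin U W W' f" and g: "lin g" "\<And>v. v \<in> U0 \<Longrightarrow> g v \<in> U" "\<And>v. v \<in> U0 \<Longrightarrow> v \<in> W0 \<Longrightarrow> g v \<in> W"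
  shows "qlin U0 W0 W' (\<lambda>v. f (g v))"
  unfolding qlin_def using qlinD[OF f] g(2,3) by (simp add: lin_simps[OF g(1)])

lemma lin_qlin:
  assumes f: "qlin U W W' f" and g: "lin g" "\<And>v. v \<in> W' \<Longrightarrow> v \<in> U' \<Longrightarrow> g v \<in> W''"
    and U: "sub U" "sub U'" "\<And>u. u \<in> U \<Longrightarrow> f u \<in> U'"
  shows "qlin U W W'' (\<lambda>u. g (f u))"
proof -
  note F = qlinD[OF f]
  have "g (f (u + v)) - (g (f u) + g (f v)) \<in> W''" if uv: "u \<in> U" "v \<in> U" for u v
  proof -
    have "f (u + v) - (f u + f v) \<in> U'"
      by (intro sub_diff[OF U(2)] sub_add[OF U(2)] U(3) sub_add[OF U(1)] uv)
    from g(2)[OF F(1)[OF uv] this] show ?thesis by (simp only: lin_simps[OF g(1)])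
  qed
  moreover have "g (f (r *s u)) - r *s g (f u) \<in> W''" if u: "u \<in> U" for r u
  proof -
    have "f (r *s u) - r *s f u \<in> U'"
      by (intro sub_diff[OF U(2)] sub_sc[OF U(2)] U(3) sub_sc[OF U(1)] u)
    from g(2)[OF F(2)[OF u] this] show ?thesis by (simp only: lin_simps[OF g(1)])
  qed
  ultimately show ?thesis unfolding qlin_def using F(3) g(2) U(3) by blast
qed

text \<open>On a finite free module the values at unit vectors define a truly linear replacement,
  which stays in \<open>L\<close> because \<open>L\<close> is a submodule.\<close>

lemma qlin_linear:
  assumes f: "qlin (Fr B) (hat \<aa>) (hat \<aa>) f" and a: "idl \<aa>" and B: "finite B"
    and L: "sub L" "\<And>v. v \<in> Fr B \<Longrightarrow> f v \<in> L"
  shows "\<exists>g. lin g \<and> (\<forall>v\<in>Fr B. g v \<in> L \<and> f v - g v \<in> hat \<aa>)"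
proof -
  note F = qlinD[OF f] and sh = sub_hat[OF a]
  have "\<exists>g. lin g \<and> (\<forall>i\<in>B. g (un i) = f (un i))"
    using basis_choice[OF B, of "\<lambda>i w. w = f (un i)"] by blast
  then obtain g where g: "lin g" "\<And>i. i \<in> B \<Longrightarrow> g (un i) = f (un i)" by blast
  let ?T = "{v \<in> Fr B. f v - g v \<in> hat \<aa>}"
  have "sub ?T"
    unfolding sub_def
  proof (intro conjI ballI allI)
    have "f 0 \<in> hat \<aa>" by (rule F(3)[OF sub_zero[OF sub_Fr] sub_zero[OF sh]])
    then show "0 \<in> ?T" using sub_zero[OF sub_Fr] by (simp add: lin_zero[OF g(1)])
    fix u assume "u \<in> ?T"
    then have u: "u \<in> Fr B" "f u - g u \<in> hat \<aa>" by simp_all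
    show "r *s u \<in> ?T" for r
    proof -
      have "f (r *s u) - g (r *s u) = (f (r *s u) - r *s f u) + r *s (f u - g u)"
        by (simp add: lin_sc[OF g(1)] sc_distrib)
      also have "\<dots> \<in> hat \<aa>" by (intro sub_add[OF sh] sub_sc[OF sh] F(2) u)
      finally show ?thesis using sub_sc[OF sub_Fr u(1)] by simp
    qed
    fix v assume "v \<in> ?T"
    then have v: "v \<in> Fr B" "f v - g v \<in> hat \<aa>" by simp_all
    have "f (u + v) - g (u + v) = (f (u + v) - (f u + f v)) + (f u - g u) + (f v - g v)"
      by (simp add: lin_add[OF g(1)])
    also have "\<dots> \<in> hat \<aa>" by (intro sub_add[OF sh] F(1) u v)
    finally show "u + v \<in> ?T" using sub_add[OF sub_Fr u(1) v(1)] by simp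
  qed
  from lin_into[OF B lin_intros(1) this] have "f v - g v \<in> hat \<aa>" if "v \<in> Fr B" for v
    using that g(2) sub_zero[OF sh] by simp
  moreover have "g v \<in> L" if "v \<in> Fr B" for v
    by (rule lin_into[OF B g(1) L(1) _ that]) (use g(2) L(2) in simp)
  ultimately show ?thesis using g(1) by blast
qed

lemma mlf_qlin:
  assumes \<phi>: "mlf \<aa> L \<phi>" and a: "idl \<aa>" and L: "sub L" and f: "qlin U (hat \<aa>) (hat \<aa>) f"
    and U: "sub U" "\<And>u. u \<in> U \<Longrightarrow> f u \<in> L"
  shows "mlf \<aa> U (\<lambda>u. \<phi> (f u))"
proof -
  note F = qlinD[OF f] and P = mlfD[OF \<phi>]
  have "\<phi> (f (u + v)) - (\<phi> (f u) + \<phi> (f v)) \<in> \<aa>" if uv: "u \<in> U" "v \<in> U" for u v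
    by (rule idl_diff_trans[OF a mlf_cong[OF \<phi> a L U(2)[OF sub_add[OF U(1) uv]]
      sub_add[OF L U(2)[OF uv(1)] U(2)[OF uv(2)]] F(1)[OF uv]] P(1)[OF U(2)[OF uv(1)] U(2)[OF uv(2)]]])
  moreover have "\<phi> (f (r *s u)) - r * \<phi> (f u) \<in> \<aa>" if u: "u \<in> U" for r u
    by (rule idl_diff_trans[OF a mlf_cong[OF \<phi> a L U(2)[OF sub_sc[OF U(1) u]]
      sub_sc[OF L U(2)[OF u]] F(2)[OF u]] P(2)[OF U(2)[OF u]]])
  ultimately show ?thesis unfolding mlf_def using P(3) F(3) U(2) by blast
qed

lemma sum_fun_scale: "r *s (\<Sum>x\<in>A. f x) = (\<Sum>x\<in>A. r *s f x)"
  by (simp add: fun_eq_iff sum_fun_apply sum_distrib_left)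

context cring
begin

text \<open>Maps in the direction opposite to \<open>slin\<close>, from an \<open>R\<close>-module
  back to vectors. Scalars of \<open>R\<close> are represented through \<open>fvar\<close>, which is
  not a ring homomorphism, so linearity can hold only modulo a submodule.\<close>

definition rlin where
  "rlin N W \<beta> \<longleftrightarrow> (\<forall>x\<in>carrier N. \<forall>y\<in>carrier N. \<beta> (x \<oplus>\<^bsub>N\<^esub> y) - (\<beta> x + \<beta> y) \<in> W) \<and>
    (\<forall>r\<in>carrier R. \<forall>x\<in>carrier N. \<beta> (r \<odot>\<^bsub>N\<^esub> x) - fvar r *s \<beta> x \<in> W)"

lemma rlinD:
  assumes "rlin N W \<beta>"
  shows "\<And>x y. x \<in> carrier N \<Longrightarrow> y \<in> carrier N \<Longrightarrow> \<beta> (x \<oplus>\<^bsub>N\<^esub> y) - (\<beta> x + \<beta> y) \<in> W"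
    "\<And>r x. r \<in> carrier R \<Longrightarrow> x \<in> carrier N \<Longrightarrow> \<beta> (r \<odot>\<^bsub>N\<^esub> x) - fvar r *s \<beta> x \<in> W"
  using assms by (auto simp: rlin_def)

lemma rlin_zero: assumes "module R N" "rlin N W \<beta>" "sub W" shows "\<beta> \<zero>\<^bsub>N\<^esub> \<in> W"
proof -
  interpret N: module R N by fact
  have "\<beta> (\<zero>\<^bsub>N\<^esub> \<oplus>\<^bsub>N\<^esub> \<zero>\<^bsub>N\<^esub>) - (\<beta> \<zero>\<^bsub>N\<^esub> + \<beta> \<zero>\<^bsub>N\<^esub>) \<in> W" by (rule rlinD(1)[OF assms(2)]) simp_all
  then have "- \<beta> \<zero>\<^bsub>N\<^esub> \<in> W" by simp
  from sub_minus[OF assms(3) this] show ?thesis by simp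
qed

definition fdelta :: "'x \<Rightarrow> 'x \<Rightarrow> 'a" where "fdelta b = (\<lambda>x. if x = b then \<one> else \<zero>)"

lemma fdelta_free: "b \<in> B \<Longrightarrow> fdelta b \<in> carrier (free_module R B)"
  by (auto simp: free_module_def fdelta_def)

lemma free_simps [simp]:
  "\<zero>\<^bsub>free_module R B\<^esub> = (\<lambda>x. \<zero>)"
  "f \<oplus>\<^bsub>free_module R B\<^esub> g = (\<lambda>x. f x \<oplus> g x)" "r \<odot>\<^bsub>free_module R B\<^esub> f = (\<lambda>x. r \<otimes> f x)"
  by (simp_all add: free_module_def)

lemma free_carrier:
  "f \<in> carrier (free_module R B) \<longleftrightarrow> (\<forall>x. f x \<in> carrier R) \<and> (\<forall>x. x \<notin> B \<longrightarrow> f x = \<zero>) \<and> finite {x. f x \<noteq> \<zero>}"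
  by (simp add: free_module_def)

lemma free_induct [consumes 1, case_names zero step]:
  fixes B :: "'x set"
  assumes g: "g \<in> carrier (free_module R B)" and z: "P (\<lambda>x. \<zero>)"
    and s: "\<And>g r b. g \<in> carrier (free_module R B) \<Longrightarrow> P g \<Longrightarrow> r \<in> carrier R \<Longrightarrow> b \<in> B \<Longrightarrow>
      P (g \<oplus>\<^bsub>free_module R B\<^esub> r \<odot>\<^bsub>free_module R B\<^esub> fdelta b)"
  shows "P g"
proof -
  have "\<forall>g. g \<in> carrier (free_module R B) \<longrightarrow> {x. g x \<noteq> \<zero>} \<subseteq> D \<longrightarrow> P g" if "finite D" for D
    using that
  proof (induction D)
    case empty
    show ?case
    proof (intro allI impI)
      fix g :: "'x \<Rightarrow> 'a" assume "{x. g x \<noteq> \<zero>} \<subseteq> {}"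
      then have "g = (\<lambda>x. \<zero>)" by (simp add: fun_eq_iff)
      then show "P g" using z by (simp only:)
    qed
  next
    case (insert b D)
    show ?case
    proof (intro allI impI)
      fix g assume g: "g \<in> carrier (free_module R B)" "{x. g x \<noteq> \<zero>} \<subseteq> insert b D"
      let ?g = "g(b := \<zero>)"
      have "finite {x. ?g x \<noteq> \<zero>}"
        by (rule finite_subset[of _ "{x. g x \<noteq> \<zero>}"]) (use g in \<open>auto simp: free_carrier\<close>)
      then have g': "?g \<in> carrier (free_module R B)" using g(1) by (auto simp: free_carrier)
      have "{x. ?g x \<noteq> \<zero>} \<subseteq> D" using g(2) by auto
      then have P: "P ?g" using insert.IH g' by blast
      show "P g"
      proof (cases "b \<in> B")
        case True
        have gb: "g b \<in> carrier R" and gx: "\<And>x. g x \<in> carrier R" using g(1) by (auto simp: free_carrier)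
        have "g = ?g \<oplus>\<^bsub>free_module R B\<^esub> g b \<odot>\<^bsub>free_module R B\<^esub> fdelta b"
          using gx by (auto simp: fun_eq_iff fdelta_def)
        then show ?thesis using s[OF g' P gb True] by simp
      next
        case False
        then have "?g = g" using g(1) by (auto simp: free_carrier)
        then show ?thesis using P by simp
      qed
    qed
  qed
  from this[of "{x. g x \<noteq> \<zero>}"] show ?thesis using g by (simp add: free_carrier)
qed

text \<open>This is additive in \<open>g\<close> only modulo \<open>\<kk>\<close>.\<close>

definition fsum :: "('x \<Rightarrow> nat \<Rightarrow> 'a frng) \<Rightarrow> ('x \<Rightarrow> 'a) \<Rightarrow> nat \<Rightarrow> 'a frng"
  where "fsum w g = (\<Sum>b | g b \<noteq> \<zero>. fvar (g b) *s w b)"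

text \<open>\<open>fvar \<zero>\<close> is not 0 but lies in \<open>\<kk>\<close>, so indices
  outside the support change the sum only modulo \<open>hat \<kk>\<close>. Two such sums can thus be
  compared over the union of their supports.\<close>

lemma fsum_support:
  assumes "finite D" "{b. g b \<noteq> \<zero>} \<subseteq> D" shows "(\<Sum>b\<in>D. fvar (g b) *s w b) - fsum w g \<in> hat \<kk>"
proof -
  have "(\<Sum>b\<in>D. fvar (g b) *s w b) = fsum w g + (\<Sum>b\<in>D - {b. g b \<noteq> \<zero>}. fvar (g b) *s w b)"
    unfolding fsum_def using sum.subset_diff[OF assms(2,1)] by (simp only: add.commute)
  moreover have "(\<Sum>b\<in>D - {b. g b \<noteq> \<zero>}. fvar (g b) *s w b) \<in> hat \<kk>"
    by (rule sub_sum[OF sub_hat[OF idl_kk]], rule hat_sc[OF idl_kk]) (auto simp: pre_def)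
  ultimately show ?thesis by simp
qed

lemma fsum_rlin: "rlin (free_module R B) (hat \<kk>) (fsum w)"
  unfolding rlin_def
proof (intro conjI ballI)
  note sh = sub_hat[OF idl_kk]
  fix g assume g: "g \<in> carrier (free_module R B)"
  then have gc: "\<And>x. g x \<in> carrier R" and gf: "finite {x. g x \<noteq> \<zero>}" by (auto simp: free_carrier)
  let ?S = "\<lambda>D g. \<Sum>b\<in>D. fvar (g b) *s w b"
  show "fsum w (g \<oplus>\<^bsub>free_module R B\<^esub> h) - (fsum w g + fsum w h) \<in> hat \<kk>"
    if h: "h \<in> carrier (free_module R B)" for h
  proof -
    have hc: "\<And>x. h x \<in> carrier R" and hf: "finite {x. h x \<noteq> \<zero>}" using h by (auto simp: free_carrier)
    let ?D = "{x. g x \<noteq> \<zero>} \<union> {x. h x \<noteq> \<zero>}"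
    let ?k = "\<lambda>x. g x \<oplus> h x"
    have D: "finite ?D" using gf hf by simp
    have "?S ?D ?k - (?S ?D g + ?S ?D h) = (\<Sum>b\<in>?D. (fvar (?k b) - (fvar (g b) + fvar (h b))) *s w b)"
      by (simp only: sum_subtractf[symmetric] sum.distrib[symmetric] sc_distrib)
    also have "\<dots> \<in> hat \<kk>"
      by (rule sub_sum[OF sh], rule hat_sc[OF idl_kk]) (simp add: pre_def gc hc)
    finally have 1: "?S ?D ?k - (?S ?D g + ?S ?D h) \<in> hat \<kk>" .
    have 2: "?S ?D ?k - fsum w ?k \<in> hat \<kk>" by (rule fsum_support[OF D]) auto
    have 3: "?S ?D g - fsum w g \<in> hat \<kk>" by (rule fsum_support[OF D]) auto
    have 4: "?S ?D h - fsum w h \<in> hat \<kk>" by (rule fsum_support[OF D]) auto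
    have "fsum w ?k - (fsum w g + fsum w h) = (?S ?D ?k - (?S ?D g + ?S ?D h)) - (?S ?D ?k - fsum w ?k) +
      (?S ?D g - fsum w g) + (?S ?D h - fsum w h)" by (simp only: diff_conv_add_uminus minus_add_distrib minus_minus ac_simps) simp
    also have "\<dots> \<in> hat \<kk>" by (intro sub_add[OF sh] sub_diff[OF sh] 1 2 3 4)
    finally show ?thesis by simp
  qed
  show "fsum w (r \<odot>\<^bsub>free_module R B\<^esub> g) - fvar r *s fsum w g \<in> hat \<kk>" if r: "r \<in> carrier R" for r
  proof -
    let ?D = "{x. g x \<noteq> \<zero>}"
    let ?k = "\<lambda>x. r \<otimes> g x"
    have "?S ?D ?k - fvar r *s ?S ?D g = (\<Sum>b\<in>?D. (fvar (?k b) - fvar r * fvar (g b)) *s w b)"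
      unfolding sum_fun_scale by (simp only: sum_subtractf[symmetric] sc_distrib sc_simps)
    also have "\<dots> \<in> hat \<kk>"
      by (rule sub_sum[OF sh], rule hat_sc[OF idl_kk]) (simp add: pre_def gc r)
    finally have 1: "?S ?D ?k - fvar r *s ?S ?D g \<in> hat \<kk>" .
    have 2: "?S ?D ?k - fsum w ?k \<in> hat \<kk>" by (rule fsum_support[OF gf]) (use r in auto)
    from sub_diff[OF sh 1 2] have "fsum w ?k - fvar r *s ?S ?D g \<in> hat \<kk>" by simp
    then show ?thesis by (simp add: fsum_def)
  qed
qed

lemma fsum_Fr: "(\<And>b. w b \<in> Fr C) \<Longrightarrow> fsum w g \<in> Fr C"
  unfolding fsum_def by (rule sub_sum[OF sub_Fr], rule sub_sc[OF sub_Fr])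

lemma module_homD:
  assumes "f \<in> module_hom R M N"
  shows "\<And>x. x \<in> carrier M \<Longrightarrow> f x \<in> carrier N"
    "\<And>x y. x \<in> carrier M \<Longrightarrow> y \<in> carrier M \<Longrightarrow> f (x \<oplus>\<^bsub>M\<^esub> y) = f x \<oplus>\<^bsub>N\<^esub> f y"
    "\<And>r x. r \<in> carrier R \<Longrightarrow> x \<in> carrier M \<Longrightarrow> f (r \<odot>\<^bsub>M\<^esub> x) = r \<odot>\<^bsub>N\<^esub> f x"
  using assms by (auto simp: module_hom_def)

lemma module_hom_zero: assumes "module R M" "module R N" "f \<in> module_hom R M N" shows "f \<zero>\<^bsub>M\<^esub> = \<zero>\<^bsub>N\<^esub>"
proof -
  interpret M: module R M by fact
  interpret N: module R N by fact
  have "f (\<zero> \<odot>\<^bsub>M\<^esub> \<zero>\<^bsub>M\<^esub>) = \<zero> \<odot>\<^bsub>N\<^esub> f \<zero>\<^bsub>M\<^esub>" by (rule module_homD(3)[OF assms(3)]) simp_all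
  then show ?thesis using module_homD(1)[OF assms(3)] by simp
qed

lemma module_hom_comp: "f \<in> module_hom R M N \<Longrightarrow> g \<in> module_hom R N L \<Longrightarrow> (\<lambda>x. g (f x)) \<in> module_hom R M L"
  by (auto simp: module_hom_def Pi_iff)

lemma rlin_comp:
  assumes "rlin N W \<beta>" "f \<in> module_hom R M N" shows "rlin M W (\<lambda>x. \<beta> (f x))"
  unfolding rlin_def using rlinD[OF assms(1)] module_homD[OF assms(2)] by simp

text \<open>\<open>P\<close> is a retract of a free module whose basis may be infinite. Choose
  preimages in \<open>Fr C\<close> for the basis elements, extend by \<open>fsum\<close>, and
  restrict along the section \<open>s\<close>.\<close>

lemma projective_lift:
  assumes P: "projective_module R P" and g: "rlin P W \<gamma>" "\<And>x. x \<in> carrier P \<Longrightarrow> \<gamma> x \<in> U"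
    and c: "cov f (C :: nat set) U W" and W: "sub W" and h: "\<And>v. v \<in> Fr C \<Longrightarrow> v \<in> hat \<kk> \<Longrightarrow> f v \<in> W"
  shows "\<exists>\<beta>. rlin P (hat \<kk>) \<beta> \<and> (\<forall>x\<in>carrier P. \<beta> x \<in> Fr C \<and> f (\<beta> x) - \<gamma> x \<in> W)"
proof -
  note Cv = covD[OF c] and sh = sub_hat[OF idl_kk]
  note fl = lin_simps[OF Cv(2)]
  from P obtain B :: "'c set" and s p where mP: "module R P"
    and s: "s \<in> module_hom R P (free_module R B)" and p: "p \<in> module_hom R (free_module R B) P"
    and ps: "\<And>x. x \<in> carrier P \<Longrightarrow> p (s x) = x"
    unfolding projective_module_def by blast
  have G: "rlin (free_module R B) W (\<lambda>g. \<gamma> (p g))" by (rule rlin_comp[OF g(1) p])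
  have GU: "\<gamma> (p g) \<in> U" if "g \<in> carrier (free_module R B)" for g by (rule g(2)[OF module_homD(1)[OF p that]])
  have "\<forall>b. \<exists>w. w \<in> Fr C \<and> (b \<in> B \<longrightarrow> f w - \<gamma> (p (fdelta b)) \<in> W)"
  proof
    fix b
    show "\<exists>w. w \<in> Fr C \<and> (b \<in> B \<longrightarrow> f w - \<gamma> (p (fdelta b)) \<in> W)"
    proof (cases "b \<in> B")
      case True
      from Cv(4)[OF GU[OF fdelta_free[OF True]]] show ?thesis using sub_diff_sym[OF W] by blast
    qed (use sub_zero[OF sub_Fr] in blast)
  qed
  then obtain w :: "_ \<Rightarrow> nat \<Rightarrow> 'a frng" where w: "\<And>b. w b \<in> Fr C" "\<And>b. b \<in> B \<Longrightarrow> f (w b) - \<gamma> (p (fdelta b)) \<in> W" by metis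
  note F = fsum_rlin[of B w]
  have wF: "fsum w g \<in> Fr C" for g by (rule fsum_Fr[OF w(1)])
  note mF = module_free[of B]
  have key: "f (fsum w g) - \<gamma> (p g) \<in> W" if "g \<in> carrier (free_module R B)" for g
    using that
  proof (induction g rule: free_induct)
    case zero
    have z: "fsum w (\<lambda>x. \<zero>) = 0" by (simp add: fsum_def)
    have "\<gamma> (p \<zero>\<^bsub>free_module R B\<^esub>) \<in> W" by (rule rlin_zero[OF mF G W])
    from sub_minus[OF W this] show ?case by (simp only: z fl diff_0 free_simps)
  next
    case (step g r b)
    let ?d = "r \<odot>\<^bsub>free_module R B\<^esub> fdelta b"
    interpret F: module R "free_module R B" by (rule mF)
    have dF: "fdelta b \<in> carrier (free_module R B)" by (rule fdelta_free[OF step(3)])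
    have d: "?d \<in> carrier (free_module R B)" by (rule F.smult_closed[OF step(2) dF])
    have hatW: "f x - f y \<in> W" if "x \<in> Fr C" "y \<in> Fr C" "x - y \<in> hat \<kk>" for x y
      using h[OF sub_diff[OF sub_Fr that(1,2)] that(3)] by (simp only: fl)
    have 1: "f (fsum w (g \<oplus>\<^bsub>free_module R B\<^esub> ?d)) - f (fsum w g + fsum w ?d) \<in> W"
      by (rule hatW[OF wF sub_add[OF sub_Fr wF wF] rlinD(1)[OF F step(1) d]])
    have 2: "f (fsum w ?d) - f (fvar r *s fsum w (fdelta b)) \<in> W"
      by (rule hatW[OF wF sub_sc[OF sub_Fr wF] rlinD(2)[OF F step(2) dF]])
    have "fsum w (fdelta b) - w b \<in> hat \<kk>"
    proof -
      have "(\<Sum>x\<in>{b}. fvar (fdelta b x) *s w x) - fsum w (fdelta b) \<in> hat \<kk>"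
        by (rule fsum_support) (auto simp: fdelta_def)
      then have "fvar \<one> *s w b - fsum w (fdelta b) \<in> hat \<kk>" by (simp add: fdelta_def)
      moreover have "(fvar \<one> - 1) *s w b \<in> hat \<kk>" by (rule hat_sc[OF idl_kk]) (simp add: pre_def)
      then have "fvar \<one> *s w b - w b \<in> hat \<kk>" by (simp add: sc_distrib)
      ultimately show ?thesis using sub_diff[OF sh] by fastforce
    qed
    then have 3: "f (fsum w (fdelta b)) - f (w b) \<in> W" by (rule hatW[OF wF w(1)])
    have 4: "\<gamma> (p (g \<oplus>\<^bsub>free_module R B\<^esub> ?d)) - (\<gamma> (p g) + \<gamma> (p ?d)) \<in> W" by (rule rlinD(1)[OF G step(1) d])
    have 5: "\<gamma> (p ?d) - fvar r *s \<gamma> (p (fdelta b)) \<in> W" by (rule rlinD(2)[OF G step(2) dF])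
    have 6: "f (w b) - \<gamma> (p (fdelta b)) \<in> W" by (rule w(2)[OF step(3)])
    let ?X = "f (fsum w (g \<oplus>\<^bsub>free_module R B\<^esub> ?d))" and ?Y = "\<gamma> (p (g \<oplus>\<^bsub>free_module R B\<^esub> ?d))"
    have "?X - ?Y = (?X - f (fsum w g + fsum w ?d)) + (f (fsum w g) - \<gamma> (p g)) +
       (f (fsum w ?d) - f (fvar r *s fsum w (fdelta b))) + fvar r *s (f (fsum w (fdelta b)) - f (w b)) +
       fvar r *s (f (w b) - \<gamma> (p (fdelta b))) - (\<gamma> (p ?d) - fvar r *s \<gamma> (p (fdelta b))) - (?Y - (\<gamma> (p g) + \<gamma> (p ?d)))"
      by (simp only: fl sc_distrib) simp
    also have "\<dots> \<in> W" by (intro sub_add[OF W] sub_diff[OF W] sub_sc[OF W] 1 2 3 4 5 6 step(4))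
    finally show ?case .
  qed
  have "rlin P (hat \<kk>) (\<lambda>x. fsum w (s x))" by (rule rlin_comp[OF F s])
  moreover have "f (fsum w (s x)) - \<gamma> x \<in> W" if "x \<in> carrier P" for x
    using key[OF module_homD(1)[OF s that]] ps[OF that] by simp
  ultimately show ?thesis using wF by blast
qed


subsection \<open>Complexes of free modules\<close>

text \<open>Coordinates are carried along an injection into the index type of the target complex:
  \<open>id\<close> for resolutions with carriers in \<open>nat => 'a\<close>,
  \<open>set_decode\<close> for Koszul complexes, and an injection into the universe type of
  \<open>qpd\<close> for the final complex.\<close>

definition emb :: "(nat \<Rightarrow> 'x) \<Rightarrow> (nat \<Rightarrow> 'a frng) \<Rightarrow> 'x \<Rightarrow> 'a"
  where "emb \<iota> v = (\<lambda>x. if x \<in> range \<iota> then \<pi> (v (inv_into UNIV \<iota> x)) else \<zero>)"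

definition unemb :: "(nat \<Rightarrow> 'x) \<Rightarrow> nat set \<Rightarrow> ('x \<Rightarrow> 'a) \<Rightarrow> nat \<Rightarrow> 'a frng"
  where "unemb \<iota> C f = (\<lambda>i. if i \<in> C then fvar (f (\<iota> i)) else 0)"

lemma emb_app: "inj \<iota> \<Longrightarrow> emb \<iota> v (\<iota> i) = \<pi> (v i)"
  by (simp add: emb_def)

lemma unemb_Fr: "unemb \<iota> C f \<in> Fr C"
  by (simp add: unemb_def Fr_def)

lemma emb_closed: assumes "inj \<iota>" "finite C" "v \<in> Fr C" shows "emb \<iota> v \<in> carrier (free_module R (\<iota> ` C))"
proof -
  have z: "emb \<iota> v x = \<zero>" if "x \<notin> \<iota> ` C" for x
  proof (cases "x \<in> range \<iota>")
    case True
    then obtain i where i: "x = \<iota> i" by blast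
    then have "i \<notin> C" using that by blast
    then show ?thesis using assms(3) by (simp add: i emb_app[OF assms(1)] Fr_def)
  qed (simp add: emb_def)
  have "finite {x. emb \<iota> v x \<noteq> \<zero>}"
    by (rule finite_subset[of _ "\<iota> ` C"]) (use z assms(2) in auto)
  then show ?thesis using z by (auto simp: free_carrier emb_def)
qed

lemma emb_unemb:
  assumes "inj \<iota>" "f \<in> carrier (free_module R (\<iota> ` C))" shows "emb \<iota> (unemb \<iota> C f) = f"
proof
  fix x
  have f: "\<And>x. f x \<in> carrier R" "\<And>x. x \<notin> \<iota> ` C \<Longrightarrow> f x = \<zero>" using assms(2) by (auto simp: free_carrier)
  show "emb \<iota> (unemb \<iota> C f) x = f x"
  proof (cases "x \<in> range \<iota>")
    case True
    then obtain i where i: "x = \<iota> i" by blast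
    have "i \<notin> C \<Longrightarrow> \<iota> i \<notin> \<iota> ` C" using assms(1) by (auto simp: inj_def)
    then show ?thesis using f by (auto simp: i emb_app[OF assms(1)] unemb_def)
  next
    case False
    then have "x \<notin> \<iota> ` C" by blast
    from f(2)[OF this] show ?thesis using False by (simp add: emb_def)
  qed
qed

lemma emb_ops:
  "emb \<iota> u \<oplus>\<^bsub>free_module R B\<^esub> emb \<iota> v = emb \<iota> (u + v)"
  "\<pi> r \<odot>\<^bsub>free_module R B\<^esub> emb \<iota> v = emb \<iota> (r *s v)" "\<zero>\<^bsub>free_module R B\<^esub> = emb \<iota> 0"
  by (auto simp: emb_def fun_eq_iff)

lemma emb_zero: "inj \<iota> \<Longrightarrow> emb \<iota> v = (\<lambda>x. \<zero>) \<longleftrightarrow> v \<in> hat \<kk>"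
proof
  assume i: "inj \<iota>" and e: "emb \<iota> v = (\<lambda>x. \<zero>)"
  have "\<pi> (v j) = \<zero>" for j using fun_cong[OF e, of "\<iota> j"] by (simp add: emb_app[OF i])
  then show "v \<in> hat \<kk>" by (simp add: hat_def pre_def)
next
  assume "v \<in> hat \<kk>"
  then show "emb \<iota> v = (\<lambda>x. \<zero>)" by (auto simp: emb_def hat_def pre_def)
qed

lemma emb_eq: assumes "inj \<iota>" shows "emb \<iota> u = emb \<iota> v \<longleftrightarrow> u - v \<in> hat \<kk>"
proof
  assume e: "emb \<iota> u = emb \<iota> v"
  have "\<pi> (u j) = \<pi> (v j)" for j using fun_cong[OF e, of "\<iota> j"] by (simp add: emb_app[OF assms])
  then show "u - v \<in> hat \<kk>" by (simp add: hat_def pi_diff_zero)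
next
  assume "u - v \<in> hat \<kk>"
  then have p: "\<pi> (u j) = \<pi> (v j)" for j by (simp add: hat_def pi_diff_zero)
  show "emb \<iota> u = emb \<iota> v" by (simp only: emb_def p)
qed

lemma slin_emb: assumes "inj \<iota>" "finite C" "lin f" "\<And>v. f v \<in> Fr C"
  shows "slin (free_module R (\<iota> ` C)) (\<lambda>v. emb \<iota> (f v))"
  unfolding slin_def using emb_closed[OF assms(1,2,4)] by (simp only: lin_simps[OF assms(3)] emb_ops) blast

text \<open>The differential has to act on functions with values in \<open>R\<close>, so they are
  lifted by \<open>unemb\<close> first. The choice of lift is harmless because a linear map
  preserves \<open>hat \<kk>\<close> on finite free modules.\<close>

definition cx :: "(nat \<Rightarrow> 'x) \<Rightarrow> (int \<Rightarrow> nat set) \<Rightarrow> (int \<Rightarrow> (nat \<Rightarrow> 'a frng) \<Rightarrow> nat \<Rightarrow> 'a frng) \<Rightarrow> ('a, 'x \<Rightarrow> 'a) module_complex"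
  where "cx \<iota> B d = \<lparr>cobj = (\<lambda>i. free_module R (\<iota> ` B i)), cdiff = (\<lambda>i f. emb \<iota> (d i (unemb \<iota> (B i) f)))\<rparr>"

lemma cx_simps [simp]: "cobj (cx \<iota> B d) i = free_module R (\<iota> ` B i)"
  by (simp add: cx_def)

lemma cx_diff:
  assumes "inj \<iota>" "cpx \<kk> B d" "v \<in> Fr (B i)" shows "cdiff (cx \<iota> B d) i (emb \<iota> v) = emb \<iota> (d i v)"
proof -
  note C = cpxD[OF assms(2)]
  let ?u = "unemb \<iota> (B i) (emb \<iota> v)"
  have e: "emb \<iota> ?u = emb \<iota> v" by (rule emb_unemb[OF assms(1) emb_closed[OF assms(1) C(1) assms(3)]])
  then have "?u - v \<in> hat \<kk>" using emb_eq[OF assms(1)] by blast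
  from lin_hat[OF idl_kk C(1,2) sub_diff[OF sub_Fr unemb_Fr assms(3)] this, of i]
  have "d i ?u - d i v \<in> hat \<kk>" by (simp only: lin_diff[OF C(2)])
  then show ?thesis using emb_eq[OF assms(1)] by (simp add: cx_def)
qed

lemma cx_elem:
  assumes "inj \<iota>" "f \<in> carrier (free_module R (\<iota> ` C))" obtains v where "v \<in> Fr C" "f = emb \<iota> v"
  using emb_unemb[OF assms] unemb_Fr by metis

lemma cx_complex:
  assumes i: "inj \<iota>" and c: "cpx \<kk> B d"
  shows "is_complex R (cx \<iota> B d)"
    "cycles (cx \<iota> B d) j = emb \<iota> ` Zc \<kk> B d j" "boundaries (cx \<iota> B d) j = emb \<iota> ` Bc \<kk> B d j"
proof -
  note C = cpxD[OF c] and D = cx_diff[OF i c]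
  have hom: "cdiff (cx \<iota> B d) j \<in> module_hom R (free_module R (\<iota> ` B j)) (free_module R (\<iota> ` B (j - 1)))" for j
    unfolding module_hom_def
  proof (intro CollectI conjI ballI)
    show "cdiff (cx \<iota> B d) j \<in> carrier (free_module R (\<iota> ` B j)) \<rightarrow> carrier (free_module R (\<iota> ` B (j - 1)))"
    proof
      fix f assume "f \<in> carrier (free_module R (\<iota> ` B j))"
      then obtain v where "v \<in> Fr (B j)" "f = emb \<iota> v" by (rule cx_elem[OF i])
      then show "cdiff (cx \<iota> B d) j f \<in> carrier (free_module R (\<iota> ` B (j - 1)))"
        using D emb_closed[OF i C(1) C(3)] by simp
    qed
    fix f assume "f \<in> carrier (free_module R (\<iota> ` B j))"
    then obtain u where u: "u \<in> Fr (B j)" "f = emb \<iota> u" by (rule cx_elem[OF i])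
    show "cdiff (cx \<iota> B d) j (f \<oplus>\<^bsub>free_module R (\<iota> ` B j)\<^esub> g) =
      cdiff (cx \<iota> B d) j f \<oplus>\<^bsub>free_module R (\<iota> ` B (j - 1))\<^esub> cdiff (cx \<iota> B d) j g"
      if "g \<in> carrier (free_module R (\<iota> ` B j))" for g
    proof -
      obtain v where v: "v \<in> Fr (B j)" "g = emb \<iota> v" using \<open>g \<in> _\<close> by (rule cx_elem[OF i])
      have "f \<oplus>\<^bsub>free_module R (\<iota> ` B j)\<^esub> g = emb \<iota> (u + v)" by (simp only: u(2) v(2) emb_ops)
      then show ?thesis using D[OF sub_add[OF sub_Fr u(1) v(1)]] D[OF u(1)] D[OF v(1)]
        by (simp only: u(2) v(2) lin_add[OF C(2)] emb_ops)
    qed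
    show "cdiff (cx \<iota> B d) j (r \<odot>\<^bsub>free_module R (\<iota> ` B j)\<^esub> f) = r \<odot>\<^bsub>free_module R (\<iota> ` B (j - 1))\<^esub> cdiff (cx \<iota> B d) j f"
      if r: "r \<in> carrier R" for r
    proof -
      have e: "r \<odot>\<^bsub>free_module R B'\<^esub> emb \<iota> w = emb \<iota> (fvar r *s w)" for B' w
        using emb_ops(2)[where \<iota> = \<iota> and r = "fvar r" and v = w and B = B'] r by simp
      show ?thesis using D[OF sub_sc[OF sub_Fr u(1)]] D[OF u(1)]
        by (simp only: u(2) e lin_sc[OF C(2)])
    qed
  qed
  show "is_complex R (cx \<iota> B d)"
    unfolding is_complex_def
  proof (intro conjI allI ballI)
    show "module R (cobj (cx \<iota> B d) j)" for j by (simp add: module_free)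
    show "cdiff (cx \<iota> B d) j \<in> module_hom R (cobj (cx \<iota> B d) j) (cobj (cx \<iota> B d) (j - 1))" for j
      using hom by simp
    fix j f assume "f \<in> carrier (cobj (cx \<iota> B d) j)"
    then have "f \<in> carrier (free_module R (\<iota> ` B j))" by simp
    then obtain u where u: "u \<in> Fr (B j)" "f = emb \<iota> u" by (rule cx_elem[OF i])
    show "cdiff (cx \<iota> B d) (j - 1) (cdiff (cx \<iota> B d) j f) = \<zero>\<^bsub>cobj (cx \<iota> B d) (j - 1 - 1)\<^esub>"
      using C(4)[OF u(1)] by (simp add: u(2) D[OF u(1)] D[OF C(3)[OF u(1)]] emb_zero[OF i])
  qed
  have car: "carrier (free_module R (\<iota> ` B j)) = emb \<iota> ` Fr (B j)" for j
    using emb_closed[OF i C(1)] cx_elem[OF i] by blast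
  have "x \<in> cycles (cx \<iota> B d) j \<longleftrightarrow> x \<in> emb \<iota> ` Zc \<kk> B d j" for x
  proof
    assume "x \<in> cycles (cx \<iota> B d) j"
    then have x: "x \<in> emb \<iota> ` Fr (B j)" "cdiff (cx \<iota> B d) j x = (\<lambda>x. \<zero>)"
      by (auto simp: cycles_def car[symmetric])
    then obtain u where u: "u \<in> Fr (B j)" "x = emb \<iota> u" by blast
    have "d j u \<in> hat \<kk>" using x(2) by (simp add: u(2) D[OF u(1)] emb_zero[OF i])
    then show "x \<in> emb \<iota> ` Zc \<kk> B d j" using u by (auto simp: Zc_def)
  next
    assume "x \<in> emb \<iota> ` Zc \<kk> B d j"
    then obtain u where u: "u \<in> Fr (B j)" "d j u \<in> hat \<kk>" "x = emb \<iota> u" by (auto simp: Zc_def)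
    then show "x \<in> cycles (cx \<iota> B d) j"
      using emb_closed[OF i C(1) u(1)] by (simp add: cycles_def D[OF u(1)] emb_zero[OF i])
  qed
  then show "cycles (cx \<iota> B d) j = emb \<iota> ` Zc \<kk> B d j" by blast
  have "x \<in> boundaries (cx \<iota> B d) j \<longleftrightarrow> x \<in> emb \<iota> ` Bc \<kk> B d j" for x
  proof
    assume "x \<in> boundaries (cx \<iota> B d) j"
    then obtain w where w: "w \<in> Fr (B (j + 1))" "x = emb \<iota> (d (j + 1) w)"
      by (auto simp: boundaries_def car D)
    then show "x \<in> emb \<iota> ` Bc \<kk> B d j" using Bc_d[OF idl_kk c w(1)] by blast
  next
    assume "x \<in> emb \<iota> ` Bc \<kk> B d j"
    then obtain u where u: "u \<in> Bc \<kk> B d j" "x = emb \<iota> u" by blast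
    from u(1) obtain w where w: "w \<in> Fr (B (j + 1))" "u - d (j + 1) w \<in> hat \<kk>" by (rule BcE)
    then have "x = emb \<iota> (d (j + 1) w)" using u(2) emb_eq[OF i] by blast
    then show "x \<in> boundaries (cx \<iota> B d) j" using w(1) D[OF w(1)] unfolding boundaries_def cx_simps car
      by (intro image_eqI[of _ _ "emb \<iota> w"]) simp_all
  qed
  then show "boundaries (cx \<iota> B d) j = emb \<iota> ` Bc \<kk> B d j" by blast
qed

text \<open>The definition of projectivity demands a basis in the type of elements of the module, so
  \<open>B\<close> is replaced by its delta functions; these are distinct because
  \<open>\<one> \<noteq> \<zero>\<close>.\<close>

lemma projective_free:
  fixes B :: "'x set"
  assumes "\<one> \<noteq> \<zero>" shows "projective_module R (free_module R B)"
proof -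
  let ?F = "free_module R B" and ?G = "free_module R ((fdelta :: 'x \<Rightarrow> 'x \<Rightarrow> 'a) ` B)"
  have inj: "fdelta x = fdelta y \<longleftrightarrow> x = y" for x y :: 'x
  proof
    assume e: "fdelta x = (fdelta y :: 'x \<Rightarrow> 'a)"
    show "x = y"
    proof (rule ccontr)
      assume "x \<noteq> y"
      then show False using fun_cong[OF e, of x] assms by (simp add: fdelta_def)
    qed
  qed simp
  let ?s = "\<lambda>f g. if g \<in> fdelta ` B then f (THE b. g = fdelta b) else \<zero>"
  let ?p = "\<lambda>f b. f (fdelta b)"
  have the: "(THE b. fdelta x = (fdelta b :: 'x \<Rightarrow> 'a)) = x" for x :: 'x
    by (rule the_equality) (simp_all add: inj)
  have nin: "(fdelta b :: 'x \<Rightarrow> 'a) \<in> fdelta ` B \<longleftrightarrow> b \<in> B" for b by (simp add: image_iff inj)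
  have fin: "finite {g. ?s f g \<noteq> \<zero>}" if "f \<in> carrier ?F" for f
    by (rule finite_subset[of _ "fdelta ` {b. f b \<noteq> \<zero>}"]) (use that the in \<open>auto simp: free_carrier\<close>)
  have fin': "finite {b. f (fdelta b) \<noteq> \<zero>}" if "f \<in> carrier ?G" for f
  proof -
    have "finite (fdelta -` {g. f g \<noteq> \<zero>} :: 'x set)"
      by (rule finite_vimageI) (use that inj in \<open>auto simp: free_carrier inj_def\<close>)
    then show ?thesis by (simp add: vimage_def)
  qed
  have "?s \<in> module_hom R ?F ?G"
    unfolding module_hom_def using fin by (auto simp: free_carrier fun_eq_iff)
  moreover have "?p \<in> module_hom R ?G ?F"
    unfolding module_hom_def
  proof (intro CollectI conjI ballI Pi_I)
    fix f assume f: "f \<in> carrier ?G"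
    show "?p f \<in> carrier ?F" using f fin'[OF f] nin unfolding free_carrier by simp
  qed simp_all
  moreover have "?p (?s f) = f" if "f \<in> carrier ?F" for f
    using that the nin unfolding free_carrier by (intro HOL.ext) simp
  ultimately show ?thesis
    unfolding projective_module_def using module_free[of B] by blast
qed

subsection \<open>Vanishing of Ext does not depend on the resolution\<close>

text \<open>\<open>U/W\<close> and \<open>N\<close> are related if they are isomorphic up to maps that factor through a free module.
  The relation passes to syzygies, which replaces the comparison theorem for projective
  resolutions.\<close>

definition trelw where
  "trelw U W N \<alpha> \<beta> (D :: nat set) \<kappa> e \<longleftrightarrow>
    (\<forall>u\<in>U. \<alpha> u \<in> carrier N) \<and> (\<forall>u\<in>U. \<forall>v\<in>U. \<alpha> (u + v) = \<alpha> u \<oplus>\<^bsub>N\<^esub> \<alpha> v) \<and>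
    (\<forall>r. \<forall>u\<in>U. \<alpha> (r *s u) = \<pi> r \<odot>\<^bsub>N\<^esub> \<alpha> u) \<and> (\<forall>u\<in>U. u \<in> W \<longrightarrow> \<alpha> u = \<zero>\<^bsub>N\<^esub>) \<and>
    rlin N W \<beta> \<and> (\<forall>x\<in>carrier N. \<beta> x \<in> U) \<and>
    finite D \<and> qlin U W (hat \<kk>) \<kappa> \<and> (\<forall>u\<in>U. \<kappa> u \<in> Fr D) \<and> lin e \<and> (\<forall>v\<in>Fr D. e v \<in> U) \<and>
    (\<forall>u\<in>U. u - \<beta> (\<alpha> u) - e (\<kappa> u) \<in> W)"

definition trel where "trel U W N \<longleftrightarrow> (\<exists>\<alpha> \<beta> D \<kappa> e. trelw U W N \<alpha> \<beta> D \<kappa> e)"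

lemma trelwD:
  assumes "trelw U W N \<alpha> \<beta> D \<kappa> e"
  shows "\<And>u. u \<in> U \<Longrightarrow> \<alpha> u \<in> carrier N" "\<And>u v. u \<in> U \<Longrightarrow> v \<in> U \<Longrightarrow> \<alpha> (u + v) = \<alpha> u \<oplus>\<^bsub>N\<^esub> \<alpha> v"
    "\<And>r u. u \<in> U \<Longrightarrow> \<alpha> (r *s u) = \<pi> r \<odot>\<^bsub>N\<^esub> \<alpha> u" "\<And>u. u \<in> U \<Longrightarrow> u \<in> W \<Longrightarrow> \<alpha> u = \<zero>\<^bsub>N\<^esub>"
    "rlin N W \<beta>" "\<And>x. x \<in> carrier N \<Longrightarrow> \<beta> x \<in> U"
    "finite D" "qlin U W (hat \<kk>) \<kappa>" "\<And>u. u \<in> U \<Longrightarrow> \<kappa> u \<in> Fr D"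
    "lin e" "\<And>v. v \<in> Fr D \<Longrightarrow> e v \<in> U" "\<And>u. u \<in> U \<Longrightarrow> u - \<beta> (\<alpha> u) - e (\<kappa> u) \<in> W"
  using assms unfolding trelw_def by simp_all

text \<open>Lift \<open>\<alpha>\<close> and \<open>\<beta>\<close> to maps between the covers; the
  defect \<open>\<eta> = 1 - \<beta>' \<alpha>' - e' \<kappa> f\<close> sends the cover of
  \<open>U\<close> into the syzygy. On the syzygy the term with \<open>\<kappa>\<close> vanishes, so
  there the identity is \<open>\<beta>' \<alpha>'\<close> plus a map factoring through
  \<open>Fr C\<close>. This is the relation for the next step, and the same decomposition extends
  functionals.\<close>

lemma trel_step:
  fixes U W :: "(nat \<Rightarrow> 'a frng) set"
  assumes noeth: "noetherian_ring R" and mN: "module R N" and P: "projective_module R P"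
    and \<epsilon>: "\<epsilon> \<in> module_hom R P N" "\<epsilon> ` carrier P = carrier N"
    and K: "K = {x \<in> carrier P. \<epsilon> x = \<zero>\<^bsub>N\<^esub>}"
    and ext: "\<And>\<theta>. \<theta> \<in> module_hom R (sub_module P K) (ring_as_module R) \<Longrightarrow>
      \<exists>\<Psi>\<in>module_hom R P (ring_as_module R). \<forall>x\<in>K. \<theta> x = \<Psi> x"
    and m: "md \<kk> U W" and B: "finite B" "U \<subseteq> Fr B" "\<And>v. v \<in> Fr B \<Longrightarrow> v \<in> hat \<kk> \<Longrightarrow> v \<in> U"
    and hW: "\<And>u. u \<in> U \<Longrightarrow> u \<in> hat \<kk> \<Longrightarrow> u \<in> W" and t: "trel U W N"
  shows "\<exists>f (C :: nat set). cov f C U W \<and> ext \<kk> (kr f C W) \<and> trel (kr f C W) (hat \<kk>) (sub_module P K)"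
proof -
  note U = mdD(1)[OF m] and W = mdD(2)[OF m] and sh = sub_hat[OF idl_kk]
  have mP: "module R P" using P by (simp add: projective_module_def)
  interpret N: module R N by (rule mN)
  interpret P: module R P by (rule mP)
  from t obtain \<alpha> \<beta> D \<kappa> e where tw: "trelw U W N \<alpha> \<beta> D \<kappa> e" unfolding trel_def by (elim exE)
  note T = trelwD[OF tw]
  note \<alpha> = T(1-4) and \<beta> = T(5,6) and D = T(7) and \<kappa> = T(8,9) and e = T(10,11) and r = T(12)
  obtain f and C :: "nat set" where f0: "cov f C U (hat \<kk>)" using noeth_cover[OF noeth B(1) U B(2,3)] by blast
  note F0 = covD[OF f0]
  have cf: "cov f C U W"
    unfolding cov_def
  proof (intro conjI ballI)
    fix u assume u: "u \<in> U"
    from F0(4)[OF u] obtain v where v: "v \<in> Fr C" "u - f v \<in> hat \<kk>" by blast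
    from hW[OF sub_diff[OF U u F0(3)[OF v(1)]] v(2)] v(1) show "\<exists>v\<in>Fr C. u - f v \<in> W" by blast
  qed (use F0 in auto)
  note F = covD[OF cf]
  note fl = lin_simps[OF F(2)]
  have fh: "f v \<in> W" if "v \<in> Fr C" "v \<in> hat \<kk>" for v by (rule cov_hat[OF cf m that])
  let ?L = "kr f C W"
  have L: "sub ?L" by (rule sub_kr[OF F(2) W])
  have "\<forall>i\<in>C. \<exists>a. a \<in> carrier P \<and> \<epsilon> a = \<alpha> (f (un i))"
  proof
    fix i assume "i \<in> C"
    then have "\<alpha> (f (un i)) \<in> \<epsilon> ` carrier P" unfolding \<epsilon>(2) by (intro \<alpha>(1) F(3) un_Fr)
    then show "\<exists>a. a \<in> carrier P \<and> \<epsilon> a = \<alpha> (f (un i))" by (elim imageE) auto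
  qed
  from bchoice[OF this] obtain a where "\<forall>i\<in>C. a i \<in> carrier P \<and> \<epsilon> (a i) = \<alpha> (f (un i))" ..
  then have a: "\<And>i. i \<in> C \<Longrightarrow> a i \<in> carrier P" "\<And>i. i \<in> C \<Longrightarrow> \<epsilon> (a i) = \<alpha> (f (un i))" by simp_all
  have "\<exists>\<phi>. slin P \<phi> \<and> (\<forall>i\<in>C. \<phi> (un i) = a i)" by (rule slin_ex[OF mP F(1) a(1)])
  then obtain \<alpha>' where "slin P \<alpha>' \<and> (\<forall>i\<in>C. \<alpha>' (un i) = a i)" ..
  then have \<alpha>': "slin P \<alpha>'" "\<And>i. i \<in> C \<Longrightarrow> \<alpha>' (un i) = a i" by simp_all
  note A = slinD[OF \<alpha>'(1)]
  have z0: "\<alpha>' 0 = \<zero>\<^bsub>P\<^esub>" by (rule slin_zero[OF mP \<alpha>'(1)])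
  have \<epsilon>0: "\<epsilon> \<zero>\<^bsub>P\<^esub> = \<zero>\<^bsub>N\<^esub>" by (rule module_hom_zero[OF mP mN \<epsilon>(1)])
  have \<epsilon>\<alpha>: "\<epsilon> (\<alpha>' v) = \<alpha> (f v)" if v: "v \<in> Fr C" for v
  proof -
    let ?T = "{v \<in> Fr C. \<epsilon> (\<alpha>' v) = \<alpha> (f v)}"
    have "sub ?T"
      unfolding sub_def
    proof (intro conjI ballI allI)
      show "0 \<in> ?T" using sub_zero[OF sub_Fr] \<alpha>(4)[OF sub_zero[OF U] sub_zero[OF W]] by (simp add: z0 \<epsilon>0 fl)
      fix u assume "u \<in> ?T"
      then have u: "u \<in> Fr C" "\<epsilon> (\<alpha>' u) = \<alpha> (f u)" by simp_all
      show "r *s u \<in> ?T" for r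
        using sub_sc[OF sub_Fr u(1)] u(2) \<alpha>(3)[OF F(3)[OF u(1)]] module_homD(3)[OF \<epsilon>(1) pi_closed A(1)]
        by (simp add: A(3) fl)
      fix v assume "v \<in> ?T"
      then have v: "v \<in> Fr C" "\<epsilon> (\<alpha>' v) = \<alpha> (f v)" by simp_all
      show "u + v \<in> ?T"
        using sub_add[OF sub_Fr u(1) v(1)] u(2) v(2) \<alpha>(2)[OF F(3)[OF u(1)] F(3)[OF v(1)]]
          module_homD(2)[OF \<epsilon>(1) A(1) A(1)] by (simp add: A(2) fl)
    qed
    from lin_into[OF F(1) lin_intros(1) this _ v] show ?thesis using \<alpha>'(2) a(2) by simp
  qed
  have "\<exists>\<beta>'. rlin P (hat \<kk>) \<beta>' \<and> (\<forall>x\<in>carrier P. \<beta>' x \<in> Fr C \<and> f (\<beta>' x) - \<beta> (\<epsilon> x) \<in> W)"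
    by (rule projective_lift[OF P rlin_comp[OF \<beta>(1) \<epsilon>(1)] \<beta>(2)[OF module_homD(1)[OF \<epsilon>(1)]] cf W fh])
  then obtain \<beta>' where \<beta>': "rlin P (hat \<kk>) \<beta>'" "\<And>x. x \<in> carrier P \<Longrightarrow> \<beta>' x \<in> Fr C"
    "\<And>x. x \<in> carrier P \<Longrightarrow> f (\<beta>' x) - \<beta> (\<epsilon> x) \<in> W" by blast
  have "\<exists>s. lin s \<and> (\<forall>v\<in>Fr D. s v \<in> Fr C \<and> f (s v) - e v \<in> W)"
    by (rule free_lift[OF D e(1) F(2) sub_Fr W]) (use F(4)[OF e(2)] sub_diff_sym[OF W] in blast)
  then obtain e' where e': "lin e'" "\<And>v. v \<in> Fr D \<Longrightarrow> e' v \<in> Fr C" "\<And>v. v \<in> Fr D \<Longrightarrow> f (e' v) - e v \<in> W" by blast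
  define \<eta> where "\<eta> v = v - \<beta>' (\<alpha>' v) - e' (\<kappa> (f v))" for v
  have \<eta>C: "\<eta> v \<in> Fr C" if v: "v \<in> Fr C" for v
    unfolding \<eta>_def by (intro sub_diff[OF sub_Fr] v \<beta>'(2) A(1) e'(2) \<kappa>(2) F(3))
  have \<eta>L: "\<eta> v \<in> ?L" if v: "v \<in> Fr C" for v
  proof -
    note fu = F(3)[OF v]
    have "f (\<eta> v) = (f v - \<beta> (\<alpha> (f v)) - e (\<kappa> (f v))) - (f (\<beta>' (\<alpha>' v)) - \<beta> (\<epsilon> (\<alpha>' v))) - (f (e' (\<kappa> (f v))) - e (\<kappa> (f v)))"
      by (simp add: \<eta>_def fl \<epsilon>\<alpha>[OF v])
    also have "\<dots> \<in> W" by (intro sub_diff[OF W] r fu \<beta>'(3) A(1) e'(3) \<kappa>(2))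
    finally show ?thesis using \<eta>C[OF v] by (simp add: kr_def)
  qed
  have q1: "qlin (Fr C) (hat \<kk>) (hat \<kk>) (\<lambda>v. v)" by (rule qlin_lin[OF lin_intros(1) sh])
  have q2: "qlin (Fr C) (hat \<kk>) (hat \<kk>) (\<lambda>v. \<beta>' (\<alpha>' v))"
    unfolding qlin_def
  proof (intro conjI ballI allI impI)
    show "\<beta>' (\<alpha>' (u + v)) - (\<beta>' (\<alpha>' u) + \<beta>' (\<alpha>' v)) \<in> hat \<kk>" for u v
      using rlinD(1)[OF \<beta>'(1) A(1) A(1)] by (simp only: A(2))
    show "\<beta>' (\<alpha>' (r *s u)) - r *s \<beta>' (\<alpha>' u) \<in> hat \<kk>" for r u
    proof -
      have 1: "\<beta>' (\<alpha>' (r *s u)) - fvar (\<pi> r) *s \<beta>' (\<alpha>' u) \<in> hat \<kk>"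
        using rlinD(2)[OF \<beta>'(1) pi_closed A(1)] by (simp only: A(3))
      have "(fvar (\<pi> r) - r) *s \<beta>' (\<alpha>' u) \<in> hat \<kk>" by (rule hat_sc[OF idl_kk]) (simp add: pre_def)
      then have "fvar (\<pi> r) *s \<beta>' (\<alpha>' u) - r *s \<beta>' (\<alpha>' u) \<in> hat \<kk>" by (simp only: sc_distrib)
      from sub_diff_trans[OF sh 1 this] show ?thesis .
    qed
    show "\<beta>' (\<alpha>' u) \<in> hat \<kk>" if "u \<in> Fr C" "u \<in> hat \<kk>" for u
      using slin_hat[OF mP \<alpha>'(1) F(1) that] rlin_zero[OF mP \<beta>'(1) sh] by simp
  qed
  have q3: "qlin (Fr C) (hat \<kk>) (hat \<kk>) (\<lambda>v. \<kappa> (f v))"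
    by (rule qlin_comp_lin[OF \<kappa>(1) F(2,3) fh])
  have q3': "qlin (Fr C) (hat \<kk>) (hat \<kk>) (\<lambda>v. e' (\<kappa> (f v)))"
    by (rule lin_qlin[OF q3 e'(1) _ sub_Fr sub_Fr]) (use lin_hat[OF idl_kk D e'(1)] \<kappa>(2) F(3) in blast)+
  have q: "qlin (Fr C) (hat \<kk>) (hat \<kk>) \<eta>"
    unfolding \<eta>_def by (rule qlin_diff[OF qlin_diff[OF q1 q2 sh] q3' sh])
  from qlin_linear[OF q idl_kk F(1) L \<eta>L] obtain \<eta>l where \<eta>l: "lin \<eta>l" "\<And>v. v \<in> Fr C \<Longrightarrow> \<eta>l v \<in> ?L"
    "\<And>v. v \<in> Fr C \<Longrightarrow> \<eta> v - \<eta>l v \<in> hat \<kk>" by blast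
  have LD: "v \<in> Fr C" "f v \<in> W" "f v \<in> U" if "v \<in> ?L" for v using that F(3) by (auto simp: kr_def)
  have \<alpha>K: "\<alpha>' v \<in> K" if v: "v \<in> ?L" for v
    using \<epsilon>\<alpha>[OF LD(1)[OF v]] \<alpha>(4)[OF LD(3)[OF v] LD(2)[OF v]] A(1) by (simp add: K)
  have KP: "x \<in> carrier P" if "x \<in> K" for x using that by (simp add: K)
  have \<beta>L: "\<beta>' x \<in> ?L" if x: "x \<in> K" for x
  proof -
    have "\<epsilon> x = \<zero>\<^bsub>N\<^esub>" using x by (simp add: K)
    then have "f (\<beta>' x) - \<beta> \<zero>\<^bsub>N\<^esub> \<in> W" using \<beta>'(3)[OF KP[OF x]] by simp
    then have "f (\<beta>' x) \<in> W" using sub_diff_iff[OF W] rlin_zero[OF mN \<beta>(1) W] by blast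
    then show ?thesis using \<beta>'(2)[OF KP[OF x]] by (simp add: kr_def)
  qed
  have \<kappa>h: "e' (\<kappa> (f v)) \<in> hat \<kk>" if v: "v \<in> ?L" for v
    by (rule lin_hat[OF idl_kk D e'(1) \<kappa>(2)[OF LD(3)[OF v]] qlinD(3)[OF \<kappa>(1) LD(3)[OF v] LD(2)[OF v]]])
  have "trel ?L (hat \<kk>) (sub_module P K)"
    unfolding trel_def trelw_def
  proof (intro exI conjI ballI allI impI)
    show "\<alpha>' u \<in> carrier (sub_module P K)" if "u \<in> ?L" for u using \<alpha>K[OF that] by simp
    show "\<alpha>' (u + v) = \<alpha>' u \<oplus>\<^bsub>sub_module P K\<^esub> \<alpha>' v" for u v by (simp add: A(2))
    show "\<alpha>' (r *s u) = \<pi> r \<odot>\<^bsub>sub_module P K\<^esub> \<alpha>' u" for r u by (simp add: A(3))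
    show "\<alpha>' u = \<zero>\<^bsub>sub_module P K\<^esub>" if "u \<in> ?L" "u \<in> hat \<kk>" for u
      using slin_hat[OF mP \<alpha>'(1) F(1) LD(1)[OF that(1)] that(2)] by simp
    show "rlin (sub_module P K) (hat \<kk>) \<beta>'" using \<beta>'(1) KP unfolding rlin_def by simp
    show "\<beta>' x \<in> ?L" if "x \<in> carrier (sub_module P K)" for x using \<beta>L that by simp
    show "finite C" by (rule F(1))
    show "qlin ?L (hat \<kk>) (hat \<kk>) (\<lambda>v. v)" by (rule qlin_lin[OF lin_intros(1) sh])
    show "u \<in> Fr C" if "u \<in> ?L" for u by (rule LD(1)[OF that])
    show "lin \<eta>l" by (rule \<eta>l(1))
    show "\<eta>l v \<in> ?L" if "v \<in> Fr C" for v by (rule \<eta>l(2)[OF that])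
    show "u - \<beta>' (\<alpha>' u) - \<eta>l u \<in> hat \<kk>" if u: "u \<in> ?L" for u
    proof -
      have "u - \<beta>' (\<alpha>' u) - \<eta>l u = (\<eta> u - \<eta>l u) + e' (\<kappa> (f u))" by (simp add: \<eta>_def)
      also have "\<dots> \<in> hat \<kk>" by (rule sub_add[OF sh \<eta>l(3)[OF LD(1)[OF u]] \<kappa>h[OF u]])
      finally show ?thesis .
    qed
  qed
  moreover have "ext \<kk> ?L"
    unfolding ext_def
  proof (intro allI impI)
    fix \<phi> assume \<phi>: "mlf \<kk> ?L \<phi>"
    note \<phi>D = mlfD[OF \<phi>]
    \<comment> \<open>Transported to \<open>K\<close>, the functional extends to \<open>P\<close> by
      hypothesis. Pulled back along \<open>\<alpha>'\<close>, it yields the part of the extension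
      that belongs to \<open>\<beta>' \<alpha>'\<close>; the other part is \<open>\<phi>\<close>
      after \<open>\<eta>\<close>.\<close>
    define \<theta> where "\<theta> x = \<pi> (\<phi> (\<beta>' x))" for x
    have "\<theta> \<in> module_hom R (sub_module P K) (ring_as_module R)"
      unfolding module_hom_def
    proof (intro CollectI conjI ballI)
      show "\<theta> \<in> carrier (sub_module P K) \<rightarrow> carrier (ring_as_module R)" by (simp add: \<theta>_def)
      fix x assume "x \<in> carrier (sub_module P K)"
      then have x: "x \<in> K" by simp
      note bx = \<beta>L[OF x]
      show "\<theta> (x \<oplus>\<^bsub>sub_module P K\<^esub> y) = \<theta> x \<oplus>\<^bsub>ring_as_module R\<^esub> \<theta> y" if "y \<in> carrier (sub_module P K)" for y
      proof -
        have y: "y \<in> K" using that by simp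
        have xy: "x \<oplus>\<^bsub>P\<^esub> y \<in> K" using x y module_homD(2)[OF \<epsilon>(1)] by (simp add: K)
        have "\<phi> (\<beta>' (x \<oplus>\<^bsub>P\<^esub> y)) - (\<phi> (\<beta>' x) + \<phi> (\<beta>' y)) \<in> \<kk>"
          by (rule idl_diff_trans[OF idl_kk mlf_cong[OF \<phi> idl_kk L \<beta>L[OF xy] sub_add[OF L bx \<beta>L[OF y]]
                rlinD(1)[OF \<beta>'(1) KP[OF x] KP[OF y]]] \<phi>D(1)[OF bx \<beta>L[OF y]]])
        then show ?thesis by (simp only: pi_diff_zero) (simp add: \<theta>_def)
      qed
      show "\<theta> (r \<odot>\<^bsub>sub_module P K\<^esub> x) = r \<odot>\<^bsub>ring_as_module R\<^esub> \<theta> x" if r: "r \<in> carrier R" for r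
      proof -
        have rx: "r \<odot>\<^bsub>P\<^esub> x \<in> K" using x r module_homD(3)[OF \<epsilon>(1)] by (simp add: K)
        have "\<phi> (\<beta>' (r \<odot>\<^bsub>P\<^esub> x)) - fvar r * \<phi> (\<beta>' x) \<in> \<kk>"
          by (rule idl_diff_trans[OF idl_kk mlf_cong[OF \<phi> idl_kk L \<beta>L[OF rx] sub_sc[OF L bx]
                rlinD(2)[OF \<beta>'(1) r KP[OF x]]] \<phi>D(2)[OF bx]])
        then show ?thesis using r by (simp only: pi_diff_zero) (simp add: \<theta>_def)
      qed
    qed
    from ext[OF this] obtain \<Psi> where \<Psi>: "\<Psi> \<in> module_hom R P (ring_as_module R)" "\<And>x. x \<in> K \<Longrightarrow> \<theta> x = \<Psi> x" by blast
    note \<Psi>h = module_homD[OF \<Psi>(1)]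
    have \<Psi>c: "\<Psi> (\<alpha>' v) \<in> carrier R" for v using \<Psi>h(1)[OF A(1)] by simp
    \<comment> \<open>The minus sign is there so that \<open>mlf_sub\<close> forms the sum of the
      two parts.\<close>
    define \<chi> where "\<chi> v = - fvar (\<Psi> (\<alpha>' v))" for v
    have "mlf \<kk> (Fr C) \<chi>"
      unfolding mlf_def
    proof (intro conjI ballI allI impI)
      show "\<chi> (u + v) - (\<chi> u + \<chi> v) \<in> \<kk>" for u v
        using \<Psi>h(2)[OF A(1) A(1)] \<Psi>c by (simp only: pi_diff_zero) (simp add: \<chi>_def A(2) minus_add minus_eq)
      show "\<chi> (r *s u) - r * \<chi> u \<in> \<kk>" for r u
        using \<Psi>h(3)[OF pi_closed A(1)] \<Psi>c by (simp only: pi_diff_zero) (simp add: \<chi>_def A(3) r_minus)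
      show "\<chi> u \<in> \<kk>" if "u \<in> Fr C" "u \<in> hat \<kk>" for u
        using slin_hat[OF mP \<alpha>'(1) F(1) that] module_hom_zero[OF mP module_ring \<Psi>(1)]
        by (simp add: \<chi>_def pre_def)
    qed
    from mlf_linear[OF mlf_sub[OF mlf_qlin[OF \<phi> idl_kk L q sub_Fr \<eta>L] this idl_kk] idl_kk F(1)]
    obtain \<psi> where \<psi>: "lin1 \<psi>" "\<And>v. v \<in> Fr C \<Longrightarrow> \<phi> (\<eta> v) - \<chi> v - \<psi> v \<in> \<kk>" by blast
    have "\<phi> v - \<psi> v \<in> \<kk>" if v: "v \<in> ?L" for v
    proof -
      note vC = LD(1)[OF v]
      let ?b = "\<beta>' (\<alpha>' v)"
      have b: "?b \<in> ?L" by (rule \<beta>L[OF \<alpha>K[OF v]])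
      have w: "v - ?b \<in> ?L" by (rule sub_diff[OF L v b])
      have 1: "\<phi> (v - ?b) - (\<phi> v - \<phi> ?b) \<in> \<kk>" by (rule mlf_minus[OF \<phi> idl_kk L v b])
      have "(v - ?b) - \<eta> v \<in> hat \<kk>" using \<kappa>h[OF v] by (simp add: \<eta>_def)
      from mlf_cong[OF \<phi> idl_kk L w \<eta>L[OF vC] this] have 2: "\<phi> (v - ?b) - \<phi> (\<eta> v) \<in> \<kk>" .
      have 3: "\<phi> ?b + \<chi> v \<in> \<kk>"
        using \<Psi>(2)[OF \<alpha>K[OF v]] \<Psi>c by (simp add: \<chi>_def pre_def \<theta>_def r_neg)
      have "\<phi> v - \<psi> v = (\<phi> (\<eta> v) - \<chi> v - \<psi> v) + (\<phi> (v - ?b) - \<phi> (\<eta> v)) - (\<phi> (v - ?b) - (\<phi> v - \<phi> ?b)) + (\<phi> ?b + \<chi> v)"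
        by simp
      also have "\<dots> \<in> \<kk>" by (intro idl_add[OF idl_kk] idl_diff[OF idl_kk] \<psi>(2) vC 1 2 3)
      finally show ?thesis .
    qed
    then show "\<exists>\<psi>. lin1 \<psi> \<and> (\<forall>v\<in>?L. \<phi> v - \<psi> v \<in> \<kk>)" using \<psi>(1) by blast
  qed
  ultimately show ?thesis using cf by blast
qed

text \<open>A resolution along which functionals extend certifies the Ext condition for every module
  related to its start. Its terms may be infinitely generated projectives, whereas the covers in
  \<open>good\<close> are finite free.\<close>

lemma trel_good:
  fixes U W :: "(nat \<Rightarrow> 'a frng) set"
  assumes noeth: "noetherian_ring R" and N: "\<And>j. module R (N j)" and P: "\<And>j. projective_module R (P j)"
    and \<epsilon>: "\<And>j. \<epsilon> j \<in> module_hom R (P j) (N j)" "\<And>j. \<epsilon> j ` carrier (P j) = carrier (N j)"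
    and K: "\<And>j. N (Suc j) = sub_module (P j) {x \<in> carrier (P j). \<epsilon> j x = \<zero>\<^bsub>N j\<^esub>}"
    and ext: "\<And>j \<theta>. \<theta> \<in> module_hom R (N (Suc j)) (ring_as_module R) \<Longrightarrow>
      \<exists>\<Psi>\<in>module_hom R (P j) (ring_as_module R). \<forall>x\<in>carrier (N (Suc j)). \<theta> x = \<Psi> x"
    and B: "finite B" and m: "md \<kk> (Fr B) W" and hW: "\<And>u. u \<in> Fr B \<Longrightarrow> u \<in> hat \<kk> \<Longrightarrow> u \<in> W" and t: "trel (Fr B) W (N 0)"
  shows "good \<kk> 0 (Fr B) W"
proof -
  define Q where "Q h U W \<longleftrightarrow> h = (0 :: nat) \<and> (\<exists>j B. finite B \<and> md \<kk> U W \<and> U \<subseteq> Fr B \<and> (\<forall>v\<in>Fr B. v \<in> hat \<kk> \<longrightarrow> v \<in> U) \<and>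
    (\<forall>u\<in>U. u \<in> hat \<kk> \<longrightarrow> u \<in> W) \<and> trel U W (N j))" for h and U W :: "(nat \<Rightarrow> 'a frng) set"
  show ?thesis
  proof (rule good_coind[of Q])
    show "Q 0 (Fr B) W" unfolding Q_def using B m hW t by blast
    fix h U W assume Qh: "Q h U W"
    then obtain j B where h: "h = 0" and j: "finite B" "md \<kk> U W" "U \<subseteq> Fr B" "\<And>v. v \<in> Fr B \<Longrightarrow> v \<in> hat \<kk> \<Longrightarrow> v \<in> U"
      "\<And>u. u \<in> U \<Longrightarrow> u \<in> hat \<kk> \<Longrightarrow> u \<in> W" "trel U W (N j)" unfolding Q_def by blast
    let ?K = "{x \<in> carrier (P j). \<epsilon> j x = \<zero>\<^bsub>N j\<^esub>}"
    have ext': "\<exists>\<Psi>\<in>module_hom R (P j) (ring_as_module R). \<forall>x\<in>?K. \<theta> x = \<Psi> x"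
      if "\<theta> \<in> module_hom R (sub_module (P j) ?K) (ring_as_module R)" for \<theta>
      using ext[of \<theta> j] that unfolding K by simp
    have "\<exists>f (C :: nat set). cov f C U W \<and> ext \<kk> (kr f C W) \<and> trel (kr f C W) (hat \<kk>) (sub_module (P j) ?K)"
      by (rule trel_step[OF noeth N P \<epsilon>(1)[of j] \<epsilon>(2)[of j] HOL.refl ext' j(2) j(1) j(3) j(4) j(5) j(6)])
    then obtain f and C :: "nat set" where
      f: "cov f C U W" "ext \<kk> (kr f C W)" "trel (kr f C W) (hat \<kk>) (N (Suc j))" unfolding K by blast
    note F = covD[OF f(1)]
    have L: "sub (kr f C W)" by (rule sub_kr[OF F(2) mdD(2)[OF j(2)]])
    have "Q (h - 1) (kr f C W) (hat \<kk>)"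
      unfolding Q_def
    proof (intro conjI exI ballI impI)
      show "finite C" by (rule F(1))
      show "md \<kk> (kr f C W) (hat \<kk>)" by (rule md_hat[OF idl_kk L])
      show "kr f C W \<subseteq> Fr C" by (auto simp: kr_def)
      show "v \<in> kr f C W" if "v \<in> Fr C" "v \<in> hat \<kk>" for v
        using cov_hat[OF f(1) j(2) that] that(1) by (simp add: kr_def)
    qed (use h f(3) in auto)
    then show "md \<kk> U W \<and> (\<exists>e B. cov e B U W \<and> (h = 0 \<longrightarrow> ext \<kk> (kr e B W)) \<and>
      (Q (h - 1) (kr e B W) (hat \<kk>) \<or> good \<kk> (h - 1) (kr e B W) (hat \<kk>)))"
      using j(2) f(1,2) by blast
  qed
qed


section \<open>Projective resolutions, Ext and G-dimension\<close>

lemma smod_ker: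
  assumes "module R M" "module R N" "f \<in> module_hom R M N" shows "smod M {x \<in> carrier M. f x = \<zero>\<^bsub>N\<^esub>}"
proof -
  interpret M: module R M by fact
  interpret N: module R N by fact
  show ?thesis using module_homD[OF assms(3)] module_hom_zero[OF assms] by (auto simp: smod_def)
qed

lemma smod_image:
  assumes "module R M" "module R N" "f \<in> module_hom R M N" shows "smod N (f ` carrier M)"
proof -
  interpret M: module R M by fact
  note f = module_homD[OF assms(3)]
  show ?thesis
    unfolding smod_def
  proof (intro conjI ballI)
    show "\<zero>\<^bsub>N\<^esub> \<in> f ` carrier M" using module_hom_zero[OF assms] by (metis M.zero_closed image_eqI)
    fix x assume "x \<in> f ` carrier M"
    then obtain a where a: "a \<in> carrier M" "x = f a" by blast
    show "r \<odot>\<^bsub>N\<^esub> x \<in> f ` carrier M" if "r \<in> carrier R" for r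
      by (rule image_eqI[of _ _ "r \<odot>\<^bsub>M\<^esub> a"]) (use a f(3)[OF that] that in simp_all)
    fix y assume "y \<in> f ` carrier M"
    then obtain b where b: "b \<in> carrier M" "y = f b" by blast
    show "x \<oplus>\<^bsub>N\<^esub> y \<in> f ` carrier M"
      by (rule image_eqI[of _ _ "a \<oplus>\<^bsub>M\<^esub> b"]) (use a b f(2) in simp_all)
  qed (use f(1) in auto)
qed

definition pres where "pres M C e \<longleftrightarrow> finite (C :: nat set) \<and> slin M e \<and> e ` Fr C = carrier M"

lemma fg_pres:
  assumes M: "module R M" and fg: "finitely_generated R M"
  shows "\<exists>C e. pres M C e"
proof -
  interpret M: module R M by fact
  from fg obtain A where A: "finite A" "A \<subseteq> carrier M"
    "\<And>x. x \<in> carrier M \<Longrightarrow> \<exists>c\<in>A \<rightarrow> carrier R. x = (\<Oplus>\<^bsub>M\<^esub>a\<in>A. c a \<odot>\<^bsub>M\<^esub> a)" unfolding finitely_generated_def by blast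
  obtain as where as: "set as = A" using finite_list[OF A(1)] by blast
  let ?C = "{..<length as}"
  have "\<exists>\<phi>. slin M \<phi> \<and> (\<forall>i\<in>?C. \<phi> (un i) = as ! i)"
    by (rule slin_ex[OF M]) (use as A(2) in \<open>auto dest: nth_mem\<close>)
  then obtain e where "slin M e \<and> (\<forall>i\<in>?C. e (un i) = as ! i)" ..
  then have e: "slin M e" "\<And>i. i \<in> ?C \<Longrightarrow> e (un i) = as ! i" by simp_all
  note S = slinD[OF e(1)]
  let ?T = "e ` Fr ?C"
  have T0: "\<zero>\<^bsub>M\<^esub> \<in> ?T" by (rule image_eqI[OF _ sub_zero[OF sub_Fr]]) (simp add: slin_zero[OF M e(1)])
  have Ta: "x \<oplus>\<^bsub>M\<^esub> y \<in> ?T" if xy: "x \<in> ?T" "y \<in> ?T" for x y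
  proof -
    from xy obtain u v where uv: "u \<in> Fr ?C" "x = e u" "v \<in> Fr ?C" "y = e v" by blast
    show ?thesis by (rule image_eqI[OF _ sub_add[OF sub_Fr uv(1,3)]]) (simp add: uv S(2))
  qed
  have Ts: "r \<odot>\<^bsub>M\<^esub> a \<in> ?T" if r: "r \<in> carrier R" and a: "a \<in> A" for r a
  proof -
    from a as obtain i where i: "i < length as" "a = as ! i" by (metis in_set_conv_nth)
    show ?thesis
      by (rule image_eqI[OF _ sub_sc[OF sub_Fr un_Fr[of i]], of _ _ "fvar r"]) (use i e(2) r in \<open>simp_all add: S(3)\<close>)
  qed
  have "(\<Oplus>\<^bsub>M\<^esub>a\<in>A'. c a \<odot>\<^bsub>M\<^esub> a) \<in> ?T" if "finite A'" "A' \<subseteq> A" "c \<in> A \<rightarrow> carrier R" for A' c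
    using that(1,2)
  proof (induction A')
    case (insert a A')
    have ca: "c b \<odot>\<^bsub>M\<^esub> b \<in> carrier M" if "b \<in> A" for b using that \<open>c \<in> _\<close> A(2) by auto
    have "(\<Oplus>\<^bsub>M\<^esub>b\<in>insert a A'. c b \<odot>\<^bsub>M\<^esub> b) = c a \<odot>\<^bsub>M\<^esub> a \<oplus>\<^bsub>M\<^esub> (\<Oplus>\<^bsub>M\<^esub>b\<in>A'. c b \<odot>\<^bsub>M\<^esub> b)"
      by (rule M.finsum_insert[OF insert.hyps]) (use ca insert.prems in auto)
    moreover have "c a \<in> carrier R" and "a \<in> A" using insert.prems \<open>c \<in> _\<close> by auto
    moreover have "(\<Oplus>\<^bsub>M\<^esub>b\<in>A'. c b \<odot>\<^bsub>M\<^esub> b) \<in> ?T" using insert.IH insert.prems by blast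
    ultimately show ?case using Ta[OF Ts] by metis
  qed (use T0 in simp)
  then have "carrier M \<subseteq> ?T" using A(1,3) by fastforce
  then show ?thesis using e(1) S(1) unfolding pres_def by (intro exI[of _ ?C] exI[of _ e]) auto
qed

lemma pres_md:
  assumes "module R M" "pres M C e" shows "md \<kk> (Fr C) {v. e v = \<zero>\<^bsub>M\<^esub>}"
proof -
  interpret M: module R M by fact
  have s: "slin M e" using assms(2) by (simp add: pres_def)
  have "sub {v. e v = \<zero>\<^bsub>M\<^esub>}" using slin_sub[OF assms(1) s smod_zero[OF assms(1)]] by simp
  then show ?thesis using sub_Fr slinD[OF s] by (simp add: md_def pre_def)
qed

text \<open>\<open>Ext\<close> picks its resolution by \<open>SOME\<close>, so one has to exist in
  the prescribed type. Dependent choice builds it by covering one syzygy after another.\<close>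

lemma exists_projective_resolution:
  assumes noeth: "noetherian_ring R" and one: "\<one> \<noteq> \<zero>" and M: "module R M" and p: "pres M C0 e0"
  shows "\<exists>F :: ('a, nat \<Rightarrow> 'a) module_complex. projective_resolution R M F"
proof -
  have C0: "finite C0" and e0: "slin M e0" "e0 ` Fr C0 = carrier M" using p by (simp_all add: pres_def)
  interpret M: module R M by fact
  \<comment> \<open>A state consists of the index set of the last free module, the map out of it,
    and the kernel that has to be covered next.\<close>
  define Q where "Q \<sigma> \<longleftrightarrow> (case \<sigma> of (C, e, L) \<Rightarrow> finite C \<and> sub L \<and> L \<subseteq> Fr C \<and> (\<forall>v\<in>Fr C. v \<in> hat \<kk> \<longrightarrow> v \<in> L))"
    for \<sigma> :: "nat set \<times> ((nat \<Rightarrow> 'a frng) \<Rightarrow> nat \<Rightarrow> 'a frng) \<times> (nat \<Rightarrow> 'a frng) set"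
  define T where "T \<sigma> \<tau> \<longleftrightarrow> (case \<sigma> of (C, e, L) \<Rightarrow> case \<tau> of (C', e', L') \<Rightarrow> cov e' C' L (hat \<kk>) \<and> L' = kr e' C' (hat \<kk>))"
    for \<sigma> \<tau> :: "nat set \<times> ((nat \<Rightarrow> 'a frng) \<Rightarrow> nat \<Rightarrow> 'a frng) \<times> (nat \<Rightarrow> 'a frng) set"
  let ?K0 = "{v \<in> Fr C0. e0 v = \<zero>\<^bsub>M\<^esub>}"
  have sK: "sub ?K0"
    using sub_preimage[OF sub_Fr mdD(2)[OF pres_md[OF M p]] lin_intros(1)] by simp
  have "\<exists>s. \<forall>n. (Q (s n) \<and> (n = 0 \<longrightarrow> s n = (C0, \<lambda>v. v, ?K0))) \<and> T (s n) (s (Suc n))"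
  proof (rule dependent_nat_choice)
    show "\<exists>x. Q x \<and> (0 = (0::nat) \<longrightarrow> x = (C0, \<lambda>v. v, ?K0))"
      by (rule exI[of _ "(C0, \<lambda>v. v, ?K0)"]) (use C0 sK slin_hat[OF M e0(1) C0] in \<open>auto simp: Q_def\<close>)
    fix x and n :: nat assume "Q x \<and> (n = 0 \<longrightarrow> x = (C0, \<lambda>v. v, ?K0))"
    then obtain C e L where x: "x = (C, e, L)" "finite C" "sub L" "L \<subseteq> Fr C" "\<And>v. v \<in> Fr C \<Longrightarrow> v \<in> hat \<kk> \<Longrightarrow> v \<in> L"
      by (cases x) (auto simp: Q_def)
    from noeth_cover[OF noeth x(2-5)] obtain e' and C' :: "nat set" where c: "cov e' C' L (hat \<kk>)" by blast
    note C' = covD[OF c]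
    have "v \<in> kr e' C' (hat \<kk>)" if "v \<in> Fr C'" "v \<in> hat \<kk>" for v
      using that lin_hat[OF idl_kk C'(1,2) that] by (simp add: kr_def)
    then have "Q (C', e', kr e' C' (hat \<kk>))"
      unfolding Q_def using C'(1) sub_kr[OF C'(2) sub_hat[OF idl_kk]] by (auto simp: kr_def)
    moreover have "T x (C', e', kr e' C' (hat \<kk>))" using c by (simp add: T_def x(1))
    ultimately show "\<exists>y. (Q y \<and> (Suc n = 0 \<longrightarrow> y = (C0, \<lambda>v. v, ?K0))) \<and> T x y" by blast
  qed
  then obtain s where s: "\<And>n. Q (s n)" "s 0 = (C0, \<lambda>v. v, ?K0)" "\<And>n. T (s n) (s (Suc n))" by blast
  define C where "C n = fst (s n)" for n
  define e where "e n = fst (snd (s n))" for n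
  define L where "L n = snd (snd (s n))" for n
  have sn: "s n = (C n, e n, L n)" for n by (simp add: C_def e_def L_def)
  have fin: "finite (C n)" and sL: "sub (L n)" and LC: "L n \<subseteq> Fr (C n)"
    and hL: "\<And>v. v \<in> Fr (C n) \<Longrightarrow> v \<in> hat \<kk> \<Longrightarrow> v \<in> L n" for n
    using s(1)[of n] unfolding Q_def sn by auto
  have c: "cov (e (Suc n)) (C (Suc n)) (L n) (hat \<kk>)" and L: "L (Suc n) = kr (e (Suc n)) (C (Suc n)) (hat \<kk>)" for n
    using s(3)[of n] unfolding T_def sn by auto
  have 0: "C 0 = C0" "L 0 = ?K0" using s(2) by (simp_all add: C_def L_def)
  define B where "B i = (if i < 0 then {} else C (nat i))" for i :: int
  \<comment> \<open>The map stored in the initial state is a dummy, so degree 0 gets the zero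
    differential; the augmentation \<open>e0\<close> is kept apart.\<close>
  define d where "d i = (if i \<le> 0 then (\<lambda>_. 0) else e (nat i))" for i :: int
  have dS: "d (int n + 1) = e (Suc n)" and BS: "B (int n + 1) = C (Suc n)" and Bn: "B (int n) = C n" for n
    by (simp_all add: d_def B_def nat_add_distrib)
  have int_cases': "i \<le> 0 \<or> (\<exists>n. i = int n + 1)" for i :: int
    by (metis add.commute int_Suc le_less_linear zero_less_imp_eq_int of_nat_0_less_iff gr0_implies_Suc)
  have cpx: "cpx \<kk> B d"
    unfolding cpx_def
  proof (intro conjI allI ballI)
    show "finite (B i)" for i using fin by (simp add: B_def)
    show "lin (d i)" for i
      using int_cases'[of i] covD(2)[OF c] dS by (auto simp: d_def lin_intros)
    fix i and v :: "nat \<Rightarrow> 'a frng" assume v: "v \<in> Fr (B i)"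
    show "d i v \<in> Fr (B (i - 1))"
    proof (cases "i \<le> 0")
      case True
      then show ?thesis by (simp add: d_def sub_zero[OF sub_Fr])
    next
      case False
      then obtain n where n: "i = int n + 1" using int_cases' by blast
      have "v \<in> Fr (C (Suc n))" using v by (simp add: n BS)
      from covD(3)[OF c this] LC[of n] show ?thesis by (auto simp: n dS Bn)
    qed
    show "d (i - 1) (d i v) \<in> hat \<kk>"
    proof (cases "i \<le> 1")
      case True
      then show ?thesis by (simp add: d_def sub_zero[OF sub_hat[OF idl_kk]])
    next
      case False
      then obtain n where n: "i - 1 = int n + 1" using int_cases'[of "i - 1"] by auto
      then have i: "i = int (Suc n) + 1" by simp
      have "v \<in> Fr (C (Suc (Suc n)))" using v by (simp only: i BS)
      from covD(3)[OF c this] show ?thesis unfolding n unfolding i dS L kr_def by blast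
    qed
  qed
  have Zc: "Zc \<kk> B d (int n + 1) = L (Suc n)" for n by (simp add: Zc_def L kr_def dS BS)
  have Bc: "Bc \<kk> B d (int n) = L n" for n
  proof
    show "Bc \<kk> B d (int n) \<subseteq> L n"
    proof
      fix v assume "v \<in> Bc \<kk> B d (int n)"
      then obtain w where w: "v \<in> Fr (C n)" "w \<in> Fr (C (Suc n))" "v - e (Suc n) w \<in> hat \<kk>"
        by (auto simp: Bc_def Bn BS dS)
      have ew: "e (Suc n) w \<in> L n" by (rule covD(3)[OF c w(2)])
      have "v - e (Suc n) w \<in> L n" by (rule hL[OF sub_diff[OF sub_Fr w(1)] w(3)]) (use ew LC in blast)
      then show "v \<in> L n" using sub_diff_iff[OF sL] ew by blast
    qed
    show "L n \<subseteq> Bc \<kk> B d (int n)"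
    proof
      fix v assume v: "v \<in> L n"
      from covD(4)[OF c v] obtain w where "w \<in> Fr (C (Suc n))" "v - e (Suc n) w \<in> hat \<kk>" by blast
      then show "v \<in> Bc \<kk> B d (int n)" using v LC by (auto simp: Bc_def Bn BS dS)
    qed
  qed
  have inj: "inj (id :: nat \<Rightarrow> nat)" by simp
  let ?F = "cx id B d"
  note F = cx_complex[OF inj cpx]
  define \<epsilon> where "\<epsilon> f = e0 (unemb id C0 f)" for f
  have \<epsilon>v: "\<epsilon> (emb id v) = e0 v" if v: "v \<in> Fr C0" for v
  proof -
    let ?u = "unemb id C0 (emb id v)"
    have "emb id ?u = emb id v" using emb_unemb[OF inj emb_closed[OF inj C0 v]] .
    then have "?u - v \<in> hat \<kk>" using emb_eq[OF inj] by blast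
    then have "e0 (?u - v) = \<zero>\<^bsub>M\<^esub>" by (rule slin_hat[OF M e0(1) C0 sub_diff[OF sub_Fr unemb_Fr v]])
    then have "e0 ?u \<ominus>\<^bsub>M\<^esub> e0 v = \<zero>\<^bsub>M\<^esub>" by (simp only: slin_minus[OF M e0(1)])
    then have "e0 ?u = e0 v"
      using M.minus_equality[of "e0 ?u" "\<ominus>\<^bsub>M\<^esub> e0 v"] slinD(1)[OF e0(1)] by (simp add: M.minus_eq)
    then show ?thesis by (simp add: \<epsilon>_def)
  qed
  have F0: "cobj ?F 0 = free_module R (id ` C0)" by (simp add: B_def 0)
  have car: "carrier (cobj ?F 0) = emb id ` Fr C0"
  proof
    show "carrier (cobj ?F 0) \<subseteq> emb id ` Fr C0"
      unfolding F0 by (rule subsetI, erule cx_elem[OF inj]) simp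
    show "emb id ` Fr C0 \<subseteq> carrier (cobj ?F 0)"
      unfolding F0 using emb_closed[OF inj C0] by blast
  qed
  have "left_resolution R M ?F"
    unfolding left_resolution_def
  proof (intro conjI allI impI bexI[of _ \<epsilon>])
    show "is_complex R ?F" by (rule F(1))
    show "zero_module (cobj ?F i)" if "i < 0" for i
      using that by (auto simp: zero_module_def B_def free_carrier)
    show "cycles ?F i = boundaries ?F i" if i: "0 < i" for i
    proof -
      obtain n where n: "i = int n + 1" using int_cases'[of i] i by auto
      have "Bc \<kk> B d i = L (Suc n)" using Bc[of "Suc n"] by (simp add: n add.commute)
      then show ?thesis using Zc[of n] by (simp only: F n)
    qed
    have "e0 ` Fr C0 = \<epsilon> ` emb id ` Fr C0" using \<epsilon>v by (force simp: image_image)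
    then show "\<epsilon> ` carrier (cobj ?F 0) = carrier M" by (simp only: car e0(2))
    have "{x \<in> emb id ` Fr C0. \<epsilon> x = \<zero>\<^bsub>M\<^esub>} = emb id ` ?K0" using \<epsilon>v by auto
    also have "\<dots> = emb id ` Bc \<kk> B d 0" using Bc[of 0] 0(2) by simp
    finally show "{x \<in> carrier (cobj ?F 0). \<epsilon> x = \<zero>\<^bsub>M\<^esub>} = boundaries ?F 0" by (simp only: car F(3))
    show "\<epsilon> \<in> module_hom R (cobj ?F 0) M"
      unfolding module_hom_def
    proof (intro CollectI conjI ballI)
      show "\<epsilon> \<in> carrier (cobj ?F 0) \<rightarrow> carrier M" using slinD(1)[OF e0(1)] by (simp add: \<epsilon>_def)
      fix x assume "x \<in> carrier (cobj ?F 0)"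
      then obtain u where u: "u \<in> Fr C0" "x = emb id u" unfolding car by blast
      show "\<epsilon> (x \<oplus>\<^bsub>cobj ?F 0\<^esub> y) = \<epsilon> x \<oplus>\<^bsub>M\<^esub> \<epsilon> y" if "y \<in> carrier (cobj ?F 0)" for y
      proof -
        obtain v where v: "v \<in> Fr C0" "y = emb id v" using \<open>y \<in> _\<close> unfolding car by blast
        show ?thesis unfolding F0 u(2) v(2) emb_ops
          by (simp only: \<epsilon>v[OF u(1)] \<epsilon>v[OF v(1)] \<epsilon>v[OF sub_add[OF sub_Fr u(1) v(1)]] slinD(2)[OF e0(1)])
      qed
      show "\<epsilon> (r \<odot>\<^bsub>cobj ?F 0\<^esub> x) = r \<odot>\<^bsub>M\<^esub> \<epsilon> x" if r: "r \<in> carrier R" for r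
      proof -
        have r': "\<pi> (fvar r) = r" using r by simp
        have "\<epsilon> (\<pi> (fvar r) \<odot>\<^bsub>cobj ?F 0\<^esub> x) = \<pi> (fvar r) \<odot>\<^bsub>M\<^esub> \<epsilon> x"
          unfolding F0 u(2) emb_ops by (simp only: \<epsilon>v[OF u(1)] \<epsilon>v[OF sub_sc[OF sub_Fr u(1)]] slinD(3)[OF e0(1)])
        then show ?thesis by (simp only: r')
      qed
    qed
  qed
  then show ?thesis unfolding projective_resolution_def by (intro exI[of _ ?F] conjI allI) (simp_all add: projective_free[OF one])
qed

text \<open>Composed with the differential, \<open>\<theta>\<close> is a cocycle in cohomological
  degree \<open>i\<close>. Vanishing homology makes it a coboundary, and the cochain that bounds it
  extends \<open>\<theta>\<close>.\<close>

lemma Ext_zero_lift: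
  assumes z: "zero_module (homology (hom_complex R F (ring_as_module R)) (- i))"
    and c: "is_complex R F" and \<theta>: "\<theta> \<in> module_hom R (sub_module (cobj F (i - 1)) (boundaries F (i - 1))) (ring_as_module R)"
  shows "\<exists>\<Psi>\<in>module_hom R (cobj F (i - 1)) (ring_as_module R). \<forall>x\<in>boundaries F (i - 1). \<theta> x = \<Psi> x"
proof -
  let ?R = "ring_as_module R" and ?H = "hom_complex R F (ring_as_module R)"
  let ?P = "\<lambda>i. cobj F i"
  have hom: "\<And>i. cdiff F i \<in> module_hom R (?P i) (?P (i - 1))" and mod: "\<And>i. module R (?P i)"
    and dd: "\<And>i x. x \<in> carrier (?P i) \<Longrightarrow> cdiff F (i - 1) (cdiff F i x) = \<zero>\<^bsub>?P (i - 1 - 1)\<^esub>"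
    using c by (auto simp: is_complex_def)
  have hom1: "cdiff F i \<in> module_hom R (?P i) (?P (i - 1))" and hom2: "cdiff F (i + 1) \<in> module_hom R (?P (i + 1)) (?P i)"
    using hom[of i] hom[of "i + 1"] by simp_all
  note h1 = module_homD[OF hom1] and h2 = module_homD[OF hom2] and th = module_homD[OF \<theta>]
  have bd: "cdiff F i x \<in> boundaries F (i - 1)" if "x \<in> carrier (?P i)" for x using that by (auto simp: boundaries_def)
  define \<phi> where "\<phi> = (\<lambda>x\<in>carrier (?P i). \<theta> (cdiff F i x))"
  interpret Pi: module R "?P i" by (rule mod)
  interpret Pi2: module R "?P (i + 1)" by (rule mod)
  have \<phi>h: "\<phi> \<in> module_hom R (?P i) ?R \<inter> extensional (carrier (?P i))"
    unfolding \<phi>_def module_hom_def using th(1) th(2)[OF _ _] th(3) bd h1 by (auto simp: Pi_iff)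
  have e1: "- (- i) = i" "1 - (- i) = i + 1" "- (- i - 1) = i + 1"
    "- (- i + 1) = i - 1" "1 - (- i + 1) = i" by simp_all
  have sub0: "smod (?P (i - 1)) (boundaries F (i - 1))" using smod_image[OF mod mod hom1] by (simp add: boundaries_def)
  have \<theta>0: "\<theta> \<zero>\<^bsub>?P (i - 1)\<^esub> = \<zero>" using module_hom_zero[OF module_sub[OF mod sub0] module_ring \<theta>] by simp
  have "compose (carrier (?P (i + 1))) \<phi> (cdiff F (i + 1)) = (\<lambda>x\<in>carrier (?P (i + 1)). \<zero>)"
    unfolding compose_def \<phi>_def using h2(1) dd[of _ "i + 1"] by (intro restrict_ext) (simp add: \<theta>0)
  then have cyc: "\<phi> \<in> cycles ?H (- i)"
    unfolding cycles_def using \<phi>h by (simp add: hom_complex_def hom_module_def) (simp add: e1 algebra_simps)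
  let ?B = "boundaries ?H (- i)"
  have B: "?B = (\<lambda>\<psi>. compose (carrier (?P i)) \<psi> (cdiff F i)) ` (module_hom R (?P (i - 1)) ?R \<inter> extensional (carrier (?P (i - 1))))"
    unfolding boundaries_def by (simp add: hom_complex_def hom_module_def)
  let ?z = "\<lambda>x\<in>carrier (?P (i - 1)). \<zero>"
  interpret Pj: module R "?P (i - 1)" by (rule mod)
  have "?z \<in> module_hom R (?P (i - 1)) ?R \<inter> extensional (carrier (?P (i - 1)))" by (auto simp: module_hom_def)
  moreover have "compose (carrier (?P i)) ?z (cdiff F i) = (\<lambda>x\<in>carrier (?P i). \<zero>)"
    unfolding compose_def using h1(1) by (intro restrict_ext) simp
  ultimately have zB: "(\<lambda>x\<in>carrier (?P i). \<zero>) \<in> ?B" unfolding B by (metis image_eqI)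
  let ?M = "sub_module (cobj ?H (- i)) (cycles ?H (- i))"
  have "?B +>\<^bsub>?M\<^esub> \<phi> \<in> carrier (homology ?H (- i))"
    unfolding homology_def quotient_module_def using cyc by (auto simp: A_RCOSETS_def')
  \<comment> \<open>Zero homology says that the coset of \<open>\<phi>\<close> is the trivial one,
    from which it follows that \<open>\<phi>\<close> is itself a coboundary.\<close>
  then have "?B +>\<^bsub>?M\<^esub> \<phi> = ?B" using z unfolding zero_module_def by (simp add: homology_def quotient_module_def)
  moreover have "(\<lambda>x\<in>carrier (?P i). \<zero>) \<oplus>\<^bsub>?M\<^esub> \<phi> \<in> ?B +>\<^bsub>?M\<^esub> \<phi>" using zB by (auto simp: a_r_coset_def')
  moreover have "(\<lambda>x\<in>carrier (?P i). \<zero>) \<oplus>\<^bsub>?M\<^esub> \<phi> = \<phi>"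
  proof -
    have "\<phi> x \<in> carrier R" if "x \<in> carrier (?P i)" for x using \<phi>h that by (auto simp: module_hom_def)
    then show ?thesis using \<phi>h by (auto simp: hom_complex_def hom_module_def fun_eq_iff extensional_def)
  qed
  ultimately have "\<phi> \<in> ?B" by simp
  then obtain \<psi> where \<psi>: "\<psi> \<in> module_hom R (?P (i - 1)) ?R" "\<phi> = compose (carrier (?P i)) \<psi> (cdiff F i)" unfolding B by blast
  have "\<theta> x = \<psi> x" if "x \<in> boundaries F (i - 1)" for x
  proof -
    from that obtain w where w: "w \<in> carrier (?P i)" "x = cdiff F i w" by (auto simp: boundaries_def)
    have "\<theta> (cdiff F i w) = \<phi> w" using w(1) by (simp add: \<phi>_def)
    also have "\<dots> = \<psi> (cdiff F i w)" using w(1) by (simp add: \<psi>(2) compose_def)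
    finally show ?thesis by (simp add: w(2))
  qed
  then show ?thesis using \<psi>(1) by blast
qed


text \<open>Vanishing Ext makes the chosen projective resolution an input for
  \<open>trel_good\<close>, with \<open>M\<close> and the successive images of the differentials as
  the modules \<open>N j\<close>. The initial relation is an honest isomorphism, so its free part is
  empty.\<close>

lemma totally_reflexive_good:
  fixes M :: "('a, nat \<Rightarrow> 'a) module"
  assumes noeth: "noetherian_ring R" and one: "\<one> \<noteq> \<zero>" and tr: "totally_reflexive R M" and p: "pres M C e"
  shows "good \<kk> 0 (Fr C) {v. e v = \<zero>\<^bsub>M\<^esub>}"
proof -
  have M: "module R M" and Ext0: "\<And>i. i > 0 \<Longrightarrow> zero_module (Ext R i M (ring_as_module R))"
    using tr by (simp_all add: totally_reflexive_def)
  interpret M: module R M by (rule M)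
  define F :: "('a, nat \<Rightarrow> 'a) module_complex" where "F = (SOME F. projective_resolution R M F)"
  have "projective_resolution R M F" unfolding F_def by (rule someI_ex[OF exists_projective_resolution[OF noeth one M p]])
  then have c: "is_complex R F" and ex: "\<And>i. i > 0 \<Longrightarrow> cycles F i = boundaries F i"
    and proj: "\<And>i. projective_module R (cobj F i)"
    and "\<exists>\<epsilon>\<in>module_hom R (cobj F 0) M. \<epsilon> ` carrier (cobj F 0) = carrier M \<and>
      {x \<in> carrier (cobj F 0). \<epsilon> x = \<zero>\<^bsub>M\<^esub>} = boundaries F 0"
    by (simp_all add: projective_resolution_def left_resolution_def)
  then obtain \<epsilon>0 where \<epsilon>0: "\<epsilon>0 \<in> module_hom R (cobj F 0) M" "\<epsilon>0 ` carrier (cobj F 0) = carrier M"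
    "{x \<in> carrier (cobj F 0). \<epsilon>0 x = \<zero>\<^bsub>M\<^esub>} = boundaries F 0" by blast
  have hom: "\<And>i. cdiff F i \<in> module_hom R (cobj F i) (cobj F (i - 1))" and mod: "\<And>i. module R (cobj F i)"
    using c by (auto simp: is_complex_def)
  have hom': "cdiff F (1 + int i) \<in> module_hom R (cobj F (1 + int i)) (cobj F (int i))" for i
    using hom[of "1 + int i"] by simp
  define N where "N j = (case j of 0 \<Rightarrow> M | Suc i \<Rightarrow> sub_module (cobj F (int i)) (boundaries F (int i)))" for j
  define \<epsilon> where "\<epsilon> j = (case j of 0 \<Rightarrow> \<epsilon>0 | Suc i \<Rightarrow> cdiff F (1 + int i))" for j
  have bd: "boundaries F (int i) = cdiff F (1 + int i) ` carrier (cobj F (1 + int i))" for i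
    by (simp add: boundaries_def add.commute)
  have sB: "smod (cobj F (int i)) (boundaries F (int i))" for i unfolding bd by (rule smod_image[OF mod mod hom'])
  show ?thesis
  proof (rule trel_good[where N = N and P = "\<lambda>j. cobj F (int j)" and \<epsilon> = \<epsilon>, OF noeth])
    show "module R (N j)" for j by (cases j) (simp_all add: N_def M module_sub[OF mod sB])
    show "projective_module R (cobj F (int j))" for j by (rule proj)
    show "\<epsilon> j \<in> module_hom R (cobj F (int j)) (N j)" for j
    proof (cases j)
      case (Suc i)
      have "cdiff F (1 + int i) \<in> module_hom R (cobj F (1 + int i)) (sub_module (cobj F (int i)) (boundaries F (int i)))"
        using module_homD(2,3)[OF hom'[of i]] unfolding module_hom_def by (simp add: bd)
      then show ?thesis by (simp add: Suc N_def \<epsilon>_def)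
    qed (simp add: N_def \<epsilon>_def \<epsilon>0(1))
    show "\<epsilon> j ` carrier (cobj F (int j)) = carrier (N j)" for j
      by (cases j) (simp_all add: N_def \<epsilon>_def \<epsilon>0(2) bd)
    show "N (Suc j) = sub_module (cobj F (int j)) {x \<in> carrier (cobj F (int j)). \<epsilon> j x = \<zero>\<^bsub>N j\<^esub>}" for j
    proof -
      have "boundaries F (int j) = {x \<in> carrier (cobj F (int j)). \<epsilon> j x = \<zero>\<^bsub>N j\<^esub>}"
        using \<epsilon>0(3) ex[of "int j"] by (cases j) (simp_all add: N_def \<epsilon>_def cycles_def)
      then show ?thesis by (simp add: N_def)
    qed
    show "\<exists>\<Psi>\<in>module_hom R (cobj F (int j)) (ring_as_module R). \<forall>x\<in>carrier (N (Suc j)). \<theta> x = \<Psi> x"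
      if "\<theta> \<in> module_hom R (N (Suc j)) (ring_as_module R)" for j \<theta>
      using Ext_zero_lift[OF _ c, of "int (Suc j)" \<theta>] that Ext0[of "Suc j"] by (simp add: N_def Ext_def F_def[symmetric])
    have s: "finite C" "slin M e" "e ` Fr C = carrier M" using p by (simp_all add: pres_def)
    show "finite C" by (rule s(1))
    show m: "md \<kk> (Fr C) {v. e v = \<zero>\<^bsub>M\<^esub>}" by (rule pres_md[OF M p])
    show "u \<in> {v. e v = \<zero>\<^bsub>M\<^esub>}" if "u \<in> Fr C" "u \<in> hat \<kk>" for u using slin_hat[OF M s(2,1) that] by simp
    have sc_zero0: "r *s (0 :: nat \<Rightarrow> 'a frng) = 0" for r by (simp add: sc_def fun_eq_iff)
    define \<beta> where "\<beta> x = (SOME v. v \<in> Fr C \<and> e v = x)" for x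
    have \<beta>: "\<beta> x \<in> Fr C \<and> e (\<beta> x) = x" if "x \<in> carrier M" for x
    proof -
      have "x \<in> e ` Fr C" using that by (simp only: s(3))
      then have "\<exists>v. v \<in> Fr C \<and> e v = x" by (elim imageE) auto
      from someI_ex[OF this] show ?thesis by (simp only: \<beta>_def)
    qed
    note S = slinD[OF s(2)]
    have \<beta>': "\<beta> x \<in> Fr C" "e (\<beta> x) = x" if "x \<in> carrier M" for x using \<beta>[OF that] by simp_all
    have em: "e (u - v) = \<zero>\<^bsub>M\<^esub>" if "e u = e v" for u v
      using slin_minus[OF M s(2), of u v] that M.r_neg[OF S(1)] by (simp only: M.minus_eq)
    have "trelw (Fr C) {v. e v = \<zero>\<^bsub>M\<^esub>} M e \<beta> {} (\<lambda>v. 0) (\<lambda>v. 0)"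
      unfolding trelw_def
    proof (intro conjI ballI allI impI)
      show "rlin M {v. e v = \<zero>\<^bsub>M\<^esub>} \<beta>"
        unfolding rlin_def
      proof (intro conjI ballI)
        fix x assume x: "x \<in> carrier M"
        show "\<beta> (x \<oplus>\<^bsub>M\<^esub> y) - (\<beta> x + \<beta> y) \<in> {v. e v = \<zero>\<^bsub>M\<^esub>}" if y: "y \<in> carrier M" for y
          by (rule CollectI, rule em) (simp only: S(2) \<beta>'(2) x y M.a_closed)
        show "\<beta> (r \<odot>\<^bsub>M\<^esub> x) - fvar r *s \<beta> x \<in> {v. e v = \<zero>\<^bsub>M\<^esub>}" if r: "r \<in> carrier R" for r
          by (rule CollectI, rule em) (simp only: S(3) pi_var r \<beta>'(2) x M.smult_closed)
      qed
      show "qlin (Fr C) {v. e v = \<zero>\<^bsub>M\<^esub>} (hat \<kk>) (\<lambda>v. 0)"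
        unfolding qlin_def using sub_zero[OF sub_hat[OF idl_kk]] by (auto simp: sc_zero0)
      show "u - \<beta> (e u) - 0 \<in> {v. e v = \<zero>\<^bsub>M\<^esub>}" for u
        unfolding diff_zero by (rule CollectI, rule em) (simp only: \<beta>'(2) S(1))
      show "e u \<in> carrier M" "e (u + v) = e u \<oplus>\<^bsub>M\<^esub> e v" "e (r *s u) = \<pi> r \<odot>\<^bsub>M\<^esub> e u" for u v r
        by (rule S)+
      show "\<beta> x \<in> Fr C" if "x \<in> carrier M" for x by (rule \<beta>'(1)[OF that])
      show "0 \<in> Fr C" "0 \<in> Fr {}" for u :: "nat \<Rightarrow> 'a frng" by (rule sub_zero[OF sub_Fr])+
    qed (simp_all add: lin_intros)
    then show "trel (Fr C) {v. e v = \<zero>\<^bsub>M\<^esub>} (N 0)" unfolding trel_def N_def by (simp only: nat.case) blast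
  qed
qed

text \<open>Totally reflexive modules have bound 0, and \<open>good_coker\<close> adds one for each
  step of the resolution. The resolution is one of the ideal; passing from \<open>I\<close> to the
  quotient by \<open>I\<close> costs one further step.\<close>

lemma G_dimension_good:
  assumes noeth: "noetherian_ring R" and one: "\<one> \<noteq> \<zero>" and I: "ideal I R"
    and G: "G_dimension R (sub_module (ring_as_module R) I) < \<infinity>"
  shows "\<exists>k. good \<kk> k (Fr {0}) (hat (pre I))"
proof -
  let ?I = "sub_module (ring_as_module R) I"
  from G obtain n and G :: "('a, nat \<Rightarrow> 'a) module_complex" where lr: "left_resolution R ?I G"
    and tr: "\<And>i. 0 \<le> i \<Longrightarrow> i \<le> int n \<Longrightarrow> totally_reflexive R (cobj G i)"
    and z: "\<And>i. int n < i \<Longrightarrow> zero_module (cobj G i)"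
  proof -
    let ?A = "{n. \<exists>G :: ('a, nat \<Rightarrow> 'a) module_complex. left_resolution R ?I G \<and>
       (\<forall>i. 0 \<le> i \<and> i \<le> int n \<longrightarrow> totally_reflexive R (cobj G i)) \<and> (\<forall>i>int n. zero_module (cobj G i))}"
    have "?A \<noteq> {}" 
    proof
      assume "?A = {}"
      then show False using G unfolding G_dimension_def by (simp only: image_empty Inf_empty) (simp add: top_enat_def)
    qed
    then show ?thesis using that by blast
  qed
  have c: "is_complex R G" and ex: "\<And>i. i > 0 \<Longrightarrow> cycles G i = boundaries G i"
    and "\<exists>\<epsilon>\<in>module_hom R (cobj G 0) ?I. \<epsilon> ` carrier (cobj G 0) = carrier ?I \<and>
      {x \<in> carrier (cobj G 0). \<epsilon> x = \<zero>\<^bsub>?I\<^esub>} = boundaries G 0"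
    using lr by (simp_all add: left_resolution_def)
  then obtain \<epsilon> where \<epsilon>: "\<epsilon> \<in> module_hom R (cobj G 0) ?I" "\<epsilon> ` carrier (cobj G 0) = I"
    "{x \<in> carrier (cobj G 0). \<epsilon> x = \<zero>} = boundaries G 0" by auto
  have hom: "\<And>i. cdiff G i \<in> module_hom R (cobj G i) (cobj G (i - 1))" and mod: "\<And>i. module R (cobj G i)"
    and dd: "\<And>i x. x \<in> carrier (cobj G i) \<Longrightarrow> cdiff G (i - 1) (cdiff G i x) = \<zero>\<^bsub>cobj G (i - 1 - 1)\<^esub>"
    using c by (auto simp: is_complex_def)
  have "\<exists>x. pres (cobj G (int k)) (fst x) (snd x) \<and> good \<kk> 0 (Fr (fst x)) {v. (snd x) v = \<zero>\<^bsub>cobj G (int k)\<^esub>} \<and> (n < k \<longrightarrow> fst x = {})" for k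
  proof (cases "k \<le> n")
    case True
    then have t: "totally_reflexive R (cobj G (int k))" using tr by simp
    then have "module R (cobj G (int k))" "finitely_generated R (cobj G (int k))" by (simp_all add: totally_reflexive_def)
    from fg_pres[OF this] obtain C e where p: "pres (cobj G (int k)) C e" by (elim exE)
    then show ?thesis using totally_reflexive_good[OF noeth one t p] True by (intro exI[of _ "(C, e)"]) simp
  next
    case False
    then have "zero_module (cobj G (int k))" using z by simp
    then have cz: "carrier (cobj G (int k)) = {\<zero>\<^bsub>cobj G (int k)\<^esub>}" by (simp add: zero_module_def)
    interpret Gk: module R "cobj G (int k)" by (rule mod)
    have p: "pres (cobj G (int k)) {} (\<lambda>_. \<zero>\<^bsub>cobj G (int k)\<^esub>)"
      unfolding pres_def using cz by (simp add: slin_def)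
    have "good \<kk> 0 (Fr {}) {v. \<zero>\<^bsub>cobj G (int k)\<^esub> = \<zero>\<^bsub>cobj G (int k)\<^esub>}"
      by (rule good_zero[OF idl_kk sub_Fr]) (auto simp: sub_def)
    then show ?thesis using p by (intro exI[of _ "({}, \<lambda>_. \<zero>\<^bsub>cobj G (int k)\<^esub>)"]) simp
  qed
  then have "\<exists>Y. \<forall>k. pres (cobj G (int k)) (fst (Y k)) (snd (Y k)) \<and>
      good \<kk> 0 (Fr (fst (Y k))) {v. (snd (Y k)) v = \<zero>\<^bsub>cobj G (int k)\<^esub>} \<and> (n < k \<longrightarrow> fst (Y k) = {})"
    by (intro choice allI)
  then obtain Y where Y: "\<And>k. pres (cobj G (int k)) (fst (Y k)) (snd (Y k))"
    "\<And>k. good \<kk> 0 (Fr (fst (Y k))) {v. (snd (Y k)) v = \<zero>\<^bsub>cobj G (int k)\<^esub>}" "\<And>k. n < k \<Longrightarrow> fst (Y k) = {}" by blast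
  define C where "C k = fst (Y k)" for k
  define e where "e k = snd (Y k)" for k
  define Kr where "Kr k = {v. e k v = \<zero>\<^bsub>cobj G (int k)\<^esub>}" for k
  have fin: "finite (C k)" and e: "slin (cobj G (int k)) (e k)" "e k ` Fr (C k) = carrier (cobj G (int k))"
    and gK: "good \<kk> 0 (Fr (C k)) (Kr k)" and Cn: "n < k \<Longrightarrow> C k = {}" for k
    using Y(1)[of k] Y(2)[of k] Y(3)[of k] by (simp_all add: pres_def C_def e_def Kr_def)
  note S = slinD[OF e(1)]
  have mK: "md \<kk> (Fr (C k)) (Kr k)" for k by (rule good_md[OF gK])
  define dl where "dl k = cdiff G (1 + int k)" for k
  have dlh: "dl k \<in> module_hom R (cobj G (1 + int k)) (cobj G (int k))" for k
    using hom[of "1 + int k"] by (simp add: dl_def)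
  have bd: "boundaries G (int k) = dl k ` carrier (cobj G (1 + int k))" for k
    by (simp add: boundaries_def dl_def add.commute)
  have sB: "smod (cobj G (int k)) (boundaries G (int k))" for k unfolding bd by (rule smod_image[OF mod mod dlh])
  \<comment> \<open>\<open>Fr (C k)\<close> modulo \<open>W k\<close> presents the cokernel of the
    map from degree \<open>k + 1\<close> to degree \<open>k\<close>, which is the
    \<open>k\<close>-th syzygy and for \<open>k = 0\<close> the ideal itself.\<close>
  define W where "W k = {v. e k v \<in> boundaries G (int k)}" for k
  have sW: "sub (W k)" for k using slin_sub[OF mod e(1) sB] by (simp add: W_def)
  have KW: "Kr k \<subseteq> W k" for k using smodD(2)[OF sB[of k]] by (auto simp: Kr_def W_def)
  have mW: "md \<kk> (Fr (C k)) (W k)" for k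
    unfolding md_def using sub_Fr sW mdD(3)[OF mK[of k]] KW[of k] by blast
  have WS: "v \<in> W (Suc k) \<longleftrightarrow> dl k (e (Suc k) v) = \<zero>\<^bsub>cobj G (int k)\<^esub>" for k v
    using ex[of "int (Suc k)", symmetric] S(1)[of "Suc k" v] by (simp add: W_def cycles_def dl_def)
  have W0: "v \<in> W 0 \<longleftrightarrow> \<epsilon> (e 0 v) = \<zero>" for v
    using \<epsilon>(3)[symmetric] S(1)[of 0 v] by (simp add: W_def)
  have step: "good \<kk> (Suc h) (Fr (C k)) (W k)" if g: "good \<kk> h (Fr (C (Suc k))) (W (Suc k))" for h k
  proof -
    interpret Gk: module R "cobj G (int k)" by (rule mod)
    have "\<forall>i\<in>C (Suc k). \<exists>w. w \<in> Fr (C k) \<and> e k w = dl k (e (Suc k) (un i))"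
    proof
      fix i
      have "dl k (e (Suc k) (un i)) \<in> carrier (cobj G (int k))"
        using module_homD(1)[OF dlh[of k]] S(1)[of "Suc k"] by simp
      then show "\<exists>w. w \<in> Fr (C k) \<and> e k w = dl k (e (Suc k) (un i))" using e(2)[of k] by (metis imageE)
    qed
    then have "\<exists>t. lin t \<and> (\<forall>i\<in>C (Suc k). t (un i) \<in> Fr (C k) \<and> e k (t (un i)) = dl k (e (Suc k) (un i)))"
      using basis_choice[OF fin, of "Suc k" "\<lambda>i w. w \<in> Fr (C k) \<and> e k w = dl k (e (Suc k) (un i))"] by blast
    then obtain t where t: "lin t" "\<And>i. i \<in> C (Suc k) \<Longrightarrow> t (un i) \<in> Fr (C k)"
      "\<And>i. i \<in> C (Suc k) \<Longrightarrow> e k (t (un i)) = dl k (e (Suc k) (un i))" by blast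
    have tF: "t v \<in> Fr (C k)" if "v \<in> Fr (C (Suc k))" for v by (rule lin_into[OF fin t(1) sub_Fr t(2) that])
    have sl1: "slin (cobj G (int k)) (\<lambda>v. e k (t v))" unfolding slin_def using S by (simp add: lin_simps[OF t(1)])
    have sl2: "slin (cobj G (int k)) (\<lambda>v. dl k (e (Suc k) v))" unfolding slin_def using S[of "Suc k"] module_homD[OF dlh[of k]] by simp
    have te: "e k (t v) = dl k (e (Suc k) v)" if "v \<in> Fr (C (Suc k))" for v
      by (rule slin_eqI[OF mod sl1 sl2 fin t(3) that])
    have k0: "sub (Kr k)" using mdD(2)[OF mK] .
    have m: "miso t (Fr (C (Suc k))) (W (Suc k)) (Fr (C k) \<inter> W k) (Kr k)"
      unfolding miso_def
    proof (intro conjI ballI)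
      show "lin t" by (rule t(1))
      fix v :: "nat \<Rightarrow> 'a frng" assume v: "v \<in> Fr (C (Suc k))"
      show "t v \<in> Fr (C k) \<inter> W k" using tF[OF v] te[OF v] S(1)[of "Suc k" v] by (simp add: W_def bd)
      show "t v \<in> Kr k \<longleftrightarrow> v \<in> W (Suc k)" using te[OF v] by (simp add: Kr_def WS)
    next
      fix w assume w: "w \<in> Fr (C k) \<inter> W k"
      then obtain x where x: "x \<in> carrier (cobj G (int (Suc k)))" "e k w = dl k x" by (auto simp: W_def bd)
      then obtain v where v: "v \<in> Fr (C (Suc k))" "x = e (Suc k) v" using e(2)[of "Suc k"] by blast
      have "e k w = e k (t v)" using x(2) v te by simp
      then have "w - t v \<in> Kr k" using S(1)[of k] by (simp add: Kr_def slin_minus[OF mod e(1)] Gk.minus_eq Gk.r_neg)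
      then show "\<exists>v\<in>Fr (C (Suc k)). w - t v \<in> Kr k" using v(1) by blast
    qed
    have sN: "sub (Fr (C k) \<inter> W k)" using sub_preimage[OF sub_Fr sW lin_intros(1)] by (simp add: Int_def)
    have gN: "good \<kk> h (Fr (C k) \<inter> W k) (Kr k)" by (rule good_miso[OF idl_kk m g md_subset[OF mK sN]]) blast
    have "ses (\<lambda>v. v) (\<lambda>v. v) (Fr (C k) \<inter> W k) (Kr k) (Fr (C k)) (Kr k) (Fr (C k)) (W k)"
      unfolding ses_def
    proof (intro conjI ballI)
      show "u \<in> W k \<longleftrightarrow> (\<exists>u1\<in>Fr (C k) \<inter> W k. u - u1 \<in> Kr k)" if u: "u \<in> Fr (C k)" for u
      proof
        assume "u \<in> W k"
        then show "\<exists>u1\<in>Fr (C k) \<inter> W k. u - u1 \<in> Kr k" using u sub_zero[OF k0] by (intro bexI[of _ u]) simp_all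
      next
        assume "\<exists>u1\<in>Fr (C k) \<inter> W k. u - u1 \<in> Kr k"
        then show "u \<in> W k" using KW[of k] sub_diff_iff[OF sW] by blast
      qed
      show "\<exists>u\<in>Fr (C k). u - u2 \<in> W k" if "u2 \<in> Fr (C k)" for u2
        using that sub_zero[OF sW] by (intro bexI[of _ u2]) simp_all
    qed (auto simp: lin_intros)
    from good_coker[OF idl_kk this gN good_mono[OF gK] mW] show ?thesis by simp
  qed
  \<comment> \<open>Descending induction from degree \<open>n + 1\<close>, where the resolution has
    ended and the module is zero.\<close>
  have "good \<kk> h (Fr (C (n + 1 - h))) (W (n + 1 - h))" if "h \<le> n + 1" for h
    using that
  proof (induction h)
    case 0
    have "C (n + 1) = {}" using Cn by simp
    then show ?case using good_zero[OF idl_kk sub_Fr sW, of "{}" "n + 1"] sub_zero[OF sW] by simp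
  next
    case (Suc h)
    then have "good \<kk> h (Fr (C (Suc (n + 1 - Suc h)))) (W (Suc (n + 1 - Suc h)))" by (simp add: Suc_diff_le)
    from step[OF this] show ?case .
  qed
  from this[of "n + 1"] have g0: "good \<kk> (n + 1) (Fr (C 0)) (W 0)" by simp
  have \<epsilon>c: "\<epsilon> (e 0 v) \<in> I" for v using \<epsilon>(2) S(1)[of 0 v] by auto
  have Ic: "\<And>x. x \<in> I \<Longrightarrow> x \<in> carrier R" using ideal.Icarr[OF I] by blast
  have "\<exists>t. lin t \<and> (\<forall>i\<in>C 0. t (un i) = fvar (\<epsilon> (e 0 (un i))) *s un 0)"
    using basis_choice[OF fin, of 0 "\<lambda>i w. w = fvar (\<epsilon> (e 0 (un i))) *s un 0"] by blast
  then obtain t where t: "lin t" "\<And>i. i \<in> C 0 \<Longrightarrow> t (un i) = fvar (\<epsilon> (e 0 (un i))) *s un (0::nat)" by blast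
  have tF: "t v \<in> Fr {0}" if "v \<in> Fr (C 0)" for v
    by (rule lin_into[OF fin t(1) sub_Fr _ that]) (simp add: t(2) sub_sc[OF sub_Fr])
  have sl1: "slin (ring_as_module R) (\<lambda>v. \<pi> (t v 0))" unfolding slin_def by (simp add: lin_simps[OF t(1)])
  have sl2: "slin (ring_as_module R) (\<lambda>v. \<epsilon> (e 0 v))" unfolding slin_def using S[of 0] module_homD[OF \<epsilon>(1)] Ic by auto
  have te: "\<pi> (t v 0) = \<epsilon> (e 0 v)" if "v \<in> Fr (C 0)" for v
  proof (rule slin_eqI[OF module_ring sl1 sl2 fin _ that])
    show "\<pi> (t (un i) 0) = \<epsilon> (e 0 (un i))" if "i \<in> C 0" for i
    proof -
      have "t (un i) 0 = fvar (\<epsilon> (e 0 (un i)))" unfolding t(2)[OF that] by (simp add: un_def sc_def)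
      then show ?thesis using \<epsilon>c Ic by simp
    qed
  qed
  let ?U = "{v \<in> Fr {0::nat}. v \<in> hat (pre I)}"
  have F0: "v \<in> hat A \<longleftrightarrow> v 0 \<in> A" if "v \<in> Fr {0::nat}" "idl A" for v and A :: "'a frng set"
  proof -
    have "v i = 0" if "i \<noteq> 0" for i using that \<open>v \<in> Fr {0}\<close> by (simp add: Fr_def)
    then have "v i \<in> A" if "v 0 \<in> A" for i using that idl_zero[OF \<open>idl A\<close>] by (cases "i = 0") auto
    then show ?thesis by (auto simp: hat_def)
  qed
  have m: "miso t (Fr (C 0)) (W 0) ?U (hat \<kk>)"
    unfolding miso_def
  proof (intro conjI ballI)
    fix v :: "nat \<Rightarrow> 'a frng" assume v: "v \<in> Fr (C 0)"
    show "t v \<in> ?U" using tF[OF v] te[OF v] \<epsilon>c F0[OF tF[OF v] idl_pre[OF I]] by (simp add: pre_def)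
    show "t v \<in> hat \<kk> \<longleftrightarrow> v \<in> W 0" using te[OF v] F0[OF tF[OF v] idl_kk] by (simp add: W0 pre_def)
  next
    fix u assume u: "u \<in> ?U"
    then have "u \<in> Fr {0}" "u \<in> hat (pre I)" by blast+
    from F0[OF this(1) idl_pre[OF I]] this(2) have "\<pi> (u 0) \<in> I" by (simp add: pre_def)
    then obtain x where x: "x \<in> carrier (cobj G 0)" "\<pi> (u 0) = \<epsilon> x" using \<epsilon>(2) by blast
    then obtain v where v: "v \<in> Fr (C 0)" "x = e 0 v" using e(2)[of 0] by auto
    have "u - t v \<in> Fr {0}" using u tF[OF v(1)] sub_diff[OF sub_Fr] by blast
    then have "u - t v \<in> hat \<kk>" using F0[OF _ idl_kk] te[OF v(1)] x(2) v(2) by (simp add: pi_diff_zero)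
    then show "\<exists>v\<in>Fr (C 0). u - t v \<in> hat \<kk>" using v(1) by blast
  qed (rule t(1))
  have sU: "sub ?U" by (rule sub_preimage[OF sub_Fr sub_hat[OF idl_pre[OF I]] lin_intros(1)])
  have gU: "good \<kk> (n + 1) ?U (hat \<kk>)" by (rule good_miso[OF idl_kk m g0 md_hat[OF idl_kk sU]])
  have "ses (\<lambda>v. v) (\<lambda>v. v) ?U (hat \<kk>) (Fr {0}) (hat \<kk>) (Fr {0}) (hat (pre I))"
    unfolding ses_def
  proof (intro conjI ballI)
    have KI: "hat \<kk> \<subseteq> hat (pre I)" using kk_pre[OF I] by (auto simp: hat_def)
    show "u \<in> hat (pre I) \<longleftrightarrow> (\<exists>u1\<in>?U. u - u1 \<in> hat \<kk>)" if u: "u \<in> Fr {0}" for u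
    proof
      assume "u \<in> hat (pre I)"
      then show "\<exists>u1\<in>?U. u - u1 \<in> hat \<kk>" using u sub_zero[OF sub_hat[OF idl_kk]] by (intro bexI[of _ u]) simp_all
    next
      assume "\<exists>u1\<in>?U. u - u1 \<in> hat \<kk>"
      then obtain u1 where "u1 \<in> hat (pre I)" "u - u1 \<in> hat (pre I)" using KI by blast
      then show "u \<in> hat (pre I)" using sub_diff_iff[OF sub_hat[OF idl_pre[OF I]]] by blast
    qed
    show "\<exists>u\<in>Fr {0}. u - u2 \<in> hat (pre I)" if "u2 \<in> Fr {0}" for u2
      using that sub_zero[OF sub_hat[OF idl_pre[OF I]]] by (intro bexI[of _ u2]) simp_all
  qed (auto simp: lin_intros)
  from good_coker[OF idl_kk this gU good_Fr[OF idl_kk] md_Fr_hat[OF idl_pre[OF I] kk_pre[OF I]]]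
  show ?thesis by blast
qed

end

section \<open>Koszul complexes\<close>

text \<open>The sign occurring in \<open>koszul_complex\<close>. It counts only elements below
  \<open>s\<close>, so it does not change when \<open>s\<close> itself enters or leaves the
  set.\<close>

definition ksign :: "nat \<Rightarrow> nat set \<Rightarrow> 's::comm_ring_1"
  where "ksign s T = (- 1) ^ card {t \<in> T. t < s}"

definition kset :: "nat \<Rightarrow> (nat \<Rightarrow> 's::comm_ring_1) \<Rightarrow> (nat set \<Rightarrow> 's) \<Rightarrow> nat set \<Rightarrow> 's"
  where "kset n y f T = (\<Sum>s\<in>{..<n} - T. ksign s T * y s * f (insert s T))"

text \<open>Left exterior multiplication by the basis element with index \<open>s\<close>; it is the
  homotopy that contracts multiplication by \<open>y s\<close>.\<close>

definition kcon :: "nat \<Rightarrow> (nat set \<Rightarrow> 's::comm_ring_1) \<Rightarrow> nat set \<Rightarrow> 's"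
  where "kcon s f T = (if s \<in> T then ksign s T * f (T - {s}) else 0)"

lemma ksign_sq: "ksign s T * (ksign s T * a) = (a :: 's::comm_ring_1)"
proof -
  have "ksign s T * ksign s T = (1 :: 's)" unfolding ksign_def by (simp flip: power_add add: mult_2[symmetric])
  then show ?thesis by (simp only: mult.assoc[symmetric] mult_1_left)
qed

lemma ksign_remove: "ksign s (T - {s}) = ksign s T"
proof -
  have "{t \<in> T - {s}. t < s} = {t \<in> T. t < s}" by auto
  then show ?thesis by (simp add: ksign_def)
qed

text \<open>Exactly one of the two counts changes, by one, when \<open>r\<close> and
  \<open>s\<close> trade places. This is anticommutativity of the exterior algebra.\<close>

lemma ksign_swap:
  assumes "finite T" "s \<in> T" "r \<notin> T"
  shows "ksign r T * ksign s (insert r T) = (- (ksign s T * ksign r (T - {s})) :: 's::comm_ring_1)"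
proof (cases "s < r")
  case True
  have 1: "{t \<in> T. t < r} = insert s {t \<in> T - {s}. t < r}" using assms True by auto
  have "card {t \<in> T. t < r} = Suc (card {t \<in> T - {s}. t < r})" unfolding 1 using assms by simp
  moreover have "{t \<in> insert r T. t < s} = {t \<in> T. t < s}" using True by auto
  ultimately show ?thesis by (simp add: ksign_def mult.commute)
next
  case False
  then have rs: "r < s" using assms by (metis linorder_neqE_nat)
  have 1: "{t \<in> insert r T. t < s} = insert r {t \<in> T. t < s}" using rs by auto
  have "card {t \<in> insert r T. t < s} = Suc (card {t \<in> T. t < s})" unfolding 1 using assms by simp
  moreover have "{t \<in> T. t < r} = {t \<in> T - {s}. t < r}" using rs by auto
  ultimately show ?thesis by (simp add: ksign_def mult.commute)
qed

text \<open>The graded Leibniz rule. If \<open>s\<close> is not in \<open>T\<close>, only the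
  summand \<open>r = s\<close> survives. Otherwise the summand for \<open>s\<close> in the second
  term gives the right side, and the remaining summands cancel by \<open>ksign_swap\<close>.\<close>

lemma koszul_homotopy:
  fixes y :: "nat \<Rightarrow> 's::comm_ring_1"
  assumes T: "T \<subseteq> {..<n}" and s: "s < n"
  shows "kset n y (kcon s f) T + kcon s (kset n y f) T = y s * f T"
proof (cases "s \<in> T")
  case False
  have "kset n y (kcon s f) T = (\<Sum>r\<in>{..<n} - T. if r = s then y s * f T else 0)"
    unfolding kset_def
  proof (rule sum.cong[OF HOL.refl])
    fix r assume r: "r \<in> {..<n} - T"
    have i: "insert s T - {s} = T" using False by auto
    have "ksign s (insert s T) = (ksign s T :: 's)" by (subst ksign_remove[symmetric]) (simp only: i)
    then show "ksign r T * y r * kcon s f (insert r T) = (if r = s then y s * f T else 0)"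
      using r False i ksign_sq[of s T "y s * f T"] by (auto simp: kcon_def ac_simps)
  qed
  also have "\<dots> = y s * f T" using s False by simp
  finally show ?thesis using False by (simp add: kcon_def)
next
  case True
  have fT: "finite T" using T finite_subset by blast
  have i: "insert s (T - {s}) = T" using True by blast
  have D: "{..<n} - (T - {s}) = insert s ({..<n} - T)" using s True by auto
  have "kcon s (kset n y f) T = ksign s T * (\<Sum>r\<in>insert s ({..<n} - T). ksign r (T - {s}) * y r * f (insert r (T - {s})))"
    using True by (simp add: kcon_def kset_def D)
  also have "\<dots> = y s * f T + ksign s T * (\<Sum>r\<in>{..<n} - T. ksign r (T - {s}) * y r * f (insert r (T - {s})))"
    using True ksign_sq[of s T "y s * f T"] by (simp add: insert_absorb ksign_remove distrib_left mult.assoc)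
  also have "ksign s T * (\<Sum>r\<in>{..<n} - T. ksign r (T - {s}) * y r * f (insert r (T - {s}))) = - kset n y (kcon s f) T"
    unfolding kset_def sum_distrib_left sum_negf[symmetric]
  proof (rule sum.cong[OF HOL.refl])
    fix r assume r: "r \<in> {..<n} - T"
    have "insert r T - {s} = insert r (T - {s})" using r True by auto
    then have "ksign r T * y r * kcon s f (insert r T) =
        (ksign r T * ksign s (insert r T)) * (y r * f (insert r (T - {s})))"
      using True by (simp add: kcon_def ac_simps)
    moreover have "ksign r T * ksign s (insert r T) = (- (ksign s T * ksign r (T - {s})) :: 's)"
      by (rule ksign_swap[OF fT True]) (use r in blast)
    ultimately show "ksign s T * (ksign r (T - {s}) * y r * f (insert r (T - {s}))) = - (ksign r T * y r * kcon s f (insert r T))"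
      by (simp only:) (simp add: mult.assoc)
  qed
  finally show ?thesis by simp
qed

text \<open>Subsets are coded as natural numbers so that the Koszul complex has the same vector type
  as all other complexes.\<close>

definition kbas :: "nat \<Rightarrow> int \<Rightarrow> nat set"
  where "kbas n i = set_encode ` {S. S \<subseteq> {..<n} \<and> int (card S) = i}"

definition kdif :: "nat \<Rightarrow> (nat \<Rightarrow> 's::comm_ring_1) \<Rightarrow> int \<Rightarrow> (nat \<Rightarrow> 's) \<Rightarrow> nat \<Rightarrow> 's"
  where "kdif n y i v m = (if m \<in> kbas n (i - 1) then kset n y (\<lambda>S. v (set_encode S)) (set_decode m) else 0)"

definition khom :: "nat \<Rightarrow> nat \<Rightarrow> int \<Rightarrow> (nat \<Rightarrow> 's::comm_ring_1) \<Rightarrow> nat \<Rightarrow> 's"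
  where "khom n s i v m = (if m \<in> kbas n (i + 1) then kcon s (\<lambda>S. v (set_encode S)) (set_decode m) else 0)"

lemma kbas_iff: "m \<in> kbas n i \<longleftrightarrow> set_decode m \<subseteq> {..<n} \<and> int (card (set_decode m)) = i"
proof
  assume "m \<in> kbas n i"
  then obtain S where "S \<subseteq> {..<n}" "int (card S) = i" "m = set_encode S" by (auto simp: kbas_def)
  then show "set_decode m \<subseteq> {..<n} \<and> int (card (set_decode m)) = i"
    using finite_subset[of S "{..<n}"] by simp
next
  assume "set_decode m \<subseteq> {..<n} \<and> int (card (set_decode m)) = i"
  then show "m \<in> kbas n i" unfolding kbas_def by (intro image_eqI[of _ _ "set_decode m"]) simp_all
qed

lemma kbas_encode: "S \<subseteq> {..<n} \<Longrightarrow> set_encode S \<in> kbas n i \<longleftrightarrow> int (card S) = i"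
  using finite_subset[of S "{..<n}"] by (simp add: kbas_iff)

lemma finite_kbas: "finite (kbas n i)"
  unfolding kbas_def by (rule finite_imageI, rule finite_subset[of _ "Pow {..<n}"]) auto

lemma kbas_empty: assumes "i < 0 \<or> int n < i" shows "kbas n i = {}"
proof (rule equals0I)
  fix m assume "m \<in> kbas n i"
  then have "set_decode m \<subseteq> {..<n}" "int (card (set_decode m)) = i" by (simp_all add: kbas_iff)
  with card_mono[OF finite_lessThan this(1)] assms show False by simp
qed

lemma kbas_top: "kbas n (int n) = {set_encode {..<n}}"
proof -
  have "{S. S \<subseteq> {..<n} \<and> int (card S) = int n} = {{..<n}}"
    using card_subset_eq[of "{..<n}"] by auto
  then show ?thesis by (simp add: kbas_def)
qed

lemma lin_kdif: "lin (kdif n y i)"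
  unfolding lin_def by (auto simp: kdif_def kset_def fun_eq_iff sc_def sum.distrib[symmetric] sum_distrib_left algebra_simps intro!: sum.cong)

lemma lin_khom: "lin (khom n s i)"
  unfolding lin_def by (auto simp: khom_def kcon_def fun_eq_iff sc_def algebra_simps)

lemma kdif_Fr: "kdif n y i v \<in> Fr (kbas n (i - 1))"
  by (simp add: kdif_def Fr_def)

lemma khom_Fr: "khom n s i v \<in> Fr (kbas n (i + 1))"
  by (simp add: khom_def Fr_def)

lemma kdif_khom:
  assumes s: "s < n" and v: "v \<in> Fr (kbas n i)"
  shows "kdif n y (i + 1) (khom n s i v) + khom n s (i - 1) (kdif n y i v) = y s *s v"
proof
  fix m
  let ?T = "set_decode m" and ?f = "\<lambda>S. v (set_encode S)"
  show "(kdif n y (i + 1) (khom n s i v) + khom n s (i - 1) (kdif n y i v)) m = (y s *s v) m"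
  proof (cases "m \<in> kbas n i")
    case True
    then have T: "?T \<subseteq> {..<n}" "int (card ?T) = i" by (simp_all add: kbas_iff)
    have "kset n y (\<lambda>S. khom n s i v (set_encode S)) ?T = kset n y (kcon s ?f) ?T"
      unfolding kset_def
    proof (rule sum.cong[OF HOL.refl])
      fix r assume r: "r \<in> {..<n} - ?T"
      have "set_encode (insert r ?T) \<in> kbas n (i + 1)"
        using r T by (subst kbas_encode) auto
      then have "khom n s i v (set_encode (insert r ?T)) = kcon s ?f (insert r ?T)"
        by (simp add: khom_def)
      then show "ksign r ?T * y r * khom n s i v (set_encode (insert r ?T)) = ksign r ?T * y r * kcon s ?f (insert r ?T)"
        by simp
    qed
    then have 1: "kdif n y (i + 1) (khom n s i v) m = kset n y (kcon s ?f) ?T" using True by (simp add: kdif_def)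
    have "kcon s (\<lambda>S. kdif n y i v (set_encode S)) ?T = kcon s (kset n y ?f) ?T"
    proof (cases "s \<in> ?T")
      case True
      then have "int (card (?T - {s})) = i - 1" using T(2) card_gt_0_iff[of ?T] by (auto simp: of_nat_diff)
      then have "set_encode (?T - {s}) \<in> kbas n (i - 1)" using T(1) by (subst kbas_encode) auto
      then show ?thesis using True by (simp add: kcon_def kdif_def)
    qed (simp add: kcon_def)
    then have 2: "khom n s (i - 1) (kdif n y i v) m = kcon s (kset n y ?f) ?T" using True by (simp add: khom_def)
    show ?thesis unfolding plus_fun_apply 1 2 using koszul_homotopy[OF T(1) s, of y ?f] by (simp add: sc_def)
  next
    case False
    then show ?thesis using v by (simp add: kdif_def khom_def sc_def Fr_def)
  qed
qed

lemma kdif_top: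
  assumes s: "s < n" shows "kdif n y (int n) v (set_encode ({..<n} - {s})) =
    ksign s ({..<n} - {s}) * (y s * v (set_encode {..<n}))"
proof -
  have m: "set_encode ({..<n} - {s}) \<in> kbas n (int n - 1)" using s by (subst kbas_encode) (auto simp: of_nat_diff)
  have D: "{..<n} - ({..<n} - {s}) = {s}" and i: "insert s ({..<n} - {s}) = {..<n}" using s by auto
  show ?thesis using m by (simp add: kdif_def kset_def D insert_absorb s mult.assoc)
qed

text \<open>A subset with \<open>n - 1\<close> elements omits exactly one \<open>s\<close>, so up to
  sign the entries of the top differential are the products of the coefficient with the
  \<open>y s\<close>.\<close>

lemma kdif_top_hat:
  assumes a: "idl \<aa>" and v: "v \<in> Fr {set_encode {..<n}}"
  shows "kdif n y (int n) v \<in> hat \<aa> \<longleftrightarrow> (\<forall>s<n. y s * v (set_encode {..<n}) \<in> \<aa>)"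
proof
  assume h: "kdif n y (int n) v \<in> hat \<aa>"
  show "\<forall>s<n. y s * v (set_encode {..<n}) \<in> \<aa>"
  proof (intro allI impI)
    fix s assume s: "s < n"
    have "ksign s ({..<n} - {s}) * (y s * v (set_encode {..<n})) \<in> \<aa>"
      using h unfolding hat_def kdif_top[OF s, symmetric] by blast
    from idl_mult[OF a this, of "ksign s ({..<n} - {s})"] show "y s * v (set_encode {..<n}) \<in> \<aa>"
      by (simp only: ksign_sq)
  qed
next
  assume *: "\<forall>s<n. y s * v (set_encode {..<n}) \<in> \<aa>"
  have "kdif n y (int n) v m \<in> \<aa>" for m
  proof (cases "m \<in> kbas n (int n - 1)")
    case True
    let ?T = "set_decode m"
    have T: "?T \<subseteq> {..<n}" "int (card ?T) = int n - 1" using True by (simp_all add: kbas_iff)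
    have "card ({..<n} - ?T) = 1" using T by (subst card_Diff_subset) auto
    then obtain s where s: "{..<n} - ?T = {s}" by (auto simp: card_1_singleton_iff)
    then have "?T = {..<n} - {s}" and sn: "s < n" using T(1) by auto
    then have "m = set_encode ({..<n} - {s})" by (metis set_decode_inverse)
    then show ?thesis using kdif_top[OF sn, of y v] idl_mult[OF a] * sn by metis
  next
    case False
    then show ?thesis using idl_zero[OF a] by (simp add: kdif_def)
  qed
  then show "kdif n y (int n) v \<in> hat \<aa>" by (simp add: hat_def)
qed

context cring
begin

subsection \<open>Free homology in coordinates\<close>

lemma emb_smod:
  assumes i: "inj \<iota>" and C: "finite C" and T: "sub T" "T \<subseteq> Fr C"
  shows "smod (free_module R (\<iota> ` C)) (emb \<iota> ` T)"
  unfolding smod_def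
proof (intro conjI ballI)
  show "emb \<iota> ` T \<subseteq> carrier (free_module R (\<iota> ` C))" using emb_closed[OF i C] T(2) by blast
  show "\<zero>\<^bsub>free_module R (\<iota> ` C)\<^esub> \<in> emb \<iota> ` T"
    unfolding emb_ops(3)[where \<iota> = \<iota>] by (rule imageI[OF sub_zero[OF T(1)]])
  fix x assume "x \<in> emb \<iota> ` T"
  then obtain u where u: "u \<in> T" "x = emb \<iota> u" by blast
  show "x \<oplus>\<^bsub>free_module R (\<iota> ` C)\<^esub> y \<in> emb \<iota> ` T" if "y \<in> emb \<iota> ` T" for y
  proof -
    from that obtain v where v: "v \<in> T" "y = emb \<iota> v" by blast
    show ?thesis unfolding u(2) v(2) emb_ops by (rule imageI[OF sub_add[OF T(1) u(1) v(1)]])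
  qed
  show "r \<odot>\<^bsub>free_module R (\<iota> ` C)\<^esub> x \<in> emb \<iota> ` T" if "r \<in> carrier R" for r
  proof -
    have "\<pi> (fvar r) \<odot>\<^bsub>free_module R (\<iota> ` C)\<^esub> emb \<iota> u \<in> emb \<iota> ` T"
      unfolding emb_ops by (rule imageI[OF sub_sc[OF T(1) u(1)]])
    then show ?thesis using that by (simp only: pi_var u(2))
  qed
qed

lemma emb_minus:
  assumes i: "inj \<iota>" and C: "finite C" and T: "sub T" "T \<subseteq> Fr C" "u \<in> T" "v \<in> T"
  shows "emb \<iota> u \<ominus>\<^bsub>sub_module (free_module R (\<iota> ` C)) (emb \<iota> ` T)\<^esub> emb \<iota> v = emb \<iota> (u - v)"
proof -
  let ?M = "sub_module (free_module R (\<iota> ` C)) (emb \<iota> ` T)"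
  interpret M: module R ?M by (rule module_sub[OF module_free emb_smod[OF i C T(1,2)]])
  have c: "emb \<iota> (u - v) \<in> carrier ?M" "emb \<iota> v \<in> carrier ?M" using sub_diff[OF T(1,3,4)] T(4) by simp_all
  have "emb \<iota> u = emb \<iota> (u - v) \<oplus>\<^bsub>?M\<^esub> emb \<iota> v"
    using emb_ops(1)[where \<iota> = \<iota> and u = "u - v" and v = v and B = "\<iota> ` C"] by simp
  then show ?thesis using c by (simp only: M.minus_eq M.a_assoc M.r_neg M.r_zero M.a_inv_closed)
qed

lemma emb_Bc:
  assumes i: "inj \<iota>" and c: "cpx \<kk> B d" and z: "z \<in> Fr (B j)"
  shows "emb \<iota> z \<in> emb \<iota> ` Bc \<kk> B d j \<longleftrightarrow> z \<in> Bc \<kk> B d j"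
proof
  assume "emb \<iota> z \<in> emb \<iota> ` Bc \<kk> B d j"
  then obtain b where b: "b \<in> Bc \<kk> B d j" "emb \<iota> z = emb \<iota> b" by blast
  have h: "z - b \<in> hat \<kk>" using b(2) emb_eq[OF i] by blast
  have "b \<in> Fr (B j)" using b(1) by (rule BcE)
  from hat_Bc[OF idl_kk c sub_diff[OF sub_Fr z this] h]
  show "z \<in> Bc \<kk> B d j" using sub_diff_iff[OF sub_Bc[OF idl_kk c]] b(1) by blast
qed blast

lemma hb_of_fbas:
  assumes i: "inj \<iota>" and c: "cpx \<kk> B d" and C: "finite C"
    and f: "fbas (sub_module (free_module R (\<iota> ` B j)) (emb \<iota> ` Zc \<kk> B d j)) (emb \<iota> ` Bc \<kk> B d j) I C \<phi>"
  shows "\<exists>\<zeta>. hb \<kk> (pre I) B d C \<zeta> j"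
proof -
  let ?F = "free_module R (\<iota> ` B j)" and ?M = "sub_module (free_module R (\<iota> ` B j)) (emb \<iota> ` Zc \<kk> B d j)"
  note D = cpxD[OF c]
  have \<phi>: "slin ?M \<phi>" "\<And>v. v \<in> Fr C \<Longrightarrow> \<phi> v \<in> emb \<iota> ` Bc \<kk> B d j \<longleftrightarrow> v \<in> hat (pre I)"
    "\<And>m. m \<in> emb \<iota> ` Zc \<kk> B d j \<Longrightarrow> \<exists>v\<in>Fr C. m \<ominus>\<^bsub>?M\<^esub> \<phi> v \<in> emb \<iota> ` Bc \<kk> B d j"
    using f unfolding fbas_def by auto
  note S = slinD[OF \<phi>(1)]
  define w where "w k = (SOME z. z \<in> Zc \<kk> B d j \<and> emb \<iota> z = \<phi> (un k))" for k :: nat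
  have w: "w k \<in> Zc \<kk> B d j" "emb \<iota> (w k) = \<phi> (un k)" for k
  proof -
    have "\<exists>z. z \<in> Zc \<kk> B d j \<and> emb \<iota> z = \<phi> (un k)" using S(1)[of "un k"] by auto
    from someI_ex[OF this] show "w k \<in> Zc \<kk> B d j" "emb \<iota> (w k) = \<phi> (un k)" by (simp_all add: w_def)
  qed
  define \<zeta> where "\<zeta> = linB C w"
  have sZ: "sub (Zc \<kk> B d j)" by (rule sub_Zc[OF idl_kk c])
  have \<zeta>Z: "\<zeta> v \<in> Zc \<kk> B d j" for v unfolding \<zeta>_def linB_def by (intro sub_sum[OF sZ] sub_sc[OF sZ] w)
  have \<zeta>l: "lin \<zeta>" unfolding \<zeta>_def by (rule lin_linB)
  have ZF: "Zc \<kk> B d j \<subseteq> Fr (B j)" by (auto simp: Zc_def)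
  have sl\<phi>: "slin ?F \<phi>" using S smodD(1)[OF emb_smod[OF i D(1) sZ ZF]] unfolding slin_def by auto
  have sl\<zeta>: "slin ?F (\<lambda>v. emb \<iota> (\<zeta> v))" by (rule slin_emb[OF i D(1) \<zeta>l ZcD(1)[OF \<zeta>Z]])
  have e: "emb \<iota> (\<zeta> v) = \<phi> v" if "v \<in> Fr C" for v
  proof (rule slin_eqI[OF module_free sl\<zeta> sl\<phi> C _ that])
    show "emb \<iota> (\<zeta> (un k)) = \<phi> (un k)" if "k \<in> C" for k
      using w(2)[of k] by (simp add: \<zeta>_def linB_un[OF C that])
  qed
  have "hb \<kk> (pre I) B d C \<zeta> j"
    unfolding hb_def miso_def
  proof (intro conjI ballI)
    show "finite C" "lin \<zeta>" by (rule C \<zeta>l)+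
    show "\<zeta> v \<in> Zc \<kk> B d j" for v by (rule \<zeta>Z)
    show "\<zeta> v \<in> Bc \<kk> B d j \<longleftrightarrow> v \<in> hat (pre I)" if "v \<in> Fr C" for v
      using \<phi>(2)[OF that] by (simp only: emb_Bc[OF i c ZcD(1)[OF \<zeta>Z]] e[OF that, symmetric])
    fix z assume z: "z \<in> Zc \<kk> B d j"
    from \<phi>(3)[OF imageI[OF z]] obtain v where v: "v \<in> Fr C" "emb \<iota> z \<ominus>\<^bsub>?M\<^esub> \<phi> v \<in> emb \<iota> ` Bc \<kk> B d j" by blast
    have "emb \<iota> (z - \<zeta> v) \<in> emb \<iota> ` Bc \<kk> B d j"
      using v(2) by (simp only: e[OF v(1), symmetric] emb_minus[OF i D(1) sZ ZF z \<zeta>Z])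
    then show "\<exists>v\<in>Fr C. z - \<zeta> v \<in> Bc \<kk> B d j"
      using v(1) emb_Bc[OF i c ZcD(1)[OF sub_diff[OF sZ z \<zeta>Z]]] by blast
  qed
  then show ?thesis by blast
qed

text \<open>\<open>power_module\<close> is indexed by an initial segment whereas \<open>C\<close> is
  an arbitrary finite set; \<open>\<rho>\<close> renames the coordinates.\<close>

lemma fbas_of_hb:
  assumes i: "inj \<iota>" and c: "cpx \<kk> B d" and I: "ideal I R" and h: "hb \<kk> (pre I) B d C \<zeta> j"
  shows "\<exists>\<phi>. fbas (sub_module (free_module R (\<iota> ` B j)) (emb \<iota> ` Zc \<kk> B d j)) (emb \<iota> ` Bc \<kk> B d j) I {..<card C} \<phi>"
proof -
  let ?M = "sub_module (free_module R (\<iota> ` B j)) (emb \<iota> ` Zc \<kk> B d j)"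
  note D = cpxD[OF c] and H = hbD[OF h]
  obtain g where g: "bij_betw g {..<card C} C" using ex_bij_betw_nat_finite[OF H(1)] by (auto simp: atLeast0LessThan)
  define g' where "g' = inv_into {..<card C} g"
  have g': "\<And>k. k < card C \<Longrightarrow> g k \<in> C \<and> g' (g k) = k" "\<And>k. k \<in> C \<Longrightarrow> g' k < card C \<and> g (g' k) = k"
    using g bij_betw_inv_into_left[OF g] bij_betw_inv_into_right[OF g] bij_betw_apply[OF g] bij_betw_apply[OF bij_betw_inv_into[OF g]]
    by (auto simp: g'_def)
  define \<rho> where "\<rho> v k = (if k \<in> C then v (g' k) else 0)" for v :: "nat \<Rightarrow> 'a frng" and k
  have \<rho>l: "\<rho> (u + v) = \<rho> u + \<rho> v" "\<rho> (r *s v) = r *s \<rho> v" for u v r by (auto simp: \<rho>_def fun_eq_iff sc_def)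
  have \<rho>C: "\<rho> v \<in> Fr C" for v by (simp add: \<rho>_def Fr_def)
  have \<rho>s: "\<exists>v\<in>Fr {..<card C}. \<rho> v = u" if u: "u \<in> Fr C" for u
    by (rule bexI[of _ "\<lambda>k. if k < card C then u (g k) else 0"]) (use g'(2) u in \<open>auto simp: \<rho>_def Fr_def fun_eq_iff\<close>)
  have \<rho>h: "\<rho> v \<in> hat (pre I) \<longleftrightarrow> v \<in> hat (pre I)" if v: "v \<in> Fr {..<card C}" for v
  proof
    assume r: "\<rho> v \<in> hat (pre I)"
    have "v k \<in> pre I" for k
    proof (cases "k < card C")
      case True
      have "\<rho> v (g k) \<in> pre I" using r unfolding hat_def by blast
      then show ?thesis using g'(1)[OF True] by (simp add: \<rho>_def)
    next
      case False
      then show ?thesis using v idl_zero[OF idl_pre[OF I]] by (simp add: Fr_def)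
    qed
    then show "v \<in> hat (pre I)" by (simp add: hat_def)
  next
    assume "v \<in> hat (pre I)"
    then show "\<rho> v \<in> hat (pre I)" using idl_zero[OF idl_pre[OF I]] by (simp add: \<rho>_def hat_def)
  qed
  have sZ: "sub (Zc \<kk> B d j)" by (rule sub_Zc[OF idl_kk c])
  have ZF: "Zc \<kk> B d j \<subseteq> Fr (B j)" by (auto simp: Zc_def)
  have "fbas ?M (emb \<iota> ` Bc \<kk> B d j) I {..<card C} (\<lambda>v. emb \<iota> (\<zeta> (\<rho> v)))"
    unfolding fbas_def
  proof (intro conjI ballI)
    show "slin ?M (\<lambda>v. emb \<iota> (\<zeta> (\<rho> v)))"
      unfolding slin_def using H(4)[OF \<rho>C]
      by (simp add: \<rho>l lin_simps[OF H(3)] emb_ops(1,2)[where \<iota> = \<iota> and B = "\<iota> ` B j", symmetric] del: mk_module_simps)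
    show "emb \<iota> (\<zeta> (\<rho> v)) \<in> emb \<iota> ` Bc \<kk> B d j \<longleftrightarrow> v \<in> hat (pre I)" if "v \<in> Fr {..<card C}" for v
      using H(5)[OF \<rho>C] by (simp only: emb_Bc[OF i c ZcD(1)[OF H(4)[OF \<rho>C]]] \<rho>h[OF that])
    fix m assume "m \<in> carrier ?M"
    then obtain z where z: "z \<in> Zc \<kk> B d j" "m = emb \<iota> z" by auto
    from H(6)[OF z(1)] obtain u where u: "u \<in> Fr C" "z - \<zeta> u \<in> Bc \<kk> B d j" by blast
    from \<rho>s[OF u(1)] obtain v where v: "v \<in> Fr {..<card C}" "\<rho> v = u" by blast
    show "\<exists>v\<in>Fr {..<card C}. m \<ominus>\<^bsub>?M\<^esub> emb \<iota> (\<zeta> (\<rho> v)) \<in> emb \<iota> ` Bc \<kk> B d j"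
      using v(1) by (rule bexI[rotated]) (simp only: v(2) z(2) emb_minus[OF i D(1) sZ ZF z(1) H(4)[OF u(1)]] imageI[OF u(2)])
  qed
  then show ?thesis by blast
qed


subsection \<open>The Koszul complex in coordinates\<close>

lemma inj_set_decode: "inj set_decode"
  by (metis injI set_decode_inverse)

lemma koszul_obj: "cobj (koszul_complex R ys) i = free_module R (set_decode ` kbas (length ys) i)"
proof -
  have "set_decode ` kbas (length ys) i = {S. S \<subseteq> {..<length ys} \<and> int (card S) = i}"
  proof
    show "{S. S \<subseteq> {..<length ys} \<and> int (card S) = i} \<subseteq> set_decode ` kbas (length ys) i"
    proof
      fix S assume "S \<in> {S. S \<subseteq> {..<length ys} \<and> int (card S) = i}"
      then have S: "S \<subseteq> {..<length ys}" "int (card S) = i" by auto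
      then have "S = set_decode (set_encode S)" using finite_subset[OF S(1)] by simp
      then show "S \<in> set_decode ` kbas (length ys) i" by (rule image_eqI) (simp add: kbas_encode S)
    qed
  qed (auto simp: kbas_iff)
  then show ?thesis by (simp add: koszul_complex_def)
qed

lemma koszul_diff:
  assumes ys: "set ys \<subseteq> carrier R"
  shows "cdiff (koszul_complex R ys) i (emb set_decode v) = emb set_decode (kdif (length ys) (\<lambda>s. fvar (ys ! s)) i v)"
proof
  fix T
  let ?n = "length ys"
  show "cdiff (koszul_complex R ys) i (emb set_decode v) T = emb set_decode (kdif ?n (\<lambda>s. fvar (ys ! s)) i v) T"
  proof (cases "T \<subseteq> {..<?n} \<and> int (card T) = i - 1")
    case True
    then have fT: "finite T" using finite_subset by blast
    have T: "T = set_decode (set_encode T)" using fT by simp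
    have m: "set_encode T \<in> kbas ?n (i - 1)" using True by (simp add: kbas_encode)
    have "emb set_decode (kdif ?n (\<lambda>s. fvar (ys ! s)) i v) T = \<pi> (kdif ?n (\<lambda>s. fvar (ys ! s)) i v (set_encode T))"
      by (subst T) (simp only: emb_app[OF inj_set_decode])
    also have "kdif ?n (\<lambda>s. fvar (ys ! s)) i v (set_encode T) =
        (\<Sum>s\<in>{..<?n} - T. (- 1) ^ card {t \<in> T. t < s} * fvar (ys ! s) * v (set_encode (insert s T)))"
      using m fT by (simp add: kdif_def kset_def ksign_def)
    also have "\<pi> \<dots> = (\<Oplus>s\<in>{..<?n} - T. \<pi> ((- 1) ^ card {t \<in> T. t < s} * fvar (ys ! s) * v (set_encode (insert s T))))"
      by (rule pi_sum) simp
    also have "\<dots> = (\<Oplus>s\<in>{..<?n} - T. (\<ominus> \<one>) [^] card {t \<in> T. t < s} \<otimes> ys ! s \<otimes> emb set_decode v (insert s T))"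
    proof (rule finsum_cong')
      have ysc: "ys ! s \<in> carrier R" if "s \<in> {..<?n} - T" for s using ys that nth_mem[of s ys] by auto
      have e: "emb set_decode v (insert s T) = \<pi> (v (set_encode (insert s T)))" for s
        using emb_app[OF inj_set_decode, of v "set_encode (insert s T)"] fT by simp
      show "\<pi> ((- 1) ^ card {t \<in> T. t < s} * fvar (ys ! s) * v (set_encode (insert s T))) =
        (\<ominus> \<one>) [^] card {t \<in> T. t < s} \<otimes> ys ! s \<otimes> emb set_decode v (insert s T)" if "s \<in> {..<?n} - T" for s
        by (simp add: pi_pow ysc[OF that] e)
      show "(\<lambda>s. (\<ominus> \<one>) [^] card {t \<in> T. t < s} \<otimes> ys ! s \<otimes> emb set_decode v (insert s T)) \<in> {..<?n} - T \<rightarrow> carrier R"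
        using ysc e by auto
    qed simp
    finally show ?thesis using True by (simp add: koszul_complex_def)
  next
    case False
    have "emb set_decode (kdif ?n (\<lambda>s. fvar (ys ! s)) i v) T = \<zero>"
    proof (cases "T \<in> range set_decode")
      case True
      then obtain m where m: "T = set_decode m" by blast
      then have "m \<notin> kbas ?n (i - 1)" using False by (simp add: kbas_iff)
      then show ?thesis unfolding m emb_app[OF inj_set_decode] by (simp add: kdif_def)
    qed (simp add: emb_def)
    then show ?thesis using False by (auto simp: koszul_complex_def)
  qed
qed

lemma koszul_resolution:
  assumes ys: "set ys \<subseteq> carrier R" and one: "\<one> \<noteq> \<zero>"
    and q: "quasi_projective_resolution R (quotient_module (ring_as_module R) (Idl (set ys))) (koszul_complex R ys)"
  defines "B \<equiv> kbas (length ys)" and "d \<equiv> kdif (length ys) (\<lambda>s. fvar (ys ! s))"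
  shows "cpx \<kk> B d" "\<exists>(C :: int \<Rightarrow> nat set) \<zeta>. \<forall>i. hb \<kk> (pre (Idl (set ys))) B d (C i) (\<zeta> i) i"
proof -
  let ?K = "koszul_complex R ys" and ?n = "length ys" and ?\<iota> = "set_decode"
  have I: "ideal (Idl (set ys)) R" by (rule genideal_ideal[OF ys])
  have c: "is_complex R ?K" using q by (simp add: quasi_projective_resolution_def)
  note i = inj_set_decode and D = koszul_diff[OF ys, folded d_def] and O = koszul_obj[of ys, folded B_def]
  have fB: "finite (B j)" for j unfolding B_def by (rule finite_kbas)
  show cp: "cpx \<kk> B d"
    unfolding cpx_def
  proof (intro conjI allI ballI fB)
    show "lin (d j)" for j unfolding d_def by (rule lin_kdif)
    show "d j v \<in> Fr (B (j - 1))" for j v unfolding d_def B_def by (rule kdif_Fr)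
    fix j and v :: "nat \<Rightarrow> 'a frng" assume v: "v \<in> Fr (B j)"
    have "emb ?\<iota> v \<in> carrier (cobj ?K j)" unfolding O by (rule emb_closed[OF i fB v])
    then have "cdiff ?K (j - 1) (cdiff ?K j (emb ?\<iota> v)) = \<zero>\<^bsub>cobj ?K (j - 1 - 1)\<^esub>"
      using c unfolding is_complex_def by blast
    then show "d (j - 1) (d j v) \<in> hat \<kk>" using emb_zero[OF i] by (simp add: D O)
  qed
  let ?F = "cx ?\<iota> B d"
  have dd: "cdiff ?K j x = cdiff ?F j x" if "x \<in> carrier (cobj ?F j)" for j x
  proof -
    from that obtain v where v: "v \<in> Fr (B j)" "x = emb ?\<iota> v" unfolding cx_simps by (rule cx_elem[OF i])
    show ?thesis unfolding v(2) D cx_diff[OF i cp v(1)] ..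
  qed
  have o: "cobj ?K j = cobj ?F j" for j by (simp only: O cx_simps)
  have "cycles ?K j = cycles ?F j" for j unfolding cycles_def o using dd by auto
  moreover have "boundaries ?K j = boundaries ?F j" for j unfolding boundaries_def o by (rule image_cong[OF HOL.refl dd])
  ultimately have H: "homology ?K j = quotient_module (sub_module (free_module R (?\<iota> ` B j)) (emb ?\<iota> ` Zc \<kk> B d j)) (emb ?\<iota> ` Bc \<kk> B d j)" for j
    by (simp only: homology_def o cx_complex[OF i cp] cx_simps)
  have sZ: "sub (Zc \<kk> B d j)" for j by (rule sub_Zc[OF idl_kk cp])
  have sB: "sub (Bc \<kk> B d j)" for j by (rule sub_Bc[OF idl_kk cp])
  have ZF: "Zc \<kk> B d j \<subseteq> Fr (B j)" for j by (auto simp: Zc_def)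
  have BF: "Bc \<kk> B d j \<subseteq> Fr (B j)" for j by (auto simp: Bc_def)
  \<comment> \<open>Degree 0 is a nonzero copy of \<open>R\<close>, so the isomorphisms of the
    resolution are available in all degrees from 0 on; in negative degrees the homology is
    zero.\<close>
  have inf0: "complex_inf ?K \<le> ereal (real_of_int j)" if "0 \<le> j" for j
  proof -
    have B0: "set_encode {} \<in> B 0" unfolding B_def by (subst kbas_encode) simp_all
    have "un (set_encode {}) \<notin> hat \<kk>" unfolding hat_def
    proof
      assume "un (set_encode {}) \<in> {v. \<forall>i. v i \<in> \<kk>}"
      then have "(un (set_encode {}) (set_encode {}) :: 'a frng) \<in> \<kk>" by blast
      then show False using one by (simp add: un_def pre_def)
    qed
    then have "emb ?\<iota> (un (set_encode {})) \<noteq> \<zero>\<^bsub>cobj ?K 0\<^esub>" using emb_zero[OF i] by (simp add: O)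
    moreover have "emb ?\<iota> (un (set_encode {})) \<in> carrier (cobj ?K 0)" unfolding O by (rule emb_closed[OF i fB un_Fr[OF B0]])
    ultimately have "\<not> zero_module (cobj ?K 0)" by (auto simp: zero_module_def)
    then have "complex_inf ?K \<le> ereal (real_of_int 0)" unfolding complex_inf_def by (intro INF_lower) simp
    also have "\<dots> \<le> ereal (real_of_int j)" using that by simp
    finally show ?thesis .
  qed
  from q obtain a :: "int \<Rightarrow> nat" where
    a: "\<And>j. complex_inf ?K \<le> ereal (real_of_int j) \<Longrightarrow>
      isomorphic_modules R (homology ?K j) (power_module (quotient_module (ring_as_module R) (Idl (set ys))) (a j))"
    unfolding quasi_projective_resolution_def by blast
  have "\<exists>x :: nat set \<times> ((nat \<Rightarrow> 'a frng) \<Rightarrow> nat \<Rightarrow> 'a frng). hb \<kk> (pre (Idl (set ys))) B d (fst x) (snd x) j" for j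
  proof (cases "0 \<le> j")
    case True
    let ?M = "sub_module (free_module R (?\<iota> ` B j)) (emb ?\<iota> ` Zc \<kk> B d j)"
    have M: "module R ?M" by (rule module_sub[OF module_free emb_smod[OF i fB sZ[of j] ZF[of j]]])
    have "Bc \<kk> B d j \<subseteq> Zc \<kk> B d j" by (rule Bc_Zc[OF idl_kk cp])
    then have N: "smod ?M (emb ?\<iota> ` Bc \<kk> B d j)"
      using emb_smod[OF i fB sB[of j] BF[of j]] unfolding smod_def by auto
    from iso_fbas[OF M N I a[OF inf0[OF True], unfolded H]] obtain \<phi> where
      "fbas ?M (emb ?\<iota> ` Bc \<kk> B d j) (Idl (set ys)) {..<a j} \<phi>" ..
    from hb_of_fbas[OF i cp finite_lessThan this] obtain \<zeta> where "hb \<kk> (pre (Idl (set ys))) B d {..<a j} \<zeta> j" ..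
    then show ?thesis by (intro exI[of _ "({..<a j}, \<zeta>)"]) simp
  next
    case False
    then have "B j = {}" unfolding B_def by (intro kbas_empty) simp
    then have Z: "Zc \<kk> B d j \<subseteq> {0}" "Bc \<kk> B d j \<subseteq> {0}" using ZF[of j] BF[of j] by simp_all
    have "hb \<kk> (pre (Idl (set ys))) B d {} (\<lambda>v. v) j"
      unfolding hb_def miso_def
    proof (intro conjI ballI)
      show "v \<in> Zc \<kk> B d j" if "v \<in> Fr {}" for v using that sub_zero[OF sZ] by simp
      show "v \<in> Bc \<kk> B d j \<longleftrightarrow> v \<in> hat (pre (Idl (set ys)))" if "v \<in> Fr {}" for v
        using that sub_zero[OF sB] sub_zero[OF sub_hat[OF idl_pre[OF I]]] by simp
      show "\<exists>u\<in>Fr {}. v - u \<in> Bc \<kk> B d j" if "v \<in> Zc \<kk> B d j" for v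
        using that Z(1) sub_zero[OF sB] by auto
    qed (simp_all add: lin_intros)
    then show ?thesis by (intro exI[of _ "({}, \<lambda>v. v)"]) simp
  qed
  then have "\<exists>Y :: int \<Rightarrow> nat set \<times> ((nat \<Rightarrow> 'a frng) \<Rightarrow> nat \<Rightarrow> 'a frng). \<forall>j. hb \<kk> (pre (Idl (set ys))) B d (fst (Y j)) (snd (Y j)) j" by (intro choice allI)
  then obtain Y :: "int \<Rightarrow> nat set \<times> ((nat \<Rightarrow> 'a frng) \<Rightarrow> nat \<Rightarrow> 'a frng)" where Y: "\<forall>j. hb \<kk> (pre (Idl (set ys))) B d (fst (Y j)) (snd (Y j)) j" ..
  show "\<exists>(C :: int \<Rightarrow> nat set) \<zeta>. \<forall>i. hb \<kk> (pre (Idl (set ys))) B d (C i) (\<zeta> i) i"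
    by (rule exI[of _ "\<lambda>j. fst (Y j)"], rule exI[of _ "\<lambda>j. snd (Y j)"]) (rule Y)
qed

lemma pre_Idl_induct:
  assumes "idl \<bb>" "\<kk> \<subseteq> \<bb>" "set ys \<subseteq> carrier R" "\<And>s. s < length ys \<Longrightarrow> fvar (ys ! s) \<in> \<bb>" "x \<in> pre (Idl (set ys))"
  shows "x \<in> \<bb>"
proof -
  have "set ys \<subseteq> \<pi> ` \<bb>"
  proof
    fix y assume "y \<in> set ys"
    then obtain s where s: "s < length ys" "y = ys ! s" by (metis in_set_conv_nth)
    have "y \<in> carrier R" using \<open>y \<in> set ys\<close> assms(3) by blast
    then show "y \<in> \<pi> ` \<bb>" using assms(4)[OF s(1)] s(2) by (intro image_eqI[of _ _ "fvar (ys ! s)"]) simp_all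
  qed
  from genideal_least[OF assms(1) this] have "\<pi> x \<in> \<pi> ` \<bb>" using assms(5) by (auto simp: pre_def)
  then show ?thesis using pre_image[OF assms(1,2)] by blast
qed

text \<open>The elements whose multiplication is null-homotopic modulo \<open>\<kk>\<close> form an
  ideal above \<open>\<kk>\<close>, and it contains the generators by
  \<open>kdif_khom\<close>.\<close>

lemma koszul_contraction:
  assumes ys: "set ys \<subseteq> carrier R" and x: "x \<in> pre (Idl (set ys))"
  defines "B \<equiv> kbas (length ys)" and "d \<equiv> kdif (length ys) (\<lambda>s. fvar (ys ! s))"
  shows "\<exists>h. \<forall>i. lin (h i) \<and> (\<forall>v\<in>Fr (B i). h i v \<in> Fr (B (i + 1)) \<and>
    d (i + 1) (h i v) + h (i - 1) (d i v) - x *s v \<in> hat \<kk>)"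
proof -
  define \<bb> where "\<bb> = {x. \<exists>h. \<forall>i. lin (h i) \<and> (\<forall>v\<in>Fr (B i). h i v \<in> Fr (B (i + 1)) \<and>
    d (i + 1) (h i v) + h (i - 1) (d i v) - x *s v \<in> hat \<kk>)}"
  have ld: "lin (d i)" for i unfolding d_def by (rule lin_kdif)
  note dl = lin_simps[OF ld] and hk = sub_hat[OF idl_kk]
  have "idl \<bb>"
    unfolding idl_def
  proof (intro conjI ballI allI)
    show "0 \<in> \<bb>" unfolding \<bb>_def
      by (intro CollectI exI[of _ "\<lambda>_ _. 0"]) (simp add: lin_intros sub_zero[OF sub_Fr] dl sub_zero[OF hk])
    fix x assume "x \<in> \<bb>"
    then obtain h where h: "\<And>i. lin (h i)" "\<And>i v. v \<in> Fr (B i) \<Longrightarrow> h i v \<in> Fr (B (i + 1))"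
      "\<And>i v. v \<in> Fr (B i) \<Longrightarrow> d (i + 1) (h i v) + h (i - 1) (d i v) - x *s v \<in> hat \<kk>" unfolding \<bb>_def by blast
    show "x + y \<in> \<bb>" if "y \<in> \<bb>" for y
    proof -
      from that obtain h' where h': "\<And>i. lin (h' i)" "\<And>i v. v \<in> Fr (B i) \<Longrightarrow> h' i v \<in> Fr (B (i + 1))"
        "\<And>i v. v \<in> Fr (B i) \<Longrightarrow> d (i + 1) (h' i v) + h' (i - 1) (d i v) - y *s v \<in> hat \<kk>" unfolding \<bb>_def by blast
      have "d (i + 1) (h i v + h' i v) + (h (i - 1) (d i v) + h' (i - 1) (d i v)) - (x + y) *s v \<in> hat \<kk>" if "v \<in> Fr (B i)" for i v
        using sub_add[OF hk h(3)[OF that] h'(3)[OF that]] by (simp add: dl sc_distrib algebra_simps)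
      moreover have "lin (\<lambda>v. h i v + h' i v)" for i unfolding lin_def by (simp add: lin_simps[OF h(1)] lin_simps[OF h'(1)] sc_distrib)
      ultimately show ?thesis unfolding \<bb>_def
        by (intro CollectI exI[of _ "\<lambda>i v. h i v + h' i v"]) (simp add: sub_add[OF sub_Fr] h(2) h'(2))
    qed
    show "r * x \<in> \<bb>" for r
    proof -
      have "d (i + 1) (r *s h i v) + r *s h (i - 1) (d i v) - (r * x) *s v \<in> hat \<kk>" if "v \<in> Fr (B i)" for i v
        using sub_sc[OF hk h(3)[OF that], of r] by (simp add: dl sc_distrib)
      moreover have "lin (\<lambda>v. r *s h i v)" for i unfolding lin_def by (simp add: lin_simps[OF h(1)] sc_distrib mult.commute)
      ultimately show ?thesis unfolding \<bb>_def
        by (intro CollectI exI[of _ "\<lambda>i v. r *s h i v"]) (simp add: sub_sc[OF sub_Fr] h(2))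
    qed
  qed
  moreover have "\<kk> \<subseteq> \<bb>"
  proof
    fix x assume x: "x \<in> \<kk>"
    have "- (x *s v) \<in> hat \<kk>" for v :: "nat \<Rightarrow> 'a frng" using hat_sc[OF idl_kk x] sub_diff[OF hk sub_zero[OF hk]] by (metis diff_0)
    then show "x \<in> \<bb>" unfolding \<bb>_def
      by (intro CollectI exI[of _ "\<lambda>_ _. 0"]) (simp add: lin_intros sub_zero[OF sub_Fr] dl)
  qed
  moreover have "fvar (ys ! s) \<in> \<bb>" if "s < length ys" for s
    unfolding \<bb>_def using kdif_khom[OF that, where y = "\<lambda>s. fvar (ys ! s)"]
    by (intro CollectI exI[of _ "khom (length ys) s"]) (simp add: lin_khom khom_Fr B_def d_def sub_zero[OF hk])
  ultimately have "x \<in> \<bb>" using pre_Idl_induct ys x by blast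
  then show ?thesis unfolding \<bb>_def by blast
qed

text \<open>The elements that multiply the top coefficient into \<open>\<aa>\<close> form an ideal
  above \<open>\<kk>\<close>, so testing the generators \<open>ys\<close> is enough.\<close>

lemma koszul_top:
  assumes ys: "set ys \<subseteq> carrier R" and a: "idl \<aa>" "\<kk> \<subseteq> \<aa>" and v: "v \<in> Fr {set_encode {..<length ys}}"
  shows "kdif (length ys) (\<lambda>s. fvar (ys ! s)) (int (length ys)) v \<in> hat \<aa> \<longleftrightarrow>
    (\<forall>s\<in>pre (Idl (set ys)). v (set_encode {..<length ys}) * s \<in> \<aa>)"
proof -
  let ?c = "v (set_encode {..<length ys})"
  have 1: "fvar (ys ! s) \<in> pre (Idl (set ys))" if "s < length ys" for s
  proof -
    have "ys ! s \<in> carrier R" "ys ! s \<in> Idl (set ys)" using nth_mem[OF that] ys genideal_self[OF ys] by blast+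
    then show ?thesis by (simp add: pre_def)
  qed
  have "idl {x. ?c * x \<in> \<aa>}"
    using idl_zero[OF a(1)] idl_add[OF a(1)] idl_mult[OF a(1)] by (auto simp: idl_def distrib_left mult.left_commute)
  moreover have "\<kk> \<subseteq> {x. ?c * x \<in> \<aa>}" using a(2) idl_mult[OF a(1)] by blast
  ultimately have "(\<forall>s<length ys. fvar (ys ! s) * ?c \<in> \<aa>) \<longleftrightarrow> (\<forall>s\<in>pre (Idl (set ys)). ?c * s \<in> \<aa>)"
    using pre_Idl_induct[of "{x. ?c * x \<in> \<aa>}" ys] ys 1 by (auto simp: mult.commute)
  then show ?thesis using kdif_top_hat[OF a(1) v, where y = "\<lambda>s. fvar (ys ! s)"] by simp
qed


section \<open>The grade is a lower bound\<close>

lemma smod_minus_iff: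
  assumes M: "module R M" and N: "smod M N" and x: "x \<in> carrier M" "y \<in> carrier M" "x \<ominus>\<^bsub>M\<^esub> y \<in> N"
  shows "x \<in> N \<longleftrightarrow> y \<in> N"
proof -
  interpret M: module R M by fact
  have "x = (x \<ominus>\<^bsub>M\<^esub> y) \<oplus>\<^bsub>M\<^esub> y" using x(1,2) by (simp add: M.minus_eq M.a_assoc M.l_neg)
  moreover have "y = x \<ominus>\<^bsub>M\<^esub> (x \<ominus>\<^bsub>M\<^esub> y)"
    using x(1,2) by (simp add: M.minus_eq M.minus_add M.a_assoc[symmetric] M.r_neg)
  ultimately show ?thesis using smodD(3)[OF N x(3)] smod_minus[OF M N _ x(3)] by metis
qed

lemma smod_minus_sym:
  assumes M: "module R M" and N: "smod M N" and x: "x \<in> carrier M" "y \<in> carrier M" "x \<ominus>\<^bsub>M\<^esub> y \<in> N"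
  shows "y \<ominus>\<^bsub>M\<^esub> x \<in> N"
proof -
  interpret M: module R M by fact
  have "y \<ominus>\<^bsub>M\<^esub> x = \<ominus>\<^bsub>M\<^esub> (x \<ominus>\<^bsub>M\<^esub> y)" using x(1,2) by (simp add: M.minus_eq M.minus_add M.a_comm)
  then show ?thesis using smod_uminus[OF M N x(3)] by simp
qed

lemma smod_minus_trans:
  assumes M: "module R M" and N: "smod M N" and c: "x \<in> carrier M" "y \<in> carrier M" "z \<in> carrier M"
    and x: "x \<ominus>\<^bsub>M\<^esub> y \<in> N" "y \<ominus>\<^bsub>M\<^esub> z \<in> N"
  shows "x \<ominus>\<^bsub>M\<^esub> z \<in> N"
proof -
  interpret M: module R M by fact
  have "(x \<ominus>\<^bsub>M\<^esub> y) \<oplus>\<^bsub>M\<^esub> (y \<ominus>\<^bsub>M\<^esub> z) = x \<oplus>\<^bsub>M\<^esub> ((\<ominus>\<^bsub>M\<^esub> y \<oplus>\<^bsub>M\<^esub> y) \<oplus>\<^bsub>M\<^esub> \<ominus>\<^bsub>M\<^esub> z)"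
    using c by (simp add: M.minus_eq M.a_assoc del: M.l_neg)
  also have "\<dots> = x \<ominus>\<^bsub>M\<^esub> z" using c by (simp add: M.minus_eq M.l_neg)
  finally show ?thesis using smodD(3)[OF N x] by simp
qed

lemma module_minus_zero:
  fixes M :: "('a, 'm) module"
  assumes "module R M" shows "\<ominus>\<^bsub>M\<^esub> \<zero>\<^bsub>M\<^esub> = \<zero>\<^bsub>M\<^esub>"
proof -
  interpret M: module R M by fact
  show ?thesis using M.minus_equality[of "\<zero>\<^bsub>M\<^esub>" "\<zero>\<^bsub>M\<^esub>"] by simp
qed

lemma module_minus_closed:
  fixes M :: "('a, 'm) module"
  assumes "module R M" "x \<in> carrier M" "y \<in> carrier M" shows "x \<ominus>\<^bsub>M\<^esub> y \<in> carrier M"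
  by (rule smod_minus[OF assms(1) smod_carrier[OF assms(1)] assms(2,3)])

lemma module_smult_minus:
  assumes M: "module R M" and x: "r \<in> carrier R" "x \<in> carrier M" "y \<in> carrier M"
  shows "r \<odot>\<^bsub>M\<^esub> (x \<ominus>\<^bsub>M\<^esub> y) = r \<odot>\<^bsub>M\<^esub> x \<ominus>\<^bsub>M\<^esub> r \<odot>\<^bsub>M\<^esub> y"
proof -
  interpret M: module R M by fact
  show ?thesis using x by (simp add: M.minus_eq M.smult_r_distr M.smult_r_minus)
qed

lemma module_hom_minus:
  assumes M: "module R M" "module R N" and f: "f \<in> module_hom R M N" and x: "x \<in> carrier M" "y \<in> carrier M"
  shows "f (x \<ominus>\<^bsub>M\<^esub> y) = f x \<ominus>\<^bsub>N\<^esub> f y"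
proof -
  interpret M: module R M by fact
  interpret N: module R N by fact
  note F = module_homD[OF f]
  have "f x = f ((x \<ominus>\<^bsub>M\<^esub> y) \<oplus>\<^bsub>M\<^esub> y)" using x by (simp add: M.minus_eq M.a_assoc M.l_neg)
  also have "\<dots> = f (x \<ominus>\<^bsub>M\<^esub> y) \<oplus>\<^bsub>N\<^esub> f y" by (rule F(2)) (use x in simp_all)
  finally show ?thesis using F(1)[OF M.minus_closed[OF x]] F(1)[OF x(2)] by (simp add: N.minus_eq N.a_assoc N.r_neg)
qed

text \<open>For projective \<open>P\<close> this is \<open>\<aa>P\<close>; regular elements modulo \<open>\<aa>\<close> are visibly regular modulo it.\<close>

definition mulid where
  "mulid \<aa> P = {u \<in> carrier P. \<forall>f\<in>module_hom R P (ring_as_module R). f u \<in> \<aa>}"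

lemma mulid_smod: assumes a: "ideal \<aa> R" and P: "module R P" shows "smod P (mulid \<aa> P)"
proof -
  interpret P: module R P by fact
  interpret a: ideal \<aa> R by fact
  show ?thesis
    unfolding smod_def
  proof (intro conjI ballI)
    show "mulid \<aa> P \<subseteq> carrier P" by (auto simp: mulid_def)
    have "f \<zero>\<^bsub>P\<^esub> \<in> \<aa>" if "f \<in> module_hom R P (ring_as_module R)" for f
      using module_hom_zero[OF P module_ring that] additive_subgroup.zero_closed[OF ideal.axioms(1)[OF a]] by simp
    then show "\<zero>\<^bsub>P\<^esub> \<in> mulid \<aa> P" by (simp add: mulid_def)
    fix u assume u: "u \<in> mulid \<aa> P"
    show "u \<oplus>\<^bsub>P\<^esub> v \<in> mulid \<aa> P" if "v \<in> mulid \<aa> P" for v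
      using u that module_homD(2) by (fastforce simp: mulid_def)
    show "r \<odot>\<^bsub>P\<^esub> u \<in> mulid \<aa> P" if "r \<in> carrier R" for r
      using u that module_homD(3) a.I_l_closed by (fastforce simp: mulid_def)
  qed
qed

lemma mulidD: "u \<in> mulid \<aa> P \<Longrightarrow> f \<in> module_hom R P (ring_as_module R) \<Longrightarrow> f u \<in> \<aa>"
  unfolding mulid_def by blast

lemma mulid_hom:
  assumes d: "d \<in> module_hom R P Q" and u: "u \<in> mulid \<aa> P" shows "d u \<in> mulid \<aa> Q"
proof -
  have "f (d u) \<in> \<aa>" if "f \<in> module_hom R Q (ring_as_module R)" for f
    using mulidD[OF u module_hom_comp[OF d that]] .
  then show ?thesis using module_homD(1)[OF d] u by (simp add: mulid_def)
qed

lemma mulid_mono: "\<aa> \<subseteq> \<bb> \<Longrightarrow> mulid \<aa> P \<subseteq> mulid \<bb> P"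
  by (auto simp: mulid_def)

lemma mulid_smult:
  assumes "ideal \<aa> R" "module R P" "x \<in> \<aa>" "u \<in> carrier P" shows "x \<odot>\<^bsub>P\<^esub> u \<in> mulid \<aa> P"
proof -
  interpret P: module R P by fact
  interpret a: ideal \<aa> R by fact
  have "f (x \<odot>\<^bsub>P\<^esub> u) \<in> \<aa>" if f: "f \<in> module_hom R P (ring_as_module R)" for f
    using module_homD(1)[OF f assms(4)] module_homD(3)[OF f a.Icarr[OF assms(3)] assms(4)] a.I_r_closed[OF assms(3)] by simp
  then show ?thesis using assms(3,4) by (simp add: mulid_def)
qed

lemma mulid_regular:
  assumes "module R P" "x \<in> carrier R" "u \<in> carrier P" "x \<odot>\<^bsub>P\<^esub> u \<in> mulid \<aa> P"
    and "\<And>a. a \<in> carrier R \<Longrightarrow> x \<otimes> a \<in> \<aa> \<Longrightarrow> a \<in> \<aa>"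
  shows "u \<in> mulid \<aa> P"
proof -
  have "f u \<in> \<aa>" if f: "f \<in> module_hom R P (ring_as_module R)" for f
    using mulidD[OF assms(4) f] module_homD(1)[OF f assms(3)] module_homD(3)[OF f assms(2,3)] assms(5)[of "f u"] by simp
  then show ?thesis using assms(3) by (simp add: mulid_def)
qed

text \<open>A vector with entries in \<open>\<aa>\<close> is a finite combination of basis vectors
  with coefficients in \<open>\<aa>\<close>, removed one by one.\<close>

lemma free_hom_ideal:
  fixes B :: "'x set"
  assumes a: "ideal \<aa> R" and h: "h \<in> module_hom R (free_module R B) (ring_as_module R)"
    and g: "g \<in> carrier (free_module R B)" "\<And>b. g b \<in> \<aa>"
  shows "h g \<in> \<aa>"
proof -
  interpret a: ideal \<aa> R by fact
  note H = module_homD[OF h]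
  have "\<forall>g. g \<in> carrier (free_module R B) \<longrightarrow> {x. g x \<noteq> \<zero>} \<subseteq> D \<longrightarrow> (\<forall>b. g b \<in> \<aa>) \<longrightarrow> h g \<in> \<aa>" if "finite D" for D
    using that
  proof (induction D)
    case empty
    have "h (\<lambda>x. \<zero>) \<in> \<aa>" using module_hom_zero[OF module_free module_ring h] by simp
    moreover have "g = (\<lambda>x. \<zero>)" if "{x. g x \<noteq> \<zero>} \<subseteq> {}" for g :: "'x \<Rightarrow> 'a" using that by auto
    ultimately show ?case by blast
  next
    case (insert b D)
    show ?case
    proof (intro allI impI)
      fix g :: "'x \<Rightarrow> 'a"
      assume g: "g \<in> carrier (free_module R B)" "{x. g x \<noteq> \<zero>} \<subseteq> insert b D" "\<forall>b. g b \<in> \<aa>"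
      let ?g = "g(b := \<zero>)"
      have gc: "\<And>x. g x \<in> carrier R" "\<And>x. x \<notin> B \<Longrightarrow> g x = \<zero>" "finite {x. g x \<noteq> \<zero>}" using g(1) by (auto simp: free_carrier)
      have "finite {x. ?g x \<noteq> \<zero>}" by (rule finite_subset[OF _ gc(3)]) auto
      then have g': "?g \<in> carrier (free_module R B)" using gc by (simp add: free_carrier)
      have D: "{x. ?g x \<noteq> \<zero>} \<subseteq> D" using g(2) by auto
      have "\<forall>c. ?g c \<in> \<aa>" using g(3) additive_subgroup.zero_closed[OF ideal.axioms(1)[OF a]] by simp
      with insert.IH g' D have 1: "h ?g \<in> \<aa>" by blast
      show "h g \<in> \<aa>"
      proof (cases "b \<in> B")
        case True
        have b: "(fdelta b :: 'x \<Rightarrow> 'a) \<in> carrier (free_module R B)" by (rule fdelta_free[OF True])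
        have s: "g b \<odot>\<^bsub>free_module R B\<^esub> fdelta b \<in> carrier (free_module R B)"
          by (rule module.smult_closed[OF module_free gc(1) b])
        have "g = ?g \<oplus>\<^bsub>free_module R B\<^esub> g b \<odot>\<^bsub>free_module R B\<^esub> fdelta b"
          using gc(1) by (auto simp: fdelta_def fun_eq_iff)
        then have "h g = h ?g \<oplus> g b \<otimes> h (fdelta b)"
          using H(2)[OF g' s] H(3)[OF gc(1)[of b] b] by (simp del: free_simps)
        moreover have "g b \<otimes> h (fdelta b) \<in> \<aa>" using a.I_r_closed[of "g b" "h (fdelta b)"] H(1)[OF b] g(3) by simp
        ultimately show ?thesis using a.a_closed 1 by simp
      next
        case False
        then have "?g = g" using gc(2) by auto
        then show ?thesis using 1 by simp
      qed
    qed
  qed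
  from this[of "{x. g x \<noteq> \<zero>}"] show ?thesis using g by (auto simp: free_carrier)
qed

lemma free_coord: "(\<lambda>g. g b) \<in> module_hom R (free_module R B) (ring_as_module R)"
  by (auto simp: module_hom_def free_carrier)

text \<open>The coordinates of the section into a free module are functionals, and they separate the
  points of a projective module.\<close>

lemma mulid_zero:
  fixes P :: "('a, 'm) module"
  assumes "projective_module R P" shows "mulid {\<zero>} P = {\<zero>\<^bsub>P\<^esub>}"
proof -
  from assms obtain B :: "'m set" and s p where P: "module R P" and s: "s \<in> module_hom R P (free_module R B)"
    and p: "p \<in> module_hom R (free_module R B) P" "\<And>x. x \<in> carrier P \<Longrightarrow> p (s x) = x"
    unfolding projective_module_def by blast
  have "u = \<zero>\<^bsub>P\<^esub>" if "u \<in> mulid {\<zero>} P" for u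
  proof -
    have u: "u \<in> carrier P" "\<And>b. s u b = \<zero>"
      using mulidD[OF that module_hom_comp[OF s free_coord]] that by (simp_all add: mulid_def)
    have "s u = (\<lambda>x. \<zero>)" using u(2) by (rule HOL.ext)
    then have "p (s u) = p \<zero>\<^bsub>free_module R B\<^esub>" by simp
    then show ?thesis using p(2)[OF u(1)] module_hom_zero[OF module_free P p(1)] by simp
  qed
  then show ?thesis using smodD(2)[OF mulid_smod[OF zeroideal P]] by blast
qed

text \<open>With \<open>\<aa> = Idl A\<close> this says that \<open>(\<aa> + xR) P\<close> lies in
  \<open>x P + \<aa> P\<close>. Projectivity enters here: divide coordinates in the free module,
  then retract.\<close>

lemma mulid_split:
  fixes P :: "('a, 'm) module"
  assumes pr: "projective_module R P" and A: "A \<subseteq> carrier R" "x \<in> carrier R" and u: "u \<in> mulid (Idl (insert x A)) P"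
  shows "\<exists>c\<in>carrier P. u \<ominus>\<^bsub>P\<^esub> x \<odot>\<^bsub>P\<^esub> c \<in> mulid (Idl A) P"
proof -
  from pr obtain B :: "'m set" and s p where P: "module R P" and s: "s \<in> module_hom R P (free_module R B)"
    and p: "p \<in> module_hom R (free_module R B) P" "\<And>x. x \<in> carrier P \<Longrightarrow> p (s x) = x"
    unfolding projective_module_def by blast
  interpret P: module R P by fact
  let ?F = "free_module R B"
  interpret F: module R ?F by (rule module_free)
  have iA: "ideal (Idl A) R" by (rule genideal_ideal[OF A(1)])
  have uc: "u \<in> carrier P" and ub: "s u b \<in> Idl (insert x A)" for b
    using mulidD[OF u module_hom_comp[OF s free_coord]] u by (simp_all add: mulid_def)
  have su: "s u \<in> carrier ?F" by (rule module_homD(1)[OF s uc])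
  then have suc: "\<And>b. s u b \<in> carrier R" "\<And>b. b \<notin> B \<Longrightarrow> s u b = \<zero>" "finite {b. s u b \<noteq> \<zero>}" by (auto simp: free_carrier)
  have "\<exists>t\<in>carrier R. s u b \<ominus> x \<otimes> t \<in> Idl A" for b
  proof -
    have "fvar (s u b) \<in> adj (pre (Idl A)) (fvar x)" unfolding adj_pre[OF A] using ub suc(1) by (simp add: pre_def)
    then obtain t where "fvar (s u b) - fvar x * t \<in> pre (Idl A)" by (auto simp: adj_def)
    then show ?thesis using suc(1) A(2) by (intro bexI[of _ "\<pi> t"]) (simp_all add: pre_def)
  qed
  then have "\<exists>t. \<forall>b. t b \<in> carrier R \<and> s u b \<ominus> x \<otimes> t b \<in> Idl A" by metis
  then obtain t where t: "\<And>b. t b \<in> carrier R" "\<And>b. s u b \<ominus> x \<otimes> t b \<in> Idl A" by blast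
  \<comment> \<open>Zero coordinates get the quotient zero, which keeps the support finite.\<close>
  define c where "c b = (if s u b = \<zero> then \<zero> else t b)" for b
  have "finite {b. c b \<noteq> \<zero>}" by (rule finite_subset[OF _ suc(3)]) (auto simp: c_def)
  then have c: "c \<in> carrier ?F" using t(1) suc(2) by (simp add: free_carrier c_def)
  have z: "\<zero> \<in> Idl A" by (rule additive_subgroup.zero_closed[OF ideal.axioms(1)[OF iA]])
  let ?g = "\<lambda>b. s u b \<ominus> x \<otimes> c b"
  have gA: "?g b \<in> Idl A" for b
    using t(2)[of b] z A(2) by (cases "s u b = \<zero>") (simp_all add: c_def minus_eq)
  have fin: "finite {b. ?g b \<noteq> \<zero>}"
    by (rule finite_subset[OF _ suc(3)]) (use A(2) in \<open>auto simp: c_def minus_eq\<close>)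
  have cb: "c b \<in> carrier R" for b using c by (auto simp: free_carrier)
  have g: "?g \<in> carrier ?F" using fin suc A(2) cb c by (auto simp: free_carrier minus_eq)
  have xc: "x \<odot>\<^bsub>?F\<^esub> c \<in> carrier ?F" by (rule F.smult_closed[OF A(2) c])
  have "s u = ?g \<oplus>\<^bsub>?F\<^esub> x \<odot>\<^bsub>?F\<^esub> c" using suc(1) A(2) cb by (simp add: fun_eq_iff minus_eq a_assoc l_neg)
  then have e: "u = p ?g \<oplus>\<^bsub>P\<^esub> x \<odot>\<^bsub>P\<^esub> p c"
    using p(2)[OF uc] module_homD(2)[OF p(1) g xc] module_homD(3)[OF p(1) A(2) c] by (simp del: free_simps)
  have "(p ?g \<oplus>\<^bsub>P\<^esub> x \<odot>\<^bsub>P\<^esub> p c) \<ominus>\<^bsub>P\<^esub> x \<odot>\<^bsub>P\<^esub> p c = p ?g"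
    using module_homD(1)[OF p(1) g] module_homD(1)[OF p(1) c] A(2) by (simp add: P.minus_eq P.a_assoc P.r_neg)
  from HOL.trans[OF arg_cong[where f = "\<lambda>t. t \<ominus>\<^bsub>P\<^esub> x \<odot>\<^bsub>P\<^esub> p c", OF e] this]
  have "u \<ominus>\<^bsub>P\<^esub> x \<odot>\<^bsub>P\<^esub> p c = p ?g" .
  moreover have "p ?g \<in> mulid (Idl A) P"
    using free_hom_ideal[OF iA module_hom_comp[OF p(1)] g gA] module_homD(1)[OF p(1) g] by (simp add: mulid_def)
  ultimately show ?thesis using module_homD(1)[OF p(1) c] by (intro bexI[of _ "p c"]) simp_all
qed

text \<open>Reduction by a regular element moves an annihilated class up one degree. If
  \<open>x u = d w\<close> modulo the earlier elements, then \<open>w\<close> is a cycle modulo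
  \<open>x\<close>. It is not a boundary, since \<open>x\<close> could be cancelled and
  \<open>u\<close> would be one; and \<open>J\<close> still annihilates its class. In the end a
  nonzero element sits \<open>length xs\<close> degrees higher.\<close>

lemma regular_sequence_chase:
  assumes c: "is_complex R P" and proj: "\<And>i. projective_module R (cobj P i)"
    and xs: "set xs \<subseteq> J" "set xs \<subseteq> carrier R"
    and reg: "\<And>i a. i < length xs \<Longrightarrow> a \<in> carrier R \<Longrightarrow> xs ! i \<otimes> a \<in> Idl (set (take i xs)) \<Longrightarrow> a \<in> Idl (set (take i xs))"
    and J: "J \<subseteq> carrier R"
    and ex: "\<And>i v. s < i \<Longrightarrow> v \<in> cycles P i \<Longrightarrow> v \<in> boundaries P i"
    and u: "u \<in> cycles P s" "u \<notin> boundaries P s" "\<And>r. r \<in> J \<Longrightarrow> r \<odot>\<^bsub>cobj P s\<^esub> u \<in> boundaries P s"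
  shows "\<not> zero_module (cobj P (s + int (length xs)))"
proof -
  let ?P = "\<lambda>i. cobj P i"
  define d where "d i = cdiff P (i + 1)" for i
  have mod: "\<And>i. module R (?P i)" and d: "\<And>i. d i \<in> module_hom R (?P (i + 1)) (?P i)"
    using c unfolding is_complex_def d_def by (auto, metis add_diff_cancel_right')
  have dd: "d i (d (i + 1) x) = \<zero>\<^bsub>?P i\<^esub>" if "x \<in> carrier (?P (i + 1 + 1))" for i x
    using c that unfolding is_complex_def d_def by (metis add_diff_cancel_right')
  note D = module_homD[OF d]
  define A where "A k = Idl (set (take k xs))" for k
  have sA: "set (take k xs) \<subseteq> carrier R" for k using xs(2) set_take_subset by fastforce
  have iA: "ideal (A k) R" for k unfolding A_def by (rule genideal_ideal[OF sA])
  define L where "L k i = mulid (A k) (?P i)" for k i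
  have sL: "smod (?P i) (L k i)" for i k unfolding L_def by (rule mulid_smod[OF iA mod])
  have Lc: "x \<in> carrier (?P i)" if "x \<in> L k i" for x k i using smodD(1)[OF sL] that by blast
  have dL: "d i x \<in> L k i" if "x \<in> L k (i + 1)" for i k x using that unfolding L_def by (rule mulid_hom[OF d])
  \<comment> \<open>Boundaries of the complex reduced by the first \<open>k\<close> elements, as a
    subset of the unreduced term.\<close>
  define S where "S k i = {v \<in> carrier (?P i). \<exists>w\<in>carrier (?P (i + 1)). v \<ominus>\<^bsub>?P i\<^esub> d i w \<in> L k i}" for k i
  \<comment> \<open>Exactness of the reduced complex above degree \<open>s + k\<close>; it is what
    shows that \<open>J\<close> annihilates the next class.\<close>
  define E where "E k \<longleftrightarrow> (\<forall>i v. s + int k \<le> i \<longrightarrow> v \<in> carrier (?P (i + 1)) \<longrightarrow> d i v \<in> L k i \<longrightarrow> v \<in> S k (i + 1))" for k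
  define U where "U k \<longleftrightarrow> (\<exists>u\<in>carrier (?P (s + int k)). u \<notin> S k (s + int k) \<and> (\<forall>r\<in>J. r \<odot>\<^bsub>?P (s + int k)\<^esub> u \<in> S k (s + int k)))" for k
  have "E k \<and> U k" if "k \<le> length xs" for k
    using that
  proof (induction k)
    case 0
    have "A 0 = {\<zero>}" by (simp add: A_def Idl_empty)
    then have L0: "L 0 i = {\<zero>\<^bsub>?P i\<^esub>}" for i unfolding L_def using mulid_zero[OF proj] by simp
    have S0: "S 0 i = boundaries P i" for i
    proof -
      interpret Pi: module R "?P i" by (rule mod)
      have "v \<ominus>\<^bsub>?P i\<^esub> d i w \<in> L 0 i \<longleftrightarrow> v = d i w" if "v \<in> carrier (?P i)" "w \<in> carrier (?P (i + 1))" for v w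
      proof
        assume "v \<ominus>\<^bsub>?P i\<^esub> d i w \<in> L 0 i"
        then have "v \<oplus>\<^bsub>?P i\<^esub> \<ominus>\<^bsub>?P i\<^esub> d i w = \<zero>\<^bsub>?P i\<^esub>" by (simp add: L0 Pi.minus_eq)
        from Pi.minus_equality[OF this] show "v = d i w" using that D(1) by simp
      next
        assume "v = d i w"
        then show "v \<ominus>\<^bsub>?P i\<^esub> d i w \<in> L 0 i" using D(1)[OF that(2)] by (simp add: L0 Pi.minus_eq Pi.r_neg)
      qed
      then show ?thesis unfolding S_def boundaries_def d_def[symmetric] using D(1) by blast
    qed
    have "E 0"
      unfolding E_def
    proof (intro allI impI)
      fix i v assume i: "s + int 0 \<le> i" and v: "v \<in> carrier (?P (i + 1))" "d i v \<in> L 0 i"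
      have "v \<in> cycles P (i + 1)" using v by (simp add: cycles_def L0 d_def)
      then show "v \<in> S 0 (i + 1)" unfolding S0 using i by (intro ex) simp_all
    qed
    moreover have "U 0" unfolding U_def S0 using u by (intro bexI[of _ u]) (auto simp: cycles_def)
    ultimately show ?case ..
  next
    case (Suc k)
    then have k: "k < length xs" and E: "E k" and "U k" by simp_all
    define x where "x = xs ! k"
    define j where "j = s + int k"
    have sj: "s + int (Suc k) = j + 1" by (simp add: j_def)
    have xJ: "x \<in> J" and x: "x \<in> carrier R" using nth_mem[OF k] xs by (auto simp: x_def)
    have Ak: "A (Suc k) = Idl (insert x (set (take k xs)))" using k by (simp add: A_def x_def take_Suc_conv_app_nth)
    have xA: "x \<in> A (Suc k)" using genideal_self[OF sA[of "Suc k"]] k by (auto simp: A_def x_def take_Suc_conv_app_nth)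
    have "A k \<subseteq> A (Suc k)"
    proof -
      have "set (take k xs) \<subseteq> A (Suc k)" using genideal_self[OF sA[of "Suc k"]] k by (auto simp: A_def take_Suc_conv_app_nth)
      then show ?thesis unfolding A_def[of k] by (rule genideal_minimal[OF iA])
    qed
    then have LL: "L k i \<subseteq> L (Suc k) i" for i unfolding L_def by (rule mulid_mono)
    have xL: "x \<odot>\<^bsub>?P i\<^esub> v \<in> L (Suc k) i" if "v \<in> carrier (?P i)" for i v
      unfolding L_def by (rule mulid_smult[OF iA mod xA that])
    have rL: "v \<in> L k i" if "v \<in> carrier (?P i)" "x \<odot>\<^bsub>?P i\<^esub> v \<in> L k i" for i v
      using that(2) unfolding L_def by (rule mulid_regular[OF mod x that(1)]) (use reg[OF k] in \<open>simp add: A_def x_def\<close>)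
    have split: "\<exists>b\<in>carrier (?P i). v \<ominus>\<^bsub>?P i\<^esub> x \<odot>\<^bsub>?P i\<^esub> b \<in> L k i" if "v \<in> L (Suc k) i" for i v
      using mulid_split[OF proj[of i] sA[of k] x, of v] that unfolding L_def Ak unfolding A_def by blast
    have xc: "x \<odot>\<^bsub>?P i\<^esub> v \<in> carrier (?P i)" if "v \<in> carrier (?P i)" for i v by (rule module.smult_closed[OF mod x that])
    have mc: "v \<ominus>\<^bsub>?P i\<^esub> w \<in> carrier (?P i)" if "v \<in> carrier (?P i)" "w \<in> carrier (?P i)" for i v w
      by (rule module_minus_closed[OF mod that])
    have dm: "d i (v \<ominus>\<^bsub>?P (i + 1)\<^esub> w) = d i v \<ominus>\<^bsub>?P i\<^esub> d i w" if "v \<in> carrier (?P (i + 1))" "w \<in> carrier (?P (i + 1))" for i v w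
      by (rule module_hom_minus[OF mod mod d that])
    have z: "\<zero>\<^bsub>?P i\<^esub> \<in> carrier (?P i)" "\<zero>\<^bsub>?P i\<^esub> \<in> L k i" for i k using smodD(2)[OF sL] Lc by blast+
    have lift: "v \<in> S (Suc k) i" if v: "v \<in> carrier (?P i)" and c: "c \<in> carrier (?P i)" and vS: "v \<ominus>\<^bsub>?P i\<^esub> x \<odot>\<^bsub>?P i\<^esub> c \<in> S k i" for i v c
    proof -
      interpret Pi: module R "?P i" by (rule mod)
      from vS obtain w where w: "w \<in> carrier (?P (i + 1))" "(v \<ominus>\<^bsub>?P i\<^esub> x \<odot>\<^bsub>?P i\<^esub> c) \<ominus>\<^bsub>?P i\<^esub> d i w \<in> L k i" unfolding S_def by blast
      note dw = D(1)[OF w(1)]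
      have "(v \<ominus>\<^bsub>?P i\<^esub> x \<odot>\<^bsub>?P i\<^esub> c) \<ominus>\<^bsub>?P i\<^esub> d i w = (v \<ominus>\<^bsub>?P i\<^esub> d i w) \<ominus>\<^bsub>?P i\<^esub> x \<odot>\<^bsub>?P i\<^esub> c"
        using v xc[OF c] dw by (simp add: Pi.minus_eq Pi.a_ac)
      then have "(v \<ominus>\<^bsub>?P i\<^esub> d i w) \<ominus>\<^bsub>?P i\<^esub> x \<odot>\<^bsub>?P i\<^esub> c \<in> L (Suc k) i" using w(2) LL by auto
      then have "v \<ominus>\<^bsub>?P i\<^esub> d i w \<in> L (Suc k) i" using smod_minus_iff[OF mod sL mc[OF v dw] xc[OF c]] xL[OF c] by blast
      then show ?thesis unfolding S_def using v w(1) by blast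
    qed
    \<comment> \<open>If \<open>d v\<close> is \<open>x b\<close> up to the earlier elements, then
      \<open>x\<close> times \<open>d b\<close> vanishes and so does \<open>d b\<close>. Exactness
      makes \<open>b\<close> a boundary \<open>d w\<close>, and \<open>v - x w\<close> is a cycle
      for the previous reduction.\<close>
    have "E (Suc k)"
      unfolding E_def
    proof (intro allI impI)
      fix i v assume i: "s + int (Suc k) \<le> i" and v: "v \<in> carrier (?P (i + 1))" "d i v \<in> L (Suc k) i"
      from split[OF v(2)] obtain b where b: "b \<in> carrier (?P i)" "d i v \<ominus>\<^bsub>?P i\<^esub> x \<odot>\<^bsub>?P i\<^esub> b \<in> L k i" by blast
      define i' where "i' = i - 1"
      have ii: "i = i' + 1" by (simp add: i'_def)
      note b' = b[unfolded ii] and v' = v[unfolded ii]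
      have "d i' (d (i' + 1) v \<ominus>\<^bsub>?P (i' + 1)\<^esub> x \<odot>\<^bsub>?P (i' + 1)\<^esub> b) \<in> L k i'" by (rule dL[OF b'(2)])
      then have "\<zero>\<^bsub>?P i'\<^esub> \<ominus>\<^bsub>?P i'\<^esub> x \<odot>\<^bsub>?P i'\<^esub> d i' b \<in> L k i'"
        using dm[OF D(1)[OF v'(1)] xc[OF b'(1)]] D(3)[OF x b'(1)] dd[OF v'(1)] by simp
      then have "x \<odot>\<^bsub>?P i'\<^esub> d i' b \<in> L k i'"
        using smod_minus_iff[OF mod sL z(1) xc[OF D(1)[OF b'(1)]]] z(2) by blast
      then have "d i' b \<in> L k i'" by (rule rL[OF D(1)[OF b'(1)]])
      then have "b \<in> S k (i' + 1)" using E i b'(1) unfolding E_def ii by simp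
      then obtain w where w: "w \<in> carrier (?P (i + 1))" "b \<ominus>\<^bsub>?P i\<^esub> d i w \<in> L k i" unfolding S_def ii by blast
      note dw = D(1)[OF w(1)]
      have "x \<odot>\<^bsub>?P i\<^esub> b \<ominus>\<^bsub>?P i\<^esub> x \<odot>\<^bsub>?P i\<^esub> d i w \<in> L k i"
        using smodD(4)[OF sL x w(2)] module_smult_minus[OF mod x b(1) dw] by simp
      from smod_minus_trans[OF mod sL D(1)[OF v(1)] xc[OF b(1)] xc[OF dw] b(2) this]
      have "d i (v \<ominus>\<^bsub>?P (i + 1)\<^esub> x \<odot>\<^bsub>?P (i + 1)\<^esub> w) \<in> L k i" using dm[OF v(1) xc[OF w(1)]] D(3)[OF x w(1)] by simp
      then have "v \<ominus>\<^bsub>?P (i + 1)\<^esub> x \<odot>\<^bsub>?P (i + 1)\<^esub> w \<in> S k (i + 1)"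
        using E mc[OF v(1) xc[OF w(1)]] i unfolding E_def by simp
      then show "v \<in> S (Suc k) (i + 1)" by (rule lift[OF v(1) w(1)])
    qed
    moreover have "U (Suc k)"
    proof -
      from \<open>U k\<close> obtain u where u: "u \<in> carrier (?P j)" "u \<notin> S k j" "\<And>r. r \<in> J \<Longrightarrow> r \<odot>\<^bsub>?P j\<^esub> u \<in> S k j"
        unfolding U_def j_def by blast
      from u(3)[OF xJ] obtain w where w: "w \<in> carrier (?P (j + 1))" "x \<odot>\<^bsub>?P j\<^esub> u \<ominus>\<^bsub>?P j\<^esub> d j w \<in> L k j"
        unfolding S_def by blast
      note dw = D(1)[OF w(1)]
      have wS: "w \<notin> S (Suc k) (j + 1)"
      proof
        assume "w \<in> S (Suc k) (j + 1)"
        then obtain y where y: "y \<in> carrier (?P (j + 1 + 1))" "w \<ominus>\<^bsub>?P (j + 1)\<^esub> d (j + 1) y \<in> L (Suc k) (j + 1)"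
          unfolding S_def by blast
        note dy = D(1)[OF y(1)]
        from split[OF y(2)] obtain b where b: "b \<in> carrier (?P (j + 1))"
          "(w \<ominus>\<^bsub>?P (j + 1)\<^esub> d (j + 1) y) \<ominus>\<^bsub>?P (j + 1)\<^esub> x \<odot>\<^bsub>?P (j + 1)\<^esub> b \<in> L k (j + 1)" by blast
        interpret Pj: module R "?P j" by (rule mod)
        note db = D(1)[OF b(1)]
        have "(d j w \<ominus>\<^bsub>?P j\<^esub> d j (d (j + 1) y)) \<ominus>\<^bsub>?P j\<^esub> x \<odot>\<^bsub>?P j\<^esub> d j b \<in> L k j"
          using dL[OF b(2)] by (simp only: dm[OF mc[OF w(1) dy] xc[OF b(1)]] dm[OF w(1) dy] D(3)[OF x b(1)])
        then have "d j w \<ominus>\<^bsub>?P j\<^esub> x \<odot>\<^bsub>?P j\<^esub> d j b \<in> L k j" using dw by (simp add: dd[OF y(1)] Pj.minus_eq module_minus_zero[OF mod])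
        from smod_minus_trans[OF mod sL xc[OF u(1)] dw xc[OF db] w(2) this]
        have "x \<odot>\<^bsub>?P j\<^esub> (u \<ominus>\<^bsub>?P j\<^esub> d j b) \<in> L k j" by (simp add: module_smult_minus[OF mod x u(1) db])
        then have "u \<ominus>\<^bsub>?P j\<^esub> d j b \<in> L k j" by (rule rL[OF mc[OF u(1) db]])
        then show False using u(1,2) b(1) unfolding S_def by blast
      qed
      have "r \<odot>\<^bsub>?P (j + 1)\<^esub> w \<in> S (Suc k) (j + 1)" if "r \<in> J" for r
      proof -
        have r: "r \<in> carrier R" using that J by blast
        \<comment> \<open>Both \<open>r w\<close> and \<open>x y\<close> have differential
          \<open>x r u\<close> modulo the earlier elements, so exactness applies to their
          difference.\<close>
        from u(3)[OF that] obtain y where y: "y \<in> carrier (?P (j + 1))" "r \<odot>\<^bsub>?P j\<^esub> u \<ominus>\<^bsub>?P j\<^esub> d j y \<in> L k j"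
          unfolding S_def by blast
        interpret Pj: module R "?P j" by (rule mod)
        interpret Pj1: module R "?P (j + 1)" by (rule mod)
        note dy = D(1)[OF y(1)]
        have rw: "r \<odot>\<^bsub>?P (j + 1)\<^esub> w \<in> carrier (?P (j + 1))" using r w(1) by simp
        have e: "r \<odot>\<^bsub>?P j\<^esub> (x \<odot>\<^bsub>?P j\<^esub> u) = x \<odot>\<^bsub>?P j\<^esub> (r \<odot>\<^bsub>?P j\<^esub> u)"
          using r x u(1) by (simp add: Pj.smult_assoc1[symmetric] m_comm)
        have 1: "x \<odot>\<^bsub>?P j\<^esub> (r \<odot>\<^bsub>?P j\<^esub> u) \<ominus>\<^bsub>?P j\<^esub> r \<odot>\<^bsub>?P j\<^esub> d j w \<in> L k j"
          using smodD(4)[OF sL r w(2)] module_smult_minus[OF mod r xc[OF u(1)] dw] by (simp add: e)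
        have 2: "x \<odot>\<^bsub>?P j\<^esub> (r \<odot>\<^bsub>?P j\<^esub> u) \<ominus>\<^bsub>?P j\<^esub> x \<odot>\<^bsub>?P j\<^esub> d j y \<in> L k j"
          using smodD(4)[OF sL x y(2)] module_smult_minus[OF mod x _ dy] r u(1) by simp
        have cc: "x \<odot>\<^bsub>?P j\<^esub> (r \<odot>\<^bsub>?P j\<^esub> u) \<in> carrier (?P j)" "r \<odot>\<^bsub>?P j\<^esub> d j w \<in> carrier (?P j)" using r x u(1) dw by simp_all
        from smod_minus_trans[OF mod sL cc(2,1) xc[OF dy] smod_minus_sym[OF mod sL cc 1] 2]
        have "d j (r \<odot>\<^bsub>?P (j + 1)\<^esub> w \<ominus>\<^bsub>?P (j + 1)\<^esub> x \<odot>\<^bsub>?P (j + 1)\<^esub> y) \<in> L k j"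
          by (simp add: dm[OF rw xc[OF y(1)]] D(3)[OF x y(1)] D(3)[OF r w(1)])
        then have "r \<odot>\<^bsub>?P (j + 1)\<^esub> w \<ominus>\<^bsub>?P (j + 1)\<^esub> x \<odot>\<^bsub>?P (j + 1)\<^esub> y \<in> S k (j + 1)"
          using E mc[OF rw xc[OF y(1)]] unfolding E_def j_def by simp
        then show ?thesis by (rule lift[OF rw y(1)])
      qed
      then show ?thesis unfolding U_def sj using w(1) wS by blast
    qed
    ultimately show ?case ..
  qed
  then obtain w where w: "w \<in> carrier (?P (s + int (length xs)))" "w \<notin> S (length xs) (s + int (length xs))"
    unfolding U_def by blast
  let ?j = "s + int (length xs)"
  interpret Pj: module R "?P ?j" by (rule mod)
  interpret Pj1: module R "?P (?j + 1)" by (rule mod)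
  have "\<zero>\<^bsub>?P ?j\<^esub> \<ominus>\<^bsub>?P ?j\<^esub> d ?j \<zero>\<^bsub>?P (?j + 1)\<^esub> = \<zero>\<^bsub>?P ?j\<^esub>"
    using module_hom_zero[OF mod mod d] by (simp add: Pj.minus_eq)
  then have "\<zero>\<^bsub>?P ?j\<^esub> \<in> S (length xs) ?j" unfolding S_def using smodD(2)[OF sL] by (auto intro!: bexI[of _ "\<zero>\<^bsub>?P (?j + 1)\<^esub>"])
  then show ?thesis using w unfolding zero_module_def by auto
qed


section \<open>Linked ideals\<close>

lemma homology_smod:
  assumes c: "is_complex R P"
  shows "module R (sub_module (cobj P i) (cycles P i))" "smod (sub_module (cobj P i) (cycles P i)) (boundaries P i)"
proof -
  have mod: "\<And>i. module R (cobj P i)" and h: "\<And>i. cdiff P i \<in> module_hom R (cobj P i) (cobj P (i - 1))"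
    using c by (simp_all add: is_complex_def)
  have h': "cdiff P (i + 1) \<in> module_hom R (cobj P (i + 1)) (cobj P i)" using h[of "i + 1"] by simp
  have "smod (cobj P i) (cycles P i)" unfolding cycles_def by (rule smod_ker[OF mod mod h])
  then show "module R (sub_module (cobj P i) (cycles P i))" by (rule module_sub[OF mod])
  have dd: "cdiff P i (cdiff P (i + 1) x) = \<zero>\<^bsub>cobj P (i - 1)\<^esub>" if "x \<in> carrier (cobj P (i + 1))" for x
    using c that unfolding is_complex_def by (metis add_diff_cancel_right')
  have "boundaries P i \<subseteq> cycles P i"
    unfolding boundaries_def cycles_def using dd module_homD(1)[OF h'] by auto
  moreover have "smod (cobj P i) (boundaries P i)" unfolding boundaries_def by (rule smod_image[OF mod mod h'])
  ultimately show "smod (sub_module (cobj P i) (cycles P i)) (boundaries P i)" by (simp add: smod_def)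
qed

lemma zero_homology:
  assumes c: "is_complex R P"
  shows "zero_module (homology P i) \<longleftrightarrow> cycles P i \<subseteq> boundaries P i"
proof -
  let ?M = "sub_module (cobj P i) (cycles P i)" and ?N = "boundaries P i"
  note H = homology_smod[OF c, of i]
  interpret M: module R ?M by (rule H(1))
  note q = quot[OF H]
  have z: "\<zero>\<^bsub>?M\<^esub> \<in> carrier ?M" by (rule M.zero_closed)
  have "?N +>\<^bsub>?M\<^esub> v = ?N \<longleftrightarrow> v \<in> ?N" if v: "v \<in> carrier ?M" for v
    using q(6)[OF v z] v unfolding q(5) by (simp add: M.minus_eq module_minus_zero[OF H(1)] del: sub_module_simps)
  moreover have "?N \<in> (\<lambda>x. ?N +>\<^bsub>?M\<^esub> x) ` carrier ?M" using q(5) z by (metis image_eqI)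
  ultimately show ?thesis unfolding zero_module_def homology_def q(1,4) by auto
qed

lemma zero_object_homology:
  assumes c: "is_complex R P" and z: "zero_module (cobj P i)" shows "zero_module (homology P i)"
proof -
  note H = homology_smod[OF c, of i]
  have "cycles P i \<subseteq> {\<zero>\<^bsub>cobj P i\<^esub>}" using z by (auto simp: cycles_def zero_module_def)
  moreover have "\<zero>\<^bsub>cobj P i\<^esub> \<in> boundaries P i" using smodD(2)[OF H(2)] by simp
  ultimately show ?thesis using zero_homology[OF c] by blast
qed

text \<open>As \<open>J\<close> is proper, the quotient is nonzero, and a power with positive
  exponent has two different elements.\<close>

lemma zero_power:
  assumes c: "is_complex R P" and J: "ideal J R" "\<one> \<notin> J"
    and iso: "isomorphic_modules R (homology P i) (power_module (quotient_module (ring_as_module R) J) a)"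
  shows "zero_module (homology P i) \<longleftrightarrow> a = 0"
proof -
  note H = homology_smod[OF c, of i] and q = quot[OF homology_smod[OF c, of i]]
  let ?Q = "quotient_module (ring_as_module R) J"
  interpret M: module R "sub_module (cobj P i) (cycles P i)" by (rule H(1))
  have z: "\<zero>\<^bsub>homology P i\<^esub> \<in> carrier (homology P i)" unfolding homology_def q(4) q(1)
    using q(5) M.zero_closed by (metis image_eqI)
  from iso obtain f where f: "bij_betw f (carrier (homology P i)) (carrier (power_module ?Q a))"
    by (auto simp: isomorphic_modules_def module_iso_def)
  have car: "carrier (power_module ?Q a) = {..<a} \<rightarrow>\<^sub>E carrier ?Q" by simp
  show ?thesis
  proof
    assume "zero_module (homology P i)"
    then have "carrier (homology P i) = {\<zero>\<^bsub>homology P i\<^esub>}" by (simp add: zero_module_def)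
    then have eq: "carrier (power_module ?Q a) = {f \<zero>\<^bsub>homology P i\<^esub>}" using f unfolding bij_betw_def by (metis image_empty image_insert)
    then have one: "x = y" if "x \<in> carrier (power_module ?Q a)" "y \<in> carrier (power_module ?Q a)" for x y
      using that unfolding eq by simp
    show "a = 0"
    proof (rule ccontr)
      assume "a \<noteq> 0"
      have "(\<lambda>i\<in>{..<a}. cosI J (\<pi> s)) \<in> carrier (power_module ?Q a)" for s
        unfolding car using quotI_ops(1)[OF J(1)] by auto
      then have "(\<lambda>i\<in>{..<a}. cosI J (\<pi> 1)) = (\<lambda>i\<in>{..<a}. cosI J (\<pi> 0))" by (intro one)
      from fun_cong[OF this, of 0] have "cosI J (\<pi> 1) = cosI J (\<pi> 0)" using \<open>a \<noteq> 0\<close> by simp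
      then have "1 - 0 \<in> pre J" using cosI_eq[OF J(1)] by blast
      then show False using J(2) by (simp add: pre_def)
    qed
  next
    assume "a = 0"
    have eq: "carrier (power_module ?Q a) = {\<lambda>_. undefined}" unfolding car \<open>a = 0\<close> by simp
    have "x = y" if xy: "x \<in> carrier (homology P i)" "y \<in> carrier (homology P i)" for x y
    proof (rule inj_onD[OF bij_betw_imp_inj_on[OF f] _ xy])
      show "f x = f y" using bij_betw_apply[OF f xy(1)] bij_betw_apply[OF f xy(2)] unfolding eq by simp
    qed
    then show "zero_module (homology P i)" using z unfolding zero_module_def by blast
  qed
qed

text \<open>The highest nonzero homology is a nonzero power of the quotient by \<open>J\<close>; the
  class of a unit vector is nonzero and annihilated by \<open>J\<close>, so it can be chased
  upwards.\<close>

lemma regular_sequence_le_qpd: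
  assumes q: "finite_quasi_projective_resolution R (quotient_module (ring_as_module R) J) P"
    and J: "ideal J R" "\<one> \<notin> J" and xs: "regular_sequence R xs" "set xs \<subseteq> J"
  shows "ereal (real (length xs)) \<le> complex_sup P - complex_hsup P"
proof -
  let ?Q = "quotient_module (ring_as_module R) J"
  have c: "is_complex R P" and proj: "\<And>i. projective_module R (cobj P i)"
    using q by (auto simp: finite_quasi_projective_resolution_def quasi_projective_resolution_def)
  from q obtain b where b: "\<And>i. b < i \<Longrightarrow> zero_module (cobj P i)"
    unfolding finite_quasi_projective_resolution_def bounded_above_def by blast
  from q obtain a :: "int \<Rightarrow> nat" where a0: "\<exists>i. complex_inf P \<le> ereal (real_of_int i) \<and> a i \<noteq> 0"
    and a: "\<And>i. complex_inf P \<le> ereal (real_of_int i) \<Longrightarrow> isomorphic_modules R (homology P i) (power_module ?Q (a i))"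
    unfolding finite_quasi_projective_resolution_def quasi_projective_resolution_def by blast
  from a0 obtain i0 where i0: "complex_inf P \<le> ereal (real_of_int i0)" "a i0 \<noteq> 0" by (elim exE conjE)
  have "\<not> zero_module (homology P i0)" using zero_power[OF c J a[OF i0(1)]] i0(2) by simp
  \<comment> \<open>Boundedness above turns the highest degree with nonzero homology into a minimum
    over natural numbers.\<close>
  from ex_has_least_nat[of "\<lambda>i. \<not> zero_module (homology P i)", OF this, of "\<lambda>i. nat (b - i)"]
  obtain s where s: "\<not> zero_module (homology P s)"
    and smin: "\<And>i. \<not> zero_module (homology P i) \<Longrightarrow> nat (b - s) \<le> nat (b - i)" by blast
  have le_b: "i \<le> b" if "\<not> zero_module (homology P i)" for i
    using that zero_object_homology[OF c b] by (meson not_le)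
  have smax: "i \<le> s" if "\<not> zero_module (homology P i)" for i using smin[OF that] le_b[OF that] le_b[OF s] by simp
  have "\<not> zero_module (cobj P s)" using zero_object_homology[OF c] s by blast
  then have "complex_inf P \<le> ereal (real_of_int s)" unfolding complex_inf_def by (intro INF_lower) simp
  note iso = a[OF this]
  have as: "a s \<noteq> 0" using zero_power[OF c J iso] s by blast
  note H = homology_smod[OF c, of s]
  from iso_fbas[OF H J(1) iso[unfolded homology_def]] obtain \<phi> where
    "fbas (sub_module (cobj P s) (cycles P s)) (boundaries P s) J {..<a s} \<phi>" ..
  then have \<phi>: "slin (sub_module (cobj P s) (cycles P s)) \<phi>"
    "\<And>v. v \<in> Fr {..<a s} \<Longrightarrow> \<phi> v \<in> boundaries P s \<longleftrightarrow> v \<in> hat (pre J)" unfolding fbas_def by blast+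
  note S = slinD[OF \<phi>(1)]
  have u0: "un 0 \<in> Fr {..<a s}" using as by simp
  have nz: "\<not> zero_module (cobj P (s + int (length xs)))"
  proof (rule regular_sequence_chase[OF c proj xs(2)])
    show "set xs \<subseteq> carrier R" using xs(1) by (simp add: regular_sequence_def)
    show "r \<in> Idl (set (take i xs))" if "i < length xs" "r \<in> carrier R" "xs ! i \<otimes> r \<in> Idl (set (take i xs))" for i r
      using xs(1) that unfolding regular_sequence_def by blast
    show "J \<subseteq> carrier R" using ideal.Icarr[OF J(1)] by blast
    show "v \<in> boundaries P i" if "s < i" "v \<in> cycles P i" for i v
      using smax[of i] zero_homology[OF c, of i] that by auto
    show "\<phi> (un 0) \<in> cycles P s" using S(1)[of "un 0"] by simp
    show "\<phi> (un 0) \<notin> boundaries P s"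
    proof
      assume "\<phi> (un 0) \<in> boundaries P s"
      then have "(un 0 :: nat \<Rightarrow> 'a frng) \<in> hat (pre J)" using \<phi>(2)[OF u0] by blast
      then have "(un (0 :: nat) 0 :: 'a frng) \<in> pre J" unfolding hat_def by blast
      then show False using J(2) by (simp add: un_def pre_def)
    qed
    show "r \<odot>\<^bsub>cobj P s\<^esub> \<phi> (un 0) \<in> boundaries P s" if r: "r \<in> J" for r
    proof -
      have rc: "r \<in> carrier R" by (rule ideal.Icarr[OF J(1) r])
      have "fvar r *s un 0 \<in> hat (pre J)" by (rule hat_sc[OF idl_pre[OF J(1)]]) (simp add: pre_def r rc)
      then have "\<phi> (fvar r *s un 0) \<in> boundaries P s" using \<phi>(2)[OF sub_sc[OF sub_Fr u0]] by blast
      then show ?thesis using S(3)[of "fvar r" "un 0"] rc by simp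
    qed
  qed
  have "ereal (real_of_int (s + int (length xs))) \<le> complex_sup P"
    unfolding complex_sup_def by (rule SUP_upper) (use nz in simp)
  moreover have "complex_hsup P \<le> ereal (real_of_int s)"
    unfolding complex_hsup_def by (rule SUP_least) (use smax in simp)
  ultimately have "ereal (real_of_int (s + int (length xs))) - ereal (real_of_int s) \<le> complex_sup P - complex_hsup P"
    by (rule ereal_minus_mono)
  then show ?thesis by simp
qed

text \<open>The estimate rests on two one-sided facts: the complex is zero above degree
  \<open>N + n\<close>, and its homology in degree \<open>N\<close> is nonzero. Neither supremum has
  to be computed.\<close>

lemma finite_resolution_of_hb:
  fixes B' C' :: "int \<Rightarrow> nat set" and \<iota> :: "nat \<Rightarrow> 'x"
  assumes i: "inj \<iota>" and one: "\<one> \<noteq> \<zero>" and J: "ideal J R" "\<one> \<notin> J" and c: "cpx \<kk> B d"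
    and h: "\<And>j. hb \<kk> (pre J) B d (C j) (\<zeta> j) j" and B: "\<And>j. j < 0 \<or> N + int n < j \<Longrightarrow> B j = {}" and C: "C N \<noteq> {}"
  shows "finite_quasi_projective_resolution R (quotient_module (ring_as_module R) J) (cx \<iota> B d)"
    "complex_sup (cx \<iota> B d) - complex_hsup (cx \<iota> B d) \<le> ereal (real n)"
proof -
  let ?Q = "cx \<iota> B d"
  note X = cx_complex[OF i c]
  have iso: "isomorphic_modules R (homology ?Q j) (power_module (quotient_module (ring_as_module R) J) (card (C j)))" for j
  proof -
    note H = homology_smod[OF X(1), of j, unfolded X(2,3) cx_simps]
    from fbas_of_hb[OF i c J(1) h] obtain \<phi> where
      "fbas (sub_module (free_module R (\<iota> ` B j)) (emb \<iota> ` Zc \<kk> B d j)) (emb \<iota> ` Bc \<kk> B d j) J {..<card (C j)} \<phi>" ..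
    from fbas_iso[OF H J(1) this] show ?thesis unfolding homology_def X(2,3) cx_simps .
  qed
  have cN: "card (C N) \<noteq> 0" using C hbD(1)[OF h] by simp
  have HN: "\<not> zero_module (homology ?Q N)" using zero_power[OF X(1) J iso] cN by simp
  then have QN: "\<not> zero_module (cobj ?Q N)" using zero_object_homology[OF X(1)] by blast
  have z: "zero_module (cobj ?Q j)" if "j < 0 \<or> N + int n < j" for j
    using B[OF that] by (auto simp: zero_module_def free_carrier)
  have inf: "complex_inf ?Q \<le> ereal (real_of_int N)"
    unfolding complex_inf_def by (rule INF_lower) (use QN in simp)
  show "finite_quasi_projective_resolution R (quotient_module (ring_as_module R) J) ?Q"
    unfolding finite_quasi_projective_resolution_def quasi_projective_resolution_def
  proof (intro conjI allI)
    show "is_complex R ?Q" by (rule X(1))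
    show "projective_module R (cobj ?Q j)" for j by (simp add: projective_free[OF one])
    show "bounded_below ?Q" unfolding bounded_below_def using z by blast
    show "bounded_above ?Q" unfolding bounded_above_def using z by blast
    show "\<exists>a :: int \<Rightarrow> nat. (\<exists>i. complex_inf ?Q \<le> ereal (real_of_int i) \<and> a i \<noteq> 0) \<and>
      (\<forall>i. complex_inf ?Q \<le> ereal (real_of_int i) \<longrightarrow>
        isomorphic_modules R (homology ?Q i) (power_module (quotient_module (ring_as_module R) J) (a i)))"
      using inf cN iso by (intro exI[of _ "\<lambda>j. card (C j)"]) blast
  qed
  have "complex_sup ?Q \<le> ereal (real_of_int (N + int n))"
    unfolding complex_sup_def
  proof (rule SUP_least)
    fix j assume "j \<in> {i. \<not> zero_module (cobj ?Q i)}"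
    then have "j \<le> N + int n" using z[of j] by (meson mem_Collect_eq not_le)
    then have "real_of_int j \<le> real_of_int (N + int n)" by (simp only: of_int_le_iff)
    then show "ereal (real_of_int j) \<le> ereal (real_of_int (N + int n))" by simp
  qed
  moreover have "ereal (real_of_int N) \<le> complex_hsup ?Q"
    unfolding complex_hsup_def by (rule SUP_upper) (use HN in simp)
  ultimately have "complex_sup ?Q - complex_hsup ?Q \<le> ereal (real_of_int (N + int n)) - ereal (real_of_int N)"
    by (rule ereal_minus_mono)
  then show "complex_sup ?Q - complex_hsup ?Q \<le> ereal (real n)" by simp
qed

lemma pre_colon:
  assumes I: "I \<subseteq> carrier R" and J: "colon_ideal R K I = J" shows "pre J = {r. \<forall>s\<in>pre I. r * s \<in> pre K}"
proof -
  have "(\<forall>a\<in>I. \<pi> r \<otimes> a \<in> K) \<longleftrightarrow> (\<forall>s\<in>pre I. r * s \<in> pre K)" for r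
  proof
    assume *: "\<forall>s\<in>pre I. r * s \<in> pre K"
    show "\<forall>a\<in>I. \<pi> r \<otimes> a \<in> K"
    proof
      fix a assume a: "a \<in> I"
      then have ac: "a \<in> carrier R" using I by blast
      then have "fvar a \<in> pre I" using a by (simp add: pre_def)
      then have "r * fvar a \<in> pre K" using * by blast
      then show "\<pi> r \<otimes> a \<in> K" using ac by (simp add: pre_def)
    qed
  qed (simp add: pre_def)
  then show ?thesis unfolding J[symmetric] colon_ideal_def by (auto simp: pre_def)
qed

theorem linked_FKH_quasi_perfect:
  assumes noeth: "noetherian_ring R" and one: "\<one> \<noteq> \<zero>" and I: "FKH_ideal R I"
    and G: "G_dimension R (sub_module (ring_as_module R) I) < \<infinity>"
    and J: "proper_ideal R J" and L: "linked R I J"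
  shows "quasi_perfect TYPE('x :: infinite) R J"
proof -
  from I obtain ys where ys: "set ys \<subseteq> carrier R" "Idl (set ys) = I"
    and kz: "quasi_projective_resolution R (quotient_module (ring_as_module R) I) (koszul_complex R ys)"
    and pI: "ideal I R" "I \<noteq> carrier R" unfolding FKH_ideal_def proper_ideal_def by blast
  have pJ: "ideal J R" "J \<noteq> carrier R" using J by (simp_all add: proper_ideal_def)
  have 1: "\<one> \<notin> I" "\<one> \<notin> J" using ideal.one_imp_carrier[OF pI(1)] ideal.one_imp_carrier[OF pJ(1)] pI(2) pJ(2) by (simp_all, metis, metis)
  from L obtain xs where xs: "regular_sequence R xs" "set xs \<subseteq> I" "set xs \<subseteq> J"
    "colon_ideal R (Idl (set xs)) I = J" "colon_ideal R (Idl (set xs)) J = I" unfolding linked_def by blast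
  have xc: "set xs \<subseteq> carrier R" using xs(1) by (simp add: regular_sequence_def)
  have IJc: "I \<subseteq> carrier R" "J \<subseteq> carrier R" using ideal.Icarr[OF pI(1)] ideal.Icarr[OF pJ(1)] by (simp_all add: subsetI)
  have xI: "x \<in> pre I" if "x \<in> set (map fvar xs)" for x
  proof -
    from that obtain a where a: "a \<in> set xs" "x = fvar a" by auto
    have "a \<in> I" "a \<in> carrier R" using a(1) xs(2) xc by blast+
    then show ?thesis by (simp add: a(2) pre_def)
  qed
  have aj: "adjl \<kk> (map fvar xs) = pre (Idl (set xs))" by (rule adjl_pre[OF xc])
  have iX: "ideal (Idl (set xs)) R" by (rule genideal_ideal[OF xc])
  let ?n = "length ys"
  let ?B = "kbas ?n" and ?d = "kdif ?n (\<lambda>s. fvar (ys ! s))"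
  note K = koszul_resolution[OF ys(1) one kz[folded ys(2)], unfolded ys(2)]
  from K(2) obtain C :: "int \<Rightarrow> nat set" and \<zeta> where hb: "\<And>i. hb \<kk> (pre I) ?B ?d (C i) (\<zeta> i) i" by blast
  from G_dimension_good[OF noeth one pI(1) G] obtain k where g: "good \<kk> k (Fr {0}) (hat (pre I))" ..
  have "\<exists>B' d' C' \<zeta>'. cpx \<kk> B' d' \<and> (\<forall>j. hb \<kk> (pre J) B' d' (C' j) (\<zeta>' j) j) \<and>
    (\<forall>j. j < 0 \<or> int ?n + int (length (map fvar xs)) < j \<longrightarrow> B' j = ({} :: nat set)) \<and> C' (int ?n) \<noteq> ({} :: nat set) \<and>
    (\<forall>j. int ?n < j \<longrightarrow> C' j = {})"
  proof (rule linked_resolution[where I = "pre I" and B = ?B and d = ?d and C = C and \<zeta> = \<zeta> and q = "set_encode {..<?n}" and k = k])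
    show "idl \<kk>" by (rule idl_kk)
    show "idl (pre I)" by (rule idl_pre[OF pI(1)])
    show "1 \<notin> pre I" using 1 by (simp add: pre_def)
    show "\<kk> \<subseteq> pre I" by (rule kk_pre[OF pI(1)])
    show "regl \<kk> (map fvar xs)" using regl_pre[OF xc] xs(1) unfolding regular_sequence_def by blast
    show "set (map fvar xs) \<subseteq> pre I" using xI by blast
    show "pre J = {r. \<forall>s\<in>pre I. r * s \<in> adjl \<kk> (map fvar xs)}" unfolding aj by (rule pre_colon[OF IJc(1) xs(4)])
    show "pre I = {r. \<forall>s\<in>pre J. r * s \<in> adjl \<kk> (map fvar xs)}" unfolding aj by (rule pre_colon[OF IJc(2) xs(5)])
    show "cpx \<kk> ?B ?d" by (rule K(1))
    show "hb \<kk> (pre I) ?B ?d (C i) (\<zeta> i) i" for i by (rule hb)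
    show "?B i = {}" if "i < 0 \<or> int ?n < i" for i by (rule kbas_empty[OF that])
    show "?B (int ?n) = {set_encode {..<?n}}" by (rule kbas_top)
    show "0 \<le> int ?n" by simp
    show "\<exists>h. \<forall>i. lin (h i) \<and> (\<forall>v\<in>Fr (?B i). h i v \<in> Fr (?B (i + 1)) \<and>
        ?d (i + 1) (h i v) + h (i - 1) (?d i v) - x *s v \<in> hat \<kk>)" if "x \<in> set (map fvar xs)" for x
    proof (rule koszul_contraction[OF ys(1)])
      show "x \<in> pre (Idl (set ys))" unfolding ys(2) by (rule xI[OF that])
    qed
    show "?d (int ?n) v \<in> hat (adjl \<kk> (map fvar xs)) \<longleftrightarrow> (\<forall>s\<in>pre I. v (set_encode {..<?n}) * s \<in> adjl \<kk> (map fvar xs))"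
      if "v \<in> Fr {set_encode {..<?n}}" for v
      using koszul_top[OF ys(1) idl_pre[OF iX] kk_pre[OF iX] that] unfolding aj ys(2) .
    show "good \<kk> k (Fr {0}) (hat (pre I))" by (rule g)
  qed
  then obtain B' d' C' \<zeta>' where c': "cpx \<kk> B' d'" and hb': "\<And>j. hb \<kk> (pre J) B' d' (C' j) (\<zeta>' j) j"
    and B': "\<And>j. j < 0 \<or> int ?n + int (length xs) < j \<Longrightarrow> B' j = ({} :: nat set)" and C': "C' (int ?n) \<noteq> ({} :: nat set)"
    unfolding length_map by (elim exE conjE) blast
  \<comment> \<open>The infinite universe type has room for the countable index set of the
    constructed complex.\<close>
  obtain \<iota> :: "nat \<Rightarrow> 'x" where i: "inj \<iota>" using infinite_countable_subset[OF infinite_UNIV] by blast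
  let ?M = "quotient_module (ring_as_module R) J"
  note Q = finite_resolution_of_hb[OF i one pJ(1) 1(2) c' hb' B' C']
  have nz: "\<not> zero_module ?M"
  proof
    assume "zero_module ?M"
    then have "cosI J (\<pi> 1) = cosI J (\<pi> 0)"
      using quotI_ops(1)[OF pJ(1)] unfolding zero_module_def by blast
    then have "1 - 0 \<in> pre J" using cosI_eq[OF pJ(1)] by blast
    then show False using 1(2) by (simp add: pre_def)
  qed
  have qpd: "qpd TYPE('x) R ?M = (INF P \<in> {P :: ('a, 'x \<Rightarrow> 'a) module_complex. finite_quasi_projective_resolution R ?M P}.
      complex_sup P - complex_hsup P)"
    using nz by (simp add: qpd_def)
  have "qpd TYPE('x) R ?M \<le> complex_sup (cx \<iota> B' d') - complex_hsup (cx \<iota> B' d')"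
    unfolding qpd by (rule INF_lower) (use Q(1) in simp)
  also have "\<dots> \<le> ereal (real (length xs))" by (rule Q(2))
  \<comment> \<open>The linking sequence itself is a regular sequence in \<open>J\<close> and so
    bounds the grade from below.\<close>
  also have "\<dots> \<le> grade R J" unfolding grade_def by (rule SUP_upper) (use xs in simp)
  finally have "qpd TYPE('x) R ?M \<le> grade R J" .
  moreover have "grade R J \<le> qpd TYPE('x) R ?M"
    unfolding qpd
  proof (rule INF_greatest)
    fix P :: "('a, 'x \<Rightarrow> 'a) module_complex" assume "P \<in> {P. finite_quasi_projective_resolution R ?M P}"
    then show "grade R J \<le> complex_sup P - complex_hsup P"
      unfolding grade_def by (intro SUP_least) (use regular_sequence_le_qpd[OF _ pJ(1) 1(2)] in blast)
  qed
  ultimately show ?thesis unfolding quasi_perfect_def by (rule antisym)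
qed

end

theorem theorem7p8:
  fixes R :: "('a, 'r) ring_scheme" and \<mm> I J :: "'a set"
  assumes "noetherian_local_ring R \<mm>"
    and "FKH_ideal R I"
    and "G_dimension R (sub_module (ring_as_module R) I) < \<infinity>"
    and "proper_ideal R J"
    and "linked R I J"
  shows "quasi_perfect TYPE('x :: infinite) R J"
proof -
  interpret noetherian_local_ring R \<mm> by (rule assms(1))
  have "\<one>\<^bsub>R\<^esub> \<noteq> \<zero>\<^bsub>R\<^esub>"
  proof
    assume "\<one>\<^bsub>R\<^esub> = \<zero>\<^bsub>R\<^esub>"
    have J: "ideal J R" "J \<noteq> carrier R" using assms(4) by (simp_all add: proper_ideal_def)
    have "\<one>\<^bsub>R\<^esub> \<in> J" unfolding \<open>\<one>\<^bsub>R\<^esub> = \<zero>\<^bsub>R\<^esub>\<close>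
      by (rule additive_subgroup.zero_closed[OF ideal.axioms(1)[OF J(1)]])
    then show False using ideal.one_imp_carrier[OF J(1)] J(2) by simp
  qed
  then show ?thesis using linked_FKH_quasi_perfect[OF noetherian_ring_axioms _ assms(2-5)] by blast
qed

end
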